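(* Let $n$ and $1\le k\le n-1$ be fixed, and write $G=G(n,n-k)$. The following are equivalent: (1) $\mathcal{BP}_k^n = \mathcal{I}_k^n$. (2) $\mathcal{M}^\infty(\mathcal{BP}_k^n) = \mathcal{M}^\infty(\mathcal{I}_k^n)$. (3) $\mathcal{M}(\mathcal{BP}_k^n) = \mathcal{M}(\mathcal{I}_k^n)$. (4) $\overline{R_{n-k}(C(S^{n-1}))_+} = \overline{R_{n-k}(C_+(S^{n-1})) + I\circ R_k(C_+(S^{n-1}))}$. (5) If $\mu+1\in\mathcal{M}(\mathcal{BP}_k^n)$ and $\mu\in\mathcal{M}(\mathcal{I}_k^n)$, then $\mu\in\mathcal{M}(\mathcal{BP}_k^n)$. (6) There does not exist $\mu\in\mathcal{M}^\infty_+(n,n-k)$ such that $R_{n-k}^*(\mu)\ge 1$, $R_k^*(\mu^\perp)\ge 1$, and \[\inf\{\langle\mu,f\rangle : f\in R_{n-k}(C(S^{n-1}))_+,\ \langle 1,f\rangle = 1\} = 0.\]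
   Context: Star-bodies are centrally-symmetric with continuous positive radial function $\rho_K(\theta)=\max\{r>0:r\theta\in K\}$, $\theta\in S^{n-1}$. $G(n,m)$ is the Grassmannian of $m$-dimensional subspaces of $\mathbb{R}^n$, with Haar probability measure; continuous functions on $G(n,m)$ or $S^{n-1}$ are identified with measures via density w.r.t. the Haar probability measure, and "$1$" denotes this Haar probability measure (constant density $1$). For $E\in G(n,m)$, $R_m f(E)=\int_{S^{n-1}\cap E}f\,d\sigma_E$ ($\sigma_E$ the Haar probability measure on $S^{n-1}\cap E$), $R_m:C(S^{n-1})\to C(G(n,m))$, and $R_m^*:\mathcal{M}(G(n,m))\to\mathcal{M}(S^{n-1})$ is the dual on signed Borel measures. $I:C(G(n,k))\to C(G(n,n-k))$ is $I(f)(E)=f(E^\perp)$; for $\mu\in\mathcal{M}(G(n,n-k))$, $\mu^\perp\in\mathcal{M}(G(n,k))$ is $\mu^\perp(A)=\mu(\{E^\perp:E\in A\})$. For measures, $\nu\ge 0$ means $\nu$ is non-negative and $\nu\ge 1$ means $\nu-1$ is non-negative. $C_+$ denotes non-negative continuous functions; $R_{n-k}(C(S^{n-1}))_+$ is the set of non-negative functions in the image of $R_{n-k}$; $R_{n-k}(C_+(S^{n-1}))$ is the image of the cone $C_+(S^{n-1})$; closures are in the maximum norm of $C(G)$; $\langle\mu,f\rangle=\int f\,d\mu$. Define $\mathcal{M}(n,n-k)=\mathcal{M}(G)/\mathrm{Ker}R_{n-k}^*$ (the dual of $\overline{\mathrm{Im}R_{n-k}}$); $R_{n-k}^*(\mu)$,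 $R_k^*(\mu^\perp)$ and $\langle\mu,f\rangle$ for $f\in\overline{\mathrm{Im}R_{n-k}}$ are well defined on cosets (one has $\mathrm{Ker}R_{n-k}^* = \mathrm{Ker}(R_k^*\circ I)$ where $I(\mu)=\mu^\perp$). $\mathcal{M}(\mathcal{BP}_k^n)=\mathcal{M}_+(n,n-k)$ is the set of cosets acting as non-negative functionals on $\overline{\mathrm{Im}R_{n-k}}$; $\mathcal{M}(\mathcal{I}_k^n)=\{\mu\in\mathcal{M}(n,n-k): R_{n-k}^*(\mu)\ge0,\ R_k^*(\mu^\perp)\ge0\}$; $\mathcal{M}^\infty(n,n-k)=\{g+\mathrm{Ker}R_{n-k}^*: g\in C^\infty(G)\}$; $\mathcal{M}^\infty(\mathcal{I}_k^n)=\mathcal{M}(\mathcal{I}_k^n)\cap\mathcal{M}^\infty(n,n-k)$ and $\mathcal{M}^\infty_+(n,n-k)=\mathcal{M}^\infty(\mathcal{BP}_k^n)=\mathcal{M}(\mathcal{BP}_k^n)\cap\mathcal{M}^\infty(n,n-k)$. $\mathcal{BP}_k^n$ is the class of star-bodies $K$ with $\rho_K^k=R_{n-k}^*(\mu)$ for a non-negative Borel measure $\mu$ on $G$. A star-body $K$ is a $k$-intersection body of a star-body $L$ if $\mathrm{Vol}_k(K\cap H^\perp)=\mathrm{Vol}_{n-k}(L\cap H)$ for all $H\in G(n,n-k)$; $\mathcal{I}_k^n$ is the class of radial-metric limits of such bodies (radial metric $\sup_\theta|\rho_{K_1}-\rho_{K_2}|$). *)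

theory Defs
  imports "HOL-Analysis.Analysis"
begin

type_synonym 'n vect = "real^'n"
type_synonym 'n matr = "real^'n^'n"

definition Sph :: "('n::finite) vect set" where
  "Sph = sphere 0 1"

text \<open>G(n,m) is represented by the orthogonal projections of rank m (the subspace E
  corresponds to the orthogonal projection onto E; this is the standard topology of the
  Grassmannian).\<close>
definition Grass :: "nat \<Rightarrow> ('n::finite) matr set" where
  "Grass m = {P. P ** P = P \<and> transpose P = P \<and> rank P = m}"

definition subsp :: "('n::finite) matr \<Rightarrow> 'n vect set" where
  "subsp P = range (\<lambda>x. P *v x)"

definition perpP :: "('n::finite) matr \<Rightarrow> 'n matr" where
  "perpP P = mat 1 - P"

definition haarS :: "('n::finite) vect measure" where
  "haarS = (THE M. sets M = sets borel \<and> emeasure M UNIV = 1 \<and> emeasure M (UNIV - Sph) = 0 \<and>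
      (\<forall>U. orthogonal_matrix U \<longrightarrow> distr M borel (\<lambda>x. U *v x) = M))"

definition sigmaE :: "('n::finite) matr \<Rightarrow> 'n vect measure" where
  "sigmaE P = (THE M. sets M = sets borel \<and> emeasure M UNIV = 1 \<and>
      emeasure M (UNIV - (Sph \<inter> subsp P)) = 0 \<and>
      (\<forall>U. orthogonal_matrix U \<and> U ** P = P ** U \<longrightarrow> distr M borel (\<lambda>x. U *v x) = M))"

definition haarG :: "nat \<Rightarrow> ('n::finite) matr measure" where
  "haarG m = (THE M. sets M = sets borel \<and> emeasure M UNIV = 1 \<and> emeasure M (UNIV - Grass m) = 0 \<and>
      (\<forall>U. orthogonal_matrix U \<longrightarrow> distr M borel (\<lambda>P. U ** P ** transpose U) = M))"

text \<open>Functions on S^{n-1} are functions on R^n restricted to the sphere; functions on G(n,m)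
  are normalised to vanish off G(n,m), so that equality of functions is equality on G(n,m).\<close>
definition CS :: "(('n::finite) vect \<Rightarrow> real) set" where
  "CS = {f. continuous_on Sph f}"

definition CSplus :: "(('n::finite) vect \<Rightarrow> real) set" where
  "CSplus = {f \<in> CS. \<forall>x\<in>Sph. 0 \<le> f x}"

definition CG :: "nat \<Rightarrow> (('n::finite) matr \<Rightarrow> real) set" where
  "CG m = {f. continuous_on (Grass m) f \<and> (\<forall>P. P \<notin> Grass m \<longrightarrow> f P = 0)}"

definition Radon :: "nat \<Rightarrow> (('n::finite) vect \<Rightarrow> real) \<Rightarrow> ('n matr \<Rightarrow> real)" where
  "Radon m f = (\<lambda>P. if P \<in> Grass m then integral\<^sup>L (sigmaE P) f else 0)"

definition Iop :: "nat \<Rightarrow> (('n::finite) matr \<Rightarrow> real) \<Rightarrow> ('n matr \<Rightarrow> real)" where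
  "Iop m f = (\<lambda>P. if P \<in> Grass m then f (perpP P) else 0)"

definition closG :: "nat \<Rightarrow> (('n::finite) matr \<Rightarrow> real) set \<Rightarrow> ('n matr \<Rightarrow> real) set" where
  "closG m A = {f \<in> CG m. \<forall>e>0. \<exists>g\<in>A. \<forall>P\<in>Grass m. \<bar>f P - g P\<bar> < e}"

section \<open>Signed measures (identified with their integration functionals)\<close>

definition fin_meas_on :: "'a::topological_space set \<Rightarrow> 'a measure \<Rightarrow> bool" where
  "fin_meas_on X M \<longleftrightarrow> sets M = sets borel \<and> finite_measure M \<and> emeasure M (UNIV - X) = 0"

text \<open>A signed Borel measure mu = mu1 - mu2 on G(n,m) acts as f \<mapsto> <mu,f>.\<close>
definition MG :: "nat \<Rightarrow> ((('n::finite) matr \<Rightarrow> real) \<Rightarrow> real) set" where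
  "MG m = {(\<lambda>f. integral\<^sup>L M1 f - integral\<^sup>L M2 f) | M1 M2.
             fin_meas_on (Grass m) M1 \<and> fin_meas_on (Grass m) M2}"

definition MGplus :: "nat \<Rightarrow> ((('n::finite) matr \<Rightarrow> real) \<Rightarrow> real) set" where
  "MGplus m = {(\<lambda>f. integral\<^sup>L M f) | M. fin_meas_on (Grass m) M}"

definition oneG :: "nat \<Rightarrow> (('n::finite) matr \<Rightarrow> real) \<Rightarrow> real" where
  "oneG m = (\<lambda>f. integral\<^sup>L (haarG m) f)"

definition Rstar :: "nat \<Rightarrow> ((('n::finite) matr \<Rightarrow> real) \<Rightarrow> real) \<Rightarrow> (('n vect \<Rightarrow> real) \<Rightarrow> real)" where
  "Rstar m mu = (\<lambda>g. mu (Radon m g))"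

text \<open>mu^perp for mu on G(n,m) is a measure on G(n,n-m) with <mu^perp,f> = <mu, I f>\<close>
definition perpM :: "nat \<Rightarrow> ((('n::finite) matr \<Rightarrow> real) \<Rightarrow> real) \<Rightarrow> (('n matr \<Rightarrow> real) \<Rightarrow> real)" where
  "perpM m mu = (\<lambda>f. mu (Iop m f))"

definition nonnegS :: "((('n::finite) vect \<Rightarrow> real) \<Rightarrow> real) \<Rightarrow> bool" where
  "nonnegS nu \<longleftrightarrow> (\<forall>g\<in>CSplus. 0 \<le> nu g)"

definition geoneS :: "((('n::finite) vect \<Rightarrow> real) \<Rightarrow> real) \<Rightarrow> bool" where
  "geoneS nu \<longleftrightarrow> nonnegS (\<lambda>g. nu g - integral\<^sup>L haarS g)"

definition coset :: "nat \<Rightarrow> ((('n::finite) matr \<Rightarrow> real) \<Rightarrow> real) \<Rightarrow> (('n matr \<Rightarrow> real) \<Rightarrow> real) set" where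
  "coset k mu = {nu \<in> MG (CARD('n) - k). \<forall>g\<in>CS. nu (Radon (CARD('n) - k) g) = mu (Radon (CARD('n) - k) g)}"

definition Mquot :: "nat \<Rightarrow> ((('n::finite) matr \<Rightarrow> real) \<Rightarrow> real) set set" where
  "Mquot k = coset k ` MG (CARD('n) - k)"

definition ImR :: "nat \<Rightarrow> (('n::finite) matr \<Rightarrow> real) set" where
  "ImR m = Radon m ` CS"

definition M_BP :: "nat \<Rightarrow> ((('n::finite) matr \<Rightarrow> real) \<Rightarrow> real) set set" where
  "M_BP k = {coset k mu | mu. mu \<in> MG (CARD('n) - k) \<and>
      (\<forall>f \<in> closG (CARD('n) - k) (ImR (CARD('n) - k)).
          (\<forall>P\<in>Grass (CARD('n) - k). 0 \<le> f P) \<longrightarrow> 0 \<le> mu f)}"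

definition M_I :: "nat \<Rightarrow> ((('n::finite) matr \<Rightarrow> real) \<Rightarrow> real) set set" where
  "M_I k = {coset k mu | mu. mu \<in> MG (CARD('n) - k) \<and>
      nonnegS (Rstar (CARD('n) - k) mu) \<and>
      nonnegS (Rstar k (perpM (CARD('n) - k) mu))}"

fun dirder :: "('a::real_normed_vector) list \<Rightarrow> ('a \<Rightarrow> real) \<Rightarrow> 'a \<Rightarrow> real" where
  "dirder [] f = f"
| "dirder (v # vs) f = (\<lambda>x. deriv (\<lambda>t. dirder vs f (x + t *\<^sub>R v)) 0)"

definition smooth :: "(('a::real_normed_vector) \<Rightarrow> real) \<Rightarrow> bool" where
  "smooth f \<longleftrightarrow> (\<forall>vs. continuous_on UNIV (dirder vs f) \<and>
      (\<forall>v x. (\<lambda>t. dirder vs f (x + t *\<^sub>R v)) differentiable (at 0)))"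

text \<open>C^infinity(G(n,m)): restrictions of smooth functions on the ambient matrix space
  (G(n,m) being a compact embedded submanifold)\<close>
definition CinfG :: "nat \<Rightarrow> (('n::finite) matr \<Rightarrow> real) set" where
  "CinfG m = {g. (\<exists>h. smooth h \<and> (\<forall>P\<in>Grass m. g P = h P)) \<and> (\<forall>P. P \<notin> Grass m \<longrightarrow> g P = 0)}"

definition densG :: "nat \<Rightarrow> (('n::finite) matr \<Rightarrow> real) \<Rightarrow> (('n matr \<Rightarrow> real) \<Rightarrow> real)" where
  "densG m g = (\<lambda>f. integral\<^sup>L (haarG m) (\<lambda>P. f P * g P))"

definition Minf :: "nat \<Rightarrow> ((('n::finite) matr \<Rightarrow> real) \<Rightarrow> real) set set" where
  "Minf k = {coset k (densG (CARD('n) - k) g) | g. g \<in> CinfG (CARD('n) - k)}"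

definition Minf_BP :: "nat \<Rightarrow> ((('n::finite) matr \<Rightarrow> real) \<Rightarrow> real) set set" where
  "Minf_BP k = M_BP k \<inter> Minf k"

definition Minf_I :: "nat \<Rightarrow> ((('n::finite) matr \<Rightarrow> real) \<Rightarrow> real) set set" where
  "Minf_I k = M_I k \<inter> Minf k"

definition star_body :: "('n::finite) vect set \<Rightarrow> bool" where
  "star_body K \<longleftrightarrow> (\<exists>\<rho>. continuous_on Sph \<rho> \<and> (\<forall>\<theta>\<in>Sph. 0 < \<rho> \<theta> \<and> \<rho> (-\<theta>) = \<rho> \<theta>) \<and>
      K = {x. x = 0 \<or> norm x \<le> \<rho> (x /\<^sub>R norm x)})"

definition radial :: "('n::finite) vect set \<Rightarrow> 'n vect \<Rightarrow> real" where
  "radial K \<theta> = Sup {r. 0 < r \<and> r *\<^sub>R \<theta> \<in> K}"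

definition vol_in :: "('n::finite) vect set \<Rightarrow> 'n vect set \<Rightarrow> ennreal" where
  "vol_in F A = (let d = dim F;
      b = (SOME b. (\<forall>i<d. b i \<in> F) \<and> (\<forall>i<d. \<forall>j<d. b i \<bullet> b j = (if i = j then 1 else 0)))
    in emeasure (PiM {..<d} (\<lambda>_. lborel))
         {c \<in> space (PiM {..<d} (\<lambda>_. lborel)). (\<Sum>i<d. c i *\<^sub>R b i) \<in> A})"

definition BP :: "nat \<Rightarrow> ('n::finite) vect set set" where
  "BP k = {K. star_body K \<and> (\<exists>mu \<in> MGplus (CARD('n) - k).
      \<forall>g\<in>CS. integral\<^sup>L haarS (\<lambda>\<theta>. g \<theta> * radial K \<theta> ^ k) = mu (Radon (CARD('n) - k) g))}"

definition k_intersection_body :: "nat \<Rightarrow> ('n::finite) vect set \<Rightarrow> 'n vect set \<Rightarrow> bool" where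
  "k_intersection_body k K L \<longleftrightarrow> star_body K \<and> star_body L \<and>
     (\<forall>H \<in> Grass (CARD('n) - k).
        vol_in (subsp (perpP H)) (K \<inter> subsp (perpP H)) = vol_in (subsp H) (L \<inter> subsp H))"

definition Icls :: "nat \<Rightarrow> ('n::finite) vect set set" where
  "Icls k = {K. star_body K \<and> (\<exists>Ks :: nat \<Rightarrow> 'n vect set.
      (\<forall>j. \<exists>L. k_intersection_body k (Ks j) L) \<and>
      (\<lambda>j. SUP \<theta>\<in>Sph. \<bar>radial (Ks j) \<theta> - radial K \<theta>\<bar>) \<longlonglongrightarrow> 0)}"

end

(* Polynomial kernels (n + P.Q)^N give positive self-adjoint operators on G(n,m), m = n - k, converging to
the identity; R_m and I o R_k intertwine them with zonal operators on the sphere. Hence I o R_k maps into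
the closure of the image of R_m, and measures may be replaced by smooth densities. All six statements are
equivalent to: a smooth density g with R_m^* g >= 0 and R_k^* (I g) >= 0 is non-negative on the non-negative
part of the image of R_m. For (4), project in L^2 onto the cone; for (6), normalise a counterexample. For (1),
u = rho_K^k and v = const rho_L^m with I R_k u = R_m v are, after smoothing, u = R_m^* g and v = R_k^* (I g)
with the same g, and conversely; a functional that is non-negative on the image of R_m is represented by a
non-negative measure as a weak limit of empirical measures. *)
theory Submission
 imports Defs "HOL-Probability.Probability"
begin

text \<open>Moments replace spherical harmonics: R_m sends (x . y)^(2i) to c_i |P y|^(2i), the dual
  transform of a power of P . Q is a polynomial in |P y|^2, and |P^perp y|^2 = 1 - |P y|^2 exchanges
  m and k. Comparing coefficients gives each intertwining relation; triangularity in the degree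
  gives injectivity on even functions and puts zonal averages into the range of the dual transform.
  The shift n in the kernel comes from n + P . Q = 2 |P|^2 + P^perp . Q^perp, so one kernel serves
  both Grassmannians with non-negative bases. That u and v share one g rests on R_m R_k^* I = I R_k
  R_m^*, valid because O(n) contains an element exchanging any two planes of equal dimension. The
  invariant measures are definite descriptions, so Haar measure is constructed, by Gram-Schmidt on a
  Lebesgue-random matrix, and integrals are moved to the group. A functional that is non-negative on
  the image of R_m is given only there; its measure is built from greedily chosen planes, whose
  averages, after zonal smoothing, approach the functional in L2 at rate r^(-1/2).\<close>

lemmas mv_assoc = matrix_vector_mul_assoc
 and borel_contI = borel_measurable_continuous_onI
 and integral_eqI = Bochner_Integration.integral_cong

section \<open>Orthogonal matrices and their action by conjugation\<close>

definition rot :: "('n::finite) matr => 'n matr => 'n matr" where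
 "rot U P = U ** P ** transpose U"

definition orth :: "('n::finite) matr set" where
 "orth = {U. orthogonal_matrix U}"

lemma orthD: "U : orth ==> transpose U ** U = mat 1" "U : orth ==> U ** transpose U = mat 1"
 by (auto simp: orth_def orthogonal_matrix_def)

lemma orth_mat1 [simp]: "mat 1 : orth"
 by (simp add: orth_def orthogonal_matrix_id)

lemma orth_mult [simp]: "U : orth ==> V : orth ==> U ** V : orth"
 by (simp add: orth_def orthogonal_matrix_mul)

lemma orth_transpose [simp]: "transpose U : orth \<longleftrightarrow> U : orth"
 by (simp add: orth_def)

declare transpose_matrix_vector [simp del]

lemma inner_matrix_vector: "(A *v x) \<bullet> y = x \<bullet> (transpose A *v y)" for A :: "real^'n^'n"
 by (metis dot_lmul_matrix inner_commute transpose_matrix_vector)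

lemma orth_inner [simp]: "U : orth ==> (U *v x) \<bullet> (U *v y) = x \<bullet> y"
 by (simp add: inner_matrix_vector mv_assoc orthD)

lemma orth_norm [simp]: "U : orth ==> norm (U *v x) = norm x"
 by (simp add: norm_eq_sqrt_inner)

lemma orthI: "(!!x y. (U *v x) \<bullet> (U *v y) = x \<bullet> y) ==> U : orth"
proof -
 assume a: "!!x y. (U *v x) \<bullet> (U *v y) = x \<bullet> y"
 have "(transpose U ** U) *v x = mat 1 *v x" for x
 proof -
  have "y \<bullet> ((transpose U ** U) *v x) = y \<bullet> x" for y
  using a[of y x] by (simp add: inner_matrix_vector mv_assoc)
  then show ?thesis
  by (metis matrix_vector_mul_lid vector_eq_ldot)
 qed
 then have "transpose U ** U = mat 1"
  using matrix_eq by blast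
 then show ?thesis by (simp add: orth_def orthogonal_matrix)
qed

lemma rot_rot: "rot U (rot V P) = rot (U ** V) P"
 by (simp add: rot_def matrix_transpose_mul matrix_mul_assoc)

lemma rot_mat1 [simp]: "rot (mat 1) P = P"
 by (simp add: rot_def)

lemma rot_transpose_cancel [simp]: "U : orth ==> rot (transpose U) (rot U P) = P"
 "U : orth ==> rot U (rot (transpose U) P) = P"
 by (simp_all add: rot_rot orthD)

lemma mv_scaleR: "A *v (c *\<^sub>R x) = c *\<^sub>R (A *v x)" for A :: "real^'n^'m"
 by (simp add: matrix_scaleR_vector_ac scaleR_matrix_vector_assoc)

lemma orth_rot_vec [simp]: "U : orth ==> rot U P *v (U *v x) = U *v (P *v x)"
 by (simp add: rot_def mv_assoc flip: matrix_mul_assoc)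
  (simp add: orthD)

lemma matr_eqI: "(!!x. A *v x = B *v x) ==> A = B" for A B :: "real^'n^'m"
 using matrix_eq by blast

lemma rot_vec: "rot U P *v x = U *v (P *v (transpose U *v x))"
 by (simp add: rot_def mv_assoc matrix_mul_assoc)

lemma rot_add: "rot U (P + Q) = rot U P + rot U Q"
 by (rule matr_eqI) (simp add: rot_vec matrix_vector_mult_add_rdistrib matrix_vector_right_distrib)

lemma rot_diff: "rot U (P - Q) = rot U P - rot U Q"
 by (rule matr_eqI) (simp add: rot_vec matrix_vector_mult_diff_rdistrib matrix_vector_mult_diff_distrib)

section \<open>Rank-one projections and reflections\<close>

definition outer :: "real^('n::finite) => real^'n => real^'n^'n" where
 "outer x y = (\<chi> i j. x $ i * y $ j)"

lemma outer_vec [simp]: "outer x y *v z = (y \<bullet> z) *\<^sub>R x"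
 by (simp add: outer_def matrix_vector_mult_def vec_eq_iff inner_vec_def sum_distrib_left sum_distrib_right mult_ac)

lemma transpose_outer [simp]: "transpose (outer x y) = outer y x"
 by (simp add: outer_def transpose_def vec_eq_iff mult.commute)

lemma mul_outer: "A ** outer x y = outer (A *v x) y" for A :: "real^'n^'n"
 by (rule matr_eqI) (simp add: mv_assoc[symmetric] mv_scaleR)

lemma outer_mul: "outer x y ** A = outer x (transpose A *v y)" for A :: "real^'n^'n"
 by (rule matr_eqI) (simp add: mv_assoc[symmetric] inner_matrix_vector)

lemma rot_outer: "rot U (outer x x) = outer (U *v x) (U *v x)"
 by (simp add: rot_def mul_outer outer_mul)

lemma transpose_rot: "transpose (rot U P) = rot U (transpose P)"
 by (simp add: rot_def matrix_transpose_mul matrix_mul_assoc)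

text \<open>Householder reflection. At \<open>v = 0\<close> division by zero makes it the identity,
  so \<open>refl (x - y)\<close> exchanges vectors of equal norm without excluding
  \<open>x = y\<close>.\<close>

definition refl :: "real^('n::finite) => real^'n^'n" where
 "refl v = mat 1 - (2 / (v \<bullet> v)) *\<^sub>R outer v v"

lemma refl_vec: "refl v *v x = x - (2 * (v \<bullet> x) / (v \<bullet> v)) *\<^sub>R v"
 by (simp add: refl_def matrix_vector_mult_diff_rdistrib flip: scaleR_matrix_vector_assoc)

lemma refl_transpose [simp]: "transpose (refl v) = refl v"
 by (rule matr_eqI, rule vector_eq_ldot[THEN iffD1], rule allI)
  (simp add: inner_matrix_vector[symmetric] refl_vec inner_diff_left inner_diff_right inner_commute mult_ac)

lemma refl_orth [simp]: "refl v : orth"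
proof (rule orthI)
 fix x y
 show "(refl v *v x) \<bullet> (refl v *v y) = x \<bullet> y"
 proof (cases "v = 0")
  case True then show ?thesis by (simp add: refl_vec)
 next
  case False
  then have "v \<bullet> v ~= 0" by simp
  then show ?thesis
  by (simp add: refl_vec inner_diff_left inner_diff_right inner_commute[of x v] field_simps)
 qed
qed

lemma refl_swap: assumes "norm x = norm y"
 shows "refl (x - y) *v x = y" "refl (x - y) *v y = x"
proof -
 have e: "x \<bullet> x = y \<bullet> y" using assms by (simp add: norm_eq_sqrt_inner)
 have *: "refl (x - y) *v x = y & refl (x - y) *v y = x"
 proof (cases "x = y")
  case True then show ?thesis by (simp add: refl_vec)
 next
  case False
  then have nz: "(x - y) \<bullet> (x - y) ~= 0" by simp
  have "2 * ((x - y) \<bullet> x) = (x - y) \<bullet> (x - y)" "2 * ((x - y) \<bullet> y) = - ((x - y) \<bullet> (x - y))"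
  using e by (simp_all add: inner_diff_left inner_diff_right inner_commute)
  then show ?thesis using nz by (simp add: refl_vec)
 qed
 then show "refl (x - y) *v x = y" "refl (x - y) *v y = x" by auto
qed

lemma refl_fix: "v \<bullet> x = 0 ==> refl v *v x = x"
 by (simp add: refl_vec)

section \<open>Orthogonal projections\<close>

definition oproj :: "('n::finite) matr => bool" where
 "oproj P \<longleftrightarrow> P ** P = P & transpose P = P"

lemma Grass_iff: "P : Grass m \<longleftrightarrow> oproj P & rank P = m"
 by (auto simp: Grass_def oproj_def)

lemma proj_idem [simp]: "oproj P ==> P *v (P *v x) = P *v x"
 by (simp add: oproj_def mv_assoc)

lemma proj_inner: "oproj P ==> (P *v x) \<bullet> y = x \<bullet> (P *v y)"
 by (simp add: oproj_def inner_matrix_vector)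

lemma proj_inner_self: "oproj P ==> x \<bullet> (P *v x) = (norm (P *v x))\<^sup>2"
 by (metis power2_norm_eq_inner proj_idem proj_inner)

lemma projI: assumes "!!x. P *v (P *v x) = P *v x" "!!x y. (P *v x) \<bullet> y = x \<bullet> (P *v y)"
 shows "oproj P"
proof -
 have 1: "P ** P = P" by (rule matr_eqI) (simp add: mv_assoc[symmetric] assms)
 have 2: "transpose P = P"
  by (rule matr_eqI, rule vector_eq_ldot[THEN iffD1], rule allI)
  (simp add: inner_matrix_vector[symmetric] assms(2))
 show ?thesis using 1 2 by (simp add: oproj_def)
qed

lemma subsp_iff: "oproj P ==> x : subsp P \<longleftrightarrow> P *v x = x"
 by (auto simp: subsp_def) (metis rangeI)

lemma proj_pyth: "oproj P ==> (norm x)\<^sup>2 = (norm (P *v x))\<^sup>2 + (norm (x - P *v x))\<^sup>2"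
 by (simp add: power2_norm_eq_inner inner_diff_left inner_diff_right proj_inner inner_commute)

lemma proj_norm_le: "oproj P ==> norm (P *v x) <= norm x"
 by (rule power2_le_imp_le) (auto simp: proj_pyth[of P x])

lemma proj_rot [simp]: assumes "oproj P" "U : orth" shows "oproj (rot U P)"
proof -
 have "rot U P ** rot U P = U ** P ** (transpose U ** U) ** P ** transpose U"
  by (simp add: rot_def matrix_mul_assoc)
 also have "... = U ** (P ** P) ** transpose U" using assms by (simp add: orthD matrix_mul_assoc)
 finally have "rot U P ** rot U P = rot U P" using assms by (simp add: oproj_def rot_def)
 then show ?thesis using assms by (simp add: oproj_def transpose_rot)
qed

lemma rank_rot [simp]: assumes "U : orth" shows "rank (rot U P) = rank P"
proof (rule antisym)
 have le: "rank (rot V Q) <= rank Q" for V Q :: "'a matr"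
  unfolding rot_def by (meson le_trans rank_mul_le_left rank_mul_le_right)
 show "rank (rot U P) <= rank P" by (rule le)
 show "rank P <= rank (rot U P)" using le[of "transpose U" "rot U P"] assms by simp
qed

lemma Grass_rot [simp]: "U : orth ==> rot U P : Grass m \<longleftrightarrow> P : Grass m"
proof -
 assume U: "U : orth"
 have "P : Grass m ==> rot U P : Grass m" using U by (simp add: Grass_iff)
 moreover have "rot U P : Grass m ==> P : Grass m"
  using U proj_rot[of "rot U P" "transpose U"] by (simp add: Grass_iff)
 ultimately show ?thesis by blast
qed

lemma proj_perp [simp]: "oproj P ==> oproj (perpP P)"
 by (rule projI) (simp_all add: perpP_def matrix_vector_mult_diff_rdistrib matrix_vector_mult_diff_distrib
  inner_diff_left inner_diff_right proj_inner)

lemma perp_vec: "perpP P *v x = x - P *v x"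
 by (simp add: perpP_def matrix_vector_mult_diff_rdistrib)

lemma perp_perp [simp]: "perpP (perpP P) = P"
 by (simp add: perpP_def)

lemma rot_perp: "U : orth ==> rot U (perpP P) = perpP (rot U P)"
 by (simp add: perpP_def rot_diff) (simp add: rot_def orthD)

lemma dim_subsp: "dim (subsp P) = rank P"
 by (simp add: subsp_def rank_dim_range)

lemma subspace_subsp [simp]: "subspace (subsp P)"
 unfolding subsp_def by (rule linear_subspace_image) (auto simp: matrix_vector_mul_linear)

text \<open>Adding a line to a range, or removing one, is the induction step of the later arguments
  on the rank. The dimension is counted by taking the complement of \<open>p\<close> inside the new
  range.\<close>

lemma proj_add_outer: assumes "oproj P" "P *v p = 0" "norm p = 1"
 shows "oproj (P + outer p p)" "rank (P + outer p p) = Suc (rank P)"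
proof -
 have pp: "p \<bullet> p = 1" using assms(3) by (simp add: norm_eq_1)
 have p0: "p \<bullet> (P *v x) = 0" for x using assms by (metis inner_zero_left proj_inner)
 have p0': "(P *v x) \<bullet> p = 0" for x using p0 by (simp add: inner_commute)
 have pc: "p \<bullet> x * (p \<bullet> y) = (p \<bullet> y) * (x \<bullet> p)" for x y by (simp add: inner_commute)
 show pr: "oproj (P + outer p p)"
  using assms by (intro projI)
  (simp_all add: matrix_vector_mult_add_rdistrib matrix_vector_right_distrib mv_scaleR p0 pp
  inner_add_left inner_add_right proj_inner pc)
 have "subsp P = {x : subsp (P + outer p p). ALL y:{p}. orthogonal y x}"
 proof (intro set_eqI iffI)
  fix x assume "x : subsp P"
  then show "x : {x : subsp (P + outer p p). ALL y:{p}. orthogonal y x}"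
  using assms pr p0[of x] by (simp add: subsp_iff orthogonal_def matrix_vector_mult_add_rdistrib)
 qed (use assms pr in "auto simp: subsp_iff orthogonal_def matrix_vector_mult_add_rdistrib")
 moreover have "span {p} \<subseteq> subsp (P + outer p p)"
 proof -
  have "p : subsp (P + outer p p)" using assms pr pp by (simp add: subsp_iff matrix_vector_mult_add_rdistrib)
  then show ?thesis by (simp add: span_minimal)
 qed
 moreover have sp: "(ALL y:span {p}. orthogonal y x) \<longleftrightarrow> (ALL y:{p}. orthogonal y x)" for x
  by (auto simp: span_singleton orthogonal_def)
 ultimately have "dim (subsp P) + dim (span {p}) = dim (subsp (P + outer p p))"
  using dim_subspace_orthogonal_to_vectors[of "span {p}" "subsp (P + outer p p)"]
  by (simp add: sp)
 moreover have "dim (span {p}) = 1" using pp by (auto simp: dim_span dim_singleton)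
 ultimately show "rank (P + outer p p) = Suc (rank P)" by (simp add: dim_subsp)
qed

lemma proj_diff_outer: assumes "oproj P" "P *v p = p" "norm p = 1"
 shows "oproj (P - outer p p)" "(P - outer p p) *v p = 0" "rank P = Suc (rank (P - outer p p))"
proof -
 have pp: "p \<bullet> p = 1" using assms(3) by (simp add: norm_eq_1)
 have p0: "p \<bullet> (P *v x) = p \<bullet> x" for x using assms by (metis proj_inner)
 have pc: "p \<bullet> x * (p \<bullet> y) = (p \<bullet> y) * (x \<bullet> p)" for x y by (simp add: inner_commute)
 show pr: "oproj (P - outer p p)"
  using assms by (intro projI)
  (simp_all add: matrix_vector_mult_diff_rdistrib matrix_vector_mult_diff_distrib mv_scaleR p0 pp
  inner_diff_left inner_diff_right proj_inner pc)
 show z: "(P - outer p p) *v p = 0" using assms pp by (simp add: matrix_vector_mult_diff_rdistrib)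
 show "rank P = Suc (rank (P - outer p p))"
  using proj_add_outer(2)[OF pr z assms(3)] by simp
qed

lemma rot_refl_perp: assumes "oproj R" "R *v v = 0" shows "rot (refl v) R = R"
proof (rule matr_eqI)
 fix x
 have "v \<bullet> (R *v x) = 0" using assms by (metis inner_zero_left proj_inner)
 then show "rot (refl v) R *v x = R *v x"
  using assms(2) by (simp add: rot_vec refl_vec matrix_vector_mult_diff_distrib mv_scaleR)
qed

lemma proj_mat1: "oproj (mat 1)"
 by (simp add: oproj_def)

lemma rot_refl_range: assumes "oproj R" "R *v v = v" shows "rot (refl v) R = R"
proof -
 have "rot (refl v) (perpP R) = perpP R"
  using assms by (intro rot_refl_perp) (auto simp: perp_vec)
 then show ?thesis by (metis rot_perp perp_perp refl_orth)
qed

lemma proj_unit: assumes "oproj P" "rank P ~= 0" obtains p where "norm p = 1" "P *v p = p"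
proof -
 have "P ~= 0" using assms(2) by auto
 then obtain x where x: "P *v x ~= 0" by (metis matr_eqI matrix_vector_mult_0)
 show ?thesis
  by (rule that[of "(P *v x) /\<^sub>R norm (P *v x)"]) (use x assms in "simp_all add: mv_scaleR")
qed

text \<open>Principal vectors: unit vectors \<open>p\<close>, \<open>q\<close> of the two ranges
  with the largest inner product decouple from the rest, so one reflection exchanges them and
  induction treats the remainder. The last clause makes the map from the induction hypothesis fix
  \<open>p\<close> and \<open>q\<close>. An actual exchange of \<open>P\<close> and
  \<open>Q\<close>, stronger than transitivity, is what makes invariant forms symmetric
  later.\<close>

lemma proj_swap:
 assumes "oproj P" "oproj Q" "rank P = r" "rank Q = r"
 shows "EX U:orth. rot U P = Q & rot U Q = P & (ALL x. P *v x = 0 & Q *v x = 0 --> U *v x = x)"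
 using assms
proof (induction r arbitrary: P Q)
 case 0
 then have "P = 0" "Q = 0" by (auto simp: rank_eq_0)
 then show ?case by (intro bexI[of _ "mat 1"]) auto
next
 case (Suc r)
 define K where "K P = sphere 0 1 \<inter> {p. P *v p = p}" for P :: "'a matr"
 have cK: "compact (K P)" for P
  unfolding K_def by (intro compact_Int_closed compact_sphere closed_Collect_eq continuous_intros)
 have ne: "K P ~= {}" "K Q ~= {}"
 proof -
  obtain p where "norm p = 1" "P *v p = p" by (rule proj_unit[of P]) (use Suc.prems in auto)
  then have "p : K P" by (simp add: K_def)
  then show "K P ~= {}" by blast
  obtain q where "norm q = 1" "Q *v q = q" by (rule proj_unit[of Q]) (use Suc.prems in auto)
  then have "q : K Q" by (simp add: K_def)
  then show "K Q ~= {}" by blast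
 qed
 obtain z where z: "z : K P \<times> K Q" "!!y. y : K P \<times> K Q ==> fst y \<bullet> snd y <= fst z \<bullet> snd z"
 proof -
  have "EX z:K P \<times> K Q. ALL y:K P \<times> K Q. fst y \<bullet> snd y <= fst z \<bullet> snd z"
  by (rule continuous_attains_sup) (use ne cK in "auto intro!: compact_Times continuous_intros")
  then show thesis using that by blast
 qed
 define p q c where "p = fst z" and "q = snd z" and "c = p \<bullet> q"
 have p: "norm p = 1" "P *v p = p" "p \<bullet> p = 1" and q: "norm q = 1" "Q *v q = q" "q \<bullet> q = 1"
  using z(1) by (auto simp: K_def p_def q_def norm_eq_1)
 have mx: "a \<bullet> b <= c" if "norm a = 1" "P *v a = a" "norm b = 1" "Q *v b = b" for a b
  using z(2)[of "(a, b)"] that by (simp add: K_def c_def p_def q_def)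
 \<comment> \<open>Maximality of \<open>a \<bullet> b\<close> over the unit vectors of the range of
   \<open>R\<close> bounds the length of the projection of \<open>b\<close> by the absolute value of
   \<open>a \<bullet> b\<close>, which its component along \<open>a\<close> already has; nothing
   else remains.\<close>
 have key: "R *v b = (a \<bullet> b) *\<^sub>R a" if R: "oproj R" "norm a = 1" "R *v a = a"
  and m: "!!a'. norm a' = 1 ==> R *v a' = a' ==> a' \<bullet> b <= a \<bullet> b" for R :: "'a matr" and a b
 proof -
  have ab: "a \<bullet> (R *v b) = a \<bullet> b" using R by (metis proj_inner)
  have "norm (R *v b) <= \<bar>a \<bullet> b\<bar>"
  proof (cases "R *v b = 0")
  case False
  have "((R *v b) /\<^sub>R norm (R *v b)) \<bullet> b <= a \<bullet> b"
  by (rule m) (use False R in "simp_all add: mv_scaleR")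
  moreover have "((R *v b) /\<^sub>R norm (R *v b)) \<bullet> b = norm (R *v b)"
  using False R proj_inner_self[of R b] by (simp add: inner_commute power2_eq_square)
  ultimately show ?thesis by simp
  qed simp
  then have "(norm (R *v b))\<^sup>2 <= (a \<bullet> b)\<^sup>2" by (metis abs_le_square_iff abs_norm_cancel)
  moreover have "(R *v b - (a \<bullet> b) *\<^sub>R a) \<bullet> (R *v b - (a \<bullet> b) *\<^sub>R a)
  = (R *v b) \<bullet> (R *v b) - (a \<bullet> b)\<^sup>2"
  using R(2) inner_commute[of "R *v b" a]
  by (simp add: inner_diff_left inner_diff_right ab norm_eq_1 power2_eq_square)
  then have "(norm (R *v b - (a \<bullet> b) *\<^sub>R a))\<^sup>2 = (norm (R *v b))\<^sup>2 - (a \<bullet> b)\<^sup>2"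
  by (simp add: power2_norm_eq_inner)
  ultimately have "(norm (R *v b - (a \<bullet> b) *\<^sub>R a))\<^sup>2 <= 0" by simp
  then show ?thesis by simp
 qed
 have Pq: "P *v q = c *\<^sub>R p" and Qp: "Q *v p = c *\<^sub>R q"
 proof -
  show "P *v q = c *\<^sub>R p"
  unfolding c_def by (rule key) (use mx Suc.prems p q in "auto simp: c_def")
  have "Q *v p = (q \<bullet> p) *\<^sub>R q"
  by (rule key) (use mx[OF p(1,2)] Suc.prems p q in "auto simp: c_def inner_commute")
  then show "Q *v p = c *\<^sub>R q" by (simp add: c_def inner_commute)
 qed
 define P' Q' where "P' = P - outer p p" and "Q' = Q - outer q q"
 have P': "oproj P'" "P' *v p = 0" "rank P' = r" and Q': "oproj Q'" "Q' *v q = 0" "rank Q' = r"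
  using proj_diff_outer[of P p] proj_diff_outer[of Q q] Suc.prems p q by (auto simp: P'_def Q'_def)
 have P'q: "P' *v q = 0" and Q'p: "Q' *v p = 0"
  using Pq Qp by (simp_all add: P'_def Q'_def matrix_vector_mult_diff_rdistrib c_def inner_commute)
 obtain V where V: "V : orth" "rot V P' = Q'" "rot V Q' = P'"
  "!!x. P' *v x = 0 ==> Q' *v x = 0 ==> V *v x = x"
  using Suc.IH[OF P'(1) Q'(1) P'(3) Q'(3)] by blast
 \<comment> \<open>\<open>H\<close> exchanges \<open>p\<close> and \<open>q\<close> and commutes
   with \<open>P'\<close> and \<open>Q'\<close>, whose ranges are orthogonal to both
   vectors.\<close>
 define H where "H = refl (p - q)"
 have H: "H : orth" "H *v p = q" "H *v q = p" "rot H P' = P'" "rot H Q' = Q'"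
  using refl_swap[of p q] p q P' Q' P'q Q'p
  by (auto simp: H_def rot_refl_perp matrix_vector_mult_diff_distrib)
 have Vpq: "V *v p = p" "V *v q = q" using V(4) P' Q' P'q Q'p by auto
 have PP: "P = P' + outer p p" "Q = Q' + outer q q" by (auto simp: P'_def Q'_def)
 have a1: "rot (V ** H) P = Q" "rot (V ** H) Q = P"
  by (simp_all add: PP rot_add rot_outer mv_assoc[symmetric] rot_rot[symmetric] H V Vpq)
 have "(V ** H) *v x = x" if x: "P *v x = 0" "Q *v x = 0" for x
 proof -
  have px: "p \<bullet> x = 0" "q \<bullet> x = 0"
  using x p q Suc.prems proj_inner[of P p x] proj_inner[of Q q x] by auto
  then have "H *v x = x" by (simp add: H_def refl_fix inner_diff_left)
  moreover have "V *v x = x"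
  by (rule V(4)) (simp_all add: P'_def Q'_def matrix_vector_mult_diff_rdistrib x px)
  ultimately show ?thesis by (simp add: mv_assoc[symmetric])
 qed
 then show ?case using a1 V(1) H(1) by (intro bexI[of _ "V ** H"]) auto
qed

section \<open>Transitivity on subspaces and on pairs of a subspace and a vector\<close>

lemma Grass_swap: assumes "P : Grass m" "Q : Grass m"
 obtains U where "U : orth" "rot U P = Q" "rot U Q = P"
 using proj_swap[of P Q m] assms by (auto simp: Grass_iff)

text \<open>The pair \<open>(P, x)\<close> has no invariants beyond the rank, \<open>norm x\<close>
  and \<open>norm (P *v x)\<close>: after \<open>P\<close> is moved to \<open>Q\<close>, one
  reflection corrects the component of the vector in the range of \<open>Q\<close> and a second one
  the component in its kernel, and both commute with \<open>Q\<close>.\<close>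

lemma Grass_pair_transitive:
 assumes P: "P : Grass m" "Q : Grass m" and "norm x = norm y" "norm (P *v x) = norm (Q *v y)"
 obtains U where "U : orth" "rot U P = Q" "U *v x = y"
proof -
 obtain V where V: "V : orth" "rot V P = Q" using Grass_swap P by metis
 define z where "z = V *v x"
 have pQ: "oproj Q" using P by (simp add: Grass_iff)
 have nz: "norm (Q *v z) = norm (Q *v y)" using V assms by (metis orth_rot_vec orth_norm z_def)
 have nz': "norm (z - Q *v z) = norm (y - Q *v y)"
 proof -
  have "norm z = norm y" using V assms by (simp add: z_def)
  then have "(norm (z - Q *v z))\<^sup>2 = (norm (y - Q *v y))\<^sup>2"
  using proj_pyth[OF pQ, of z] proj_pyth[OF pQ, of y] nz by simp
  then show ?thesis by simp
 qed
 define v w where "v = Q *v z - Q *v y" and "w = (z - Q *v z) - (y - Q *v y)"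
 have Qv: "Q *v v = v" and Qw: "Q *v w = 0"
  using pQ by (simp_all add: v_def w_def matrix_vector_mult_diff_distrib)
 have vp: "v \<bullet> (u - Q *v u) = 0" and wp: "w \<bullet> (Q *v u) = 0" for u
  using Qv Qw proj_inner[OF pQ, of v u] proj_inner[OF pQ, of w u] by (simp_all add: inner_diff_right)
 have 1: "refl v *v z = Q *v y + (z - Q *v z)"
 proof -
  have "refl v *v (Q *v z + (z - Q *v z)) = Q *v y + (z - Q *v z)"
  using refl_swap(1)[OF nz] refl_fix[OF vp[of z]]
  by (simp only: matrix_vector_right_distrib v_def[symmetric])
  then show ?thesis by simp
 qed
 have 2: "refl w *v (Q *v y + (z - Q *v z)) = y"
  using refl_swap(1)[OF nz'] refl_fix[OF wp[of y]]
  by (simp only: matrix_vector_right_distrib w_def[symmetric]) simp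
 have c: "rot (refl w) (rot (refl v) Q) = Q"
  using Qv Qw pQ by (simp add: rot_refl_range rot_refl_perp)
 show ?thesis
 proof (rule that[of "refl w ** (refl v ** V)"])
  show "refl w ** (refl v ** V) : orth" using V by simp
  show "rot (refl w ** (refl v ** V)) P = Q" using V c by (simp add: rot_rot[symmetric])
  show "refl w ** (refl v ** V) *v x = y"
  using 1 2 by (simp add: mv_assoc[symmetric] z_def)
 qed
qed

lemma Grass_mono_ex: "m <= CARD('n) ==> EX P::('n::finite) matr. P : Grass m"
proof (induction m)
 case 0
 have "(0::'n matr) : Grass 0" by (simp add: Grass_iff oproj_def transpose_def vec_eq_iff)
 then show ?case by blast
next
 case (Suc m)
 then obtain P :: "'n matr" where P: "oproj P" "rank P = m" by (auto simp: Grass_iff)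
 then have "rank P < CARD('n)" using Suc by simp
 then obtain x where x: "x ~= 0" "P *v x = 0" using less_rank_noninjective[of P] 
  by (metis matrix_left_invertible_injective matrix_left_invertible_ker)
 define p where "p = x /\<^sub>R norm x"
 have "norm p = 1" "P *v p = 0" using x by (simp_all add: p_def mv_scaleR)
 then show ?case using proj_add_outer[of P p] P by (auto simp: Grass_iff)
qed

lemma Grass_perp: fixes P :: "('n::finite) matr"
 assumes "m <= CARD('n)" "P : Grass m"
 shows "perpP P : Grass (CARD('n) - m)"
proof -
 have "ALL P::'n matr. oproj P --> rank P = m --> rank (perpP P) = CARD('n) - m"
  using assms(1)
 proof (induction m)
  case 0
  then show ?case by (auto simp: rank_eq_0 perpP_def rank_I)
 next
  case (Suc m)
  show ?case
  proof (intro allI impI)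
  fix P :: "'n matr" assume P: "oproj P" "rank P = Suc m"
  obtain p where p: "norm p = 1" "P *v p = p" using proj_unit[of P] P by auto
  define Q where "Q = P - outer p p"
  have Q: "oproj Q" "Q *v p = 0" "rank Q = m"
  using proj_diff_outer[of P p] P p by (auto simp: Q_def)
  have "rank (perpP Q) = CARD('n) - m" using Suc Q by auto
  moreover have "perpP P = perpP Q - outer p p" by (simp add: Q_def perpP_def)
  moreover have "rank (perpP Q) = Suc (rank (perpP Q - outer p p))"
  using proj_diff_outer(3)[of "perpP Q" p] Q p by (simp add: perp_vec)
  ultimately show "rank (perpP P) = CARD('n) - Suc m" by simp
  qed
 qed
 then show ?thesis using assms by (auto simp: Grass_iff)
qed

lemma outer_Grass: "norm x = 1 ==> outer x x : Grass 1"
 using proj_add_outer[of 0 x] by (simp add: Grass_iff oproj_def transpose_def vec_eq_iff)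

lemma Grass_containing: fixes x :: "('n::finite) vect"
 assumes "1 <= m" "m <= CARD('n)" "norm x = 1"
 obtains P :: "'n matr" where "P : Grass m" "P *v x = x"
proof -
 obtain Q :: "'n matr" where Q: "Q : Grass m" using Grass_mono_ex assms by blast
 then obtain y where y: "norm y = 1" "Q *v y = y" using proj_unit[of Q] assms by (auto simp: Grass_iff)
 define H where "H = refl (y - x)"
 have H: "H : orth" "H *v y = x" using refl_swap[of y x] assms y by (auto simp: H_def)
 show ?thesis
  by (rule that[of "rot H Q"]) (use H Q y in "auto simp: H(2)[symmetric]")
qed

lemma Grass_avoiding: fixes x :: "('n::finite) vect"
 assumes "m < CARD('n)" "norm x = 1"
 obtains P :: "'n matr" where "P : Grass m" "P *v x = 0"
proof -
 obtain Q :: "'n matr" where Q: "Q : Grass (CARD('n) - m)" "Q *v x = x"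
  by (rule Grass_containing[of "CARD('n) - m" x]) (use assms in auto)
 then have "perpP Q : Grass (CARD('n) - (CARD('n) - m))" by (intro Grass_perp) auto
 moreover have "CARD('n) - (CARD('n) - m) = m" using assms by simp
 ultimately show ?thesis using that[of "perpP Q"] Q by (simp add: perp_vec)
qed

section \<open>Hilbert-Schmidt inner product and continuity of matrix operations\<close>

lemma inner_matr: "A \<bullet> B = (SUM j:UNIV. (A *v axis j 1) \<bullet> (B *v axis j 1))" for A B :: "real^'n^'n"
proof -
 have "A \<bullet> B = (SUM i:UNIV. SUM j:UNIV. A $ i $ j * B $ i $ j)" by (simp add: inner_vec_def)
 also have "... = (SUM j:UNIV. SUM i:UNIV. A $ i $ j * B $ i $ j)" by (rule sum.swap)
 also have "... = (SUM j:UNIV. (A *v axis j 1) \<bullet> (B *v axis j 1))"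
  by (simp add: inner_vec_def matrix_vector_mult_basis column_def)
 finally show ?thesis .
qed

lemma inner_transpose: "transpose A \<bullet> transpose B = A \<bullet> B" for A B :: "real^'n^'n"
 by (simp add: inner_vec_def transpose_def) (rule sum.swap)

lemma inner_orth_left [simp]: "U : orth ==> (U ** A) \<bullet> (U ** B) = A \<bullet> B" for A :: "real^'n^'n"
 by (simp add: inner_matr mv_assoc[symmetric])

lemma inner_orth_right [simp]: "U : orth ==> (A ** U) \<bullet> (B ** U) = A \<bullet> B" for A :: "real^'n^'n"
 using inner_orth_left[of "transpose U" "transpose A" "transpose B"] inner_transpose[of "A ** U" "B ** U"]
 by (simp add: matrix_transpose_mul inner_transpose)

lemma inner_rot [simp]: "U : orth ==> rot U A \<bullet> rot U B = A \<bullet> B"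
 by (simp add: rot_def)

lemma norm_rot [simp]: "U : orth ==> norm (rot U A) = norm A"
 by (simp add: norm_eq_sqrt_inner)

lemma norm_orth_left [simp]: "U : orth ==> norm (U ** A) = norm A" for A :: "real^'n^'n"
 by (simp add: norm_eq_sqrt_inner)

lemma inner_outer: "A \<bullet> outer x x = x \<bullet> (A *v x)" for A :: "real^'n^'n"
 by (simp add: inner_vec_def outer_def matrix_vector_mult_def sum_distrib_left mult_ac)

lemma bilinear_mult: "bounded_bilinear (%(A::real^'n^'n) (B::real^'n^'n). A ** B)"
proof -
 have "bilinear (%(A::real^'n^'n) (B::real^'n^'n). A ** B)"
  unfolding bilinear_def linear_iff
  by (intro conjI allI matr_eqI)
  (simp_all add: mv_assoc[symmetric] matrix_vector_mult_add_rdistrib matrix_vector_right_distrib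
  mv_scaleR scaleR_matrix_vector_assoc[symmetric])
 then show ?thesis by (simp add: bilinear_conv_bounded_bilinear)
qed

lemma bounded_bilinear_matrix_vector: "bounded_bilinear (%(A::real^'n^'n) x. A *v x)"
proof -
 have "bilinear (%(A::real^'n^'n) (x::real^'n). A *v x)"
  unfolding bilinear_def linear_iff
  by (intro conjI allI)
  (simp_all add: matrix_vector_mult_add_rdistrib matrix_vector_right_distrib
  mv_scaleR scaleR_matrix_vector_assoc[symmetric])
 then show ?thesis by (simp add: bilinear_conv_bounded_bilinear)
qed

lemma bounded_linear_transpose: "bounded_linear (transpose :: real^'n^'n => real^'n^'n)"
 by (rule linear_conv_bounded_linear[THEN iffD1]) (simp add: linear_iff transpose_def vec_eq_iff)

lemmas continuous_on_matrix_mult [continuous_intros] =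
 bounded_bilinear.continuous_on[OF bilinear_mult]
lemmas continuous_on_matrix_vector [continuous_intros] =
 bounded_bilinear.continuous_on[OF bounded_bilinear_matrix_vector]
lemmas continuous_on_transpose [continuous_intros] =
 bounded_linear.continuous_on[OF bounded_linear_transpose]

lemma continuous_on_rot [continuous_intros]:
 "continuous_on S f ==> continuous_on S g ==> continuous_on S (%x. rot (f x) (g x))"
 unfolding rot_def by (intro continuous_intros)

lemma continuous_on_outer [continuous_intros]:
 "continuous_on S f ==> continuous_on S g ==> continuous_on S (%x. outer (f x) (g x))"
 unfolding outer_def by (intro continuous_intros)

lemma continuous_on_perpP [continuous_intros]:
 "continuous_on S f ==> continuous_on S (%x. perpP (f x))"
 unfolding perpP_def by (intro continuous_intros)

section \<open>Stabilisers, orbits and compactness\<close>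

definition Stab :: "('n::finite) matr => 'n matr set" where
 "Stab P = {U : orth. U ** P = P ** U}"

lemma Stab_iff: "U : Stab P \<longleftrightarrow> U : orth & rot U P = P"
proof -
 have "rot U P = P \<longleftrightarrow> U ** P = P ** U" if "U : orth"
  using that by (metis rot_def matrix_mul_assoc matrix_mul_rid orthD)
 then show ?thesis by (auto simp: Stab_def)
qed

lemma Stab_mat1 [simp]: "Stab (mat 1) = orth"
 by (auto simp: Stab_def)

lemma Stab_transpose: "U : Stab P ==> transpose U : Stab P"
 by (auto simp: Stab_iff) (metis rot_transpose_cancel(1))

lemma Stab_orth: "U : Stab P ==> U : orth"
 by (simp add: Stab_def)

lemma compact_Stab: "compact (Stab P)"
proof -
 have "Stab P = {U. transpose U ** U = mat 1} \<inter> {U. U ** P = P ** U}"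
  by (auto simp: Stab_def orth_def orthogonal_matrix)
 moreover have "closed \<dots>"
  by (intro closed_Int closed_Collect_eq continuous_intros)
 moreover have "bounded (Stab P)"
 proof (rule boundedI)
  fix U assume "U : Stab P"
  then have "norm (U ** mat 1) = norm (mat 1 :: 'a matr)" using Stab_orth norm_orth_left by blast
  then show "norm U <= norm (mat 1 :: 'a matr)" by simp
 qed
 ultimately show ?thesis by (simp add: compact_eq_bounded_closed)
qed

lemma compact_orth: "compact orth"
 using compact_Stab[of "mat 1"] by simp

lemma Grass_orbit: fixes P :: "('n::finite) matr" assumes "P : Grass m" shows "Grass m = (%U. rot U P) ` orth"
proof (intro set_eqI iffI)
 fix Q :: "'n matr" assume "Q : Grass m"
 then obtain U where "U : orth" "rot U P = Q" using Grass_swap[OF assms] by metis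
 then show "Q : (%U. rot U P) ` orth" by blast
qed (use assms in auto)

lemma compact_Grass: "compact (Grass m :: ('n::finite) matr set)"
proof (cases "Grass m = ({} :: 'n matr set)")
 case False
 then obtain P :: "'n matr" where P: "P : Grass m" by blast
 show ?thesis
  unfolding Grass_orbit[OF P] by (intro compact_continuous_image continuous_intros compact_orth)
qed simp

lemma sphere_orbit: assumes "e : Sph" shows "Sph = (%U. U *v e) ` orth"
proof -
 have "y : (%U. U *v e) ` orth" if "y : Sph" for y
  using refl_swap(1)[of e y] that assms
  by (intro image_eqI[of _ _ "refl (e - y)"]) (auto simp: Sph_def)
 then show ?thesis using assms by (auto simp: Sph_def)
qed

lemma compact_Sph: "compact (Sph :: 'n::finite vect set)"
 by (simp add: Sph_def)

text \<open>A continuous map out of a compact set is a quotient map onto its image. Functions on the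
  sphere and on the Grassmannian are shown continuous by pulling them back to the orthogonal
  group.\<close>

lemma continuous_on_quotient:
 fixes q :: "'a::euclidean_space => 'b::euclidean_space" and F :: "'b => 'c::t1_space"
 assumes K: "compact K" and q: "continuous_on K q" and F: "continuous_on K (%u. F (q u))"
 shows "continuous_on (q ` K) F"
proof (rule continuous_on_closed_vimage[THEN iffD2])
 show "closed (q ` K)" using K q by (simp add: compact_continuous_image compact_imp_closed)
 show "ALL B. closed B --> closed (F -` B \<inter> q ` K)"
 proof (intro allI impI)
  fix B :: "'c set" assume "closed B"
  then have "closed ((%u. F (q u)) -` B \<inter> K)"
  using continuous_on_closed_vimage[of K "%u. F (q u)"] F K by (auto simp: compact_imp_closed)
  then have "compact ((%u. F (q u)) -` B \<inter> K)"
  using K by (metis Int_absorb1 Int_commute Int_lower2 compact_Int_closed)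
  then have "compact (q ` ((%u. F (q u)) -` B \<inter> K))"
  by (rule compact_continuous_image[rotated]) (use q continuous_on_subset in blast)
  moreover have "q ` ((%u. F (q u)) -` B \<inter> K) = F -` B \<inter> q ` K" by auto
  ultimately show "closed (F -` B \<inter> q ` K)" by (metis compact_imp_closed)
 qed
qed

section \<open>Uniqueness of translation invariant measures\<close>

text \<open>Weil's uniqueness argument: the double integral of \<open>f x * g (y + x)\<close> is
  evaluated in both orders, and symmetry of \<open>B\<close> replaces inversion. Only translations
  by the carrier \<open>F\<close> are assumed to preserve the measures, so that Lebesgue measure on
  a subspace of the ambient space is covered too.\<close>

lemma translation_invariant_unique:
 fixes M N :: "'a::euclidean_space measure"
 assumes M: "sets M = sets borel" "sigma_finite_measure M" "AE x in M. x : F"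
  and N: "sets N = sets borel" "sigma_finite_measure N" "AE x in N. x : F"
  and trM: "!!y. y : F ==> distr M borel (%x. x + y) = M"
  and trN: "!!y. y : F ==> distr N borel (%x. x + y) = N"
  and F: "!!x. x : F ==> - x : F"
  and A[measurable]: "A : sets borel" and B[measurable]: "B : sets borel" and sym: "!!x. - x : B \<longleftrightarrow> x : B"
 shows "emeasure M B * emeasure N A = emeasure M A * emeasure N B"
proof -
 interpret M: sigma_finite_measure M by fact
 interpret N: sigma_finite_measure N by fact
 interpret MN: pair_sigma_finite M N ..
 note [measurable_cong] = M(1) N(1)
 have sM: "(\<integral>\<^sup>+x. h (x + y) \<partial>M) = (\<integral>\<^sup>+x. h x \<partial>M)" if "y : F" "h : borel_measurable borel" for h y
  using nn_integral_distr[of "%x. x + y" M borel h] trM[OF that(1)] that(2) by simp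
 have sN: "(\<integral>\<^sup>+x. h (x + y) \<partial>N) = (\<integral>\<^sup>+x. h x \<partial>N)" if "y : F" "h : borel_measurable borel" for h y
  using nn_integral_distr[of "%x. x + y" N borel h] trN[OF that(1)] that(2) by simp
 define f g :: "'a => ennreal" where "f = indicator B" and "g = indicator A"
 have [measurable]: "f : borel_measurable borel" "g : borel_measurable borel" by (auto simp: f_def g_def)
 have "emeasure M B * emeasure N A = (\<integral>\<^sup>+x. f x \<partial>M) * (\<integral>\<^sup>+y. g y \<partial>N)"
  by (simp add: f_def g_def M N)
 also have "... = (\<integral>\<^sup>+x. f x * (\<integral>\<^sup>+y. g y \<partial>N) \<partial>M)"
  by (simp add: nn_integral_multc)
 also have "... = (\<integral>\<^sup>+x. (\<integral>\<^sup>+y. f x * g (y + x) \<partial>N) \<partial>M)"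
 proof (rule nn_integral_cong_AE, use M(3) in eventually_elim)
  fix x assume "x : F"
  then show "f x * (\<integral>\<^sup>+y. g y \<partial>N) = (\<integral>\<^sup>+y. f x * g (y + x) \<partial>N)"
  by (simp add: nn_integral_cmult sN)
 qed
 also have "... = (\<integral>\<^sup>+y. (\<integral>\<^sup>+x. f x * g (y + x) \<partial>M) \<partial>N)"
  by (rule MN.Fubini'[symmetric]) measurable
 also have "... = (\<integral>\<^sup>+y. (\<integral>\<^sup>+x. f (x - y) * g x \<partial>M) \<partial>N)"
 proof (rule nn_integral_cong_AE, use N(3) in eventually_elim)
  fix y assume "y : F"
  then show "(\<integral>\<^sup>+x. f x * g (y + x) \<partial>M) = (\<integral>\<^sup>+x. f (x - y) * g x \<partial>M)"
  using sM[of y "%x. f (x - y) * g x"] by (simp add: add.commute)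
 qed
 also have "... = (\<integral>\<^sup>+x. (\<integral>\<^sup>+y. f (x - y) * g x \<partial>N) \<partial>M)"
  by (rule MN.Fubini') measurable
 also have "... = (\<integral>\<^sup>+x. g x * (\<integral>\<^sup>+y. f y \<partial>N) \<partial>M)"
 proof (rule nn_integral_cong_AE, use M(3) in eventually_elim)
  fix x assume x: "x : F"
  have "f (x - y) = f (y + - x)" for y using sym[of "x - y"] by (auto simp: f_def indicator_def)
  then show "(\<integral>\<^sup>+y. f (x - y) * g x \<partial>N) = g x * (\<integral>\<^sup>+y. f y \<partial>N)"
  using sN[of "- x" f] F[OF x] by (simp add: nn_integral_cmult mult.commute)
 qed
 also have "... = emeasure M A * emeasure N B"
  by (simp add: nn_integral_multc f_def g_def M N)
 finally show ?thesis .
qed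

text \<open>The image measure is again translation invariant, hence proportional to
  \<open>lborel\<close>; the unit ball, which \<open>T\<close> preserves, fixes the factor to one.
  \<open>S\<close> supplies the translation before \<open>T\<close> that induces a given translation
  after it.\<close>

lemma lborel_isometry_invariant:
 fixes T :: "'a::euclidean_space => 'a"
 assumes T: "linear T" "!!x. norm (T x) = norm x" and S: "!!y. T (S y) = y"
 shows "distr lborel borel T = lborel"
proof -
 have cT: "continuous_on UNIV T" using T(1) by (simp add: linear_continuous_on linear_linear)
 then have [measurable]: "T : borel_measurable borel" by (simp add: borel_contI)
 define N where "N = distr lborel borel T"
 have inj: "inj T" using T by (metis linear_injective_0 norm_eq_zero)
 have em: "emeasure N X = emeasure lborel (T -` X)" if "X : sets borel" for X
  using that by (simp add: N_def emeasure_distr)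
 have ballT: "T -` (ball 0 r) = ball 0 r" for r by (auto simp: T(2))
 have tr: "distr N borel (%x. x + y) = N" for y
 proof -
  have "distr N borel (%x. x + y) = distr lborel borel (%x. T x + y)"
  by (simp add: N_def distr_distr comp_def)
  also have "(%x. T x + y) = (%x. T (S y + x))"
  using T(1) S by (simp add: linear_add add.commute)
  also have "distr lborel borel (%x. T (S y + x)) = distr (distr lborel borel ((+) (S y))) borel T"
  by (simp add: distr_distr comp_def)
  finally show ?thesis by (simp add: lborel_distr_plus N_def)
 qed
 have sf: "sigma_finite_measure N"
 proof
  show "EX A. countable A & A \<subseteq> sets N & \<Union> A = space N & (ALL a:A. emeasure N a ~= \<infinity>)"
  proof (intro exI conjI ballI)
  show "countable (range (%n::nat. ball (0::'a) n))" by simp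
  show "range (%n::nat. ball (0::'a) n) \<subseteq> sets N" by (auto simp: N_def)
  show "\<Union> (range (%n::nat. ball (0::'a) n)) = space N"
  by (auto simp: N_def reals_Archimedean2)
  fix a assume "a : range (%n::nat. ball (0::'a) n)"
  then show "emeasure N a ~= \<infinity>"
  using emeasure_lborel_ball_finite by (auto simp: em ballT less_top)
  qed
 qed
 have "emeasure N A = emeasure lborel A" if A: "A : sets borel" for A
 proof -
  let ?b = "ball (0::'a) 1"
  have "emeasure lborel ?b * emeasure N A = emeasure lborel A * emeasure N ?b"
  by (rule translation_invariant_unique[where F = UNIV])
  (use A tr sf sigma_finite_lborel in \<open>auto simp: N_def add.commute[of _ "_::'a"] lborel_distr_plus\<close>)
  then have eq: "emeasure lborel ?b * emeasure N A = emeasure lborel ?b * emeasure lborel A"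
  by (simp add: em ballT mult.commute)
  have "emeasure lborel ?b ~= 0" "emeasure lborel ?b ~= \<infinity>"
  using emeasure_lborel_ball_finite[of "0::'a" 1] content_ball_pos[of 1 "0::'a"]
  by (auto simp: emeasure_eq_measure2 measure_def less_top)
  then show ?thesis using eq by (simp add: ennreal_mult_cancel_left)
 qed
 then show ?thesis by (intro measure_eqI) (auto simp: N_def)
qed

section \<open>Gram--Schmidt\<close>

text \<open>Normalising by \<open>sgn\<close> gives 0 once a vector depends on its predecessors,
  which keeps the process total and measurable; orthonormality is claimed only for independent
  input.\<close>

function gs :: "(nat => 'a::real_inner) => nat => 'a" where
 "gs a i = sgn (a i - (SUM j<i. (a i \<bullet> gs a j) *\<^sub>R gs a j))"
 by auto
termination by (relation "Wellfounded.measure snd") auto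
declare gs.simps [simp del]

lemma gs_equivariant: "U : orth ==> gs (%i. U *v a i) i = U *v gs a i"
proof (induction i rule: less_induct)
 case (less i)
 have "(SUM j<i. ((U *v a i) \<bullet> gs (%i. U *v a i) j) *\<^sub>R gs (%i. U *v a i) j)
  = (SUM j<i. (a i \<bullet> gs a j) *\<^sub>R (U *v gs a j))"
  using less by (intro sum.cong) auto
 also have "... = U *v (SUM j<i. (a i \<bullet> gs a j) *\<^sub>R gs a j)"
  by (simp add: linear_sum[OF matrix_vector_mul_linear] mv_scaleR)
 finally show ?case
  by (subst (1 2) gs.simps) (simp add: less.prems sgn_div_norm mv_scaleR
  flip: matrix_vector_mult_diff_distrib)
qed

lemma gs_measurable: "(!!i. a i : borel_measurable M) ==> (%x. gs (%i. a i x) i) : borel_measurable M"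
 for a :: "nat => 'b => 'a::euclidean_space"
proof (induction i rule: less_induct)
 case (less i)
 note [measurable] = less.prems
 have [measurable]: "(%x. SUM j<i. (a i x \<bullet> gs (%i. a i x) j) *\<^sub>R gs (%i. a i x) j) : borel_measurable M"
  using less by (intro borel_measurable_sum borel_measurable_scaleR borel_measurable_inner) auto
 show ?case by (subst gs.simps) (simp add: sgn_div_norm)
qed

lemma gs_span: "gs a i : span (a ` {..i})"
proof (induction i rule: less_induct)
 case (less i)
 have "gs a j : span (a ` {..i})" if "j < i" for j
  using less[OF that] that span_mono[of "a ` {..j}" "a ` {..i}"] by force
 then have "a i - (SUM j<i. (a i \<bullet> gs a j) *\<^sub>R gs a j) : span (a ` {..i})"
  by (intro span_diff span_sum span_scale) (auto intro: span_base)
 then show ?case by (subst gs.simps) (simp add: sgn_div_norm span_scale)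
qed

lemma gs_orthonormal:
 assumes "!!i. i < n ==> a i \<notin> span (a ` {..<i})" "i < n"
 shows "norm (gs a i) = 1 & (ALL j<i. gs a i \<bullet> gs a j = 0)"
 using assms(2)
proof (induction i rule: less_induct)
 case (less i)
 define r where "r = a i - (SUM j<i. (a i \<bullet> gs a j) *\<^sub>R gs a j)"
 have g: "gs a i = sgn r" by (subst gs.simps) (simp add: r_def)
 have "gs a j : span (a ` {..<i})" if "j < i" for j
  using gs_span[of a j] that span_mono[of "a ` {..j}" "a ` {..<i}"] by force
 then have "(SUM j<i. (a i \<bullet> gs a j) *\<^sub>R gs a j) : span (a ` {..<i})"
  by (intro span_sum span_scale) auto
 then have r: "r ~= 0" using assms(1)[OF less.prems] by (auto simp: r_def)
 have "r \<bullet> gs a k = 0" if k: "k < i" for k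
 proof -
  have "(SUM j<i. (a i \<bullet> gs a j) * (gs a j \<bullet> gs a k)) = (SUM j<i. if j = k then a i \<bullet> gs a k else 0)"
  proof (rule sum.cong)
  fix j assume "j : {..<i}"
  then consider "j = k" | "j < k" | "k < j" "j < i" by fastforce
  then show "(a i \<bullet> gs a j) * (gs a j \<bullet> gs a k) = (if j = k then a i \<bullet> gs a k else 0)"
  proof cases
  case 1 then show ?thesis using less.IH[OF k] k less.prems by (simp add: norm_eq_1)
  next
  case 2 then show ?thesis using less.IH[OF k] k less.prems by (simp add: inner_commute)
  next
  case 3 then show ?thesis using less.IH[of j] less.prems by simp
  qed
  qed simp
  then show ?thesis using k by (simp add: r_def inner_diff_left inner_sum_left)
 qed
 then show ?case using r by (simp add: g norm_sgn sgn_div_norm)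
qed

text \<open>Vectors from the range and from the kernel of \<open>P\<close> are orthogonal, so each
  subtraction involves only predecessors of the same type. Hence the orthonormalised frame still
  splits along \<open>P\<close>.\<close>

lemma gs_eigen: assumes P: "oproj P" and e: "!!i. P *v a i = (if c i then a i else 0)"
 shows "P *v gs a i = (if c i then gs a i else 0)"
proof (induction i rule: less_induct)
 case (less i)
 have "P *v ((a i \<bullet> gs a j) *\<^sub>R gs a j) = (if c i then (a i \<bullet> gs a j) *\<^sub>R gs a j else 0)" if "j < i" for j
 proof (cases "c i = c j")
  case True then show ?thesis using less[OF that] by (simp add: mv_scaleR)
 next
  case False
  have "(P *v a i) \<bullet> gs a j = a i \<bullet> (P *v gs a j)" using P by (rule proj_inner)
  then have "a i \<bullet> gs a j = 0" using False less[OF that] e[of i] by (auto split: if_splits)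
  then show ?thesis by (simp)
 qed
 then have "P *v (SUM j<i. (a i \<bullet> gs a j) *\<^sub>R gs a j) = (if c i then (SUM j<i. (a i \<bullet> gs a j) *\<^sub>R gs a j) else 0)"
  by (simp add: linear_sum[OF matrix_vector_mul_linear])
 then show ?case
  by (subst (1 2) gs.simps) (simp add: sgn_div_norm mv_scaleR matrix_vector_mult_diff_distrib e)
qed

section \<open>Haar measure on stabilizers\<close>

lemma adapted_basis:
 fixes P :: "('n::finite) matr" assumes P: "oproj P"
 obtains b :: "nat => 'n vect" and c where
  "!!i j. i < CARD('n) ==> j < CARD('n) ==> b i \<bullet> b j = (if i = j then 1 else 0)"
  "!!i. P *v b i = (if c i then b i else 0)"
  "!!x. (SUM i<CARD('n). (b i \<bullet> x) *\<^sub>R b i) = x"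
proof -
 obtain B1 where B1: "B1 \<subseteq> subsp P" "pairwise orthogonal B1" "!!x. x : B1 ==> norm x = 1"
  "independent B1" "card B1 = dim (subsp P)" "span B1 = subsp P"
  using orthonormal_basis_subspace[OF subspace_subsp[of P]] by metis
 obtain B2 where B2: "B2 \<subseteq> subsp (perpP P)" "pairwise orthogonal B2" "!!x. x : B2 ==> norm x = 1"
  "independent B2" "card B2 = dim (subsp (perpP P))" "span B2 = subsp (perpP P)"
  using orthonormal_basis_subspace[OF subspace_subsp[of "perpP P"]] by metis
 have fin: "finite B1" "finite B2" using independent_imp_finite[OF B1(4)] independent_imp_finite[OF B2(4)] by auto
 have e1: "P *v x = x" if "x : B1" for x using B1(1) that P by (auto simp: subsp_iff)
 have e2: "P *v x = 0" if "x : B2" for x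
  using B2(1) that P by (force simp: subsp_iff perp_vec)
 have cross: "x \<bullet> y = 0" if "x : B1" "y : B2" for x y
  using e1[OF that(1)] e2[OF that(2)] proj_inner[OF P, of x y] by simp
 have cross': "y \<bullet> x = 0" if "x : B1" "y : B2" for x y
  using cross[OF that] by (simp add: inner_commute)
 have disj: "B1 \<inter> B2 = {}" using e1 e2 B1(3) by fastforce
 define B where "B = B1 \<union> B2"
 have rk: "rank P <= CARD('n)" using rank_bound[of P] by simp
 have "perpP P : Grass (CARD('n) - rank P)"
  by (rule Grass_perp) (use P rk in "auto simp: Grass_iff")
 then have cB: "card B = CARD('n)"
  using rk by (simp add: B_def card_Un_disjoint fin disj B1(5) B2(5) dim_subsp Grass_iff)
 have fB: "finite B" using fin by (simp add: B_def)
 have sp: "x : span B" for x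
 proof -
  have "P *v x : span B1" using P by (simp add: B1 subsp_iff)
  moreover have "x - P *v x : span B2" using P by (simp add: B2 subsp_iff perp_vec matrix_vector_mult_diff_distrib)
  ultimately have "P *v x + (x - P *v x) : span B"
  by (intro span_add) (use span_mono[of _ B] in "auto simp: B_def")
  then show ?thesis by simp
 qed
 have orthB: "pairwise orthogonal B"
  using B1(2) B2(2) cross cross'
  by (auto simp: pairwise_def B_def orthogonal_def)
 have n1: "norm x = 1" if "x : B" for x using that B1 B2 by (auto simp: B_def)
 obtain h where h: "bij_betw h {..<CARD('n)} B"
  using ex_bij_betw_nat_finite[OF fB] cB by (auto simp: atLeast0LessThan)
 \<comment> \<open>Zero beyond the dimension, so that the eigenvector condition holds for every
   index, as \<open>gs_eigen\<close> requires.\<close>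
 define b where "b i = (if i < CARD('n) then h i else 0)" for i
 have hB: "h i : B" if "i < CARD('n)" for i using h that by (auto simp: bij_betw_def)
 show ?thesis
 proof (rule that[of b "%i. b i : B1"])
  fix i j assume ij: "i < CARD('n)" "j < CARD('n)"
  then have "h i = h j \<longleftrightarrow> i = j" using h by (auto simp: bij_betw_def inj_on_def)
  then show "b i \<bullet> b j = (if i = j then 1 else 0)"
  using ij orthB hB[of i] hB[of j] n1[of "h i"]
  by (auto simp: b_def pairwise_def orthogonal_def norm_eq_1)
 next
  fix i
  show "P *v b i = (if b i : B1 then b i else 0)"
  using e1 e2 hB[of i] by (auto simp: b_def B_def)
 next
  fix x
  have "(SUM i<CARD('n). (b i \<bullet> x) *\<^sub>R b i) = (SUM i<CARD('n). (h i \<bullet> x) *\<^sub>R h i)"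
  by (simp add: b_def)
  also have "... = (SUM v:B. (v \<bullet> x) *\<^sub>R v)" by (rule sum.reindex_bij_betw[OF h])
  also have "... = x"
  using orthonormal_basis_expand[OF orthB n1 sp fB, of x] by (simp add: inner_commute)
  finally show "(SUM i<CARD('n). (b i \<bullet> x) *\<^sub>R b i) = x" .
 qed
qed

lemma matrix_mult_lborel: "U : orth ==> distr lborel borel (%A. U ** A) = (lborel :: ('n::finite) matr measure)"
proof (rule lborel_isometry_invariant[where S = "%A. transpose U ** A"])
 assume U: "U : orth"
 show "linear (%A :: 'n matr. U ** A)"
  using bounded_bilinear.bounded_linear_right[OF bilinear_mult] bounded_linear.linear by blast
 show "norm (U ** A) = norm A" for A :: "'n matr" using U by simp
 show "U ** (transpose U ** A) = A" for A :: "'n matr" using U by (simp add: matrix_mul_assoc orthD)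
qed

lemma continuous_on_det: "continuous_on S (f :: 'a::topological_space => real^'n^'n) ==> continuous_on S (%x. det (f x))"
 unfolding det_def by (intro continuous_intros)

lemma borel_measurable_matrix_mult [measurable (raw)]:
 fixes f g :: "'a => real^'n^'n"
 shows "f : borel_measurable M ==> g : borel_measurable M ==> (%x. f x ** g x) : borel_measurable M"
 by (rule borel_measurable_continuous_Pair) (auto intro!: continuous_intros)

lemma borel_measurable_matrix_vector [measurable (raw)]:
 fixes f :: "'a => real^'n^'n"
 shows "f : borel_measurable M ==> g : borel_measurable M ==> (%x. f x *v g x) : borel_measurable M"
 by (rule borel_measurable_continuous_Pair) (auto intro!: continuous_intros)

lemma borel_measurable_outer [measurable (raw)]:
 fixes f :: "'a => real^'n"
 shows "f : borel_measurable M ==> g : borel_measurable M ==> (%x. outer (f x) (g x)) : borel_measurable M"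
 by (rule borel_measurable_continuous_Pair) (auto intro!: continuous_intros)

lemma borel_measurable_transpose [measurable (raw)]:
 fixes f :: "'a => real^'n^'n"
 shows "f : borel_measurable M ==> (%x. transpose (f x)) : borel_measurable M"
 by (rule borel_measurable_continuous_on[where f = transpose]) (intro continuous_intros)

lemma borel_measurable_rot [measurable (raw)]:
 fixes f :: "'a => real^'n^'n"
 shows "f : borel_measurable M ==> g : borel_measurable M ==> (%x. rot (f x) (g x)) : borel_measurable M"
 unfolding rot_def by (intro borel_measurable_matrix_mult borel_measurable_transpose)

lemma borel_measurable_perpP [measurable (raw)]:
 fixes f :: "'a => real^'n^'n"
 shows "f : borel_measurable M ==> (%x. perpP (f x)) : borel_measurable M"
 unfolding perpP_def by measurable

definition is_haar :: "('n::finite) matr => 'n matr measure => bool" where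
 "is_haar P M \<longleftrightarrow> sets M = sets borel & prob_space M & (AE U in M. U : Stab P) \<and>
  (ALL V:Stab P. distr M borel (%U. V ** U) = M)"

text \<open>A Lebesgue-random matrix is made orthogonal by Gram-Schmidt. Since the process commutes
  with left multiplication by orthogonal matrices and Lebesgue measure is invariant under it, the
  image law is left invariant. An adapted basis together with the block-diagonal part of the matrix
  forces the result to commute with \<open>P\<close>.\<close>

lemma haar_exists: fixes P :: "('n::finite) matr" assumes P: "oproj P" shows "EX M. is_haar P M"
proof -
 define n where "n = CARD('n)"
 obtain b :: "nat => 'n vect" and c where
  b: "!!i j. i < n ==> j < n ==> b i \<bullet> b j = (if i = j then 1 else 0)"
  "!!i. P *v b i = (if c i then b i else 0)"
  "!!x. (SUM i<n. (b i \<bullet> x) *\<^sub>R b i) = x"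
 proof (rule adapted_basis[OF P])
  fix b :: "nat => 'n vect" and c
  assume "!!i j. i < CARD('n) ==> j < CARD('n) ==> b i \<bullet> b j = (if i = j then 1 else 0)"
  "!!i. P *v b i = (if c i then b i else 0)" "!!x. (SUM i<CARD('n). (b i \<bullet> x) *\<^sub>R b i) = x"
  then show thesis using that[of b c] by (simp add: n_def)
 qed
 \<comment> \<open>The part of \<open>A\<close> that commutes with \<open>P\<close>; only this part
   is orthonormalised.\<close>
 define blk where "blk A = P ** A ** P + perpP P ** A ** perpP P" for A :: "'n matr"
 define G where "G A = (SUM i<n. outer (gs (%i. blk A *v b i) i) (b i))" for A
 \<comment> \<open>Bounded for finite measure, open and containing the identity for positive measure
   (hence the radius one above the norm of \<open>mat 1\<close>), and invariant under the stabiliser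
   because the norm and the non-vanishing of the determinant are.\<close>
 define \<Omega> where "\<Omega> = {A. norm A < norm (mat 1 :: 'n matr) + 1 & det (blk A) ~= 0}"
 have [measurable]: "blk : borel_measurable borel" unfolding blk_def by measurable
 have [measurable]: "G : borel_measurable borel"
 proof -
  have [measurable]: "(%A. gs (%i. blk A *v b i) i) : borel_measurable borel" for i
  by (rule gs_measurable) measurable
  show ?thesis unfolding G_def by measurable
 qed
 have cdet: "continuous_on UNIV (%A. det (blk A))"
  unfolding blk_def by (intro continuous_on_det continuous_intros)
 have open\<Omega>: "open \<Omega>"
  unfolding \<Omega>_def by (intro open_Collect_conj open_Collect_less open_Collect_neq cdet continuous_intros)
 then have [measurable]: "\<Omega> : sets borel" by simp
 have "P ** P = P" using P by (simp add: oproj_def)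
 moreover have "perpP P ** perpP P = perpP P" using proj_perp[OF P] by (simp add: oproj_def)
 ultimately have "blk (mat 1) = mat 1" by (simp add: blk_def perpP_def)
 then have one: "mat 1 : \<Omega>" by (simp add: \<Omega>_def)
 have fin: "emeasure lborel \<Omega> ~= \<infinity>"
 proof -
  have "emeasure lborel \<Omega> <= emeasure lborel (ball (0::'n matr) (norm (mat 1 :: 'n matr) + 1))"
  by (rule emeasure_mono) (auto simp: \<Omega>_def)
  also have "... < \<infinity>" using emeasure_lborel_ball_finite by simp
  finally show ?thesis by simp
 qed
 have pos: "emeasure lborel \<Omega> ~= 0"
 proof -
  obtain e where e: "e > 0" "ball (mat 1) e \<subseteq> \<Omega>" using open\<Omega> one openE by blast
  have "0 < measure lborel (ball (mat 1 :: 'n matr) e)"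
  using content_ball_pos[OF e(1)] by (simp add: measure_def)
  then have "0 < emeasure lborel (ball (mat 1 :: 'n matr) e)"
  by (metis measure_def enn2real_positive_iff)
  then show ?thesis using e(2) by (metis emeasure_mono less_le_not_le not_gr_zero open\<Omega> borel_open sets_lborel)
 qed
 define \<mu> where "\<mu> = uniform_measure lborel \<Omega>"
 have sets\<mu>[measurable_cong]: "sets \<mu> = sets borel" by (simp add: \<mu>_def)
 have ps: "prob_space \<mu>" unfolding \<mu>_def by (rule prob_space_uniform_measure) (use fin pos in auto)
 have good: "G A : Stab P" if A: "A : \<Omega>" for A
 proof -
  define q where "q i = gs (%i. blk A *v b i) i" for i
  have inj: "inj ((*v) (blk A))"
  using A by (auto simp: \<Omega>_def) (metis invertible_det_nz inj_matrix_vector_mult)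
  have nsp: "blk A *v b i \<notin> span ((%i. blk A *v b i) ` {..<i})" if i: "i < n" for i
  proof
  assume "blk A *v b i : span ((%i. blk A *v b i) ` {..<i})"
  also have "(%i. blk A *v b i) ` {..<i} = (*v) (blk A) ` (b ` {..<i})" by auto
  also have "span \<dots> = (*v) (blk A) ` span (b ` {..<i})"
  by (rule span_linear_image) (rule matrix_vector_mul_linear)
  finally have "b i : span (b ` {..<i})" using inj by (auto dest: injD)
  moreover have "orthogonal (b i) x" if "x : span (b ` {..<i})" for x
  by (rule orthogonal_to_span[OF that]) (use b(1) i in "auto simp: orthogonal_def")
  ultimately have "b i \<bullet> b i = 0" by (simp add: orthogonal_def)
  then show False using b(1) i by simp
  qed
  have q: "norm (q i) = 1 & (ALL j<i. q i \<bullet> q j = 0)" if "i < n" for i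
  unfolding q_def using gs_orthonormal[of n "%i. blk A *v b i", OF nsp that] by blast
  have qq: "q i \<bullet> q j = (if i = j then 1 else 0)" if "i < n" "j < n" for i j
  using q[OF that(1)] q[OF that(2)] by (cases i j rule: linorder_cases) (auto simp: inner_commute norm_eq_1)
  have "P *v (blk A *v b i) = (if c i then blk A *v b i else 0)" for i
  proof -
  have "P *v (blk A *v b i) = blk A *v (P *v b i)"
  proof -
  have "P ** perpP P = 0" "perpP P ** P = 0"
  using P by (auto intro!: matr_eqI simp: mv_assoc[symmetric] perp_vec matrix_vector_mult_diff_distrib)
  moreover have "P ** P = P" using P by (simp add: oproj_def)
  ultimately have "P ** blk A = P ** A ** P" "blk A ** P = P ** A ** P"
  by (simp_all add: blk_def bounded_bilinear.add_right[OF bilinear_mult]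
  bounded_bilinear.add_left[OF bilinear_mult] matrix_mul_assoc)
  (simp_all add: matrix_mul_assoc[symmetric])
  then show ?thesis by (simp add: mv_assoc)
  qed
  then show ?thesis by (simp add: b(2))
  qed
  then have Pq: "P *v q i = (if c i then q i else 0)" for i
  unfolding q_def by (rule gs_eigen[OF P])
  have Gx: "G A *v x = (SUM i<n. (b i \<bullet> x) *\<^sub>R q i)" for x
  proof -
  have "(SUM i:I. outer (q i) (b i)) *v x = (SUM i:I. (b i \<bullet> x) *\<^sub>R q i)" if "finite I" for I
  using that by (induction I) (auto simp: matrix_vector_mult_add_rdistrib)
  then show ?thesis by (simp add: G_def q_def)
  qed
  have "G A : orth"
  proof (rule orthI)
  fix x y
  have "(G A *v x) \<bullet> (G A *v y) = (SUM i<n. SUM j<n. (b i \<bullet> x) * ((b j \<bullet> y) * (q i \<bullet> q j)))"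
  by (simp add: Gx inner_sum_left inner_sum_right sum_distrib_left)
  (subst sum.swap, simp add: mult.left_commute)
  also have "... = (SUM i<n. SUM j<n. if j = i then (b i \<bullet> x) * (b i \<bullet> y) else 0)"
  by (intro sum.cong) (auto simp: qq)
  also have "... = (SUM i<n. (b i \<bullet> x) *\<^sub>R b i) \<bullet> y" by (simp add: inner_sum_left)
  finally show "(G A *v x) \<bullet> (G A *v y) = x \<bullet> y" by (simp add: b(3))
  qed
  moreover have "G A ** P = P ** G A"
  proof (rule matr_eqI)
  fix x
  have "b i \<bullet> (P *v x) = (if c i then b i \<bullet> x else 0)" for i
  using proj_inner[OF P, of "b i" x] by (simp add: b(2) split: if_splits)
  then have "(b i \<bullet> (P *v x)) *\<^sub>R q i = P *v ((b i \<bullet> x) *\<^sub>R q i)" for i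
  by (simp add: mv_scaleR Pq)
  then show "G A ** P *v x = P ** G A *v x"
  by (simp add: mv_assoc[symmetric] Gx linear_sum[OF matrix_vector_mul_linear])
  qed
  ultimately show ?thesis by (simp add: Stab_def)
 qed
 have blkV: "blk (V ** A) = V ** blk A" if V: "V : Stab P" for V A
 proof -
  have "V ** P = P ** V" "V ** perpP P = perpP P ** V"
  using V by (auto simp: Stab_def perpP_def bounded_bilinear.diff_left[OF bilinear_mult]
  bounded_bilinear.diff_right[OF bilinear_mult])
  then show ?thesis
  by (simp add: blk_def bounded_bilinear.add_right[OF bilinear_mult] matrix_mul_assoc)
 qed
 have equi: "G (V ** A) = V ** G A" if V: "V : Stab P" for V A
 proof -
  have "blk (V ** A) *v b i = V *v (blk A *v b i)" for i
  by (simp add: blkV[OF V] mv_assoc)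
  then have "G (V ** A) = (SUM i<n. outer (V *v gs (%i. blk A *v b i) i) (b i))"
  using V by (simp add: G_def gs_equivariant Stab_orth)
  also have "... = V ** G A"
  by (simp add: G_def mul_outer[symmetric] bounded_bilinear.sum_right[OF bilinear_mult])
  finally show ?thesis .
 qed
 have inv: "distr \<mu> borel (%A. V ** A) = \<mu>" if V: "V : Stab P" for V
 proof (rule measure_eqI)
  have Vo: "V : orth" using V by (rule Stab_orth)
  have \<Omega>V: "(%A. V ** A) -` \<Omega> = \<Omega>"
  proof -
  have "det V ~= 0" using Vo det_orthogonal_matrix[of V] by (auto simp: orth_def)
  then show ?thesis using Vo by (auto simp: \<Omega>_def det_mul blkV[OF V])
  qed
  fix X assume "X : sets (distr \<mu> borel (%A. V ** A))"
  then have X[measurable]: "X : sets borel" by simp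
  have X'[measurable]: "(%A. V ** A) -` X : sets borel"
  using measurable_sets_borel[of "%A. V ** A" borel X] by simp
  have "emeasure (distr \<mu> borel (%A. V ** A)) X = emeasure \<mu> ((%A. V ** A) -` X)"
  by (simp add: emeasure_distr \<mu>_def)
  also have "... = emeasure lborel (\<Omega> \<inter> (%A. V ** A) -` X) / emeasure lborel \<Omega>"
  by (simp add: \<mu>_def)
  also have "\<Omega> \<inter> (%A. V ** A) -` X = (%A. V ** A) -` (\<Omega> \<inter> X)" using \<Omega>V by auto
  also have "emeasure lborel \<dots> = emeasure (distr lborel borel (%A. V ** A)) (\<Omega> \<inter> X)"
  by (simp add: emeasure_distr)
  also have "... = emeasure lborel (\<Omega> \<inter> X)" by (simp add: matrix_mult_lborel[OF Vo])
  finally show "emeasure (distr \<mu> borel (%A. V ** A)) X = emeasure \<mu> X"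
  by (simp add: \<mu>_def)
 qed (simp add: \<mu>_def)
 define H where "H = distr \<mu> borel G"
 have "is_haar P H"
  unfolding is_haar_def
 proof (intro conjI ballI)
  show "sets H = sets borel" by (simp add: H_def)
  show "prob_space H" unfolding H_def by (rule prob_space.prob_space_distr[OF ps]) measurable
  have "AE A in \<mu>. A : \<Omega>" unfolding \<mu>_def by (rule AE_uniform_measureI) auto
  moreover have "closed (Stab P)" using compact_Stab by (rule compact_imp_closed)
  ultimately show "AE U in H. U : Stab P"
  unfolding H_def by (subst AE_distr_iff) (auto intro: good)
  fix V assume V: "V : Stab P"
  have "distr H borel (%U. V ** U) = distr \<mu> borel (%A. G (V ** A))"
  by (simp add: H_def distr_distr comp_def equi[OF V])
  also have "... = distr (distr \<mu> borel (%A. V ** A)) borel G" by (simp add: distr_distr comp_def)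
  also have "... = H" by (simp add: inv[OF V] H_def)
  finally show "distr H borel (%U. V ** U) = H" .
 qed
 then show ?thesis by blast
qed

section \<open>Bounded measurable functions\<close>

text \<open>Bounded Borel functions on the whole space are integrable for every finite Borel measure
  and closed under the operations below, so Fubini applies to them without further
  conditions.\<close>

definition bm :: "('a::topological_space => real) => bool" where
 "bm f \<longleftrightarrow> f : borel_measurable borel & bounded (range f)"

text \<open>Extension by zero makes two such functions equal as soon as they agree on
  \<open>X\<close>, and for compact \<open>X\<close> makes them bounded Borel functions on the
  ambient space.\<close>

definition cont0 :: "'a::topological_space set => ('a => real) => bool" where
 "cont0 X f \<longleftrightarrow> continuous_on X f & (ALL x. x \<notin> X --> f x = 0)"

lemma bm_meas: "bm f ==> f : borel_measurable borel"
 by (simp add: bm_def)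

lemma bmI: "f : borel_measurable borel ==> (!!x. \<bar>f x\<bar> <= B) ==> bm f"
 by (auto simp: bm_def bounded_iff)

lemma bmE: assumes "bm f" obtains B where "B > 0" "!!x. \<bar>f x\<bar> <= B"
 using assms by (auto simp: bm_def bounded_pos)

lemma bm_comp: "bm f ==> h : borel_measurable borel ==> bm (%x. f (h x))"
 by (auto simp: bm_def bounded_iff)

lemma bm_const [simp]: "bm (%x. c)"
 by (rule bmI[of _ "\<bar>c\<bar>"]) auto

lemma bm_add: "bm f ==> bm g ==> bm (%x. f x + g x)"
 by (auto simp: bm_def intro: bounded_plus_comp)

lemma bm_diff: "bm f ==> bm g ==> bm (%x. f x - g x)"
 by (auto simp: bm_def intro: bounded_minus_comp)

lemma bm_mult: assumes "bm f" "bm g" shows "bm (%x. f x * g x)"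
proof -
 obtain A where A: "A > 0" "!!x. \<bar>f x\<bar> <= A" using bmE[OF assms(1)] by blast
 obtain B where B: "B > 0" "!!x. \<bar>g x\<bar> <= B" using bmE[OF assms(2)] by blast
 have "\<bar>f x * g x\<bar> <= A * B" for x
  unfolding abs_mult by (rule mult_mono) (use A B in auto)
 then show ?thesis
  using borel_measurable_times[OF assms[THEN bm_meas]] by (rule bmI[rotated])
qed

lemma bm_cmult: "bm f ==> bm (%x. c * f x)"
 by (rule bm_mult) auto

lemma bm_power: "bm f ==> bm (%x. f x ^ n)"
 by (induction n) (auto intro: bm_mult)

lemma bm_sum: "(!!i. i : I ==> bm (f i)) ==> bm (%x. SUM i:I. f i x)"
 by (induction I rule: infinite_finite_induct) (auto intro: bm_add)

lemma bm_indicator: "A : sets borel ==> bm (indicator A)"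
 by (rule bmI[of _ 1]) (auto simp: indicator_def)

lemma bm_integrable: assumes "finite_measure M" "sets M = sets borel" "bm f" shows "integrable M f"
proof -
 obtain B where "!!x. \<bar>f x\<bar> <= B" using bmE[OF assms(3)] by blast
 moreover have "f : borel_measurable M"
  using bm_meas[OF assms(3)] measurable_cong_sets[OF assms(2) refl] by blast
 ultimately show ?thesis by (intro finite_measure.integrable_const_bound[OF assms(1), of _ B]) auto
qed

lemma cont0_bm: fixes X :: "'a::{t2_space} set" assumes "compact X" "cont0 X f" shows "bm f"
proof -
 have "closed X" using assms by (simp add: compact_imp_closed)
 then have "(%x. indicator X x *\<^sub>R f x) : borel_measurable borel"
  by (intro borel_measurable_continuous_on_indicator) (use assms in "auto simp: cont0_def")
 moreover have "(%x. indicator X x *\<^sub>R f x) = f"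
  using assms by (auto simp: cont0_def indicator_def fun_eq_iff)
 moreover have "bounded (range f)"
 proof -
  have "bounded (f ` X)"
  using assms by (simp add: cont0_def compact_continuous_image compact_imp_bounded)
  then have "bounded (insert 0 (f ` X))" by simp
  moreover have "range f \<subseteq> insert 0 (f ` X)" using assms by (auto simp: cont0_def)
  ultimately show ?thesis by (rule bounded_subset)
 qed
 ultimately show ?thesis by (simp add: bm_def)
qed

lemma bm_fubini:
 fixes f :: "'a::second_countable_topology => 'b::second_countable_topology => real"
 assumes M: "finite_measure M" "sets M = sets borel" and N: "finite_measure N" "sets N = sets borel"
  and f: "bm (case_prod f)"
 shows "(LINT x|M. (LINT y|N. f x y)) = (LINT y|N. (LINT x|M. f x y))"
  and "bm (%x. \<integral>y. f x y \<partial>N)" and "bm (%y. \<integral>x. f x y \<partial>M)"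
proof -
 interpret M: finite_measure M by fact
 interpret N: finite_measure N by fact
 interpret MN: pair_sigma_finite M N ..
 note [measurable_cong] = M(2) N(2)
 obtain B where B: "B > 0" "!!x y. \<bar>f x y\<bar> <= B" using bmE[OF f] by (auto simp: split_paired_all)
 have s: "sets (M \<Otimes>\<^sub>M N) = sets (borel :: ('a \<times> 'b) measure)"
  by (metis M(2) N(2) borel_prod sets_pair_measure_cong)
 have m: "case_prod f : borel_measurable (M \<Otimes>\<^sub>M N)"
  using bm_meas[OF f] measurable_cong_sets[OF s refl] by blast
 interpret P: finite_measure "M \<Otimes>\<^sub>M N"
 proof
  show "emeasure (M \<Otimes>\<^sub>M N) (space (M \<Otimes>\<^sub>M N)) ~= \<infinity>"
  by (simp add: space_pair_measure N.emeasure_pair_measure_Times ennreal_mult_eq_top_iff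
  M.emeasure_finite N.emeasure_finite)
 qed
 have "integrable (M \<Otimes>\<^sub>M N) (case_prod f)"
  by (rule P.integrable_const_bound[of _ B]) (use B m in auto)
 then show "(LINT x|M. (LINT y|N. f x y)) = (LINT y|N. (LINT x|M. f x y))"
  by (rule MN.Fubini_integral[symmetric])
 have bd: "\<bar>\<integral>x. h x \<partial>K\<bar> <= B * measure K (space K)" if "finite_measure K" "!!x. \<bar>h x\<bar> <= B" for h and K :: "'c measure"
 proof -
  interpret K: finite_measure K by fact
  show ?thesis
  proof (cases "integrable K h")
  case True
  have "\<bar>\<integral>x. h x \<partial>K\<bar> <= (LINT x|K. \<bar>h x\<bar>)" by (rule integral_abs_bound)
  also have "... <= (LINT x|K. B)" using True that by (intro integral_mono) auto
  finally show ?thesis by (simp add: mult.commute)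
  next
  case False
  then show ?thesis using B by (simp add: not_integrable_integral_eq)
  qed
 qed
 have "(%x. \<integral>y. f x y \<partial>N) : borel_measurable M"
  using m by (rule N.borel_measurable_lebesgue_integral)
 then show "bm (%x. \<integral>y. f x y \<partial>N)"
  using measurable_cong_sets[OF M(2) refl] by (intro bmI[of _ "B * measure N (space N)"] bd N B) auto
 have "case_prod (%y x. f x y) : borel_measurable (N \<Otimes>\<^sub>M M)"
  using measurable_pair_swap[OF m] by (simp add: case_prod_beta')
 then have "(%y. \<integral>x. f x y \<partial>M) : borel_measurable N"
  by (rule M.borel_measurable_lebesgue_integral)
 then show "bm (%y. \<integral>x. f x y \<partial>M)"
  using measurable_cong_sets[OF N(2) refl] by (intro bmI[of _ "B * measure M (space M)"] bd M B) auto
qed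

lemma integral_distr_bm: "g : borel_measurable M ==> bm f ==>
 (LINT x|(distr M borel g). f x) = (LINT x|M. f (g x))"
 by (rule integral_distr) (auto simp: bm_meas)

section \<open>Haar measure\<close>

text \<open>The default point mass keeps \<open>haar P\<close> a Borel probability measure for every
  matrix, so these facts can be simplification rules without conditions.\<close>

definition haar :: "('n::finite) matr => 'n matr measure" where
 "haar P = (if oproj P then SOME M. is_haar P M else return borel (mat 1))"

lemma haar_is_haar: "oproj P ==> is_haar P (haar P)"
 using haar_exists[of P] by (auto simp: haar_def intro: someI_ex)

lemma sets_haar [simp, measurable_cong]: "sets (haar P) = sets borel"
 using haar_is_haar[of P] by (cases "oproj P") (auto simp: is_haar_def haar_def)

lemma space_haar [simp]: "space (haar P) = UNIV"
 using sets_eq_imp_space_eq[OF sets_haar] by simp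

lemma prob_space_haar: "prob_space (haar P)"
 using haar_is_haar[of P] by (cases "oproj P") (auto simp: is_haar_def haar_def intro: prob_space_return)

lemma finite_haar [simp]: "finite_measure (haar P)"
 using prob_space_haar by (rule prob_space.finite_measure)

lemma haar_measurable [simp]: "borel_measurable (haar P) = borel_measurable borel"
 by (rule measurable_cong_sets) auto

lemma bm_integrable_haar [simp]: "bm f ==> integrable (haar P) f"
 by (rule bm_integrable) auto

lemma AE_haar: "oproj P ==> AE U in haar P. U : Stab P"
 using haar_is_haar[of P] by (auto simp: is_haar_def)

lemma haar_left: assumes P: "oproj P" "V : Stab P" "bm f"
 shows "(LINT U|(haar P). f (V ** U)) = (LINT U|(haar P). f U)"
proof -
 have "distr (haar P) borel (%U. V ** U) = haar P" using haar_is_haar P by (auto simp: is_haar_def)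
 then show ?thesis
  using integral_distr_bm[of "%U. V ** U" "haar P" f] P by simp
qed

lemma measure_haar_UNIV [simp]: "measure (haar P) UNIV = 1"
 using prob_space.prob_space[OF prob_space_haar[of P]] by simp

text \<open>Unimodularity of a compact group: integrating \<open>f (transpose V ** U)\<close> over
  \<open>U\<close> first gives the integral of \<open>f\<close>, over \<open>V\<close> first that of
  \<open>f\<close> composed with inversion.\<close>

lemma haar_transpose: fixes P :: "('n::finite) matr" assumes P: "oproj P" and f: "bm f"
 shows "(LINT U|(haar P). f (transpose U)) = (LINT U|(haar P). f U)"
proof -
 have f2: "bm (%(V :: 'n matr, U). f (transpose V ** U))"
  unfolding case_prod_beta'
  by (rule bm_comp[OF f]) (intro borel_contI continuous_intros)
 have "(LINT U|(haar P). f U) = (LINT V|(haar P). (LINT U|(haar P). f U))" by simp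
 also have "... = (LINT V|(haar P). (LINT U|(haar P). f (transpose V ** U)))"
 proof (rule integral_cong_AE)
  show "AE V in haar P. (LINT U|(haar P). f U) = (LINT U|(haar P). f (transpose V ** U))"
  using AE_haar[OF P] by eventually_elim (use haar_left[OF P Stab_transpose f] in simp)
 qed (use bm_fubini(2)[OF _ _ _ _ f2, of "haar P" "haar P"] in "auto simp: bm_meas")
 also have "... = (LINT U|(haar P). (LINT V|(haar P). f (transpose V ** U)))"
  by (rule bm_fubini(1)[OF _ _ _ _ f2]) auto
 also have "... = (LINT U|(haar P). (LINT V|(haar P). f (transpose V)))"
 proof (rule integral_cong_AE)
  show "AE U in haar P. (LINT V|(haar P). f (transpose V ** U)) = (LINT V|(haar P). f (transpose V))"
  using AE_haar[OF P]
  proof eventually_elim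
  fix U assume U: "U : Stab P"
  have "bm (%V. f (transpose V))" by (rule bm_comp[OF f]) measurable
  from haar_left[OF P Stab_transpose[OF U] this]
  show "(LINT V|(haar P). f (transpose V ** U)) = (LINT V|(haar P). f (transpose V))"
  by (simp add: matrix_transpose_mul)
  qed
 qed (use bm_fubini(3)[OF _ _ _ _ f2, of "haar P" "haar P"] in "auto simp: bm_meas")
 finally show ?thesis by simp
qed

lemma haar_right: assumes P: "oproj P" and V: "V : Stab P" and f: "bm f"
 shows "(LINT U|(haar P). f (U ** V)) = (LINT U|(haar P). f U)"
proof -
 have 1: "bm (%U. f (transpose U))" by (rule bm_comp[OF f]) measurable
 have 2: "bm (%U. f (U ** V))" by (rule bm_comp[OF f]) measurable
 have "(LINT U|(haar P). f (U ** V)) = (LINT U|(haar P). f (transpose U ** V))"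
  using haar_transpose[OF P 2] by simp
 also have "... = (LINT U|(haar P). f (transpose (transpose V ** U)))"
  by (simp add: matrix_transpose_mul)
 also have "... = (LINT U|(haar P). f (transpose U))"
  by (rule haar_left[OF P Stab_transpose[OF V] 1])
 also have "... = (LINT U|(haar P). f U)" by (rule haar_transpose[OF P f])
 finally show ?thesis .
qed

text \<open>An invariant measure equals its average over the group. After Fubini the inner integral
  runs over the orbit of a point, and right invariance of Haar measure makes it independent of the
  point, which may then be taken to be \<open>x0\<close>.\<close>

lemma homogeneous_measure_unique:
 fixes act :: "('n::finite) matr => 'b::euclidean_space => 'b"
 assumes P: "oproj P" and \<mu>: "prob_space \<mu>" "sets \<mu> = sets borel" "AE x in \<mu>. x : X"
  and inv: "!!U. U : Stab P ==> distr \<mu> borel (act U) = \<mu>"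
  and act: "case_prod act : borel_measurable borel"
  and comp: "!!U V. act U (act V x0) = act (U ** V) x0"
  and trans: "!!x. x : X ==> EX V:Stab P. x = act V x0"
 shows "\<mu> = distr (haar P) borel (%U. act U x0)"
proof (rule measure_eqI)
 interpret prob_space \<mu> by fact
 note [measurable_cong] = \<mu>(2)
 have actx: "(%U. act U x) : borel_measurable borel" and actU: "act U : borel_measurable borel" for x U
 proof -
  have "(%U. case_prod act (U, x)) : borel_measurable borel"
  by (rule measurable_compose[OF _ act]) (auto intro!: borel_contI continuous_intros)
  then show "(%U. act U x) : borel_measurable borel" by simp
  have "(%x. case_prod act (U, x)) : borel_measurable borel"
  by (rule measurable_compose[OF _ act]) (auto intro!: borel_contI continuous_intros)
  then show "act U : borel_measurable borel" by simp
 qed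
 have mm: "borel_measurable \<mu> = (borel_measurable borel :: ('b => real) set)"
  by (rule measurable_cong_sets) (auto simp: \<mu>)
 let ?\<nu> = "distr (haar P) borel (%U. act U x0)"
 fix A assume "A : sets \<mu>"
 then have A: "A : sets borel" using \<mu> by simp
 define f :: "'b => real" where "f = indicator A"
 have f: "bm f" unfolding f_def using A by (rule bm_indicator)
 have f2: "bm (%(U, x). f (act U x))"
  using bm_comp[OF f act] by (simp add: case_prod_beta')
 have "measure \<mu> A = (LINT U|(haar P). (LINT x|(\<mu>). f x))" by (simp add: f_def \<mu> A)
 also have "... = (LINT U|(haar P). (LINT x|(\<mu>). f (act U x)))"
 proof (rule integral_cong_AE)
  show "AE U in haar P. (LINT x|(\<mu>). f x) = (LINT x|(\<mu>). f (act U x))"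
  using AE_haar[OF P]
  proof eventually_elim
  fix U assume U: "U : Stab P"
  show "(LINT x|(\<mu>). f x) = (LINT x|(\<mu>). f (act U x))"
  using integral_distr_bm[of "act U" \<mu> f] inv[OF U] f actU[of U] measurable_cong_sets[OF \<mu>(2) refl] by simp
  qed
 qed (use bm_fubini(2)[OF _ _ _ _ f2, of "haar P" \<mu>] \<mu> finite_measure_axioms in "auto simp: bm_meas")
 also have "... = (LINT x|(\<mu>). (LINT U|(haar P). f (act U x)))"
  by (rule bm_fubini(1)[OF _ _ _ _ f2]) (auto simp: \<mu> finite_measure_axioms)
 also have "... = (LINT x|(\<mu>). (LINT U|(haar P). f (act U x0)))"
 proof (rule integral_cong_AE)
  show "AE x in \<mu>. (LINT U|(haar P). f (act U x)) = (LINT U|(haar P). f (act U x0))"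
  using \<mu>(3)
  proof eventually_elim
  fix x assume "x : X"
  then obtain V where V: "V : Stab P" "x = act V x0" using trans by blast
  have "bm (%U. f (act U x0))" by (rule bm_comp[OF f actx])
  from haar_right[OF P V(1) this]
  show "(LINT U|(haar P). f (act U x)) = (LINT U|(haar P). f (act U x0))" by (simp add: V(2) comp)
  qed
 qed (use bm_fubini(3)[OF _ _ _ _ f2, of "haar P" \<mu>] \<mu> finite_measure_axioms
  in "auto simp: bm_meas mm")
 also have "... = (LINT U|(haar P). f (act U x0))" by (simp add: prob_space)
 also have "... = (LINT x|(?\<nu>). f x)"
  using integral_distr_bm[of "%U. act U x0" "haar P" f] f actx by simp
 also have "... = measure ?\<nu> A" by (simp add: f_def A)
 finally have "measure \<mu> A = measure ?\<nu> A" .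
 moreover have "finite_measure ?\<nu>"
  by (rule prob_space.finite_measure, rule prob_space.prob_space_distr[OF prob_space_haar]) (use actx in simp)
 ultimately show "emeasure \<mu> A = emeasure ?\<nu> A"
  by (simp add: emeasure_eq_measure finite_measure.emeasure_eq_measure)
qed (use \<mu> in simp)

text \<open>Discharges the definite descriptions that define \<open>haarS\<close>,
  \<open>haarG\<close> and \<open>sigmaE\<close>: existence by pushing Haar measure forward along
  the orbit map, uniqueness by the previous lemma.\<close>

lemma homogeneous_measure_THE:
 fixes act :: "('n::finite) matr => 'b::euclidean_space => 'b"
 assumes P: "oproj P" and X: "closed X"
  and act: "continuous_on UNIV (case_prod act)"
  and comp: "!!U V. act U (act V x0) = act (U ** V) x0"
  and X0: "!!V. V : Stab P ==> act V x0 : X"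
  and trans: "!!x. x : X ==> EX V:Stab P. x = act V x0"
 shows "(THE M. sets M = sets borel & emeasure M UNIV = 1 & emeasure M (UNIV - X) = 0 \<and>
  (ALL U:Stab P. distr M borel (act U) = M)) = distr (haar P) borel (%U. act U x0)"
proof (rule the_equality)
 have act': "case_prod act : borel_measurable borel" using act by (rule borel_contI)
 have Xc: "UNIV - X : sets borel" using X by auto
 have actx[measurable]: "(%U. act U x) : borel_measurable borel" and actU[measurable]: "act U : borel_measurable borel" for x U
 proof -
  have "continuous_on UNIV (%U. case_prod act (U, x))"
  by (rule continuous_on_compose2[OF act]) (auto intro!: continuous_intros)
  then show "(%U. act U x) : borel_measurable borel" by (simp add: borel_contI)
  have "continuous_on UNIV (%x. case_prod act (U, x))"
  by (rule continuous_on_compose2[OF act]) (auto intro!: continuous_intros)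
  then show "act U : borel_measurable borel" by (simp add: borel_contI)
 qed
 let ?\<nu> = "distr (haar P) borel (%U. act U x0)"
 interpret nu: prob_space ?\<nu> by (rule prob_space.prob_space_distr[OF prob_space_haar]) simp
 have "AE x in ?\<nu>. x : X"
  using AE_haar[OF P] X by (subst AE_distr_iff) (auto elim!: eventually_mono intro: X0)
 then have "emeasure ?\<nu> (UNIV - X) = 0"
  using Xc by (subst (asm) AE_iff_measurable[of "UNIV - X"]) auto
 moreover have "distr ?\<nu> borel (act V) = ?\<nu>" if V: "V : Stab P" for V
 proof -
  have "distr ?\<nu> borel (act V) = distr (haar P) borel (%U. act (V ** U) x0)"
  by (simp add: distr_distr comp_def comp)
  also have "... = distr (distr (haar P) borel (%U. V ** U)) borel (%U. act U x0)"
  by (simp add: distr_distr comp_def)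
  also have "distr (haar P) borel (%U. V ** U) = haar P"
  using haar_is_haar[OF P] V by (auto simp: is_haar_def)
  finally show ?thesis .
 qed
 ultimately show "sets ?\<nu> = sets borel & emeasure ?\<nu> UNIV = 1 & emeasure ?\<nu> (UNIV - X) = 0 \<and>
  (ALL U:Stab P. distr ?\<nu> borel (act U) = ?\<nu>)"
  using nu.emeasure_space_1 by auto
next
 fix M assume M: "sets M = sets borel & emeasure M UNIV = 1 & emeasure M (UNIV - X) = 0 \<and>
  (ALL U:Stab P. distr M borel (act U) = M)"
 have sp: "space M = UNIV" using M sets_eq_imp_space_eq[of M borel] by simp
 have "prob_space M" by (rule prob_spaceI) (use M sp in auto)
 moreover have "AE x in M. x : X"
  by (rule AE_I[of _ _ "UNIV - X"]) (use M X in auto)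
 ultimately show "M = distr (haar P) borel (%U. act U x0)"
  by (intro homogeneous_measure_unique[OF P _ _ _ _ borel_contI[OF act] comp trans])
  (use M in auto)
qed

lemma closed_Stab [simp]: "closed (Stab P)" by (rule compact_imp_closed[OF compact_Stab])
lemma closed_Grass [simp]: "closed (Grass m)" by (rule compact_imp_closed[OF compact_Grass])
lemma closed_Sph [simp]: "closed Sph" by (rule compact_imp_closed[OF compact_Sph])
lemma borel_Stab [measurable, simp]: "Stab P : sets borel" by (rule borel_closed) simp
lemma borel_Grass [measurable, simp]: "Grass m : sets borel" by (rule borel_closed) simp
lemma borel_Sph [measurable, simp]: "Sph : sets borel" by (rule borel_closed) simp

lemma haar_unique:
 fixes P :: "('n::finite) matr"
 assumes P: "oproj P" and M: "is_haar P M" shows "M = haar P"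
proof -
 have "M = distr (haar P) borel (%U. U ** mat 1)"
  by (rule homogeneous_measure_unique[OF P, of M "Stab P" "%U V. U ** V"])
  (use M in "auto simp: is_haar_def matrix_mul_assoc case_prod_beta' intro!: borel_contI continuous_intros")
 also have "... = haar P" by (simp add: distr_id2)
 finally show ?thesis .
qed

lemma Stab_rot: "W : orth ==> V : Stab (rot W P) \<longleftrightarrow> rot (transpose W) V : Stab P"
proof -
 assume W: "W : orth"
 have o: "rot (transpose W) V : orth \<longleftrightarrow> V : orth"
 proof
  assume h: "rot (transpose W) V : orth"
  have "W ** rot (transpose W) V ** transpose W : orth" using W h by (intro orth_mult) auto
  moreover have "W ** rot (transpose W) V ** transpose W = V"
  by (metis W rot_def rot_transpose_cancel(2))
  ultimately show "V : orth" by simp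
 qed (use W in "simp add: rot_def")
 have "rot (rot (transpose W) V) P = rot (transpose W) (rot V (rot W P))"
  using W by (simp add: rot_rot) (simp add: rot_def[of "transpose W" V] matrix_mul_assoc)
 then have "rot (rot (transpose W) V) P = P \<longleftrightarrow> rot V (rot W P) = rot W P"
  using W by (metis rot_transpose_cancel)
 then show ?thesis by (simp add: Stab_iff o)
qed

lemma haar_rot:
 assumes P: "oproj P" and W: "W : orth"
 shows "haar (rot W P) = distr (haar P) borel (rot W)"
proof (rule haar_unique[symmetric])
 have [measurable]: "rot W : borel_measurable borel" by measurable
 show "oproj (rot W P)" using P W by simp
 show "is_haar (rot W P) (distr (haar P) borel (rot W))"
  unfolding is_haar_def
 proof (intro conjI ballI)
  show "prob_space (distr (haar P) borel (rot W))"
  by (rule prob_space.prob_space_distr[OF prob_space_haar]) simp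
  have "AE U in haar P. rot W U : Stab (rot W P)"
  using AE_haar[OF P] by eventually_elim (use W in "simp add: Stab_rot")
  then show "AE U in distr (haar P) borel (rot W). U : Stab (rot W P)"
  by (subst AE_distr_iff) auto
  fix V assume V: "V : Stab (rot W P)"
  define V' where "V' = rot (transpose W) V"
  have V': "V' : Stab P" using V W by (simp add: V'_def Stab_rot)
  have e: "V ** rot W U = rot W (V' ** U)" for U
  proof -
  have "rot W (V' ** U) = (W ** transpose W) ** V ** (W ** U ** transpose W)"
  by (simp add: rot_def V'_def matrix_mul_assoc)
  then show ?thesis using W by (simp add: orthD rot_def)
  qed
  have "distr (distr (haar P) borel (rot W)) borel (%U. V ** U) = distr (haar P) borel (%U. rot W (V' ** U))"
  by (simp add: distr_distr comp_def e)
  also have "... = distr (distr (haar P) borel (%U. V' ** U)) borel (rot W)"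
  by (simp add: distr_distr comp_def)
  also have "distr (haar P) borel (%U. V' ** U) = haar P"
  using haar_is_haar[OF P] V' by (auto simp: is_haar_def)
  finally show "distr (distr (haar P) borel (rot W)) borel (%U. V ** U) = distr (haar P) borel (rot W)" .
 qed simp
qed

lemma integral_haar_rot:
 "oproj P ==> W : orth ==> bm f ==> (LINT U|(haar (rot W P)). f U) = (LINT U|(haar P). f (rot W U))"
 by (simp add: haar_rot integral_distr_bm)

section \<open>Invariant measures on the sphere, its sections and the Grassmannian\<close>

abbreviation haarO :: "('n::finite) matr measure" where "haarO \<equiv> haar (mat 1)"

lemma AE_haarO: "AE U in haarO. U : orth"
 using AE_haar[OF proj_mat1] by simp

lemma haarO_right: "V : orth ==> bm f ==> (LINT U|haarO. f (U ** V)) = (LINT U|haarO. f U)"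
 by (rule haar_right[OF proj_mat1]) auto

lemma haarS_eq: assumes e: "e : Sph" shows "haarS = distr haarO borel (%U. U *v e)"
proof -
 have "(THE M. sets M = sets borel & emeasure M UNIV = 1 & emeasure M (UNIV - Sph) = 0 \<and>
  (ALL U:Stab (mat 1). distr M borel (%x. U *v x) = M)) = distr haarO borel (%U. U *v e)"
 proof (rule homogeneous_measure_THE[where act = "%U x. U *v x"])
  show "EX V:Stab (mat 1). x = V *v e" if "x : Sph" for x
  using sphere_orbit[OF e] that by auto
 qed (use e compact_Sph in "auto simp: proj_mat1 case_prod_beta' Sph_def
  mv_assoc intro!: continuous_intros")
 then show ?thesis by (simp add: haarS_def orth_def)
qed

lemma haarG_eq: assumes P: "P : Grass m" shows "haarG m = distr haarO borel (%U. rot U P)"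
proof -
 have "(THE M. sets M = sets borel & emeasure M UNIV = 1 & emeasure M (UNIV - Grass m) = 0 \<and>
  (ALL U:Stab (mat 1). distr M borel (%P. rot U P) = M)) = distr haarO borel (%U. rot U P)"
 proof (rule homogeneous_measure_THE[where act = "%U x. rot U x"])
  show "EX V:Stab (mat 1). x = rot V P" if "x : Grass m" for x
  using Grass_orbit[OF P] that by auto
 qed (use P compact_Grass in "auto simp: proj_mat1 case_prod_beta'
  rot_rot intro!: continuous_intros")
 then show ?thesis by (simp add: haarG_def orth_def rot_def)
qed

lemma sigmaE_eq: assumes P: "oproj P" and e: "e : Sph" "P *v e = e"
 shows "sigmaE P = distr (haar P) borel (%U. U *v e)"
proof -
 have cl: "closed (subsp P)" by (rule closed_subspace) simp
 have "(THE M. sets M = sets borel & emeasure M UNIV = 1 & emeasure M (UNIV - (Sph \<inter> subsp P)) = 0 \<and>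
  (ALL U:Stab P. distr M borel (%x. U *v x) = M)) = distr (haar P) borel (%U. U *v e)"
 proof (rule homogeneous_measure_THE[where act = "%U x. U *v x"])
  show "EX V:Stab P. x = V *v e" if "x : Sph \<inter> subsp P" for x
  proof (rule bexI[of _ "refl (e - x)"])
  show "x = refl (e - x) *v e" using that e by (intro refl_swap(1)[symmetric]) (auto simp: Sph_def)
  have "P *v (e - x) = e - x" using that e P by (simp add: matrix_vector_mult_diff_distrib subsp_iff)
  then show "refl (e - x) : Stab P" using P by (simp add: Stab_iff rot_refl_range)
  qed
  show "V *v e : Sph \<inter> subsp P" if "V : Stab P" for V
  proof -
  have "P *v (V *v e) = V *v e"
  proof -
  have "P *v (V *v e) = V *v (P *v e)"
  using that by (simp add: mv_assoc Stab_def)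
  then show ?thesis using e(2) by simp
  qed
  then show ?thesis using that e P Stab_orth[OF that] by (simp add: Sph_def subsp_iff)
  qed
 qed (use P cl compact_Sph in "auto simp: proj_mat1 case_prod_beta'
  mv_assoc intro!: continuous_intros")
 then show ?thesis by (simp add: sigmaE_def Stab_def orth_def)
qed

lemma Sph_axis: "axis undefined 1 : (Sph :: ('n::finite) vect set)"
 by (simp add: Sph_def)

lemma Sph_norm: "x : Sph \<longleftrightarrow> norm x = 1"
 by (simp add: Sph_def)

lemma sets_haarS [simp, measurable_cong]: "sets haarS = sets borel"
 by (simp add: haarS_eq[OF Sph_axis])

lemma prob_space_haarS: "prob_space haarS"
 unfolding haarS_eq[OF Sph_axis] by (rule prob_space.prob_space_distr[OF prob_space_haar]) simp

lemma integral_haarS: "e : Sph ==> bm f ==> (LINT x|haarS. f x) = (LINT U|haarO. f (U *v e))"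
 by (simp add: haarS_eq integral_distr_bm)

lemma integral_haarG: "P : Grass m ==> bm f ==> (LINT x|(haarG m). f x) = (LINT U|haarO. f (rot U P))"
 by (simp add: haarG_eq integral_distr_bm)

lemma integral_sigmaE: "oproj P ==> e : Sph ==> P *v e = e ==> bm f ==>
  (LINT x|(sigmaE P). f x) = (LINT U|(haar P). f (U *v e))"
 by (simp add: sigmaE_eq integral_distr_bm)

lemma AE_haarS: "AE x in haarS. x : Sph"
proof -
 have "AE U in haarO. U *v axis undefined 1 : (Sph :: 'a vect set)"
  using AE_haarO by eventually_elim (use Sph_axis in "simp add: Sph_def")
 then show ?thesis unfolding haarS_eq[OF Sph_axis]
  by (subst AE_distr_iff) auto
qed

lemma sets_haarG [simp]: "P : Grass m ==> sets (haarG m :: 'n matr measure) = sets borel" for P :: "('n::finite) matr"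
 by (simp add: haarG_eq)

lemma prob_space_haarG: "P : Grass m ==> prob_space (haarG m :: 'n matr measure)" for P :: "('n::finite) matr"
 by (simp add: haarG_eq prob_space.prob_space_distr[OF prob_space_haar])

lemma AE_haarG: fixes P :: "('n::finite) matr" assumes "P : Grass m"
 shows "AE Q in (haarG m :: 'n matr measure). Q : Grass m"
proof -
 have "AE U in haarO. rot U P : Grass m"
  using AE_haarO by eventually_elim (use assms in simp)
 then show ?thesis unfolding haarG_eq[OF assms] by (subst AE_distr_iff) auto
qed

section \<open>Full support\<close>

text \<open>Balls of equal radius around group elements have equal measure, because left
  multiplication is an isometry; finitely many of them cover the compact stabiliser, so none is
  null.\<close>

lemma haar_ball_pos:
 assumes P: "oproj P" and V: "V : Stab P" and r: "r > 0"
 shows "measure (haar P) (ball V r) > 0"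
proof -
 interpret prob_space "haar P" by (rule prob_space_haar)
 have eq: "measure (haar P) (ball V r) = measure (haar P) (ball (mat 1) r)" if V: "V : Stab P" for V
 proof -
  have "measure (haar P) (ball V r) = (LINT U|(haar P). indicator (ball V r) U)" by simp
  also have "... = (LINT U|(haar P). indicator (ball V r) (V ** U))"
  by (rule haar_left[OF P V, symmetric]) (simp add: bm_indicator)
  also have "... = (LINT U|(haar P). indicator (ball (mat 1) r) U)"
  proof (rule integral_eqI)
  fix U
  have "V - V ** U = V ** (mat 1 - U)" by (simp add: bounded_bilinear.diff_right[OF bilinear_mult])
  then have "dist V (V ** U) = dist (mat 1) U"
  using Stab_orth[OF V] by (simp add: dist_norm)
  then show "indicator (ball V r) (V ** U) = (indicator (ball (mat 1) r) U :: real)"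
  by (simp add: indicator_def)
  qed simp
  finally show ?thesis by simp
 qed
 have "measure (haar P) (ball (mat 1) r) ~= 0"
 proof
  assume z: "measure (haar P) (ball (mat 1) r) = 0"
  have "Stab P \<subseteq> (\<Union>V\<in>Stab P. ball V r)" using r by auto
  then obtain T where T: "T \<subseteq> Stab P" "finite T" "Stab P \<subseteq> (\<Union>V\<in>T. ball V r)"
  using compactE_image[OF compact_Stab[of P], of "Stab P" "%V. ball V r"] by auto
  have null: "(\<Union>V\<in>T. ball V r) : null_sets (haar P)"
  using T z eq by (intro null_sets.finite_UN) (auto intro!: null_setsI simp: emeasure_eq_measure)
  have "AE U in haar P. U \<notin> (\<Union>V\<in>T. ball V r)" using null by (rule AE_not_in)
  then have "AE U in haar P. False" using AE_haar[OF P] by eventually_elim (use T in blast)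
  then show False by simp
 qed
 then have "measure (haar P) (ball (mat 1) r) > 0" by (simp add: zero_less_measure_iff)
 then show ?thesis using eq[OF V] by simp
qed

lemma haar_integral_pos:
 assumes P: "oproj P" and f: "bm f" "continuous_on (Stab P) f" "!!U. U : Stab P ==> 0 <= f U"
  and V: "V : Stab P" "0 < f V"
 shows "0 < (LINT U|(haar P). f U)"
proof -
 obtain r where r: "r > 0" "!!U. U : Stab P ==> dist U V < r ==> dist (f U) (f V) < f V / 2"
  using f(2) V unfolding continuous_on_iff by (meson half_gt_zero)
 have "0 < f V / 2 * measure (haar P) (ball V r)" using V haar_ball_pos[OF P V(1) r(1)] by simp
 also have "... = (LINT U|(haar P). f V / 2 * indicator (ball V r) U)" by simp
 also have "... <= (LINT U|(haar P). f U)"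
 proof (rule integral_mono_AE)
  show "AE U in haar P. f V / 2 * indicator (ball V r) U <= f U"
  using AE_haar[OF P]
  proof eventually_elim
  fix U assume U: "U : Stab P"
  show "f V / 2 * indicator (ball V r) U <= f U"
  proof (cases "dist U V < r")
  case True
  then have "\<bar>f U - f V\<bar> < f V / 2" using r(2)[OF U] by (simp add: dist_real_def)
  then have "f V / 2 <= f U" by linarith
  then show ?thesis using f(3)[OF U] by (simp add: indicator_def)
  qed (use f(3)[OF U] in "simp add: indicator_def dist_commute")
  qed
  show "integrable (haar P) (%U. f V / 2 * indicator (ball V r) U)"
  by (rule bm_integrable_haar, rule bm_cmult, rule bm_indicator) simp
 qed (use f in simp)
 finally show ?thesis .
qed

lemma continuous_on_integral:
 fixes h :: "'a::metric_space => 'b::topological_space => real"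
 assumes M: "finite_measure M" "sets M = sets borel" "AE v in M. v : C"
  and h: "!!w. w : K ==> h w : borel_measurable borel" "!!w v. w : K ==> \<bar>h w v\<bar> <= B"
  and c: "!!v. v : C ==> continuous_on K (%w. h w v)"
 shows "continuous_on K (%w. \<integral>v. h w v \<partial>M)"
proof (rule continuous_on_sequentiallyI)
 interpret finite_measure M by fact
 have mm: "borel_measurable M = (borel_measurable borel :: ('b => real) set)"
  by (rule measurable_cong_sets) (auto simp: M)
 fix u a assume u: "ALL n. u n : K" "a : K" "u \<longlonglongrightarrow> a"
 show "(%n. \<integral>v. h (u n) v \<partial>M) \<longlonglongrightarrow> (LINT v|M. h a v)"
 proof (rule integral_dominated_convergence[where w = "%_. B"])
  show "AE v in M. (%n. h (u n) v) \<longlonglongrightarrow> h a v"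
  using M(3)
  proof eventually_elim
  fix v assume "v : C"
  then show "(%n. h (u n) v) \<longlonglongrightarrow> h a v"
  using continuous_on_tendsto_compose[OF c u(3) u(2)] u(1) by auto
  qed
 qed (use h u in "auto simp: mm")
qed

section \<open>The spherical Radon transform and its dual\<close>

lemma bm_Sph: "cont0 Sph f ==> bm f"
 by (rule cont0_bm[OF compact_Sph])

lemma bm_Grass: "cont0 (Grass m) f ==> bm f"
 by (rule cont0_bm[OF compact_Grass])

lemma bm_rot1: "bm g ==> bm (%U. g (rot U P))"
 by (erule bm_comp) measurable

lemma rot_mult: "W : orth ==> rot W V ** W = W ** V"
 by (simp add: rot_def matrix_mul_assoc[symmetric] orthD)

lemma bm_vec1: "bm f ==> bm (%U :: real^'n^'n. f (U *v e))"
 by (erule bm_comp) measurable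

lemma Grass_oproj: "P : Grass m ==> oproj P"
 by (simp add: Grass_iff)

lemma outer_oproj: "e : Sph ==> oproj (outer e e)"
 using outer_Grass[of e] by (simp add: Sph_norm Grass_iff)

lemma Stab_outer: assumes e: "e : Sph" and V: "V : Stab (outer e e)"
 shows "V *v e = e \<or> V *v e = - e"
proof -
 have n: "norm e = 1" "e \<bullet> e = 1" using e by (simp_all add: Sph_norm norm_eq_1)
 have "outer (V *v e) (V *v e) = outer e e" using V by (simp add: Stab_iff rot_outer)
 then have "outer (V *v e) (V *v e) *v e = outer e e *v e" by simp
 then have c: "((V *v e) \<bullet> e) *\<^sub>R (V *v e) = e" using n by simp
 have "norm (((V *v e) \<bullet> e) *\<^sub>R (V *v e)) = \<bar>(V *v e) \<bullet> e\<bar>"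
  using n Stab_orth[OF V] by simp
 then have "\<bar>(V *v e) \<bullet> e\<bar> = 1" using c n by simp
 then consider "(V *v e) \<bullet> e = 1" | "(V *v e) \<bullet> e = -1" by linarith
 then show ?thesis
 proof cases
  case 2
  then have "- (V *v e) = e" using c by simp
  then show ?thesis by (metis minus_minus)
 qed (use c in simp)
qed

text \<open>Working form of the transform: an average over the stabiliser of a base plane,
  translated by \<open>W\<close>. With it later computations take place on the orthogonal
  group.\<close>

lemma Radon_rot:
 assumes P: "P : Grass m" and e: "e : Sph" "P *v e = e" and W: "W : orth" and f: "bm f"
 shows "Radon m f (rot W P) = (LINT V|(haar P). f (W ** V *v e))"
proof -
 have oP: "oproj P" using P by (rule Grass_oproj)
 have "Radon m f (rot W P) = (LINT x|(sigmaE (rot W P)). f x)"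
  using P W by (simp add: Radon_def)
 also have "... = (LINT U|(haar (rot W P)). f (U *v (W *v e)))"
  by (rule integral_sigmaE) (use oP e W f in "auto simp: Sph_norm")
 also have "... = (LINT U|(haar P). f (rot W U *v (W *v e)))"
  by (rule integral_haar_rot[OF oP W]) (rule bm_vec1[OF f])
 also have "... = (LINT V|(haar P). f (W ** V *v e))"
  using W by (simp add: mv_assoc rot_mult)
 finally show ?thesis .
qed

lemma Radon_at:
 assumes P: "P : Grass m" and e: "e : Sph" "P *v e = e" and f: "bm f"
 shows "Radon m f P = (LINT V|(haar P). f (V *v e))"
 using Radon_rot[OF P e orth_mat1 f] by simp

lemma Grass_base: assumes "1 <= m" "m <= CARD('n)"
 obtains P :: "('n::finite) matr" and e where "P : Grass m" "e : Sph" "P *v e = e"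
proof -
 obtain P :: "'n matr" where "P : Grass m" "P *v axis undefined 1 = axis undefined 1"
  by (rule Grass_containing[of m "axis undefined 1 :: 'n vect"]) (use assms in auto)
 then show ?thesis using that Sph_axis[where 'n = 'n] by blast
qed

lemma Grass_unit: assumes "1 <= m" "P : Grass m" obtains e where "e : Sph" "P *v e = e"
 using proj_unit[of P] assms by (auto simp: Grass_iff Sph_norm)

lemma cont0_Sph_vec: assumes f: "cont0 Sph f" and e: "e : Sph"
  and c: "continuous_on K g" "!!w. w : K ==> g w : orth"
 shows "continuous_on K (%w. f (g w *v e))"
 by (rule continuous_on_compose2[of Sph f K]) (use f e c in "auto simp: cont0_def Sph_norm intro!: continuous_intros")

lemma cont0_Grass_rot: assumes f: "cont0 (Grass m) f" and P: "P : Grass m"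
  and c: "continuous_on K g" "!!w. w : K ==> g w : orth"
 shows "continuous_on K (%w. f (rot (g w) P))"
 by (rule continuous_on_compose2[of "Grass m" f K]) (use f P c in "auto simp: cont0_def intro!: continuous_intros")

lemma Radon_cont0: fixes f :: "('n::finite) vect => real"
 assumes m: "1 <= m" and f: "cont0 Sph f"
 shows "cont0 (Grass m) (Radon m f)"
proof -
 have "continuous_on (Grass m) (Radon m f)"
 proof (cases "Grass m = ({} :: 'n matr set)")
  case False
  then obtain P :: "'n matr" where P: "P : Grass m" by blast
  obtain e where e: "e : Sph" "P *v e = e" using Grass_unit[OF m P] .
  have oP: "oproj P" using P by (rule Grass_oproj)
  obtain B where B: "!!x. \<bar>f x\<bar> <= B" using bmE[OF bm_Sph[OF f]] by blast
  have "continuous_on orth (%W. \<integral>V. f (W ** V *v e) \<partial>haar P)"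
  proof (rule continuous_on_integral[where C = "Stab P" and B = B])
  show "(%V. f (W ** V *v e)) : borel_measurable borel" for W :: "'n matr"
  by (rule bm_meas, rule bm_comp[OF bm_Sph[OF f]]) measurable
  show "continuous_on orth (%W. f (W ** V *v e))" if "V : Stab P" for V
  by (rule cont0_Sph_vec[OF f e(1)]) (use Stab_orth[OF that] in "auto intro!: continuous_intros")
  qed (use AE_haar[OF oP] B in auto)
  then have "continuous_on orth (%W. Radon m f (rot W P))"
  using Radon_rot[OF P e _ bm_Sph[OF f]] by (simp cong: continuous_on_cong)
  then show ?thesis unfolding Grass_orbit[OF P]
  by (intro continuous_on_quotient compact_orth) (auto intro!: continuous_intros)
 qed simp
 then show ?thesis by (simp add: cont0_def Radon_def)
qed

text \<open>Density of the dual transform of the measure with density \<open>g\<close>: the average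
  of \<open>g\<close> over the planes through \<open>th\<close>. The group used preserves the line
  of \<open>th\<close> and may reverse \<open>th\<close>; this is harmless because \<open>V\<close>
  and \<open>- V\<close> rotate a plane alike. \<open>Rdual_rot\<close> shows that the plane picked
  by \<open>SOME\<close> is immaterial.\<close>

definition Rdual :: "nat => (('n::finite) matr => real) => 'n vect => real" where
 "Rdual m g th = (if th : Sph then
  \<integral>V. g (rot V (SOME P. P : Grass m & P *v th = th)) \<partial>haar (outer th th) else 0)"

lemma Rdual_rot:
 assumes P: "P : Grass m" and e: "e : Sph" "P *v e = e" and W: "W : orth" and g: "bm g"
 shows "Rdual m g (W *v e) = (LINT V|(haar (outer e e)). g (rot (W ** V) P))"
proof -
 define P' where "P' = (SOME P. P : Grass m & P *v (W *v e) = W *v e)"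
 have "rot W P : Grass m & rot W P *v (W *v e) = W *v e" using P W e by simp
 then have P': "P' : Grass m & P' *v (W *v e) = W *v e" unfolding P'_def by (rule someI)
 have We: "W *v e : Sph" using W e by (simp add: Sph_norm)
 \<comment> \<open>The plane picked by \<open>SOME\<close> and the rotated base plane contain the
   same vector, hence differ by an element of its stabiliser, which right invariance
   absorbs.\<close>
 obtain Z where Z: "Z : orth" "rot Z (rot W P) = P'" "Z *v (W *v e) = W *v e"
  by (rule Grass_pair_transitive[of "rot W P" m P' "W *v e" "W *v e"]) (use P W P' e in auto)
 have ZS: "Z : Stab (outer (W *v e) (W *v e))" using Z by (simp add: Stab_iff rot_outer)
 have "Rdual m g (W *v e) = (LINT V|(haar (outer (W *v e) (W *v e))). g (rot V P'))"
  using We by (simp add: Rdual_def P'_def)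
 also have "... = (LINT V|(haar (outer (W *v e) (W *v e))). g (rot (V ** Z) (rot W P)))"
  by (simp add: Z(2)[symmetric] rot_rot matrix_mul_assoc)
 also have "... = (LINT V|(haar (outer (W *v e) (W *v e))). g (rot V (rot W P)))"
  by (rule haar_right[OF outer_oproj[OF We] ZS]) (rule bm_rot1[OF g])
 also have "... = (LINT V|(haar (rot W (outer e e))). g (rot V (rot W P)))" by (simp add: rot_outer)
 also have "... = (LINT V|(haar (outer e e)). g (rot (rot W V) (rot W P)))"
  by (rule integral_haar_rot[OF outer_oproj[OF e(1)] W]) (rule bm_rot1[OF g])
 also have "... = (LINT V|(haar (outer e e)). g (rot (W ** V) P))"
  by (simp add: rot_rot rot_mult[OF W])
 finally show ?thesis .
qed

lemma Rdual_cont0: fixes g :: "('n::finite) matr => real"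
 assumes m: "1 <= m" "m <= CARD('n)" and g: "cont0 (Grass m) g"
 shows "cont0 Sph (Rdual m g)"
proof -
 obtain P :: "'n matr" and e where P: "P : Grass m" and e: "e : Sph" "P *v e = e"
  using Grass_base[OF m] .
 obtain B where B: "!!x. \<bar>g x\<bar> <= B" using bmE[OF bm_Grass[OF g]] by blast
 have "continuous_on orth (%W. \<integral>V. g (rot (W ** V) P) \<partial>haar (outer e e))"
 proof (rule continuous_on_integral[where C = "Stab (outer e e)" and B = B])
  show "(%V. g (rot (W ** V) P)) : borel_measurable borel" for W :: "'n matr"
  by (rule bm_meas, rule bm_comp[OF bm_Grass[OF g]]) measurable
  show "continuous_on orth (%W. g (rot (W ** V) P))" if "V : Stab (outer e e)" for V
  by (rule cont0_Grass_rot[OF g P]) (use Stab_orth[OF that] in "auto intro!: continuous_intros")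
 qed (use AE_haar[OF outer_oproj[OF e(1)]] B in auto)
 then have "continuous_on orth (%W. Rdual m g (W *v e))"
  using Rdual_rot[OF P e _ bm_Grass[OF g]] by (simp cong: continuous_on_cong)
 then have "continuous_on Sph (Rdual m g)" unfolding sphere_orbit[OF e(1)]
  by (intro continuous_on_quotient compact_orth) (auto intro!: continuous_intros)
 then show ?thesis by (simp add: cont0_def Rdual_def)
qed

lemma bm_orth2: fixes f :: "('n::finite) vect => real" shows "bm f ==> bm (%(U::'n matr, V::'n matr). f (U ** V *v e))"
 unfolding case_prod_beta' by (erule bm_comp) (intro borel_contI continuous_intros)

lemma bm_rot2: fixes f :: "('n::finite) matr => real" shows "bm f ==> bm (%(U::'n matr, V::'n matr). f (rot (U ** V) P))"
 unfolding case_prod_beta' by (erule bm_comp) (intro borel_contI continuous_intros)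

lemma bm_fst: fixes f :: "'a::topological_space => real" shows "bm f ==> bm (%(U::'a, V::'b::topological_space). f U)"
 unfolding case_prod_beta' by (erule bm_comp) (intro borel_contI continuous_intros)

lemma bm_snd: fixes f :: "'b::topological_space => real" shows "bm f ==> bm (%(U::'a::topological_space, V::'b). f V)"
 unfolding case_prod_beta' by (erule bm_comp) (intro borel_contI continuous_intros)

lemma integral_cong_orth:
 "bm f ==> bm g ==> (!!U. U : orth ==> f U = g U) ==> (LINT U|haarO. f U) = (LINT U|haarO. g U)"
 by (rule integral_cong_AE) (use AE_haarO in "auto simp: bm_meas elim: eventually_mono")

lemma integral_cong_Stab:
 "oproj P ==> bm f ==> bm g ==> (!!U. U : Stab P ==> f U = g U) ==> (LINT U|(haar P). f U) = (LINT U|(haar P). g U)"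
 by (rule integral_cong_AE) (auto simp: bm_meas intro: eventually_mono[OF AE_haar])

lemma bm_case_mult: "bm (case_prod f) ==> bm (case_prod g) ==> bm (%(x, y). f x y * g x y)"
 using bm_mult[of "case_prod f" "case_prod g"] by (simp add: case_prod_beta')

text \<open>Both sides of the duality are compared with the integral over incident pairs
  \<open>(U *v e, rot U P)\<close>. Here the average over the stabiliser of \<open>P\<close> is
  absorbed by right invariance of Haar measure.\<close>

lemma pairing_Radon:
 assumes P: "P : Grass m" and e: "e : Sph" "P *v e = e" and f: "cont0 Sph f" and g: "bm g"
 shows "(LINT Q|(haarG m). Radon m f Q * g Q) = (LINT U|haarO. f (U *v e) * g (rot U P))"
proof -
 have oP: "oproj P" using P by (rule Grass_oproj)
 have m: "1 <= m"
 proof (rule ccontr)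
  assume "\<not> 1 <= m"
  then have "rank P = 0" using P by (simp add: Grass_iff)
  then have "P = 0" by (simp add: rank_eq_0)
  then show False using e by (auto simp: Sph_norm)
 qed
 have bf: "bm f" using f by (rule bm_Sph)
 have bR: "bm (Radon m f)" using Radon_cont0[OF m f] by (rule bm_Grass)
 have b2: "bm (%(U, V). f (U ** V *v e) * g (rot U P))"
  by (intro bm_case_mult bm_orth2 bf bm_fst bm_rot1 g)
 have "(LINT Q|(haarG m). Radon m f Q * g Q) = (LINT U|haarO. Radon m f (rot U P) * g (rot U P))"
  by (rule integral_haarG[OF P]) (intro bm_mult bR g)
 also have "... = (LINT U|haarO. (LINT V|(haar P). f (U ** V *v e) * g (rot U P)))"
 proof (rule integral_cong_orth)
  show "bm (%U. \<integral>V. f (U ** V *v e) * g (rot U P) \<partial>haar P)"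
  by (rule bm_fubini(2)[where M = haarO, OF _ _ _ _ b2]) auto
  show "bm (%U. Radon m f (rot U P) * g (rot U P))" by (intro bm_mult bm_rot1 bR g)
 qed (simp add: Radon_rot[OF P e _ bf])
 also have "... = (LINT V|(haar P). (LINT U|haarO. f (U ** V *v e) * g (rot U P)))"
  by (rule bm_fubini(1)[OF _ _ _ _ b2]) auto
 also have "... = (LINT V|(haar P). (LINT U|haarO. f (U *v e) * g (rot U P)))"
 proof (rule integral_cong_Stab[OF oP])
  show "bm (%V. \<integral>U. f (U ** V *v e) * g (rot U P) \<partial>haarO)"
  by (rule bm_fubini(3)[where N = "haar P", OF _ _ _ _ b2]) auto
  fix V assume V: "V : Stab P"
  then have "(LINT U|haarO. f (U ** V *v e) * g (rot U P)) = (LINT U|haarO. f (U ** V *v e) * g (rot (U ** V) P))"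
  by (simp add: rot_rot[symmetric] Stab_iff)
  also have "... = (LINT U|haarO. f (U *v e) * g (rot U P))"
  by (rule haarO_right) (use Stab_orth[OF V] in "auto intro!: bm_mult bm_rot1 bm_vec1 bf g")
  finally show "(LINT U|haarO. f (U ** V *v e) * g (rot U P)) = (LINT U|haarO. f (U *v e) * g (rot U P))" .
 qed auto
 finally show ?thesis by simp
qed

lemma matrix_vector_uminus: "(- A) *v x = - (A *v x)" for A :: "real^'n^'m"
 using scaleR_matrix_vector_assoc[of "-1" A x] by simp

lemma uminus_orth: "U : orth ==> - U : orth"
 by (rule orthI) (simp add: matrix_vector_uminus)

lemma rot_uminus: "rot (- U) P = rot U P"
proof -
 have "transpose (- U) = - transpose U" by (simp add: transpose_def vec_eq_iff)
 then show ?thesis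
  by (simp add: rot_def bounded_bilinear.minus_left[OF bilinear_mult]
  bounded_bilinear.minus_right[OF bilinear_mult])
qed

lemma pairing_Rdual: fixes f :: "('n::finite) vect => real"
 assumes P: "P : Grass m" and e: "e : Sph" "P *v e = e" and m: "1 <= m" "m <= CARD('n)"
  and f: "bm f" and g: "cont0 (Grass m) g"
 shows "(LINT x|haarS. f x * Rdual m g x) = (LINT U|haarO. f (U *v e) * g (rot U P))"
proof -
 have oe: "oproj (outer e e)" using e by (simp add: outer_oproj)
 have bg: "bm g" using g by (rule bm_Grass)
 have bR: "bm (Rdual m g)" using Rdual_cont0[OF m g] by (rule bm_Sph)
 have b2: "bm (%(U, V). f (U *v e) * g (rot (U ** V) P))"
  by (intro bm_case_mult bm_rot2 f bm_fst bm_vec1 bg)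
 have "(LINT x|haarS. f x * Rdual m g x) = (LINT U|haarO. f (U *v e) * Rdual m g (U *v e))"
  by (rule integral_haarS[OF e(1)]) (intro bm_mult bR f)
 also have "... = (LINT U|haarO. (LINT V|(haar (outer e e)). f (U *v e) * g (rot (U ** V) P)))"
 proof (rule integral_cong_orth)
  show "bm (%U. \<integral>V. f (U *v e) * g (rot (U ** V) P) \<partial>haar (outer e e))"
  by (rule bm_fubini(2)[where M = haarO, OF _ _ _ _ b2]) auto
  show "bm (%U. f (U *v e) * Rdual m g (U *v e))" by (intro bm_mult bm_vec1 bR f)
 qed (simp add: Rdual_rot[OF P e _ bg])
 also have "... = (LINT V|(haar (outer e e)). (LINT U|haarO. f (U *v e) * g (rot (U ** V) P)))"
  by (rule bm_fubini(1)[OF _ _ _ _ b2]) auto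
 also have "... = (LINT V|(haar (outer e e)). (LINT U|haarO. f (U *v e) * g (rot U P)))"
 proof (rule integral_cong_Stab[OF oe])
  show "bm (%V. \<integral>U. f (U *v e) * g (rot (U ** V) P) \<partial>haarO)"
  by (rule bm_fubini(3)[where N = "haar (outer e e)", OF _ _ _ _ b2]) auto
  fix V assume V: "V : Stab (outer e e)"
  \<comment> \<open>An element preserving the line of \<open>e\<close> may send \<open>e\<close> to
    \<open>- e\<close>; its negative then fixes \<open>e\<close> and rotates planes in the same
    way.\<close>
  have "EX Z:orth. Z *v e = e & (ALL U. rot (U ** V) P = rot (U ** Z) P)"
  proof (cases "V *v e = e")
  case True
  then show ?thesis using Stab_orth[OF V] by blast
  next
  case False
  then have "V *v e = - e" using Stab_outer[OF e(1) V] by blast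
  then show ?thesis using Stab_orth[OF V]
  by (intro bexI[of _ "- V"]) (auto simp: uminus_orth rot_rot[symmetric] rot_uminus matrix_vector_uminus)
  qed
  then obtain Z where Z: "Z : orth" "Z *v e = e" "!!U. rot (U ** V) P = rot (U ** Z) P" by blast
  have "(LINT U|haarO. f (U *v e) * g (rot (U ** V) P)) = (LINT U|haarO. f ((U ** Z) *v e) * g (rot (U ** Z) P))"
  by (simp add: Z(3) mv_assoc[symmetric] Z(2))
  also have "... = (LINT U|haarO. f (U *v e) * g (rot U P))"
  by (rule haarO_right) (use Z in "auto intro!: bm_mult bm_rot1 bm_vec1 bg f")
  finally show "(LINT U|haarO. f (U *v e) * g (rot (U ** V) P)) = (LINT U|haarO. f (U *v e) * g (rot U P))" .
 qed auto
 finally show ?thesis by simp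
qed

lemma Radon_duality: fixes f :: "('n::finite) vect => real"
 assumes m: "1 <= m" "m <= CARD('n)" and f: "cont0 Sph f" and g: "cont0 (Grass m) g"
 shows "(LINT Q|(haarG m). Radon m f Q * g Q) = (LINT x|haarS. f x * Rdual m g x)"
proof -
 obtain P :: "'n matr" and e where Pe: "P : Grass m" "e : Sph" "P *v e = e"
  using Grass_base[OF m] .
 show ?thesis
  using pairing_Radon[OF Pe f bm_Grass[OF g]] pairing_Rdual[OF Pe m bm_Sph[OF f] g] by simp
qed

lemma orth_Sph [simp]: "V : orth ==> V *v e : Sph \<longleftrightarrow> e : Sph"
 by (simp add: Sph_norm)

lemma Stab_norm [simp]: "V : Stab P ==> norm (V *v e) = norm e"
 by (rule orth_norm[OF Stab_orth])

lemma Stab_Sph [simp]: "V : Stab P ==> V *v e : Sph \<longleftrightarrow> e : Sph"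
 by (rule orth_Sph[OF Stab_orth])

lemma Stab_Grass [simp]: "V : Stab R ==> rot V P : Grass m \<longleftrightarrow> P : Grass m"
 by (rule Grass_rot[OF Stab_orth])

section \<open>Functions extended by zero and elementary properties of the two transforms\<close>

definition restr :: "'a set => ('a => real) => 'a => real" where
 "restr X f = (%x. if x : X then f x else 0)"

lemma restr_in [simp]: "x : X ==> restr X f x = f x"
 by (simp add: restr_def)

lemma cont0_restr: "continuous_on X f ==> cont0 X (restr X f)"
 by (simp add: cont0_def restr_def cong: continuous_on_cong_simp)

lemma cont0_add: "cont0 X f ==> cont0 X g ==> cont0 X (%x. f x + g x)"
 by (auto simp: cont0_def intro!: continuous_intros)

lemma cont0_diff: "cont0 X f ==> cont0 X g ==> cont0 X (%x. f x - g x)"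
 by (auto simp: cont0_def intro!: continuous_intros)

lemma cont0_cmult: "cont0 X f ==> cont0 X (%x. c * f x)"
 by (auto simp: cont0_def intro!: continuous_intros)

lemma cont0_mult: "cont0 X f ==> cont0 X g ==> cont0 X (%x. f x * g x)"
 by (auto simp: cont0_def intro!: continuous_intros)

lemma cont0_sum: "(!!i. i : I ==> cont0 X (f i)) ==> cont0 X (%x. SUM i:I. f i x)"
 by (auto simp: cont0_def intro!: continuous_intros)

lemma cont0_const: "cont0 X (restr X (%x. c))"
 by (rule cont0_restr) auto

lemma cont0_ext: "cont0 X f ==> cont0 X g ==> (!!x. x : X ==> f x = g x) ==> f = g"
 by (auto simp: cont0_def fun_eq_iff) metis

lemma Radon_linear:
 assumes P: "P : Grass m" and m: "1 <= m" and fg: "bm f" "bm g"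
 shows "Radon m (%x. a * f x + b * g x) P = a * Radon m f P + b * Radon m g P"
proof -
 obtain e where e: "e : Sph" "P *v e = e" using Grass_unit[OF m P] .
 have i: "bm h ==> integrable (haar P) (%V. h (V *v e))" for h by (intro bm_integrable_haar bm_vec1)
 show ?thesis using i[OF fg(1)] i[OF fg(2)]
  by (simp add: Radon_at[OF P e] fg bm_add bm_cmult)
qed

lemma Radon_mono:
 assumes P: "P : Grass m" and m: "1 <= m" and fg: "bm f" "bm g" and le: "!!x. x : Sph ==> f x <= g x"
 shows "Radon m f P <= Radon m g P"
proof -
 obtain e where e: "e : Sph" "P *v e = e" using Grass_unit[OF m P] .
 have "(LINT V|(haar P). f (V *v e)) <= (LINT V|(haar P). g (V *v e))"
 proof (rule integral_mono_AE)
  show "AE V in haar P. f (V *v e) <= g (V *v e)"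
  using AE_haar[OF Grass_oproj[OF P]]
  by eventually_elim (use e in "auto intro!: le")
 qed (use fg in "auto intro!: bm_integrable_haar bm_vec1")
 then show ?thesis by (simp add: Radon_at[OF P e] fg)
qed

lemma Radon_const:
 assumes P: "P : Grass m" and m: "1 <= m"
 shows "Radon m (restr Sph (%x. c)) P = c"
proof -
 obtain e where e: "e : Sph" "P *v e = e" using Grass_unit[OF m P] .
 have "Radon m (restr Sph (%x. c)) P = (LINT V|(haar P). restr Sph (%x. c) (V *v e))"
  by (rule Radon_at[OF P e]) (rule bm_Sph, rule cont0_const)
 also have "... = (LINT V|(haar P). c)"
  by (rule integral_cong_Stab[OF Grass_oproj[OF P]])
  (use e in "auto intro!: bm_vec1 bm_Sph cont0_const")
 finally show ?thesis by simp
qed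

lemma Radon_bound:
 assumes P: "P : Grass m" and m: "1 <= m" and f: "bm f" and le: "!!x. x : Sph ==> \<bar>f x\<bar> <= c"
 shows "\<bar>Radon m f P\<bar> <= c"
proof -
 have b: "bm (restr Sph (%x. c))" for c :: real by (rule bm_Sph, rule cont0_const)
 have "f x <= restr Sph (%x. c) x" "restr Sph (%x. - c) x <= f x" if "x : Sph" for x
  using le[OF that] that by auto
 then have "Radon m f P <= c" "- c <= Radon m f P"
  using Radon_mono[OF P m f b[of c]] Radon_mono[OF P m b[of "- c"] f] Radon_const[OF P m] by metis+
 then show ?thesis by simp
qed

lemma Radon_even:
 assumes P: "P : Grass m" and m: "1 <= m" and f: "bm f"
 shows "Radon m (%x. f (- x)) P = Radon m f P"
proof -
 obtain e where e: "e : Sph" "P *v e = e" using Grass_unit[OF m P] .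
 have e': "- e : Sph" "P *v (- e) = - e" using e
  by (auto simp: Sph_norm linear_neg[OF matrix_vector_mul_linear])
 have 1: "bm (%x. f (- x))" by (rule bm_comp[OF f]) simp
 show ?thesis
  using Radon_at[OF P e 1] Radon_at[OF P e' f] by (simp add: linear_neg[OF matrix_vector_mul_linear])
qed

lemma Rdual_linear: fixes f :: "('n::finite) matr => real"
 assumes m: "1 <= m" "m <= CARD('n)" and x: "x : Sph" and fg: "bm f" "bm g"
 shows "Rdual m (%P. a * f P + b * g P) x = a * Rdual m f x + b * Rdual m g x"
proof -
 obtain P :: "'n matr" where P: "P : Grass m" "P *v x = x" using Grass_containing[of m x] m x by (auto simp: Sph_norm)
 have i: "bm h ==> integrable (haar Q) (%V. h (rot V P))" for h Q by (intro bm_integrable_haar bm_rot1)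
 show ?thesis using i[OF fg(1)] i[OF fg(2)]
  Rdual_rot[OF P(1) x P(2) orth_mat1 fg(1)] Rdual_rot[OF P(1) x P(2) orth_mat1 fg(2)]
  Rdual_rot[OF P(1) x P(2) orth_mat1, of "%P. a * f P + b * g P"] fg
  by (simp add: bm_add bm_cmult)
qed

lemma Rdual_mono: fixes f :: "('n::finite) matr => real"
 assumes m: "1 <= m" "m <= CARD('n)" and x: "x : Sph" and fg: "bm f" "bm g"
  and le: "!!P. P : Grass m ==> f P <= g P"
 shows "Rdual m f x <= Rdual m g x"
proof -
 obtain P :: "'n matr" where P: "P : Grass m" "P *v x = x" using Grass_containing[of m x] m x by (auto simp: Sph_norm)
 have "(LINT V|(haar (outer x x)). f (rot V P)) <= (LINT V|(haar (outer x x)). g (rot V P))"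
 proof (rule integral_mono_AE)
  show "AE V in haar (outer x x). f (rot V P) <= g (rot V P)"
  using AE_haar[OF outer_oproj[OF x]] by eventually_elim (use P in "auto intro!: le")
 qed (use fg in "auto intro!: bm_integrable_haar bm_rot1")
 then show ?thesis
  using Rdual_rot[OF P(1) x P(2) orth_mat1 fg(1)] Rdual_rot[OF P(1) x P(2) orth_mat1 fg(2)] by simp
qed

lemma Rdual_const: fixes x :: "('n::finite) vect"
 assumes m: "1 <= m" "m <= CARD('n)" and x: "x : Sph"
 shows "Rdual m (restr (Grass m) (%P. c)) x = c"
proof -
 obtain P :: "'n matr" where P: "P : Grass m" "P *v x = x" using Grass_containing[of m x] m x by (auto simp: Sph_norm)
 have b: "bm (restr (Grass m) (%P :: 'n matr. c))" by (rule bm_Grass, rule cont0_const)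
 have "Rdual m (restr (Grass m) (%P. c)) x = (LINT V|(haar (outer x x)). restr (Grass m) (%P. c) (rot V P))"
  using Rdual_rot[OF P(1) x P(2) orth_mat1 b] by simp
 also have "... = (LINT V|(haar (outer x x)). c)"
  by (rule integral_cong_Stab[OF outer_oproj[OF x]])
  (use P in "auto intro!: bm_rot1 b")
 finally show ?thesis by simp
qed

lemma Rdual_even: fixes x :: "('n::finite) vect"
 assumes m: "1 <= m" "m <= CARD('n)" and x: "x : Sph" and g: "bm g"
 shows "Rdual m g (- x) = Rdual m g x"
proof -
 obtain P :: "'n matr" where P: "P : Grass m" "P *v x = x" using Grass_containing[of m x] m x by (auto simp: Sph_norm)
 have "- mat 1 : (orth :: 'n matr set)" by (simp add: uminus_orth)
 from Rdual_rot[OF P(1) x P(2) this g] Rdual_rot[OF P(1) x P(2) orth_mat1 g] show ?thesis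
  by (simp add: matrix_vector_uminus rot_rot[symmetric] rot_uminus)
qed

lemma haarG_nonneg_zero: fixes g :: "('n::finite) matr => real"
 assumes g: "cont0 (Grass m) g" "!!P. P : Grass m ==> 0 <= g P" and z: "(LINT P|(haarG m). g P) <= 0"
 shows "g P = 0"
proof (rule ccontr)
 assume nz: "g P ~= 0"
 then have P: "P : Grass m" using g by (auto simp: cont0_def)
 have c: "continuous_on orth (%U. g (rot U P))"
  by (rule cont0_Grass_rot[OF g(1) P]) auto
 have "0 < (LINT U|haarO. g (rot U P))"
  by (rule haar_integral_pos[OF proj_mat1, where V = "mat 1"])
  (use g nz P c in "auto intro!: bm_rot1 bm_Grass[OF g(1)] simp: order.strict_iff_order")
 then show False using z integral_haarG[OF P bm_Grass[OF g(1)]] by simp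
qed

lemma haarS_nonneg_zero: fixes g :: "('n::finite) vect => real"
 assumes g: "cont0 Sph g" "!!x. x : Sph ==> 0 <= g x" and z: "(LINT x|haarS. g x) <= 0"
 shows "g x = 0"
proof (rule ccontr)
 assume nz: "g x ~= 0"
 then have x: "x : Sph" using g by (auto simp: cont0_def)
 have c: "continuous_on orth (%U. g (U *v x))"
  by (rule cont0_Sph_vec[OF g(1) x]) auto
 have "0 < (LINT U|haarO. g (U *v x))"
  by (rule haar_integral_pos[OF proj_mat1, where V = "mat 1"])
  (use g nz x c in "auto intro!: bm_vec1 bm_Sph simp: order.strict_iff_order Sph_norm")
 then show False using z integral_haarS[OF x bm_Sph[OF g(1)]] by simp
qed

lemma cont0_eq_if_pairings: fixes f g :: "('n::finite) vect => real"
 assumes f: "cont0 Sph f" and g: "cont0 Sph g"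
  and eq: "!!h. cont0 Sph h ==> (LINT x|haarS. h x * f x) = (LINT x|haarS. h x * g x)"
 shows "f = g"
proof -
 let ?w = "%x. f x - g x"
 have w: "cont0 Sph ?w" using f g by (rule cont0_diff)
 have i: "integrable haarS h" if "cont0 Sph h" for h :: "'n vect => real"
  by (rule bm_integrable) (use prob_space_haarS prob_space.finite_measure bm_Sph[OF that] in auto)
 have "(LINT x|haarS. ?w x * ?w x) = (LINT x|haarS. ?w x * f x - ?w x * g x)" by (simp add: algebra_simps)
 also have "... = (LINT x|haarS. ?w x * f x) - (LINT x|haarS. ?w x * g x)"
  by (rule Bochner_Integration.integral_diff) (intro i cont0_mult w f g)+
 also have "... = 0" using eq[OF w] by simp
 finally have "?w x * ?w x = 0" for x
  by (intro haarS_nonneg_zero[where g = "%x. ?w x * ?w x"] cont0_mult w) auto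
 then show ?thesis by (auto simp: fun_eq_iff)
qed

section \<open>Orthogonal complements\<close>

lemma perp_Grass: fixes P :: "('n::finite) matr"
 assumes "m + k = CARD('n)" shows "perpP P : Grass k \<longleftrightarrow> P : Grass m"
proof -
 have "m <= CARD('n)" "k <= CARD('n)" "CARD('n) - m = k" "CARD('n) - k = m" using assms by auto
 then show ?thesis using Grass_perp[of m P] Grass_perp[of k "perpP P"] by auto
qed

lemma Iop_cont0: fixes f :: "('n::finite) matr => real"
 assumes "m + k = CARD('n)" "cont0 (Grass k) f" shows "cont0 (Grass m) (Iop m f)"
proof -
 have "continuous_on (Grass m) (%P. f (perpP P))"
  by (rule continuous_on_compose2[of "Grass k"])
  (use assms perp_Grass in "auto simp: cont0_def intro!: continuous_intros")
 then show ?thesis by (simp add: cont0_def Iop_def cong: continuous_on_cong_simp)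
qed

lemma integral_Iop: fixes f :: "('n::finite) matr => real"
 assumes mk: "m + k = CARD('n)" and f: "cont0 (Grass k) f"
 shows "(LINT P|(haarG m). Iop m f P) = (LINT P|(haarG k). f P)"
proof -
 obtain P :: "'n matr" where P: "P : Grass m" using Grass_mono_ex[of m, where 'n = 'n] mk by auto
 have P': "perpP P : Grass k" using P perp_Grass[OF mk] by blast
 have "(LINT P|(haarG m). Iop m f P) = (LINT U|haarO. Iop m f (rot U P))"
  by (rule integral_haarG[OF P]) (rule bm_Grass[OF Iop_cont0[OF mk f]])
 also have "... = (LINT U|haarO. f (rot U (perpP P)))"
 proof (rule integral_cong_orth)
  fix U :: "'n matr" assume "U : orth"
  then show "Iop m f (rot U P) = f (rot U (perpP P))" using P by (simp add: Iop_def rot_perp)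
 qed (intro bm_rot1 bm_Grass[OF Iop_cont0[OF mk f]] bm_Grass[OF f])+
 also have "... = (LINT P|(haarG k). f P)"
  by (rule integral_haarG[OF P', symmetric]) (rule bm_Grass[OF f])
 finally show ?thesis .
qed

lemma Iop_mult: "Iop m (%P. f P * g P) = (%P. Iop m f P * Iop m g P)"
 by (auto simp: Iop_def)

lemma Iop_Iop: fixes g :: "('n::finite) matr => real"
 assumes mk: "m + k = CARD('n)" and g: "cont0 (Grass m) g" shows "Iop m (Iop k g) = g"
 using perp_Grass[OF mk] g by (auto simp: Iop_def cont0_def fun_eq_iff)

text \<open>The Gelfand pair argument: any two subspaces of equal dimension can be swapped by an
  orthogonal map, so orthogonally invariant bilinear forms are symmetric.\<close>

lemma invariant_form_symmetric:
 assumes A: "A : Grass m" "B : Grass m" and g: "bm g" "bm h"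
 shows "(LINT U|haarO. g (rot U A) * h (rot U B)) = (LINT U|haarO. g (rot U B) * h (rot U A))"
proof -
 obtain W where W: "W : orth" "rot W A = B" "rot W B = A" using Grass_swap[OF A] .
 have "(LINT U|haarO. g (rot U A) * h (rot U B)) = (LINT U|haarO. g (rot (U ** W) A) * h (rot (U ** W) B))"
  by (rule haarO_right[OF W(1), symmetric]) (intro bm_mult bm_rot1 g)
 then show ?thesis by (simp add: rot_rot[symmetric] W)
qed

text \<open>Unfolding both dual transforms over the stabiliser of one line gives an average of
  invariant forms in \<open>g\<close> and \<open>h\<close> at two planes of dimension
  \<open>m\<close>, each of which is symmetric. In operator terms, \<open>Radon m\<close> after
  \<open>Rdual k\<close> after \<open>Iop k\<close> is self-adjoint.\<close>

lemma Rdual_Iop_symmetric: fixes g h :: "('n::finite) matr => real"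
 assumes mk: "m + k = CARD('n)" "1 <= m" "1 <= k" and g: "cont0 (Grass m) g" and h: "cont0 (Grass m) h"
 shows "(LINT x|haarS. Rdual k (Iop k g) x * Rdual m h x) = (LINT x|haarS. Rdual k (Iop k h) x * Rdual m g x)"
proof -
 have km: "k + m = CARD('n)" "m <= CARD('n)" "k <= CARD('n)" using mk by auto
 obtain P :: "'n matr" and e where P: "P : Grass m" and e: "e : Sph" "P *v e = e" using Grass_base[OF mk(2) km(2)] .
 obtain P' :: "'n matr" where P': "P' : Grass k" "P' *v e = e"
  using Grass_containing[of k e] mk km e by (auto simp: Sph_norm)
 let ?E = "haar (outer e e)"
 have ST: "oproj (outer e e)" using e by (rule_tac outer_oproj)
 have main: "(LINT x|haarS. Rdual k (Iop k g) x * Rdual m h x)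
  = (LINT V'|?E. (LINT V|?E. (LINT U|haarO. g (rot U (rot V' (perpP P'))) * h (rot U (rot V P)))))"
  (is "?L = _") if g: "cont0 (Grass m) g" and h: "cont0 (Grass m) h" for g h
 proof -
  have bI: "bm (Iop k g)" and bg: "bm g" and bh: "bm h"
  using bm_Grass[OF Iop_cont0[OF km(1) g]] bm_Grass g h by auto
  have bR: "bm (Rdual k (Iop k g))" "bm (Rdual m h)"
  using Rdual_cont0[OF mk(3) km(3) Iop_cont0[OF km(1) g]] Rdual_cont0[OF mk(2) km(2) h] bm_Sph by auto
  have b1: "bm (%(U, V'). g (rot (U ** V') (perpP P')) * Rdual m h (U *v e))"
  by (intro bm_case_mult bm_rot2 bg bm_fst bm_vec1 bR)
  have "?L = (LINT U|haarO. Rdual k (Iop k g) (U *v e) * Rdual m h (U *v e))"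
  by (rule integral_haarS[OF e(1)]) (intro bm_mult bR)
  also have "... = (LINT U|haarO. (LINT V'|?E. g (rot (U ** V') (perpP P')) * Rdual m h (U *v e)))"
  proof (rule integral_cong_orth)
  show "bm (%U. \<integral>V'. g (rot (U ** V') (perpP P')) * Rdual m h (U *v e) \<partial>?E)"
  by (rule bm_fubini(2)[where M = haarO, OF _ _ _ _ b1]) auto
  show "bm (%U. Rdual k (Iop k g) (U *v e) * Rdual m h (U *v e))" by (intro bm_mult bm_vec1 bR)
  fix U :: "'n matr" assume U: "U : orth"
  have IU: "Iop k g (rot (U ** V) P') = g (rot (U ** V) (perpP P'))" if "V : Stab (outer e e)" for V
  proof -
  have "U ** V : orth" using U Stab_orth[OF that] by simp
  then show ?thesis using P' by (simp add: Iop_def rot_perp)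
  qed
  have "(LINT V|?E. Iop k g (rot (U ** V) P')) = (LINT V|?E. g (rot (U ** V) (perpP P')))"
  by (rule integral_cong_Stab[OF ST])
  (use U P' Stab_orth in "auto simp: IU rot_perp
  intro!: bm_comp[OF bI] bm_comp[OF bg]")
  then show "Rdual k (Iop k g) (U *v e) * Rdual m h (U *v e)
  = (LINT V'|?E. g (rot (U ** V') (perpP P')) * Rdual m h (U *v e))"
  by (simp add: Rdual_rot[OF P'(1) e(1) P'(2) U bI])
  qed
  also have "... = (LINT V'|?E. (LINT U|haarO. g (rot (U ** V') (perpP P')) * Rdual m h (U *v e)))"
  by (rule bm_fubini(1)[OF _ _ _ _ b1]) auto
  also have "... = (LINT V'|?E. (LINT V|?E. (LINT U|haarO. g (rot U (rot V' (perpP P'))) * h (rot U (rot V P)))))"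
  proof (rule integral_eqI[OF refl])
  fix V' :: "'n matr"
  have b2: "bm (%(U, V). g (rot (U ** V') (perpP P')) * h (rot (U ** V) P))"
  by (intro bm_case_mult bm_rot2 bh bm_fst) (rule bm_comp[OF bg], measurable)
  have "(LINT U|haarO. g (rot (U ** V') (perpP P')) * Rdual m h (U *v e))
  = (LINT U|haarO. (LINT V|?E. g (rot (U ** V') (perpP P')) * h (rot (U ** V) P)))"
  proof (rule integral_cong_orth)
  show "bm (%U. \<integral>V. g (rot (U ** V') (perpP P')) * h (rot (U ** V) P) \<partial>?E)"
  by (rule bm_fubini(2)[where M = haarO, OF _ _ _ _ b2]) auto
  show "bm (%U. g (rot (U ** V') (perpP P')) * Rdual m h (U *v e))"
  by (intro bm_mult bm_vec1 bR) (rule bm_comp[OF bg], measurable)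
  qed (simp add: Rdual_rot[OF P e _ bh])
  also have "... = (LINT V|?E. (LINT U|haarO. g (rot (U ** V') (perpP P')) * h (rot (U ** V) P)))"
  by (rule bm_fubini(1)[OF _ _ _ _ b2]) auto
  finally show "(LINT U|haarO. g (rot (U ** V') (perpP P')) * Rdual m h (U *v e))
  = (LINT V|?E. (LINT U|haarO. g (rot U (rot V' (perpP P'))) * h (rot U (rot V P))))"
  by (simp add: rot_rot)
  qed
  finally show ?thesis .
 qed
 have in1: "rot V' (perpP P') : Grass m" "rot V P : Grass m" if "V : Stab (outer e e)" "V' : Stab (outer e e)" for V V'
  using that P P' perp_Grass[OF km(1), of P'] Stab_orth by auto
 have bmJ: "bm (%V. \<integral>U. g (rot U A) * h (rot U (rot V B)) \<partial>haarO)"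
  if "bm g" "bm h" for g h and A B :: "'n matr"
 proof (rule bm_fubini(3)[where N = ?E, OF _ _ _ _ ])
  show "bm (%(U, V). g (rot U A) * h (rot U (rot V B)))"
  unfolding rot_rot by (intro bm_case_mult bm_rot2 that bm_fst bm_rot1)
 qed auto
 have bmK: "bm (%V'. \<integral>V. (LINT U|haarO. g (rot U (rot V' A)) * h (rot U (rot V B))) \<partial>?E)"
  if gh: "bm g" "bm h" for g h and A B :: "'n matr"
 proof -
  have b0: "bm (%(U, V). h (rot U (rot V B)))" unfolding rot_rot by (rule bm_rot2[OF gh(2)])
  have bH: "bm (%U. \<integral>V. h (rot U (rot V B)) \<partial>?E)"
  by (rule bm_fubini(2)[where M = haarO, OF _ _ _ _ b0]) auto
  have b3: "bm (%(U, V'). g (rot U (rot V' A)) * (LINT V|?E. h (rot U (rot V B))))"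
  by (intro bm_case_mult bm_fst bH) (unfold rot_rot, rule bm_rot2[OF gh(1)])
  have "(LINT V|?E. (LINT U|haarO. g (rot U (rot V' A)) * h (rot U (rot V B))))
  = (LINT U|haarO. g (rot U (rot V' A)) * (LINT V|?E. h (rot U (rot V B))))" for V'
  proof -
  have "bm (%(U, V). g (rot U (rot V' A)) * h (rot U (rot V B)))"
  by (intro bm_case_mult bm_fst b0 bm_rot1 gh)
  from bm_fubini(1)[where M = haarO and N = ?E, OF _ _ _ _ this] show ?thesis by simp
  qed
  then show ?thesis using bm_fubini(3)[where M = haarO and N = ?E, OF _ _ _ _ b3] by simp
 qed
 have b: "bm g" "bm h" using g h bm_Grass by auto
 show ?thesis
  unfolding main[OF g h] main[OF h g]
 proof (rule integral_cong_Stab[OF ST])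
  fix V' assume V': "V' : Stab (outer e e)"
  show "(LINT V|?E. (LINT U|haarO. g (rot U (rot V' (perpP P'))) * h (rot U (rot V P))))
  = (LINT V|?E. (LINT U|haarO. h (rot U (rot V' (perpP P'))) * g (rot U (rot V P))))"
  proof (rule integral_cong_Stab[OF ST])
  fix V assume "V : Stab (outer e e)"
  from invariant_form_symmetric[OF in1[OF this V'] b]
  show "(LINT U|haarO. g (rot U (rot V' (perpP P'))) * h (rot U (rot V P)))
  = (LINT U|haarO. h (rot U (rot V' (perpP P'))) * g (rot U (rot V P)))" by (simp add: mult.commute)
  qed (intro bmJ b)+
 qed (intro bmK b)+
qed

text \<open>The operator on the left is self-adjoint and the one on the right is its adjoint, by
  Radon duality in both dimensions. The identity is the source of intersection bodies: it pairs
  \<open>Rdual m g\<close> with \<open>Rdual k (Iop k g)\<close>.\<close>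

lemma Radon_Rdual_intertwine: fixes g :: "('n::finite) matr => real"
 assumes mk: "m + k = CARD('n)" "1 <= m" "1 <= k" and g: "cont0 (Grass m) g"
 shows "Radon m (Rdual k (Iop k g)) = Iop m (Radon k (Rdual m g))"
proof -
 have km: "k + m = CARD('n)" "m <= CARD('n)" "k <= CARD('n)" using mk by auto
 let ?A = "Radon m (Rdual k (Iop k g))" and ?B = "Iop m (Radon k (Rdual m g))"
 have cA: "cont0 (Grass m) ?A"
  by (intro Radon_cont0 Rdual_cont0 Iop_cont0[OF km(1)] mk km g)
 have cR: "cont0 (Grass k) (Radon k (Rdual m g))" by (intro Radon_cont0 Rdual_cont0 mk km g)
 have cB: "cont0 (Grass m) ?B" by (rule Iop_cont0[OF mk(1) cR])
 have eq: "(LINT P|(haarG m). ?A P * h P) = (LINT P|(haarG m). ?B P * h P)" if h: "cont0 (Grass m) h" for h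
 proof -
  have "(LINT P|(haarG m). ?A P * h P) = (LINT x|haarS. Rdual k (Iop k g) x * Rdual m h x)"
  by (intro Radon_duality Rdual_cont0 Iop_cont0[OF km(1)] mk km g h)
  also have "... = (LINT x|haarS. Rdual k (Iop k h) x * Rdual m g x)"
  by (rule Rdual_Iop_symmetric[OF mk g h])
  also have "... = (LINT x|haarS. Rdual m g x * Rdual k (Iop k h) x)" by (simp add: mult.commute)
  also have "... = (LINT P|(haarG k). Radon k (Rdual m g) P * Iop k h P)"
  by (intro Radon_duality[symmetric] Rdual_cont0 Iop_cont0[OF km(1)] mk km g h)
  also have "... = (LINT P|(haarG m). Iop m (%P. Radon k (Rdual m g) P * Iop k h P) P)"
  by (rule integral_Iop[OF mk(1), symmetric]) (intro cont0_mult cR Iop_cont0[OF km(1)] h)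
  also have "... = (LINT P|(haarG m). ?B P * h P)" by (simp add: Iop_mult Iop_Iop[OF mk(1) h])
  finally show ?thesis .
 qed
 obtain P0 :: "'n matr" where P0: "P0 : Grass m" using Grass_mono_ex[of m, where 'n = 'n] km by auto
 let ?w = "%P. ?A P - ?B P"
 have w: "cont0 (Grass m) ?w" using cA cB by (rule cont0_diff)
 have i: "integrable (haarG m) h" if "cont0 (Grass m) h" for h :: "'n matr => real"
  by (rule bm_integrable) (use prob_space_haarG[OF P0] prob_space.finite_measure bm_Grass[OF that] sets_haarG[OF P0] in auto)
 have "(LINT P|(haarG m). ?w P * ?w P) = (LINT P|(haarG m). ?A P * ?w P - ?B P * ?w P)" by (simp add: algebra_simps)
 also have "... = (LINT P|(haarG m). ?A P * ?w P) - (LINT P|(haarG m). ?B P * ?w P)"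
  by (rule Bochner_Integration.integral_diff) (intro i cont0_mult w cA cB)+
 also have "... = 0" using eq[OF w] by simp
 finally have "?w P * ?w P = 0" for P
  by (intro haarG_nonneg_zero[where g = "%P. ?w P * ?w P" and m = m] cont0_mult w) auto
 then show ?thesis by (auto simp: fun_eq_iff)
qed

section \<open>Kernel operators\<close>

text \<open>The kernel is cut off outside \<open>X \<times> Y\<close>, so that continuity there
  already yields a bounded Borel kernel on the product space and a result vanishing off
  \<open>X\<close>.\<close>

definition kint :: "'a::euclidean_space set => 'b::euclidean_space set => 'b measure =>
  ('a => 'b => real) => ('b => real) => 'a => real" where
 "kint X Y M k f = (%x. \<integral>y. restr (X \<times> Y) (case_prod k) (x, y) * f y \<partial>M)"

lemma bm_kernel:
 fixes X :: "'a::euclidean_space set" and Y :: "'b::euclidean_space set"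
 assumes "compact X" "compact Y" "continuous_on (X \<times> Y) (case_prod k)"
 shows "bm (restr (X \<times> Y) (case_prod k))"
 using assms by (intro cont0_bm[of "X \<times> Y"] compact_Times cont0_restr)

lemma kint_eq: "x : X ==> (!!y. y \<notin> Y ==> f y = 0) ==> kint X Y M k f x = (LINT y|M. k x y * f y)"
 unfolding kint_def by (rule integral_eqI) (auto simp: restr_def)

lemma bm_kernel_mult:
 fixes X :: "'a::euclidean_space set" and Y :: "'b::euclidean_space set"
 assumes "compact X" "compact Y" "continuous_on (X \<times> Y) (case_prod k)" "bm f"
 shows "bm (%(x, y). restr (X \<times> Y) (case_prod k) (x, y) * f y)"
proof (rule bm_case_mult)
 show "bm (%(x, y). restr (X \<times> Y) (case_prod k) (x, y))"
  using bm_kernel[OF assms(1-3)] by (simp only: case_prod_eta)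
qed (rule bm_snd[OF assms(4)])

lemma bm_slice2: fixes f :: "'a::second_countable_topology => 'b::second_countable_topology => real"
 shows "bm (case_prod f) ==> bm (f x)"
 using bm_comp[of "case_prod f" "%y. (x, y)"]
 by (simp add: borel_contI continuous_on_Pair)

lemma kint_cont0:
 fixes X :: "'a::euclidean_space set" and Y :: "'b::euclidean_space set"
 assumes k: "compact X" "compact Y" "continuous_on (X \<times> Y) (case_prod k)" and f: "bm f"
  and M: "finite_measure M" "sets M = sets borel"
 shows "cont0 X (kint X Y M k f)"
proof -
 obtain B where B: "!!z. \<bar>(%(x, y). restr (X \<times> Y) (case_prod k) (x, y) * f y) z\<bar> <= B"
  using bmE[OF bm_kernel_mult[OF k f]] by blast
 have "continuous_on X (kint X Y M k f)"
  unfolding kint_def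
 proof (rule continuous_on_integral[where C = UNIV and B = B])
  show "(%y. restr (X \<times> Y) (case_prod k) (x, y) * f y) : borel_measurable borel" for x
  by (rule bm_meas, rule bm_slice2[OF bm_kernel_mult[OF k f]])
  show "\<bar>restr (X \<times> Y) (case_prod k) (x, y) * f y\<bar> <= B" for x y using B[of "(x, y)"] by simp
  show "continuous_on X (%x. restr (X \<times> Y) (case_prod k) (x, y) * f y)" for y
  proof (cases "y : Y")
  case True
  then have "continuous_on X (%x. case_prod k (x, y))"
  by (intro continuous_on_compose2[OF k(3)]) (auto intro!: continuous_intros)
  then show ?thesis using True
  by (auto simp: restr_def intro!: continuous_intros cong: continuous_on_cong_simp)
  qed (simp add: restr_def)
 qed (use M in auto)
 then show ?thesis by (simp add: cont0_def kint_def restr_def)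
qed

lemma kint_fubini:
 fixes X :: "'a::euclidean_space set" and Y :: "'b::euclidean_space set"
 assumes k: "compact X" "compact Y" "continuous_on (X \<times> Y) (case_prod k)" and f: "bm f" and g: "bm g"
  and M: "finite_measure M" "sets M = sets borel" and N: "finite_measure N" "sets N = sets borel"
 shows "(LINT x|N. g x * kint X Y M k f x) = (LINT y|M. f y * kint Y X N (%y x. k x y) g y)"
proof -
 have b: "bm (%(x, y). g x * (restr (X \<times> Y) (case_prod k) (x, y) * f y))"
  by (rule bm_case_mult[OF bm_fst[OF g] bm_kernel_mult[OF k f]])
 have "(LINT x|N. g x * kint X Y M k f x) = (LINT x|N. (LINT y|M. g x * (restr (X \<times> Y) (case_prod k) (x, y) * f y)))"
  by (simp add: kint_def)
 also have "... = (LINT y|M. (LINT x|N. g x * (restr (X \<times> Y) (case_prod k) (x, y) * f y)))"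
  by (rule bm_fubini(1)[OF N M b])
 also have "... = (LINT y|M. f y * kint Y X N (%y x. k x y) g y)"
 proof (rule integral_eqI[OF refl])
  fix y
  have "(LINT x|N. g x * (restr (X \<times> Y) (case_prod k) (x, y) * f y))
  = (LINT x|N. f y * (restr (Y \<times> X) (%(y, x). k x y) (y, x) * g x))"
  by (intro integral_eqI) (auto simp: restr_def)
  then show "(LINT x|N. g x * (restr (X \<times> Y) (case_prod k) (x, y) * f y)) = f y * kint Y X N (%y x. k x y) g y"
  by (simp add: kint_def)
 qed
 finally show ?thesis .
qed

lemma Radon_kint:
 fixes P :: "('n::finite) matr" and Y :: "'b::euclidean_space set"
 assumes k: "compact Y" "continuous_on (Sph \<times> Y) (case_prod k)" and f: "bm f"
  and M: "finite_measure M" "sets M = sets borel" and P: "P : Grass m" and m: "1 <= m"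
 shows "Radon m (kint Sph Y M k f) P = (LINT y|M. Radon m (%x. restr (Sph \<times> Y) (case_prod k) (x, y)) P * f y)"
proof -
 obtain e where e: "e : Sph" "P *v e = e" using Grass_unit[OF m P] .
 note k' = compact_Sph k
 have bK: "bm (restr (Sph \<times> Y) (case_prod k))" by (rule bm_kernel[OF k'])
 have b: "bm (%(V :: 'n matr, y). restr (Sph \<times> Y) (case_prod k) (V *v e, y) * f y)"
 proof -
  have 1: "bm (%z :: 'n matr \<times> 'b. restr (Sph \<times> Y) (case_prod k) (fst z *v e, snd z))"
  by (rule bm_comp[OF bK]) (intro borel_contI continuous_intros)
  have 2: "bm (%z :: 'n matr \<times> 'b. f (snd z))"
  by (rule bm_comp[OF f]) (intro borel_contI continuous_intros)
  show ?thesis using bm_mult[OF 1 2] by (simp add: split_def)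
 qed
 have bs: "bm (%x. restr (Sph \<times> Y) (case_prod k) (x, y))" for y
  by (rule bm_comp[OF bK]) (intro borel_contI continuous_intros)
 have bk: "bm (kint Sph Y M k f)" by (rule bm_Sph, rule kint_cont0[OF k' f M])
 have "Radon m (kint Sph Y M k f) P = (LINT V|(haar P). (LINT y|M. restr (Sph \<times> Y) (case_prod k) (V *v e, y) * f y))"
  by (simp add: Radon_at[OF P e bk]) (simp add: kint_def)
 also have "... = (LINT y|M. (LINT V|(haar P). restr (Sph \<times> Y) (case_prod k) (V *v e, y) * f y))"
  by (rule bm_fubini(1)[OF _ _ M b]) auto
 finally show ?thesis by (simp add: Radon_at[OF P e bs])
qed

lemma Rdual_kint:
 fixes x :: "('n::finite) vect" and Y :: "'b::euclidean_space set"
 assumes k: "compact Y" "continuous_on (Grass m \<times> Y) (case_prod k)" and f: "bm f"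
  and M: "finite_measure M" "sets M = sets borel" and x: "x : Sph" and m: "1 <= m" "m <= CARD('n)"
 shows "Rdual m (kint (Grass m) Y M k f) x = (LINT y|M. Rdual m (%P. restr (Grass m \<times> Y) (case_prod k) (P, y)) x * f y)"
proof -
 obtain P :: "'n matr" where P: "P : Grass m" "P *v x = x" using Grass_containing[of m x] m x by (auto simp: Sph_norm)
 note k' = compact_Grass k
 have bK: "bm (restr (Grass m \<times> Y) (case_prod k))" by (rule bm_kernel[OF k'])
 have b: "bm (%(V :: 'n matr, y). restr (Grass m \<times> Y) (case_prod k) (rot V P, y) * f y)"
 proof -
  have 1: "bm (%z :: 'n matr \<times> 'b. restr (Grass m \<times> Y) (case_prod k) (rot (fst z) P, snd z))"
  by (rule bm_comp[OF bK]) (intro borel_contI continuous_intros)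
  have 2: "bm (%z :: 'n matr \<times> 'b. f (snd z))"
  by (rule bm_comp[OF f]) (intro borel_contI continuous_intros)
  show ?thesis using bm_mult[OF 1 2] by (simp add: split_def)
 qed
 have bs: "bm (%P. restr (Grass m \<times> Y) (case_prod k) (P, y))" for y
  by (rule bm_comp[OF bK]) (intro borel_contI continuous_intros)
 have bk: "bm (kint (Grass m) Y M k f)" by (rule bm_Grass, rule kint_cont0[OF k' f M])
 have at: "Rdual m g x = (LINT V|(haar (outer x x)). g (rot V P))" if "bm g" for g
  using Rdual_rot[OF P(1) x P(2) orth_mat1 that] by simp
 have "Rdual m (kint (Grass m) Y M k f) x = (LINT V|(haar (outer x x)). (LINT y|M. restr (Grass m \<times> Y) (case_prod k) (rot V P, y) * f y))"
  by (simp add: at[OF bk]) (simp add: kint_def)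
 also have "... = (LINT y|M. (LINT V|(haar (outer x x)). restr (Grass m \<times> Y) (case_prod k) (rot V P, y) * f y))"
  by (rule bm_fubini(1)[OF _ _ M b]) auto
 finally show ?thesis by (simp add: at[OF bs])
qed

section \<open>Moments\<close>

text \<open>On the plane the inner product with \<open>y\<close> is the inner product with
  \<open>P *v y\<close>, and rotations within the plane make the average depend only on the norm of
  that vector, homogeneously of degree \<open>2 * i\<close>.\<close>

lemma Radon_moments:
 assumes m: "1 <= m" "m <= CARD('n)"
 obtains c :: "nat => real" where "!!i. c i > 0"
  "!!P y i. P : Grass m ==> Radon m (restr Sph (%x. (x \<bullet> y) ^ (2 * i))) P
  = c i * norm (P *v (y :: ('n::finite) vect)) ^ (2 * i)"
proof -
 obtain P0 :: "'n matr" and e0 where P0: "P0 : Grass m" and e0: "e0 : Sph" "P0 *v e0 = e0" using Grass_base[OF m] .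
 have oP0: "oproj P0" using P0 by (rule Grass_oproj)
 define F :: "'n vect => nat => 'n vect => real" where "F y i = restr Sph (%x. (x \<bullet> y) ^ (2 * i))" for y i
 have cF: "cont0 Sph (F y i)" for y i unfolding F_def by (intro cont0_restr continuous_intros)
 have bF: "bm (F y i)" for y i using cF by (rule bm_Sph)
 define c where "c i = (LINT V|(haar P0). F e0 i (V *v e0))" for i
 have pos: "c i > 0" for i
  unfolding c_def
 proof (rule haar_integral_pos[OF oP0, where V = "mat 1"])
  show "continuous_on (Stab P0) (%V. F e0 i (V *v e0))"
  by (rule cont0_Sph_vec[OF cF e0(1)]) (auto intro: Stab_orth)
  have "e0 \<bullet> e0 = 1" using e0(1) by (simp add: Sph_norm norm_eq_1)
  then show "0 < F e0 i (mat 1 *v e0)" using e0 by (simp add: F_def)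
 qed (use e0 in "auto simp: F_def Stab_iff intro!: bm_vec1 bF[unfolded F_def]")
 have base: "(LINT V|(haar P0). F y i (V *v y)) = c i" if y: "y : Sph" "P0 *v y = y" for y i
 proof -
  define Z where "Z = refl (e0 - y)"
  have Z: "Z : Stab P0" "Z *v e0 = y"
  using y e0 oP0 refl_swap(1)[of e0 y]
  by (auto simp: Z_def Stab_iff Sph_norm matrix_vector_mult_diff_distrib intro!: rot_refl_range)
  have "(LINT V|(haar P0). F y i (V *v y)) = (LINT V|(haar P0). F y i (Z ** V *v y))"
  by (rule haar_left[OF oP0 Z(1), symmetric]) (rule bm_vec1[OF bF])
  also have "... = (LINT V|(haar P0). F y i (Z ** (V ** transpose Z) *v y))"
  by (rule haar_right[OF oP0 Stab_transpose[OF Z(1)], symmetric])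
  (rule bm_comp[OF bF], measurable)
  also have "... = c i" unfolding c_def
  proof (rule integral_cong_Stab[OF oP0])
  fix V assume V: "V : Stab P0"
  have ZO: "Z : orth" using Stab_orth Z(1) by blast
  have "transpose Z *v y = e0" using Z ZO by (metis mv_assoc matrix_vector_mul_lid orthD(1))
  then have "Z ** (V ** transpose Z) *v y = Z *v (V *v e0)"
  by (simp add: mv_assoc[symmetric])
  moreover have "(Z *v (V *v e0)) \<bullet> y = (V *v e0) \<bullet> e0" using ZO Z(2) by (metis orth_inner)
  ultimately show "F y i (Z ** (V ** transpose Z) *v y) = F e0 i (V *v e0)"
  using ZO V e0 by (simp add: F_def)
  qed (rule bm_comp[OF bF], measurable)+
  finally show ?thesis .
 qed
 have main: "Radon m (F y i) P = c i * norm (P *v y) ^ (2 * i)" if P: "P : Grass m" for P y i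
 proof -
  obtain W where W: "W : orth" "rot W P0 = P" using Grass_swap[OF P0 P] by blast
  define z where "z = transpose W *v y"
  have Wz: "W *v z = y" using W by (simp add: z_def mv_assoc orthD)
  have nz: "norm (P *v y) = norm (P0 *v z)" using W Wz by (metis orth_norm orth_rot_vec)
  have R: "Radon m (F y i) P = (LINT V|(haar P0). F y i (W ** V *v e))" if "e : Sph" "P0 *v e = e" for e
  using Radon_rot[OF P0 that W(1) bF] W(2) by simp
  have val: "F y i (W ** V *v e) = ((V *v e) \<bullet> (P0 *v z)) ^ (2 * i)" if V: "V : Stab P0" and e: "e : Sph" "P0 *v e = e" for V e
  proof -
  have "P0 *v (V *v e) = V *v (P0 *v e)" using V by (simp add: mv_assoc Stab_def)
  then have "(V *v e) \<bullet> (P0 *v z) = (V *v e) \<bullet> z" using proj_inner[OF oP0, of "V *v e" z] e by simp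
  moreover have "(W *v (V *v e)) \<bullet> (W *v z) = (V *v e) \<bullet> z" using W by simp
  ultimately show ?thesis using V W e by (simp add: F_def mv_assoc[symmetric] Wz[symmetric])
  qed
  show ?thesis
  proof (cases "P0 *v z = 0")
  case True
  have "(LINT V|(haar P0). F y i (W ** V *v e0)) = (LINT V|(haar P0). 0 ^ (2 * i))"
  by (rule integral_cong_Stab[OF oP0]) (use val[OF _ e0] True in "auto intro!: bm_comp[OF bF] simp: power_0_left")
  \<comment> \<open>At \<open>i = 0\<close> the degenerate case involves the power
    \<open>0 ^ 0 = 1\<close>, so the normalisation of \<open>c 0\<close> matters.\<close>
  moreover have "c 0 = 1"
  proof -
  have "c 0 = (LINT V|(haar P0). 1)" unfolding c_def
  by (rule integral_cong_Stab[OF oP0]) (use e0 in "auto simp: F_def intro!: bm_vec1 bF[unfolded F_def] bm_Sph cont0_const")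
  then show ?thesis by simp
  qed
  ultimately show ?thesis using R[OF e0] nz True by (cases i) auto
  next
  case False
  define v where "v = (P0 *v z) /\<^sub>R norm (P0 *v z)"
  have v: "v : Sph" "P0 *v v = v" using False oP0 by (auto simp: v_def Sph_norm mv_scaleR)
  have Pz: "P0 *v z = norm (P0 *v z) *\<^sub>R v" using False by (simp add: v_def)
  have "(LINT V|(haar P0). F y i (W ** V *v v)) = (LINT V|(haar P0). norm (P0 *v z) ^ (2 * i) * F v i (V *v v))"
  proof (rule integral_cong_Stab[OF oP0])
  fix V assume V: "V : Stab P0"
  show "F y i (W ** V *v v) = norm (P0 *v z) ^ (2 * i) * F v i (V *v v)"
  using val[OF V v] V v by (subst (asm) Pz) (simp add: F_def power_mult_distrib)
  qed (auto intro!: bm_cmult bm_vec1 bF bm_comp[OF bF])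
  also have "... = norm (P0 *v z) ^ (2 * i) * c i" using base[OF v] by simp
  finally show ?thesis using R[OF v] nz by (simp add: mult.commute)
  qed
 qed
 show ?thesis using that[of c] pos main by (simp add: F_def)
qed

lemma inner_mult_left: "(A ** B) \<bullet> C = B \<bullet> (transpose A ** C)" for A B C :: "real^'n^'n"
 by (simp add: inner_matr mv_assoc[symmetric] inner_matrix_vector)

lemma inner_proj: assumes "oproj P" "oproj Q" shows "P \<bullet> Q = (norm (P ** Q))\<^sup>2"
proof -
 have p: "P ** P = P" "transpose P = P" and q: "Q ** Q = Q" "transpose Q = Q" using assms by (auto simp: oproj_def)
 have "(P ** Q) \<bullet> (P ** Q) = Q \<bullet> (P ** Q)"
  using inner_mult_left[of P Q "P ** Q"] by (simp add: p matrix_mul_assoc)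
 also have "... = transpose Q \<bullet> transpose (P ** Q)" by (simp only: inner_transpose)
 also have "... = Q \<bullet> (Q ** P)" by (simp add: matrix_transpose_mul p q)
 also have "... = (Q ** Q) \<bullet> P" using inner_mult_left[of Q Q P] by (simp add: q)
 finally show ?thesis by (simp add: q power2_norm_eq_inner inner_commute)
qed

lemma inner_proj_nonneg: "oproj P ==> oproj Q ==> 0 <= P \<bullet> Q"
 by (simp add: inner_proj)

lemma Grass_norm: "P : Grass m ==> Q : Grass m ==> norm P = norm Q" for P Q :: "('n::finite) matr"
proof -
 assume PQ: "P : Grass m" "Q : Grass m"
 obtain U where "U : orth" "rot U P = Q" using Grass_swap[OF PQ] .
 then show ?thesis using norm_rot[of U P] by simp
qed

text \<open>Every pair \<open>(P, \<theta>)\<close> lies in the orthogonal orbit of exactly one point of an explicit path of pairs,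
  and along the path \<open>P \<bullet> Q\<close> is affine in \<open>(norm (P \<theta>))\<^sup>2\<close> with non-negative coefficients.\<close>

lemma Rdual_moments:
 assumes r: "1 <= r" "r < CARD('n)" and m: "1 <= m" "m <= CARD('n)" and c: "0 <= (c::real)"
 obtains a :: "nat => real" where "!!i. 0 <= a i"
  "!!P th. P : Grass r ==> th : Sph ==> Rdual m (restr (Grass m) (%Q. (c + P \<bullet> Q) ^ N)) th
  = (SUM i<=N. a i * norm (P *v (th :: ('n::finite) vect)) ^ (2 * i))"
  "m < CARD('n) ==> 0 < a N"
proof -
 define t where "t = (axis undefined 1 :: 'n vect)"
 have t: "t : Sph" "t \<bullet> t = 1" by (simp_all add: t_def Sph_axis)
 obtain P1 :: "'n matr" where P1: "P1 : Grass r" "P1 *v t = 0"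
  using Grass_avoiding[OF r(2), of t] t by (auto simp: Sph_norm)
 obtain w where w: "w : Sph" "P1 *v w = w" using Grass_unit[OF r(1) P1(1)] .
 have oP1: "oproj P1" using P1 by (simp add: Grass_iff)
 have ww: "w \<bullet> w = 1" using w by (simp add: Sph_norm norm_eq_1)
 have wt: "w \<bullet> t = 0" "t \<bullet> w = 0" using proj_inner[OF oP1, of w t] w P1 by (simp_all add: inner_commute)
 define P' where "P' = P1 - outer w w"
 have P': "oproj P'" "P' *v w = 0" "P' *v t = 0"
  using proj_diff_outer[OF oP1 w(2)] w P1 wt by (auto simp: P'_def Sph_norm matrix_vector_mult_diff_rdistrib)
 \<comment> \<open>Unit vectors whose squared component along \<open>t\<close> is \<open>s\<close>;
   replacing \<open>w\<close> by \<open>u s\<close> in the range of \<open>P1\<close> runs through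
   all possible squared norms of the projection of \<open>t\<close>.\<close>
 define u where "u s = sqrt s *\<^sub>R t + sqrt (1 - s) *\<^sub>R w" for s
 define Ps where "Ps s = P' + outer (u s) (u s)" for s
 have path: "Ps s : Grass r" "norm (Ps s *v t) = sqrt s" if s: "0 <= s" "s <= 1" for s
 proof -
  have nu: "norm (u s) = 1"
  proof -
  have "(u s) \<bullet> (u s) = 1" using s
  by (simp add: u_def inner_add_left inner_add_right wt ww t(2))
  then show ?thesis by (simp add: norm_eq_1)
  qed
  define H where "H = refl (w - u s)"
  have "P' *v (w - u s) = 0"
  by (simp add: u_def matrix_vector_mult_diff_distrib matrix_vector_right_distrib mv_scaleR P')
  then have H: "rot H P' = P'" unfolding H_def by (rule rot_refl_perp[OF P'(1)])
  have "H *v w = u s" unfolding H_def by (rule refl_swap(1)) (use nu w in "simp add: Sph_norm")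
  then have "rot H P1 = Ps s"
  using H rot_add[of H P' "outer w w"] by (simp add: P'_def Ps_def rot_outer)
  then show "Ps s : Grass r" using P1 by (metis Grass_rot H_def refl_orth)
  have "u s \<bullet> t = sqrt s" by (simp add: u_def inner_add_left wt t(2))
  then have "Ps s *v t = sqrt s *\<^sub>R u s" by (simp add: Ps_def matrix_vector_mult_add_rdistrib P')
  then show "norm (Ps s *v t) = sqrt s" using nu s by simp
 qed
 obtain Q0 :: "'n matr" where Q0: "Q0 : Grass m" "Q0 *v t = t"
  using Grass_containing[of m t] m t by (auto simp: Sph_norm)
 let ?E = "Stab (outer t t)"
 have oE: "oproj (outer t t)" by (rule outer_oproj[OF t(1)])
 define q where "q V = w \<bullet> (rot V Q0 *v w)" for V
 define A where "A V = c + P' \<bullet> rot V Q0 + q V" for V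
 have cq: "continuous_on ?E q" "continuous_on ?E A"
  unfolding q_def A_def by (intro continuous_intros)+
 have VQ: "rot V Q0 : Grass m" "rot V Q0 *v t = t" if V: "V : ?E" for V
 proof -
  show "rot V Q0 : Grass m" using V Q0 by simp
  have "V *v t = t \<or> V *v t = - t" using Stab_outer[OF t(1) V] .
  moreover have "rot V Q0 *v (V *v t) = V *v t" using Stab_orth[OF V] Q0 by simp
  ultimately show "rot V Q0 *v t = t" by (auto simp: linear_neg[OF matrix_vector_mul_linear])
 qed
 have qb: "0 <= q V" "q V <= 1" "0 <= A V" if V: "V : ?E" for V
 proof -
  have o: "oproj (rot V Q0)" using VQ(1)[OF V] by (rule Grass_oproj)
  have qn: "q V = (norm (rot V Q0 *v w))\<^sup>2" unfolding q_def by (rule proj_inner_self[OF o])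
  show 0: "0 <= q V" by (simp add: qn)
  have "norm (rot V Q0 *v w) <= 1" using proj_norm_le[OF o, of w] w by (simp add: Sph_norm)
  then show "q V <= 1" by (simp add: qn power_le_one)
  show "0 <= A V" using inner_proj_nonneg[OF P'(1) o] 0 c by (simp add: A_def)
 qed
 define h where "h i = restr ?E (%V. of_nat (N choose i) * (1 - q V) ^ i * A V ^ (N - i))" for i
 have ch: "cont0 ?E (h i)" for i unfolding h_def by (intro cont0_restr continuous_intros cq)
 have bh: "bm (h i)" for i using ch by (rule cont0_bm[OF compact_Stab])
 define a where "a i = (LINT V|(haar (outer t t)). h i V)" for i
 have nonneg: "0 <= a i" for i
  unfolding a_def by (rule Bochner_Integration.integral_nonneg) (use qb in "auto simp: h_def restr_def")
 have form: "Rdual m (restr (Grass m) (%Q. (c + P \<bullet> Q) ^ N)) th = (SUM i<=N. a i * norm (P *v th) ^ (2 * i))"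
  if P: "P : Grass r" and th: "th : Sph" for P :: "'n matr" and th
 proof -
  define s where "s = (norm (P *v th))\<^sup>2"
  have s: "0 <= s" "s <= 1"
  using proj_norm_le[OF Grass_oproj[OF P], of th] th by (auto simp: s_def Sph_norm power_le_one)
  obtain W where W: "W : orth" "rot W (Ps s) = P" "W *v t = th"
  by (rule Grass_pair_transitive[OF path(1)[OF s] P, of t th])
  (use t th path(2)[OF s] in "auto simp: Sph_norm s_def")
  define g where "g = restr (Grass m) (%Q. (c + P \<bullet> Q) ^ N)"
  have bg: "bm g" unfolding g_def by (rule bm_Grass[of m]) (intro cont0_restr continuous_intros)
  have "Rdual m g th = (LINT V|(haar (outer t t)). g (rot (W ** V) Q0))"
  using Rdual_rot[OF Q0(1) t(1) Q0(2) W(1) bg] W(3) by simp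
  also have "... = (LINT V|(haar (outer t t)). (SUM i<=N. h i V * s ^ i))"
  proof (rule integral_cong_Stab[OF oE])
  fix V assume V: "V : ?E"
  let ?Q = "rot V Q0"
  have o: "oproj ?Q" using VQ(1)[OF V] by (rule Grass_oproj)
  have "rot (W ** V) Q0 : Grass m" using W VQ(1)[OF V] by (simp add: rot_rot[symmetric])
  moreover have "P \<bullet> rot (W ** V) Q0 = Ps s \<bullet> ?Q"
  using W by (simp add: rot_rot[symmetric] W(2)[symmetric] del: W(2))
  ultimately have "g (rot (W ** V) Q0) = (c + Ps s \<bullet> ?Q) ^ N" by (simp add: g_def)
  also have "Ps s \<bullet> ?Q = P' \<bullet> ?Q + u s \<bullet> (?Q *v u s)"
  by (simp add: Ps_def inner_add_left inner_outer inner_commute[of "outer (u s) (u s)"])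
  also have "u s \<bullet> (?Q *v u s) = s + (1 - s) * q V"
  proof -
  have "t \<bullet> (?Q *v w) = 0" using proj_inner[OF o, of t w] VQ(2)[OF V] wt by simp
  moreover have "?Q *v u s = sqrt s *\<^sub>R t + sqrt (1 - s) *\<^sub>R (?Q *v w)"
  by (simp add: u_def matrix_vector_right_distrib mv_scaleR VQ(2)[OF V])
  ultimately show ?thesis using s
  by (simp add: u_def inner_add_left inner_add_right wt t(2) q_def)
  qed
  \<comment> \<open>Affine in \<open>s\<close> with both coefficients non-negative, since
    \<open>q V\<close> lies between 0 and 1; the binomial theorem then yields the non-negative
    \<open>h i V\<close>.\<close>
  also have "c + (P' \<bullet> ?Q + (s + (1 - s) * q V)) = s * (1 - q V) + A V" by (simp add: A_def algebra_simps)
  also have "... ^ N = (SUM i<=N. h i V * s ^ i)"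
  using V by (simp add: binomial_ring h_def power_mult_distrib mult_ac)
  finally show "g (rot (W ** V) Q0) = (SUM i<=N. h i V * s ^ i)" .
  qed (use bh in "auto intro!: bm_sum bm_mult bm_comp[OF bg]")
  also have "... = (SUM i<=N. a i * s ^ i)"
  unfolding a_def using bm_integrable_haar[OF bh] by (subst Bochner_Integration.integral_sum) auto
  finally show ?thesis by (simp add: g_def s_def power_mult)
 qed
 \<comment> \<open>The top coefficient averages \<open>(1 - q V) ^ N\<close>. Below full dimension
   some unit vector is orthogonal to the range of \<open>Q0\<close>, and a reflection moving it to
   \<open>w\<close> gives a plane with \<open>q = 0\<close>.\<close>
 have top: "0 < a N" if mn: "m < CARD('n)"
 proof -
  have "\<not> inj ((*v) Q0)"
  using mn Q0(1) less_rank_noninjective[of Q0] by (simp add: Grass_iff)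
  then obtain x where x: "x ~= 0" "Q0 *v x = 0"
  by (metis matrix_left_invertible_injective matrix_left_invertible_ker)
  define w' where "w' = x /\<^sub>R norm x"
  have w': "norm w' = 1" "Q0 *v w' = 0" using x by (simp_all add: w'_def mv_scaleR)
  have w't: "w' \<bullet> t = 0" using proj_inner[OF Grass_oproj[OF Q0(1)], of w' t] Q0 w' by simp
  define Z where "Z = refl (w' - w)"
  have Z: "Z : orth" "Z *v t = t" "Z *v w' = w"
  using refl_swap(1)[of w' w] w w' by (auto simp: Z_def Sph_norm inner_diff_left wt w't intro!: refl_fix)
  have ZE: "Z : ?E" using Z by (simp add: Stab_iff rot_outer)
  have "rot Z Q0 *v w = 0" using Z w' by (metis matrix_vector_mult_0_right orth_rot_vec)
  then have "h N Z = 1" using ZE by (simp add: h_def q_def)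
  then show ?thesis unfolding a_def
  by (intro haar_integral_pos[OF oE bh _ _ ZE]) (use cq qb in "auto simp: h_def intro!: continuous_intros")
 qed
 show ?thesis using that[of a] nonneg form top by blast
qed

section \<open>Smoothing operators\<close>

definition kern :: "real => nat => ('n::finite) matr => 'n matr => real" where
 "kern c N P Q = (c + P \<bullet> Q) ^ N"

definition kmass :: "'n::finite itself => nat => real => nat => real" where
 "kmass _ d c N = (LINT Q|(haarG d). restr (Grass d) (kern c N (SOME P :: 'n matr. P : Grass d)) Q)"

definition Top :: "nat => real => nat => (('n::finite) matr => real) => 'n matr => real" where
 "Top d c N = kint (Grass d) (Grass d) (haarG d) (%P Q. kern c N P Q / kmass TYPE('n) d c N)"

lemma continuous_kern [continuous_intros]:
 "continuous_on X f ==> continuous_on X g ==> continuous_on X (%x. kern c N (f x) (g x))"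
 unfolding kern_def by (intro continuous_intros)

lemma kern_rot: "U : orth ==> kern c N (rot U P) (rot U Q) = kern c N P Q"
 by (simp add: kern_def)

lemma kern_commute: "kern c N P Q = kern c N Q P"
 by (simp add: kern_def inner_commute)

lemma kern_nonneg: "0 <= c ==> P : Grass d ==> Q : Grass d' ==> 0 <= kern c N P Q"
 unfolding kern_def by (intro zero_le_power add_nonneg_nonneg inner_proj_nonneg Grass_oproj)

lemma haarG_invariant: fixes P0 :: "('n::finite) matr" and f :: "'n matr => real"
 assumes P0: "P0 : Grass d" and W: "W : orth" and f: "bm f"
 shows "(LINT Q|(haarG d). f (rot W Q)) = (LINT Q|(haarG d). f Q)"
proof -
 have "(LINT Q|(haarG d). f (rot W Q)) = (LINT U|haarO. f (rot (W ** U) P0))"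
  using integral_haarG[OF P0 bm_comp[OF f, of "rot W"]] by (simp add: rot_rot)
 also have "... = (LINT U|haarO. f (rot U P0))"
  by (rule haar_left[OF proj_mat1, of W "%U. f (rot U P0)"]) (use W f in "auto intro: bm_rot1")
 also have "... = (LINT Q|(haarG d). f Q)" by (rule integral_haarG[OF P0 f, symmetric])
 finally show ?thesis .
qed

lemma haarS_invariant: fixes f :: "('n::finite) vect => real"
 assumes W: "W : orth" and f: "bm f"
 shows "(LINT x|haarS. f (W *v x)) = (LINT x|haarS. f x)"
proof -
 have b: "bm (%x. f (W *v x))" by (rule bm_comp[OF f]) measurable
 have "(LINT x|haarS. f (W *v x)) = (LINT U|haarO. f (W ** U *v axis undefined 1))"
  using integral_haarS[OF Sph_axis b] by (simp add: mv_assoc)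
 also have "... = (LINT U|haarO. f (U *v axis undefined 1))"
  by (rule haar_left[OF proj_mat1, of W "%U. f (U *v axis undefined 1)"]) (use W f in "auto intro: bm_vec1")
 also have "... = (LINT x|haarS. f x)" by (rule integral_haarS[OF Sph_axis f, symmetric])
 finally show ?thesis .
qed

lemma bm_kern: "bm (restr (Grass d) (kern c N P))"
 by (rule bm_Grass[of d]) (intro cont0_restr continuous_intros)

lemma kmass_eq: fixes P :: "('n::finite) matr" assumes P: "P : Grass d"
 shows "(LINT Q|(haarG d). restr (Grass d) (kern c N P) Q) = kmass TYPE('n) d c N"
proof -
 define P' where "P' = (SOME P :: 'n matr. P : Grass d)"
 have P': "P' : Grass d" unfolding P'_def using P by (rule someI)
 obtain W where W: "W : orth" "rot W P = P'" using Grass_swap[OF P P'] .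
 have "kmass TYPE('n) d c N = (LINT Q|(haarG d). restr (Grass d) (kern c N P') (rot W Q))"
  unfolding kmass_def P'_def[symmetric] by (rule haarG_invariant[OF P W(1) bm_kern, symmetric])
 also have "... = (LINT Q|(haarG d). restr (Grass d) (kern c N P) Q)"
  using W by (intro integral_eqI) (auto simp: restr_def kern_rot W(2)[symmetric])
 finally show ?thesis by simp
qed

lemma kmass_pos: fixes P :: "('n::finite) matr" assumes P: "P : Grass d" and d: "1 <= d" and c: "0 <= c"
 shows "0 < kmass TYPE('n) d c N"
proof (rule ccontr)
 assume "\<not> 0 < kmass TYPE('n) d c N"
 then have "restr (Grass d) (kern c N P) P = 0"
  using kmass_eq[OF P, of c N] kern_nonneg[OF c P]
  by (intro haarG_nonneg_zero[where m = d]) (auto intro!: cont0_restr continuous_intros)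
 moreover have "P \<bullet> P > 0"
 proof -
  have "P ~= 0" using P d by (auto simp: Grass_iff)
  then show ?thesis by simp
 qed
 ultimately show False using P c by (simp add: kern_def)
qed

lemma compact_kernel_cont: "continuous_on (X \<times> Y) (case_prod (%P Q. kern c N P Q / z))"
 unfolding case_prod_beta' divide_inverse by (intro continuous_intros)

lemma finite_haarG: assumes "d <= CARD('n)"
 shows "finite_measure (haarG d :: ('n::finite) matr measure)" "sets (haarG d :: 'n matr measure) = sets borel"
  "prob_space (haarG d :: 'n matr measure)"
proof -
 obtain P :: "'n matr" where P: "P : Grass d" using Grass_mono_ex[OF assms] by blast
 show "prob_space (haarG d :: 'n matr measure)" using P by (rule prob_space_haarG)
 then show "finite_measure (haarG d :: 'n matr measure)" by (rule prob_space.finite_measure)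
 show "sets (haarG d :: 'n matr measure) = sets borel" using P by (rule sets_haarG)
qed

lemma finite_haarS [simp]: "finite_measure haarS"
 using prob_space_haarS by (rule prob_space.finite_measure)

lemma Top_cont0: fixes f :: "('n::finite) matr => real"
 assumes "d <= CARD('n)" "bm f" shows "cont0 (Grass d) (Top d c N f)"
 unfolding Top_def
 by (intro kint_cont0 compact_Grass compact_kernel_cont assms finite_haarG)

lemma Top_eq: fixes P :: "('n::finite) matr"
 assumes "P : Grass d" "cont0 (Grass d) f"
 shows "Top d c N f P = (LINT Q|(haarG d). restr (Grass d) (kern c N P) Q * f Q) / kmass TYPE('n) d c N"
proof -
 have "Top d c N f P = (LINT Q|(haarG d). (restr (Grass d) (kern c N P) Q * f Q) / kmass TYPE('n) d c N)"
  unfolding Top_def kint_def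
  by (rule integral_eqI) (use assms in "auto simp: restr_def")
 then show ?thesis by simp
qed

text \<open>Projections of equal rank have equal norm, so by polarisation a kernel with non-negative
  shift decreases with the distance between the planes and concentrates on the diagonal.\<close>

lemma Grass_inner_dist: "P : Grass d ==> Q : Grass d ==> P \<bullet> Q = (norm P)\<^sup>2 - (norm (P - Q))\<^sup>2 / 2"
 for P Q :: "('n::finite) matr"
 using Grass_norm[of P d Q]
 by (simp add: dot_norm_neg)

text \<open>Within distance \<open>r\<close> of \<open>P0\<close> the kernel is at least the N-th
  power of its base at distance \<open>r\<close>; \<open>p\<close> is the integral of a tent
  function supported there, positive because Haar measure has full support.\<close>

lemma kmass_lower:
 fixes P0 :: "('n::finite) matr"
 assumes P0: "P0 : Grass d" and c: "0 <= c" and r: "0 < r" and b: "0 <= c + (norm P0)\<^sup>2 - r\<^sup>2 / 2"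
 shows "EX p>0. ALL N. p * (c + (norm P0)\<^sup>2 - r\<^sup>2 / 2) ^ N <= kmass TYPE('n) d c N"
proof -
 define b where "b = c + (norm P0)\<^sup>2 - r\<^sup>2 / 2"
 define h where "h = restr (Grass d) (%Q. max 0 (1 - dist P0 Q / r))"
 have ch: "cont0 (Grass d) h" unfolding h_def using r by (intro cont0_restr continuous_intros) auto
 have bh: "bm h" using ch by (rule bm_Grass)
 define p where "p = (LINT Q|(haarG d). h Q)"
 have "0 < p"
 proof (rule ccontr)
  assume "\<not> 0 < p"
  then have "h P0 = 0" by (intro haarG_nonneg_zero[OF ch]) (auto simp: h_def p_def)
  then show False using P0 by (simp add: h_def)
 qed
 moreover have "p * b ^ N <= kmass TYPE('n) d c N" for N
 proof -
  have i: "integrable (haarG d) g" if "bm g" for g :: "'n matr => real"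
  using prob_space_haarG[OF P0] that sets_haarG[OF P0]
  by (intro bm_integrable) (auto intro: prob_space.finite_measure)
  have "p * b ^ N = (LINT Q|(haarG d). h Q * b ^ N)" by (simp add: p_def)
  also have "... <= (LINT Q|(haarG d). restr (Grass d) (kern c N P0) Q)"
  proof (rule integral_mono)
  fix Q
  show "h Q * b ^ N <= restr (Grass d) (kern c N P0) Q"
  proof (cases "Q : Grass d")
  case Q: True
  show ?thesis
  proof (cases "dist P0 Q < r")
  case True
  have "(norm (P0 - Q))\<^sup>2 <= r\<^sup>2" using True by (intro power_mono) (auto simp: dist_norm)
  then have "b <= c + P0 \<bullet> Q" using Grass_inner_dist[OF P0 Q] by (simp add: b_def)
  then have "b ^ N <= kern c N P0 Q" using b unfolding kern_def b_def by (intro power_mono) auto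
  moreover have "0 <= h Q" "h Q <= 1" using Q r by (auto simp: h_def)
  moreover have "0 <= b ^ N" using b by (simp add: b_def)
  ultimately have "h Q * b ^ N <= 1 * kern c N P0 Q" by (intro mult_mono) auto
  then show ?thesis using Q by simp
  next
  case False
  then have "h Q = 0" using Q r by (auto simp: h_def)
  then show ?thesis using Q kern_nonneg[OF c P0 Q] by simp
  qed
  qed (simp add: h_def restr_def)
  qed (use bh bm_kern in "auto intro!: i bm_mult")
  finally show ?thesis by (simp add: kmass_eq[OF P0])
 qed
 ultimately show ?thesis unfolding b_def by blast
qed

text \<open>Laplace's method: beyond distance \<delta> the kernel is at most
  \<open>\<alpha> ^ N\<close>, while its mass is at least \<open>p * \<beta> ^ N\<close> with
  \<beta> taken at half that distance. Since \<alpha> < \<beta>, the far part is negligible after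
  normalisation; uniform continuity controls the near part.\<close>

lemma Top_approximates:
 fixes f :: "('n::finite) matr => real"
 assumes d: "1 <= d" "d <= CARD('n)" and c: "0 <= c" and f: "cont0 (Grass d) f" and e: "0 < e"
 shows "EX N0. ALL N>=N0. ALL P:Grass d. \<bar>Top d c N f P - f P\<bar> < e"
proof -
 obtain P0 :: "'n matr" where P0: "P0 : Grass d" using Grass_mono_ex[OF d(2)] by blast
 have bf: "bm f" using f by (rule bm_Grass)
 obtain B where B: "B > 0" "!!x. \<bar>f x\<bar> <= B" using bmE[OF bf] by blast
 define \<tau> where "\<tau> = (norm P0)\<^sup>2"
 have "P0 ~= 0" using P0 d by (auto simp: Grass_iff)
 then have \<tau>: "\<tau> > 0" by (simp add: \<tau>_def)
 have uc: "uniformly_continuous_on (Grass d) f"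
  using f compact_uniformly_continuous[OF _ compact_Grass] by (auto simp: cont0_def)
 then obtain \<delta>0 where \<delta>0: "\<delta>0 > 0" "!!P Q. P : Grass d ==> Q : Grass d ==> dist Q P < \<delta>0 ==> dist (f Q) (f P) < e / 2"
  unfolding uniformly_continuous_on_def using e by (metis half_gt_zero)
 \<comment> \<open>The cap at the square root of \<tau> keeps the base \<alpha>
   non-negative.\<close>
 define \<delta> where "\<delta> = min \<delta>0 (sqrt \<tau>)"
 have \<delta>: "\<delta> > 0" "\<delta> <= \<delta>0" "\<delta>\<^sup>2 <= \<tau>"
  using \<delta>0 \<tau> real_sqrt_pow2[of \<tau>] power_mono[of \<delta> "sqrt \<tau>" 2] by (auto simp: \<delta>_def)
 define \<alpha> \<beta> where "\<alpha> = c + \<tau> - \<delta>\<^sup>2 / 2" and "\<beta> = c + \<tau> - (\<delta> / 2)\<^sup>2 / 2"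
 have d2: "\<delta>\<^sup>2 > 0" using \<delta> by simp
 have \<alpha>: "0 <= \<alpha>" "\<alpha> < \<beta>" "0 < \<beta>" using c \<delta>(3) d2 \<tau> by (auto simp: \<alpha>_def \<beta>_def power_divide)
 obtain p where p: "p > 0" "!!N. p * \<beta> ^ N <= kmass TYPE('n) d c N"
  using kmass_lower[OF P0 c, of "\<delta> / 2"] \<alpha> \<delta> by (auto simp: \<beta>_def \<tau>_def)
 have "(%N. 2 * B / p * (\<alpha> / \<beta>) ^ N) \<longlonglongrightarrow> 2 * B / p * 0"
  by (intro tendsto_mult tendsto_const LIMSEQ_realpow_zero) (use \<alpha> in auto)
 then have "eventually (%N. 2 * B / p * (\<alpha> / \<beta>) ^ N < e / 2) sequentially"
  using e by (intro order_tendstoD(2)) auto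
 then obtain N0 where N0: "!!N. N \<ge> N0 ==> 2 * B / p * (\<alpha> / \<beta>) ^ N < e / 2"
  by (auto simp: eventually_sequentially)
 have "\<bar>Top d c N f P - f P\<bar> < e" if N: "N \<ge> N0" and P: "P : Grass d" for N P
 proof -
  define Z where "Z = kmass TYPE('n) d c N"
  define K where "K = restr (Grass d) (kern c N P)"
  have Zpos: "Z > 0" unfolding Z_def by (rule kmass_pos[OF P d(1) c])
  have bK: "bm K" unfolding K_def by (rule bm_kern)
  have ZK: "Z = (LINT Q|(haarG d). K Q)" unfolding Z_def K_def by (rule kmass_eq[OF P, symmetric])
  have nP: "(norm P)\<^sup>2 = \<tau>" using Grass_norm[OF P P0] by (simp add: \<tau>_def)
  have i: "integrable (haarG d) g" if "bm g" for g :: "'n matr => real"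
  using finite_haarG[OF d(2)] that by (intro bm_integrable) auto
  have T: "Z * (Top d c N f P - f P) = (LINT Q|(haarG d). K Q * (f Q - f P))"
  proof -
  have "(LINT Q|(haarG d). K Q * (f Q - f P)) = (LINT Q|(haarG d). K Q * f Q - K Q * f P)" by (simp add: algebra_simps)
  also have "... = (LINT Q|(haarG d). K Q * f Q) - (LINT Q|(haarG d). K Q * f P)"
  by (rule Bochner_Integration.integral_diff) (auto intro!: i bm_mult bK bf)
  also have "... = Z * (Top d c N f P - f P)"
  using Zpos by (simp add: Top_eq[OF P f] K_def[symmetric] Z_def[symmetric] ZK[symmetric] right_diff_distrib)
  finally show ?thesis by simp
  qed
  have "\<bar>Z * (Top d c N f P - f P)\<bar> <= (LINT Q|(haarG d). \<bar>K Q * (f Q - f P)\<bar>)"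
  unfolding T by (rule integral_abs_bound)
  also have "... <= (LINT Q|(haarG d). K Q * (e / 2) + 2 * B * \<alpha> ^ N)"
  proof (rule integral_mono)
  show "integrable (haarG d) (%Q. \<bar>K Q * (f Q - f P)\<bar>)"
  by (intro integrable_abs i bm_mult bm_diff bK bf) auto
  show "integrable (haarG d) (%Q. K Q * (e / 2) + 2 * B * \<alpha> ^ N)"
  by (intro i bm_add bm_mult bK) auto
  fix Q
  show "\<bar>K Q * (f Q - f P)\<bar> <= K Q * (e / 2) + 2 * B * \<alpha> ^ N"
  proof (cases "Q : Grass d")
  case Q: True
  have K0: "0 <= K Q" using kern_nonneg[OF c P Q] Q by (simp add: K_def)
  have \<alpha>N: "0 <= 2 * B * \<alpha> ^ N" using \<alpha> B by simp
  show ?thesis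
  proof (cases "dist Q P < \<delta>")
  case True
  then have "\<bar>f Q - f P\<bar> <= e / 2" using \<delta>0(2)[OF P Q] \<delta>(2) by (simp add: dist_real_def)
  then have "\<bar>K Q * (f Q - f P)\<bar> <= K Q * (e / 2)" unfolding abs_mult using K0 by (intro mult_mono) auto
  then show ?thesis using \<alpha>N by linarith
  next
  case False
  have "\<delta>\<^sup>2 <= (norm (P - Q))\<^sup>2" using False \<delta>(1) by (intro power_mono) (auto simp: dist_norm norm_minus_commute)
  then have "c + P \<bullet> Q <= \<alpha>" using Grass_inner_dist[OF P Q] nP by (simp add: \<alpha>_def)
  moreover have "0 <= c + P \<bullet> Q" using c inner_proj_nonneg[of P Q] P Q by (auto simp: Grass_oproj)
  ultimately have "K Q <= \<alpha> ^ N" using Q by (simp add: K_def kern_def power_mono)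
  moreover have "\<bar>f Q - f P\<bar> <= 2 * B" using B(2)[of Q] B(2)[of P] by linarith
  ultimately have "\<bar>K Q * (f Q - f P)\<bar> <= \<alpha> ^ N * (2 * B)"
  unfolding abs_mult using K0 \<alpha> by (intro mult_mono) auto
  then show ?thesis using K0 e by (simp add: mult.commute add_increasing)
  qed
  qed (use B \<alpha> in "simp add: K_def restr_def")
  qed
  also have "... = Z * (e / 2) + 2 * B * \<alpha> ^ N"
  proof -
  have "(LINT Q|(haarG d). K Q * (e / 2) + 2 * B * \<alpha> ^ N) = (LINT Q|(haarG d). K Q * (e / 2)) + (LINT Q|(haarG d :: 'n matr measure). 2 * B * \<alpha> ^ N)"
  by (rule Bochner_Integration.integral_add) (intro i bm_mult bK bm_const)+
  then show ?thesis using prob_space.prob_space[OF finite_haarG(3)[OF d(2)]] by (simp add: ZK)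
  qed
  also have "... < Z * (e / 2) + Z * (e / 2)"
  proof -
  have "2 * B * \<alpha> ^ N < p * \<beta> ^ N * (e / 2)"
  using N0[OF N] p(1) \<alpha> by (simp add: field_simps power_divide)
  also have "... <= Z * (e / 2)" using p(2)[of N] e unfolding Z_def by (intro mult_right_mono) auto
  finally show ?thesis by simp
  qed
  finally have "Z * \<bar>Top d c N f P - f P\<bar> < Z * e" using Zpos by (simp add: abs_mult)
  then show ?thesis using Zpos by simp
 qed
 then show ?thesis by blast
qed

section \<open>Zonal polynomial operators on the sphere\<close>

definition zker :: "(nat => real) => nat => ('n::finite) vect => 'n vect => real" where
 "zker b N x y = (SUM i<=N. b i * (x \<bullet> y) ^ (2 * i))"

definition Zon :: "(nat => real) => nat => (('n::finite) vect => real) => 'n vect => real" where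
 "Zon b N = kint Sph Sph haarS (zker b N)"

lemma continuous_zker [continuous_intros]:
 "continuous_on X f ==> continuous_on X g ==> continuous_on X (%x. zker b N (f x) (g x))"
 unfolding zker_def by (intro continuous_intros)

lemma zker_commute: "zker b N x y = zker b N y x"
 by (simp add: zker_def inner_commute)

lemma zker_nonneg: "(!!i. 0 <= b i) ==> 0 <= zker b N x y"
 unfolding zker_def by (intro sum_nonneg mult_nonneg_nonneg) (auto simp: power_mult)

lemma zker_cont: "continuous_on (X \<times> Y) (case_prod (zker b N))"
 unfolding case_prod_beta' by (intro continuous_intros)

lemma Zon_cont0: "bm f ==> cont0 Sph (Zon b N f)"
 unfolding Zon_def by (intro kint_cont0 compact_Sph zker_cont) auto

lemma Zon_eq: "x : Sph ==> cont0 Sph f ==> Zon b N f x = (LINT y|haarS. zker b N x y * f y)"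
 unfolding Zon_def by (rule kint_eq) (auto simp: cont0_def)

lemma Zon_selfadjoint: "bm f ==> bm g ==> (LINT x|haarS. g x * Zon b N f x) = (LINT x|haarS. f x * Zon b N g x)"
proof -
 assume "bm f" "bm g"
 moreover have "(%y x. zker b N x y) = zker b N" by (intro ext) (rule zker_commute)
 then have "kint Sph Sph haarS (%y x. zker b N x y) g = kint Sph Sph haarS (zker b N) g"
  by (rule arg_cong[where f = "%k. kint Sph Sph haarS k g"])
 ultimately show ?thesis
  unfolding Zon_def using kint_fubini[OF compact_Sph compact_Sph zker_cont, of f g haarS haarS b N] by simp
qed

lemma Zon_nonneg: fixes f :: "('n::finite) vect => real" assumes b: "!!i. 0 <= b i" and f: "!!x. x : Sph ==> 0 <= f x"
 shows "0 <= Zon b N f x"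
 unfolding Zon_def kint_def
proof (rule integral_nonneg_AE)
 show "AE y in haarS. 0 <= restr (Sph \<times> Sph) (case_prod (zker b N)) (x, y) * f y"
  using AE_haarS
 proof eventually_elim
  fix y :: "'n vect" assume "y : Sph"
  then have "0 <= zker b N x y * f y" using zker_nonneg[OF b] f by (intro mult_nonneg_nonneg)
  then show "0 <= restr (Sph \<times> Sph) (case_prod (zker b N)) (x, y) * f y" by (simp add: restr_def)
 qed
qed

lemma Zon_even: "Zon b N f (- x) = Zon b N f x"
proof -
 have "zker b N (- x) y = zker b N x y" for y by (simp add: zker_def)
 then have "restr (Sph \<times> Sph) (case_prod (zker b N)) (- x, y) = restr (Sph \<times> Sph) (case_prod (zker b N)) (x, y)" for y
  by (cases "x : Sph & y : Sph") (auto simp: restr_def Sph_norm)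
 then show ?thesis by (simp add: Zon_def kint_def)
qed

lemma Radon_Zon:
 assumes P: "P : Grass m" and m: "1 <= m" and f: "cont0 Sph f"
  and c: "!!y i. Radon m (restr Sph (%x. (x \<bullet> y) ^ (2 * i))) P = c i * norm (P *v y) ^ (2 * i)"
 shows "Radon m (Zon b N f) P = (LINT y|haarS. (SUM i<=N. b i * c i * norm (P *v y) ^ (2 * i)) * f y)"
proof -
 have bf: "bm f" using f by (rule bm_Sph)
 obtain e where e: "e : Sph" "P *v e = e" using Grass_unit[OF m P] .
 have bi: "bm (restr Sph (%x. (x \<bullet> y) ^ (2 * i)))" for y i
  by (rule bm_Sph) (intro cont0_restr continuous_intros)
 have *: "Radon m (restr Sph (%x. zker b N x y)) P = (SUM i<=N. b i * c i * norm (P *v y) ^ (2 * i))" for y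
 proof -
  have "restr Sph (%x. zker b N x y) = (%x. SUM i<=N. b i * restr Sph (%x. (x \<bullet> y) ^ (2 * i)) x)"
  by (auto simp: restr_def zker_def)
  then have "Radon m (restr Sph (%x. zker b N x y)) P
  = (LINT V|(haar P). (SUM i<=N. b i * restr Sph (%x. (x \<bullet> y) ^ (2 * i)) (V *v e)))"
  by (simp add: Radon_at[OF P e] bm_sum bm_cmult bi)
  also have "... = (SUM i<=N. b i * (LINT V|(haar P). restr Sph (%x. (x \<bullet> y) ^ (2 * i)) (V *v e)))"
  by (subst Bochner_Integration.integral_sum) (auto intro!: bm_integrable_haar bm_cmult bm_vec1 bi)
  also have "... = (SUM i<=N. b i * c i * norm (P *v y) ^ (2 * i))"
  by (simp add: Radon_at[OF P e bi, symmetric] c mult.assoc)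
  finally show ?thesis .
 qed
 have "Radon m (Zon b N f) P = (LINT y|haarS. Radon m (%x. restr (Sph \<times> Sph) (case_prod (zker b N)) (x, y)) P * f y)"
  unfolding Zon_def by (rule Radon_kint[OF compact_Sph zker_cont bf _ _ P m]) auto
 also have "... = (LINT y|haarS. (SUM i<=N. b i * c i * norm (P *v y) ^ (2 * i)) * f y)"
 proof (rule integral_eqI[OF refl])
  fix y
  show "Radon m (%x. restr (Sph \<times> Sph) (case_prod (zker b N)) (x, y)) P * f y
  = (SUM i<=N. b i * c i * norm (P *v y) ^ (2 * i)) * f y"
  proof (cases "y : Sph")
  case True
  then have "(%x. restr (Sph \<times> Sph) (case_prod (zker b N)) (x, y)) = restr Sph (%x. zker b N x y)"
  by (auto simp: restr_def)
  then show ?thesis using * by simp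
  qed (use f in "simp add: cont0_def")
 qed
 finally show ?thesis .
qed

text \<open>Both sides integrate \<open>f\<close> against a polynomial in the squared norm of
  \<open>P *v y\<close>: on the left the dual transform of the kernel, with coefficients
  \<open>a i\<close>, on the right the Radon transform of the zonal kernel, with coefficients
  \<open>b i * cm i\<close>. Equating them, up to the mass, determines \<open>b\<close>, and its
  signs come from those of \<open>a\<close>.\<close>

lemma Top_Radon:
 assumes d: "1 <= d" "d < CARD('n::finite)" and c: "0 <= c"
 shows "EX b. (ALL i. 0 <= b i) & (ALL f :: 'n vect => real. cont0 Sph f --> Top d c N (Radon d f) = Radon d (Zon b N f))"
proof -
 have d': "d <= CARD('n)" using d by simp
 obtain cm :: "nat => real" where cm: "!!i. cm i > 0"
  "!!P y i. P : Grass d ==> Radon d (restr Sph (%x. (x \<bullet> y) ^ (2 * i))) P = cm i * norm (P *v (y :: 'n vect)) ^ (2 * i)"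
 proof (rule Radon_moments[OF d(1) d'])
  fix c :: "nat => real"
  assume "!!i. c i > 0"
  "!!P y i. P : Grass d ==> Radon d (restr Sph (%x. (x \<bullet> y) ^ (2 * i))) P = c i * norm (P *v (y :: 'n vect)) ^ (2 * i)"
  then show thesis by (rule that)
 qed
 obtain a :: "nat => real" where a: "!!i. 0 <= a i"
  "!!P th. P : Grass d ==> th : Sph ==> Rdual d (restr (Grass d) (%Q. (c + P \<bullet> Q) ^ N)) th
  = (SUM i<=N. a i * norm (P *v (th :: 'n vect)) ^ (2 * i))"
 proof (rule Rdual_moments[OF d d(1) d' c, of N])
  fix a :: "nat => real"
  assume "!!i. 0 <= a i"
  "!!P th. P : Grass d ==> th : Sph ==> Rdual d (restr (Grass d) (%Q. (c + P \<bullet> Q) ^ N)) th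
  = (SUM i<=N. a i * norm (P *v (th :: 'n vect)) ^ (2 * i))"
  then show thesis by (rule that)
 qed
 define Z where "Z = kmass TYPE('n) d c N"
 obtain P0 :: "'n matr" where P0: "P0 : Grass d" using Grass_mono_ex[OF d'] by blast
 have Z: "Z > 0" unfolding Z_def by (rule kmass_pos[OF P0 d(1) c])
 define b where "b i = a i / (cm i * Z)" for i
 have "Top d c N (Radon d f) = Radon d (Zon b N f)" if f: "cont0 Sph f" for f :: "'n vect => real"
 proof (rule cont0_ext[where X = "Grass d"])
  have cR: "cont0 (Grass d) (Radon d f)" using Radon_cont0[OF d(1) f] .
  show "cont0 (Grass d) (Top d c N (Radon d f))" by (rule Top_cont0[OF d' bm_Grass[OF cR]])
  show "cont0 (Grass d) (Radon d (Zon b N f))" by (intro Radon_cont0 d Zon_cont0 bm_Sph[OF f])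
  fix P :: "'n matr" assume P: "P : Grass d"
  have "Top d c N (Radon d f) P * Z = (LINT Q|(haarG d). Radon d f Q * restr (Grass d) (kern c N P) Q)"
  using Z by (simp add: Top_eq[OF P cR] Z_def[symmetric] mult.commute)
  also have "... = (LINT x|haarS. f x * Rdual d (restr (Grass d) (kern c N P)) x)"
  by (rule Radon_duality[OF d(1) d' f]) (intro cont0_restr continuous_intros)
  also have "... = (LINT y|haarS. Z * ((SUM i<=N. b i * cm i * norm (P *v y) ^ (2 * i)) * f y))"
  proof (rule integral_eqI[OF refl])
  fix y
  show "f y * Rdual d (restr (Grass d) (kern c N P)) y = Z * ((SUM i<=N. b i * cm i * norm (P *v y) ^ (2 * i)) * f y)"
  proof (cases "y : Sph")
  case True
  have "b i * cm i = a i / Z" for i using cm(1)[of i] by (simp add: b_def)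
  then have "(SUM i<=N. b i * cm i * norm (P *v y) ^ (2 * i)) = (SUM i<=N. a i * norm (P *v y) ^ (2 * i)) / Z"
  by (simp add: sum_divide_distrib)
  then show ?thesis using a(2)[OF P True] Z by (simp add: kern_def[abs_def])
  qed (use f in "simp add: cont0_def")
  qed
  also have "... = Z * Radon d (Zon b N f) P"
  by (simp add: Radon_Zon[OF P d(1) f cm(2)[OF P]])
  finally show "Top d c N (Radon d f) P = Radon d (Zon b N f) P" using Z by simp
 qed
 moreover have "ALL i. 0 <= b i" using a(1) cm(1) Z by (auto simp: b_def less_imp_le)
 ultimately show ?thesis by blast
qed

lemma integrable_haarS [simp]: "bm f ==> integrable haarS f"
 by (rule bm_integrable) auto

lemma cont0_mult_left: "continuous_on X p ==> cont0 X f ==> cont0 X (%x. p x * f x)"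
 by (auto simp: cont0_def intro!: continuous_intros)

lemma cont0_Sph_rot: assumes "W : orth" "cont0 Sph h" shows "cont0 Sph (%y. h (W *v y))"
proof -
 have "continuous_on Sph (%y. h (W *v y))"
  by (rule continuous_on_compose2[of Sph h]) (use assms in "auto simp: cont0_def intro!: continuous_intros")
 then show ?thesis using assms by (auto simp: cont0_def)
qed

lemma zker_mult_cont0: "cont0 Sph h ==> cont0 Sph (%y. zker b N x y * h y)"
 by (rule cont0_mult_left) (auto intro!: continuous_intros)

lemma Zon_rot:
 assumes W: "W : orth" and x: "x : Sph" and h: "cont0 Sph h"
 shows "Zon b N h (W *v x) = Zon b N (%y. h (W *v y)) x"
proof -
 have "Zon b N h (W *v x) = (LINT y|haarS. zker b N (W *v x) y * h y)"
  using W x by (intro Zon_eq h) auto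
 also have "... = (LINT y|haarS. zker b N (W *v x) (W *v y) * h (W *v y))"
  by (rule haarS_invariant[OF W bm_Sph[OF zker_mult_cont0[OF h]], symmetric])
 also have "... = (LINT y|haarS. zker b N x y * h (W *v y))" using W by (simp add: zker_def)
 also have "... = Zon b N (%y. h (W *v y)) x" by (rule Zon_eq[OF x cont0_Sph_rot[OF W h], symmetric])
 finally show ?thesis .
qed

lemma Radon_const_fun: "1 <= m ==> Radon m (restr Sph (%x. c)) = restr (Grass m) (%P. c)"
proof
 fix P assume "1 <= m"
 then show "Radon m (restr Sph (%x. c)) P = restr (Grass m) (%P. c) P"
  using Radon_const[of P m c] by (cases "P : Grass m") (simp_all add: restr_def[of "Grass m"], simp add: Radon_def)
qed

lemma Top_const: fixes P :: "('n::finite) matr"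
 assumes "1 <= d" "0 <= c" "P : Grass d" shows "Top d c N (restr (Grass d) (%P. z)) P = z"
proof -
 have "(LINT Q|(haarG d). restr (Grass d) (kern c N P) Q * restr (Grass d) (%P. z) Q)
  = (LINT Q|(haarG d). restr (Grass d) (kern c N P) Q * z)"
  by (rule integral_eqI) (auto simp: restr_def)
 then show ?thesis
  using kmass_pos[OF assms(3,1,2), of N] by (simp add: Top_eq[OF assms(3) cont0_const] kmass_eq[OF assms(3)])
qed

text \<open>The image of a constant is rotation invariant, hence constant; its value is read off
  through \<open>Radon d\<close>, where the normalised smoothing operator preserves
  constants.\<close>

lemma Zon_const:
 assumes d: "1 <= d" "d < CARD('n::finite)" and c: "0 <= c"
  and TR: "!!f :: 'n vect => real. cont0 Sph f ==> Top d c N (Radon d f) = Radon d (Zon b N f)"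
  and x: "x : (Sph :: 'n vect set)"
 shows "Zon b N (restr Sph (%x. z)) x = z"
proof -
 define one where "one = restr (Sph :: 'n vect set) (%x. z)"
 have c1: "cont0 Sph one" unfolding one_def by (rule cont0_const)
 define ka where "ka = Zon b N one x"
 have "Zon b N one y = ka" if y: "y : Sph" for y
 proof -
  obtain W where W: "W : orth" "y = W *v x" using sphere_orbit[OF x] y by auto
  have "(%v. one (W *v v)) = one" using W by (auto simp: one_def restr_def)
  then show ?thesis using Zon_rot[OF W(1) x c1, of b N] W by (simp add: ka_def)
 qed
 then have "Zon b N one = restr Sph (%x. ka)"
  using Zon_cont0[OF bm_Sph[OF c1]] by (intro cont0_ext[OF _ cont0_const]) auto
 moreover obtain P :: "'n matr" where P: "P : Grass d" using Grass_mono_ex[of d, where 'n = 'n] d by auto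
 moreover have "Top d c N (Radon d one) P = z"
  unfolding one_def Radon_const_fun[OF d(1)] by (rule Top_const[OF d(1) c P])
 ultimately have "z = ka" using TR[OF c1] Radon_const[OF P d(1), of ka] by simp
 then show ?thesis by (simp add: ka_def one_def)
qed

lemma outer_square: "v \<bullet> (outer x x *v v) = (x \<bullet> v)\<^sup>2"
 by (simp add: power2_eq_square inner_commute)

text \<open>Concentration of the zonal kernels: averaging the second moment \<open>(x \<bullet> y)\<^sup>2\<close> over a subspace
  orthogonal to \<open>x\<close> turns the convergence of \<open>Top\<close> into the Korovkin condition.\<close>

lemma Zon_concentrates:
 assumes d: "1 <= d" "d < CARD('n::finite)" and c: "0 <= c"
  and TR: "!!N f. cont0 Sph (f :: 'n vect => real) ==> Top d c N (Radon d f) = Radon d (Zon (b N) N f)"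
 shows "\<exists>ep. ep \<longlonglongrightarrow> 0 & (ALL N. ALL x:(Sph :: 'n vect set). ALL y:Sph. x \<bullet> y = 0 -->
  Zon (b N) N (restr Sph (%v. (x \<bullet> v)\<^sup>2)) y = ep N)"
proof -
 have d': "d <= CARD('n)" using d by simp
 define x0 where "x0 = (axis undefined 1 :: 'n vect)"
 have x0: "x0 : Sph" unfolding x0_def by (rule Sph_axis)
 obtain P0 :: "'n matr" where P0: "P0 : Grass d" "P0 *v x0 = 0"
  using Grass_avoiding[OF d(2), of x0] x0 by (auto simp: Sph_norm)
 obtain e where e: "e : Sph" "P0 *v e = e" using Grass_unit[OF d(1) P0(1)] .
 have oP0: "oproj P0" using P0 by (simp add: Grass_oproj)
 have perp: "x0 \<bullet> y = 0" if "P0 *v y = y" for y using proj_inner[OF oP0, of x0 y] P0 that by simp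
 define h where "h x = restr Sph (%v. (x \<bullet> v)\<^sup>2)" for x :: "'n vect"
 have ch: "cont0 Sph (h x)" for x unfolding h_def by (intro cont0_restr continuous_intros)
 \<comment> \<open>The value at one orthogonal vector suffices: pairs of orthogonal unit vectors, up
   to sign of the first, form a single orbit.\<close>
 define ep where "ep N = Zon (b N) N (h x0) e" for N
 have inv: "Zon (b N) N (h x) y = ep N" if x: "x : Sph" and y: "y : Sph" and xy: "x \<bullet> y = 0" for N x y
 proof -
  have G: "outer x0 x0 : Grass 1" "outer x x : Grass 1" using outer_Grass[of x0] outer_Grass[of x] x0 x by (simp_all add: Sph_norm)
  obtain W where W: "W : orth" "rot W (outer x0 x0) = outer x x" "W *v e = y"
  by (rule Grass_pair_transitive[OF G, of e y]) (use e y xy perp[OF e(2)] in "auto simp: Sph_norm")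
  have "h x (W *v v) = h x0 v" for v
  proof -
  have "(x \<bullet> (W *v v))\<^sup>2 = (W *v v) \<bullet> (rot W (outer x0 x0) *v (W *v v))"
  unfolding W(2) by (simp only: outer_square)
  also have "... = v \<bullet> (outer x0 x0 *v v)" using W(1) by (simp del: outer_vec)
  finally have "(x \<bullet> (W *v v))\<^sup>2 = (x0 \<bullet> v)\<^sup>2" by (simp only: outer_square)
  then show ?thesis using W by (simp add: h_def restr_def)
  qed
  then show ?thesis using Zon_rot[OF W(1) e(1) ch, of "b N" N x] W by (simp add: ep_def)
 qed
 have bh: "bm (h x)" for x using ch by (rule bm_Sph)
 have VP: "P0 *v (V *v e) = V *v e" if V: "V : Stab P0" for V
 proof -
  have "P0 *v (V *v e) = V *v (P0 *v e)" using V by (simp add: mv_assoc Stab_def)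
  then show ?thesis using e by simp
 qed
 have R0: "Radon d (h x0) P0 = 0"
 proof -
  have "Radon d (h x0) P0 = (LINT V|(haar P0). h x0 (V *v e))" by (rule Radon_at[OF P0(1) e bh])
  also have "... = (LINT V|(haar P0). 0)"
  by (rule integral_cong_Stab[OF oP0]) (use e perp[OF VP] in "auto intro!: bm_vec1 bh bh[unfolded h_def] simp: h_def")
  finally show ?thesis by simp
 qed
 have RZ: "Radon d (Zon (b N) N (h x0)) P0 = ep N" for N
 proof -
  have bz: "bm (Zon (b N) N (h x0))" by (rule bm_Sph[OF Zon_cont0[OF bh]])
  have "Radon d (Zon (b N) N (h x0)) P0 = (LINT V|(haar P0). Zon (b N) N (h x0) (V *v e))"
  by (rule Radon_at[OF P0(1) e bz])
  also have "... = (LINT V|(haar P0). ep N)"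
  by (rule integral_cong_Stab[OF oP0])
  (use e inv[OF x0 _ perp[OF VP]] in "auto intro!: bm_vec1 bz")
  finally show ?thesis by simp
 qed
 have "ep \<longlonglongrightarrow> 0"
 proof (rule LIMSEQ_I)
  fix r :: real assume "0 < r"
  from Top_approximates[OF d(1) d' c Radon_cont0[OF d(1) ch] this]
  obtain N0 where "!!N. N \<ge> N0 ==> \<bar>Top d c N (Radon d (h x0)) P0 - Radon d (h x0) P0\<bar> < r"
  using P0 by blast
  then show "EX N0. ALL N>=N0. norm (ep N - 0) < r"
  using TR[OF ch] by (intro exI[of _ N0]) (simp add: R0 RZ)
 qed
 then show ?thesis using inv unfolding h_def by blast
qed

text \<open>Parseval in the hyperplane orthogonal to \<open>x\<close>: the Korovkin test function
  \<open>1 - (x \<bullet> y)\<^sup>2\<close> becomes a sum of second moments in directions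
  orthogonal to \<open>x\<close>, whose zonal averages at \<open>x\<close> are known.\<close>

lemma sphere_complement_squares:
 fixes x :: "('n::finite) vect" assumes x: "x : Sph"
 obtains B where "finite B" "card B <= CARD('n)" "!!v. v : B ==> v : Sph & v \<bullet> x = 0"
  "!!y. y : Sph ==> 1 - (x \<bullet> y)\<^sup>2 = (SUM v:B. (v \<bullet> y)\<^sup>2)"
proof (rule adapted_basis[OF outer_oproj[OF x]])
 fix b :: "nat => 'n vect" and c
 assume b: "!!i j. i < CARD('n) ==> j < CARD('n) ==> b i \<bullet> b j = (if i = j then 1 else 0)"
  "!!i. outer x x *v b i = (if c i then b i else 0)" "!!y. (SUM i<CARD('n). (b i \<bullet> y) *\<^sub>R b i) = y"
 have xx: "x \<bullet> x = 1" using x by (simp add: Sph_norm norm_eq_1)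
 define I where "I = {i. i < CARD('n) & \<not> c i}"
 have inj: "inj_on b I" unfolding inj_on_def I_def using b(1) by (metis (mono_tags, lifting) mem_Collect_eq zero_neq_one)
 have perp: "x \<bullet> b i = 0" if "i : I" for i
 proof -
  have "(x \<bullet> b i) *\<^sub>R x = 0" using b(2)[of i] that by (simp add: I_def)
  then show ?thesis using xx by auto
 qed
 show thesis
 proof (rule that[of "b ` I"])
  show "finite (b ` I)" by (simp add: I_def)
  have "card (b ` I) <= card I" by (rule card_image_le) (simp add: I_def)
  also have "... <= card {..<CARD('n)}" by (rule card_mono) (auto simp: I_def)
  finally show "card (b ` I) <= CARD('n)" by simp
  show "v : Sph & v \<bullet> x = 0" if "v : b ` I" for v
  using that b(1) perp by (auto simp: I_def Sph_norm norm_eq_1 inner_commute)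
  fix y :: "'n vect" assume y: "y : Sph"
  have "outer x x *v y = (SUM i<CARD('n). (b i \<bullet> y) *\<^sub>R (outer x x *v b i))"
  by (subst (1) b(3)[of y, symmetric])
  (simp only: linear_sum[OF matrix_vector_mul_linear] mv_scaleR)
  then have "y - outer x x *v y = (SUM i<CARD('n). (b i \<bullet> y) *\<^sub>R b i) - (SUM i<CARD('n). (b i \<bullet> y) *\<^sub>R (outer x x *v b i))"
  by (simp only: b(3))
  also have "... = (SUM i<CARD('n). if c i then 0 else (b i \<bullet> y) *\<^sub>R b i)"
  unfolding sum_subtractf[symmetric] by (rule sum.cong) (auto simp: b(2) simp del: outer_vec)
  also have "... = (SUM i:I. (b i \<bullet> y) *\<^sub>R b i)"
  unfolding I_def by (intro sum.mono_neutral_cong_right) auto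
  finally have "y \<bullet> (y - (x \<bullet> y) *\<^sub>R x) = y \<bullet> (SUM i:I. (b i \<bullet> y) *\<^sub>R b i)" by simp
  moreover have "y \<bullet> b i = b i \<bullet> y" "y \<bullet> x = x \<bullet> y" for i by (simp_all add: inner_commute)
  ultimately have "1 - (x \<bullet> y)\<^sup>2 = (SUM i:I. (b i \<bullet> y)\<^sup>2)"
  using y by (simp add: inner_diff_right inner_sum_right power2_eq_square Sph_norm norm_eq_1)
  then show "1 - (x \<bullet> y)\<^sup>2 = (SUM v:b ` I. (v \<bullet> y)\<^sup>2)"
  by (simp add: sum.reindex[OF inj])
 qed
qed

text \<open>The test function vanishes only at \<open>x\<close> and \<open>- x\<close>, and evenness
  lets both points count as near. Away from them it is bounded below by half the square of \<delta>,
  which determines \<open>C\<close>.\<close>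

lemma even_modulus:
 fixes f :: "('n::finite) vect => real"
 assumes f: "cont0 Sph f" "!!x. f (- x) = f x" and e: "0 < e"
 shows "EX C>=0. ALL x:Sph. ALL y:Sph. \<bar>f y - f x\<bar> <= e + C * (1 - (x \<bullet> y)\<^sup>2)"
proof -
 have "uniformly_continuous_on Sph f"
  using f compact_uniformly_continuous[OF _ compact_Sph] by (auto simp: cont0_def)
 then obtain \<delta> where \<delta>: "\<delta> > 0" "!!x y. x : Sph ==> y : Sph ==> dist y x < \<delta> ==> dist (f y) (f x) < e"
  unfolding uniformly_continuous_on_def using e by metis
 obtain B where B: "B > 0" "!!x. \<bar>f x\<bar> <= B" using bmE[OF bm_Sph[OF f(1)]] by blast
 define C where "C = 2 * B / (\<delta>\<^sup>2 / 2)"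
 have C: "C \<ge> 0" using B \<delta> by (simp add: C_def)
 have "\<bar>f y - f x\<bar> <= e + C * (1 - (x \<bullet> y)\<^sup>2)" if x: "x : Sph" and y: "y : Sph" for x y
 proof -
  have xx: "x \<bullet> x = 1" "y \<bullet> y = 1" using x y by (simp_all add: Sph_norm norm_eq_1)
  have cs: "\<bar>x \<bullet> y\<bar> <= 1" using Cauchy_Schwarz_ineq2[of x y] x y by (simp add: Sph_norm)
  then have "(x \<bullet> y)\<^sup>2 <= 1" by (metis abs_le_square_iff abs_one one_power2)
  then have C0: "0 <= C * (1 - (x \<bullet> y)\<^sup>2)" using C by simp
  show ?thesis
  proof (cases "dist y x < \<delta> \<or> dist y (- x) < \<delta>")
  case True
  then have "\<bar>f y - f x\<bar> < e"
  proof
  assume "dist y (- x) < \<delta>"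
  moreover have "- x : Sph" using x by (simp add: Sph_norm)
  ultimately show ?thesis using \<delta>(2)[of "- x" y] y f(2)[of x] by (simp add: dist_real_def)
  qed (use \<delta>(2)[OF x y] in "simp add: dist_real_def")
  then show ?thesis using C0 by linarith
  next
  case False
  then have "\<delta>\<^sup>2 <= (dist y x)\<^sup>2" "\<delta>\<^sup>2 <= (dist y (- x))\<^sup>2" using \<delta>(1) by (auto intro!: power_mono)
  moreover have "(dist y x)\<^sup>2 = 2 - 2 * (x \<bullet> y)" "(dist y (- x))\<^sup>2 = 2 + 2 * (x \<bullet> y)"
  by (simp_all add: dist_norm power2_norm_eq_inner inner_diff_left inner_diff_right inner_add_left inner_add_right
  xx inner_commute)
  ultimately have a: "\<bar>x \<bullet> y\<bar> <= 1 - \<delta>\<^sup>2 / 2" by linarith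
  have "(x \<bullet> y)\<^sup>2 = \<bar>x \<bullet> y\<bar> * \<bar>x \<bullet> y\<bar>" by (simp add: power2_eq_square)
  also have "... <= \<bar>x \<bullet> y\<bar> * 1" using cs by (intro mult_left_mono) auto
  finally have "\<delta>\<^sup>2 / 2 <= 1 - (x \<bullet> y)\<^sup>2" using a by linarith
  then have "C * (\<delta>\<^sup>2 / 2) <= C * (1 - (x \<bullet> y)\<^sup>2)" using C by (rule mult_left_mono)
  moreover have "C * (\<delta>\<^sup>2 / 2) = 2 * B" using \<delta> by (simp add: C_def)
  moreover have "\<bar>f y - f x\<bar> <= 2 * B" using B(2)[of x] B(2)[of y] by linarith
  ultimately show ?thesis using e by linarith
  qed
 qed
 then show ?thesis using C by blast
qed

text \<open>Korovkin's argument: the kernel is non-negative with unit mass, so the error at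
  \<open>x\<close> is at most \<open>e / 2\<close> plus \<open>C\<close> times the zonal average of
  the test function, which is \<open>card B * ep N\<close> and tends to zero uniformly in
  \<open>x\<close>.\<close>

lemma Zon_approximates:
 fixes f :: "('n::finite) vect => real"
 assumes d: "1 <= d" "d < CARD('n)" and c: "0 <= c" and b: "!!N i. 0 <= b N i"
  and TR: "!!N f. cont0 Sph (f :: 'n vect => real) ==> Top d c N (Radon d f) = Radon d (Zon (b N) N f)"
  and f: "cont0 Sph f" "!!x. f (- x) = f x" and e: "0 < e"
 shows "EX N0. ALL N>=N0. ALL x:Sph. \<bar>Zon (b N) N f x - f x\<bar> < e"
proof -
 obtain ep where ep: "ep \<longlonglongrightarrow> 0" "!!N x y. x : Sph ==> y : Sph ==> x \<bullet> y = 0 ==>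
  Zon (b N) N (restr Sph (%v. (x \<bullet> v)\<^sup>2)) (y :: 'n vect) = ep N"
  using Zon_concentrates[OF d c TR] by blast
 obtain C where C: "C \<ge> 0" "!!x y. x : Sph ==> y : Sph ==> \<bar>f y - f x\<bar> <= e / 2 + C * (1 - (x \<bullet> y)\<^sup>2)"
  using even_modulus[OF f, of "e / 2"] e by auto
 have "(%N. C * real CARD('n) * \<bar>ep N\<bar>) \<longlonglongrightarrow> C * real CARD('n) * \<bar>0\<bar>"
  by (intro tendsto_intros ep(1))
 then have "eventually (%N. C * real CARD('n) * \<bar>ep N\<bar> < e / 2) sequentially"
  using e by (intro order_tendstoD(2)) auto
 then obtain N0 where N0: "!!N. N \<ge> N0 ==> C * real CARD('n) * \<bar>ep N\<bar> < e / 2"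
  by (auto simp: eventually_sequentially)
 have bf: "bm f" using f(1) by (rule bm_Sph)
 have "\<bar>Zon (b N) N f x - f x\<bar> < e" if N: "N \<ge> N0" and x: "x : Sph" for N x
 proof -
  define K where "K = (%y. restr Sph (zker (b N) N x) y)"
  have cK: "cont0 Sph K" unfolding K_def by (intro cont0_restr continuous_intros)
  have bK: "bm K" using cK by (rule bm_Sph)
  have K0: "0 <= K y" for y using zker_nonneg[of "b N" N x y, OF b] by (simp add: K_def restr_def)
  have ZK: "Zon (b N) N g x = (LINT y|haarS. K y * g y)" if "cont0 Sph g" for g
  unfolding Zon_eq[OF x that] using that
  by (intro integral_eqI) (auto simp: K_def restr_def cont0_def)
  have K1: "(LINT y|haarS. K y * z) = z" for z
  proof -
  have "(LINT y|haarS. K y * z) = (LINT y|haarS. K y * restr Sph (%x. z) y)"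
  by (intro integral_eqI) (auto simp: K_def restr_def)
  then show ?thesis using ZK[OF cont0_const, of z] Zon_const[OF d c TR x, of N z] by simp
  qed
  obtain B where B: "finite B" "card B <= CARD('n)" "!!v. v : B ==> v : Sph & v \<bullet> x = 0"
  "!!y. y : Sph ==> 1 - (x \<bullet> y)\<^sup>2 = (SUM v:B. (v \<bullet> y)\<^sup>2)"
  proof (rule sphere_complement_squares[OF x])
  fix B :: "'n vect set" assume "finite B" "card B <= CARD('n)" "!!v. v : B ==> v : Sph & v \<bullet> x = 0"
  "!!y. y : Sph ==> 1 - (x \<bullet> y)\<^sup>2 = (SUM v:B. (v \<bullet> y)\<^sup>2)"
  then show thesis by (rule that)
  qed
  define S2 where "S2 y = (SUM v:B. restr Sph (%y. (v \<bullet> y)\<^sup>2) y)" for y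
  have cv: "cont0 Sph (restr Sph (%y. (v \<bullet> y)\<^sup>2))" for v :: "'n vect" by (intro cont0_restr continuous_intros)
  have bS2: "bm S2" unfolding S2_def by (intro bm_sum bm_Sph cv)
  have IS: "(LINT y|haarS. K y * S2 y) = card B * ep N"
  proof -
  have "(LINT y|haarS. K y * S2 y) = (SUM v:B. \<integral>y. K y * restr Sph (%y. (v \<bullet> y)\<^sup>2) y \<partial>haarS)"
  unfolding S2_def sum_distrib_left
  by (rule Bochner_Integration.integral_sum) (intro integrable_haarS bm_mult bK bm_Sph cv)
  also have "... = (SUM v:B. ep N)"
  by (rule sum.cong) (use B(3) ep(2) x in "auto simp: ZK[OF cv, symmetric]")
  finally show ?thesis by simp
  qed
  have "Zon (b N) N f x - f x = (LINT y|haarS. K y * f y) - (LINT y|haarS. K y * f x)"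
  by (simp only: ZK[OF f(1)] K1)
  also have "... = (LINT y|haarS. K y * f y - K y * f x)"
  by (rule Bochner_Integration.integral_diff[symmetric]) (intro integrable_haarS bm_mult bK bf bm_const)+
  finally have "\<bar>Zon (b N) N f x - f x\<bar> = \<bar>\<integral>y. K y * (f y - f x) \<partial>haarS\<bar>" by (simp add: right_diff_distrib)
  also have "... <= (LINT y|haarS. \<bar>K y * (f y - f x)\<bar>)" by (rule integral_abs_bound)
  also have "... <= (LINT y|haarS. K y * (e / 2) + C * (K y * S2 y))"
  proof (rule integral_mono)
  show "integrable haarS (%y. \<bar>K y * (f y - f x)\<bar>)"
  by (intro integrable_abs integrable_haarS bm_mult bm_diff bK bf bm_const)
  show "integrable haarS (%y. K y * (e / 2) + C * (K y * S2 y))"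
  by (intro integrable_haarS bm_add bm_mult bK bS2 bm_const)
  fix y
  show "\<bar>K y * (f y - f x)\<bar> <= K y * (e / 2) + C * (K y * S2 y)"
  proof (cases "y : Sph")
  case True
  have "K y * \<bar>f y - f x\<bar> <= K y * (e / 2 + C * S2 y)"
  using C(2)[OF x True] B(4)[OF True] True by (intro mult_left_mono K0) (simp add: S2_def)
  moreover have "\<bar>K y * (f y - f x)\<bar> = K y * \<bar>f y - f x\<bar>" using K0[of y] by (simp only: abs_mult abs_of_nonneg)
  ultimately show ?thesis by (simp only: distrib_left mult.left_commute)
  qed (simp add: K_def restr_def)
  qed
  also have "... = (LINT y|haarS. K y * (e / 2)) + (LINT y|haarS. C * (K y * S2 y))"
  by (rule Bochner_Integration.integral_add) (intro integrable_haarS bm_mult bK bS2 bm_const)+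
  also have "... = e / 2 + C * (card B * ep N)" by (simp only: K1 IS Bochner_Integration.integral_mult_right_zero)
  also have "... <= e / 2 + C * real CARD('n) * \<bar>ep N\<bar>"
  proof -
  have "card B * ep N <= real (card B) * \<bar>ep N\<bar>" by (intro mult_left_mono) auto
  also have "... <= real CARD('n) * \<bar>ep N\<bar>" using B(2) by (intro mult_right_mono) auto
  finally show ?thesis using C(1) by (simp add: mult.assoc mult_left_mono)
  qed
  also have "... < e" using N0[OF N] by simp
  finally show ?thesis .
 qed
 then show ?thesis by blast
qed

section \<open>Smooth functions\<close>

lemma real_polynomial_dirder1:
 fixes f :: "'a::euclidean_space => real"
 assumes "real_polynomial_function f"
 shows "EX f'. real_polynomial_function f' & (ALL x. ((%t. f (x + t *\<^sub>R v)) has_real_derivative f' x) (at 0))"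
 using assms
proof (induction rule: real_polynomial_function.induct)
 case (linear f)
 interpret bounded_linear f by fact
 have "((%t. f (x + t *\<^sub>R v)) has_real_derivative f v) (at 0)" for x
  by (auto simp: add scaleR intro!: derivative_eq_intros)
 then show ?case by (intro exI[of _ "%x. f v"]) (auto intro: real_polynomial_function.intros(2))
next
 case (const c)
 show ?case by (intro exI[of _ "%x. 0"]) (auto intro: real_polynomial_function.intros(2))
next
 case (add f g)
 then obtain f' g' where "real_polynomial_function f'" "real_polynomial_function g'"
  "!!x. ((%t. f (x + t *\<^sub>R v)) has_real_derivative f' x) (at 0)"
  "!!x. ((%t. g (x + t *\<^sub>R v)) has_real_derivative g' x) (at 0)" by blast
 then show ?case
  by (intro exI[of _ "%x. f' x + g' x"]) (auto intro!: derivative_eq_intros real_polynomial_function.intros(3))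
next
 case (mult f g)
 then obtain f' g' where *: "real_polynomial_function f'" "real_polynomial_function g'"
  "!!x. ((%t. f (x + t *\<^sub>R v)) has_real_derivative f' x) (at 0)"
  "!!x. ((%t. g (x + t *\<^sub>R v)) has_real_derivative g' x) (at 0)" by blast
 have "((%t. f (x + t *\<^sub>R v) * g (x + t *\<^sub>R v)) has_real_derivative f' x * g x + g' x * f x) (at 0)" for x
  using DERIV_mult[OF *(3)[of x] *(4)[of x]] by simp
 then show ?case using * mult
  by (intro exI[of _ "%x. f' x * g x + g' x * f x"])
  (auto intro!: real_polynomial_function.intros(3) real_polynomial_function.intros(4))
qed

lemma real_polynomial_dirder:
 fixes f :: "'a::euclidean_space => real"
 assumes "real_polynomial_function f" shows "real_polynomial_function (dirder vs f)"
proof (induction vs)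
 case (Cons v vs)
 obtain f' where "real_polynomial_function f'"
  "!!x. ((%t. dirder vs f (x + t *\<^sub>R v)) has_real_derivative f' x) (at 0)"
  using real_polynomial_dirder1[OF Cons] by blast
 moreover from this have "dirder (v # vs) f = f'" by (auto simp: fun_eq_iff intro: DERIV_imp_deriv)
 ultimately show ?case by simp
qed (use assms in simp)

lemma real_polynomial_smooth:
 fixes f :: "'a::euclidean_space => real"
 assumes "real_polynomial_function f" shows "smooth f"
 unfolding smooth_def
proof (intro allI conjI)
 fix vs :: "'a list"
 have p: "real_polynomial_function (dirder vs f)" by (rule real_polynomial_dirder[OF assms])
 show "continuous_on UNIV (dirder vs f)"
  using continuous_real_polymonial_function[OF p] by (simp add: continuous_at_imp_continuous_on)
 show "(%t. dirder vs f (x + t *\<^sub>R v)) differentiable (at 0)" for v x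
  using real_polynomial_dirder1[OF p, of v] by (auto simp: real_differentiable_def)
qed

lemma dirder_linear:
 assumes "smooth f" "smooth g"
 shows "dirder vs (%x. a * f x + b * g x) = (%x. a * dirder vs f x + b * dirder vs g x)"
proof (induction vs)
 case (Cons v vs)
 show ?case
 proof
  fix x
  have "((%t. dirder vs h (x + t *\<^sub>R v)) has_real_derivative dirder (v # vs) h x) (at 0)" if "smooth h" for h
  using that by (auto simp: smooth_def real_differentiable_def DERIV_deriv_iff_real_differentiable)
  from DERIV_add[OF DERIV_cmult[OF this[OF assms(1)]] DERIV_cmult[OF this[OF assms(2)]]]
  show "dirder (v # vs) (%x. a * f x + b * g x) x = a * dirder (v # vs) f x + b * dirder (v # vs) g x"
  by (simp only: dirder.simps(2) Cons) (rule DERIV_imp_deriv, simp)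
 qed
qed simp

lemma smooth_linear:
 assumes fg: "smooth f" "smooth g" shows "smooth (%x. a * f x + b * g x)"
proof -
 have "continuous_on UNIV (dirder vs f)" "continuous_on UNIV (dirder vs g)"
  "(%t. dirder vs f (x + t *\<^sub>R v)) differentiable (at 0)"
  "(%t. dirder vs g (x + t *\<^sub>R v)) differentiable (at 0)" for vs v x
  using fg by (auto simp: smooth_def)
 then show ?thesis
  unfolding smooth_def dirder_linear[OF fg]
  by (intro allI conjI continuous_intros differentiable_add differentiable_mult differentiable_const) auto
qed

lemma CinfG_cont0: assumes "g : CinfG m" shows "cont0 (Grass m) g"
proof -
 obtain h where h: "smooth h" "ALL P:Grass m. g P = h P" "ALL P. P \<notin> Grass m --> g P = 0"
  using assms by (auto simp: CinfG_def)
 have "continuous_on UNIV (dirder [] h)" using h(1) unfolding smooth_def by blast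
 then have "continuous_on (Grass m) h" using continuous_on_subset[of UNIV h "Grass m"] by simp
 then show ?thesis using h by (simp add: cont0_def cong: continuous_on_cong)
qed

lemma CinfG_linear: assumes "f : CinfG m" "g : CinfG m" shows "(%P. a * f P + b * g P) : CinfG m"
proof -
 obtain h1 h2 where "smooth h1" "ALL P:Grass m. f P = h1 P" "smooth h2" "ALL P:Grass m. g P = h2 P"
  using assms by (auto simp: CinfG_def)
 then show ?thesis using assms
  by (auto simp: CinfG_def intro!: exI[of _ "%P. a * h1 P + b * h2 P"] smooth_linear)
qed

lemma CinfG_poly: "real_polynomial_function h ==> restr (Grass m) h : CinfG m"
 by (auto simp: CinfG_def restr_def intro!: exI[of _ h] real_polynomial_smooth)

lemma CinfG_const: "restr (Grass m) (%P. c) : CinfG m"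
 by (rule CinfG_poly) (rule real_polynomial_function.intros(2))

text \<open>Expanding one factor \<open>c + A y \<bullet> Q\<close> in coordinates lowers the power
  and moves \<open>A y \<bullet> b\<close> into the density; the induction therefore generalises
  over \<open>u\<close>.\<close>

lemma real_polynomial_integral:
 fixes A :: "'b::second_countable_topology => 'a::euclidean_space"
 assumes M: "finite_measure M" "sets M = sets borel" and A: "!!b. b : Basis ==> bm (%y. A y \<bullet> b)" and u: "bm u"
 shows "real_polynomial_function (%Q. \<integral>y. (c + A y \<bullet> Q) ^ j * u y \<partial>M)"
 using u
proof (induction j arbitrary: u)
 case 0
 then show ?case by (simp add: real_polynomial_function.intros(2))
next
 case (Suc j)
 have AQ: "A y \<bullet> Q = (SUM b:Basis. (Q \<bullet> b) * (A y \<bullet> b))" for y Q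
  by (subst euclidean_inner) (simp add: mult.commute)
 have bA: "bm (%y. A y \<bullet> Q)" for Q
 proof -
  have e: "(%y. A y \<bullet> Q) = (%y. SUM b:Basis. (Q \<bullet> b) * (A y \<bullet> b))" by (rule ext) (rule AQ)
  have "bm (%y. SUM b:Basis. (Q \<bullet> b) * (A y \<bullet> b))" by (intro bm_sum bm_cmult A)
  then show ?thesis by (subst e)
 qed
 have bb: "bm (%y. (c + A y \<bullet> Q) ^ j * v y)" if "bm v" for Q v
  by (intro bm_mult bm_power bm_add bm_const bA that)
 have int: "integrable M v" if "bm v" for v by (rule bm_integrable[OF M that])
 have "(LINT y|M. (c + A y \<bullet> Q) ^ Suc j * u y)
  = c * (LINT y|M. (c + A y \<bullet> Q) ^ j * u y) + (SUM b:Basis. (Q \<bullet> b) * (LINT y|M. (c + A y \<bullet> Q) ^ j * ((A y \<bullet> b) * u y)))" for Q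
 proof -
  have "(LINT y|M. (c + A y \<bullet> Q) ^ Suc j * u y)
  = (LINT y|M. c * ((c + A y \<bullet> Q) ^ j * u y) + (SUM b:Basis. (Q \<bullet> b) * ((c + A y \<bullet> Q) ^ j * ((A y \<bullet> b) * u y))))"
  proof (rule integral_eqI[OF refl])
  fix y
  have "(c + A y \<bullet> Q) ^ Suc j * u y = c * ((c + A y \<bullet> Q) ^ j * u y) + (A y \<bullet> Q) * ((c + A y \<bullet> Q) ^ j * u y)"
  by (simp add: algebra_simps)
  also have "(A y \<bullet> Q) * ((c + A y \<bullet> Q) ^ j * u y)
  = (SUM b:Basis. (Q \<bullet> b) * ((c + A y \<bullet> Q) ^ j * ((A y \<bullet> b) * u y)))"
  by (subst (1) AQ) (simp add: sum_distrib_right sum_distrib_left mult_ac)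
  finally show "(c + A y \<bullet> Q) ^ Suc j * u y = c * ((c + A y \<bullet> Q) ^ j * u y)
  + (SUM b:Basis. (Q \<bullet> b) * ((c + A y \<bullet> Q) ^ j * ((A y \<bullet> b) * u y)))" .
  qed
  also have "... = (LINT y|M. c * ((c + A y \<bullet> Q) ^ j * u y))
  + (LINT y|M. (SUM b:Basis. (Q \<bullet> b) * ((c + A y \<bullet> Q) ^ j * ((A y \<bullet> b) * u y))))"
  by (intro Bochner_Integration.integral_add int bm_sum bm_cmult bb bm_mult A Suc.prems)
  also have "(LINT y|M. (SUM b:Basis. (Q \<bullet> b) * ((c + A y \<bullet> Q) ^ j * ((A y \<bullet> b) * u y))))
  = (SUM b:Basis. \<integral>y. (Q \<bullet> b) * ((c + A y \<bullet> Q) ^ j * ((A y \<bullet> b) * u y)) \<partial>M)"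
  by (intro Bochner_Integration.integral_sum int bm_cmult bb bm_mult A Suc.prems)
  finally show ?thesis by simp
 qed
 moreover have "real_polynomial_function (%Q. c * (LINT y|M. (c + A y \<bullet> Q) ^ j * u y)
  + (SUM b:Basis. (Q \<bullet> b) * (LINT y|M. (c + A y \<bullet> Q) ^ j * ((A y \<bullet> b) * u y))))"
  by (intro real_polynomial_function.intros(3) real_polynomial_function.intros(4) real_polynomial_function.intros(2)
  real_polynomial_function_sum Suc.IH Suc.prems bm_mult A real_polynomial_function.intros(1)
  bounded_linear_inner_left) auto
 ultimately show ?case by simp
qed

lemma kint_poly_CinfG:
 fixes Y :: "'b::euclidean_space set" and A :: "'b => ('n::finite) matr"
 assumes M: "finite_measure M" "sets M = sets borel" and Y: "compact Y" "continuous_on Y A"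
  and u: "cont0 Y u \<or> (bm u & (AE y in M. y : Y))"
 shows "kint (Grass m) Y M (%Q y. (c + A y \<bullet> Q) ^ j / z) u : CinfG m"
proof -
 define A0 where "A0 y = (if y : Y then A y else 0)" for y
 define u0 where "u0 = restr Y u"
 have bA: "bm (%y. A0 y \<bullet> b)" for b
 proof -
  have "(%y. A0 y \<bullet> b) = restr Y (%y. A y \<bullet> b)" by (auto simp: A0_def restr_def)
  then show ?thesis using cont0_bm[OF Y(1) cont0_restr[of Y "%y. A y \<bullet> b"]] Y(2)
  by (simp add: continuous_on_inner)
 qed
 have bu: "bm u0"
 proof -
  have "bm u" using u cont0_bm[OF Y(1)] by blast
  moreover have "u0 = (%y. indicator Y y * u y)" by (auto simp: u0_def restr_def indicator_def)
  moreover have "Y : sets borel" using Y(1) by (simp add: borel_compact)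
  ultimately show ?thesis by (simp add: bm_mult bm_indicator)
 qed
 have "kint (Grass m) Y M (%Q y. (c + A y \<bullet> Q) ^ j / z) u
  = restr (Grass m) (%Q. (LINT y|M. (c + A0 y \<bullet> Q) ^ j * u0 y) * (1 / z))"
 proof
  fix Q
  show "kint (Grass m) Y M (%Q y. (c + A y \<bullet> Q) ^ j / z) u Q
  = restr (Grass m) (%Q. (LINT y|M. (c + A0 y \<bullet> Q) ^ j * u0 y) * (1 / z)) Q"
  proof (cases "Q : Grass m")
  case True
  have "kint (Grass m) Y M (%Q y. (c + A y \<bullet> Q) ^ j / z) u Q
  = (LINT y|M. ((c + A0 y \<bullet> Q) ^ j * u0 y) * (1 / z))"
  unfolding kint_def
  by (rule integral_eqI) (use True in "auto simp: restr_def A0_def u0_def")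
  then show ?thesis using True by simp
  qed (simp add: kint_def restr_def)
 qed
 moreover have "real_polynomial_function (%Q. (LINT y|M. (c + A0 y \<bullet> Q) ^ j * u0 y) * (1 / z))"
  by (intro real_polynomial_function.intros(4) real_polynomial_function.intros(2) real_polynomial_integral M bA bu)
 ultimately show ?thesis by (simp add: CinfG_poly)
qed

lemma Top_CinfG: fixes f :: "('n::finite) matr => real"
 assumes "d <= CARD('n)" "cont0 (Grass d) f" shows "Top d c N f : CinfG d"
proof -
 have "kint (Grass d) (Grass d) (haarG d) (%Q y. (c + y \<bullet> Q) ^ N / kmass TYPE('n) d c N) f : CinfG d"
  using assms by (intro kint_poly_CinfG finite_haarG compact_Grass) (auto intro: continuous_intros)
 then show ?thesis by (simp add: Top_def kern_def inner_commute)
qed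

section \<open>Smoothing under orthogonal complements\<close>

lemma inner_mat1_proj: "oproj P ==> mat 1 \<bullet> P = (norm P)\<^sup>2" for P :: "('n::finite) matr"
 using inner_proj[OF proj_mat1, of P] by simp

lemma inner_perp: fixes P Q :: "('n::finite) matr"
 assumes P: "P : Grass d" and Q: "Q : Grass d"
 shows "perpP P \<bullet> perpP Q = real CARD('n) - 2 * (norm P)\<^sup>2 + P \<bullet> Q"
proof -
 have n1: "(mat 1 :: 'n matr) \<bullet> mat 1 = CARD('n)"
  by (simp add: inner_vec_def mat_def if_distrib cong: if_cong)
 have "mat 1 \<bullet> P = (norm P)\<^sup>2" "mat 1 \<bullet> Q = (norm P)\<^sup>2"
  using inner_mat1_proj[OF Grass_oproj[OF P]] inner_mat1_proj[OF Grass_oproj[OF Q]] Grass_norm[OF P Q] by auto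
 then show ?thesis
  using inner_commute[of P "mat 1"] by (simp add: perpP_def inner_diff_left inner_diff_right n1)
qed

text \<open>Complementation carries the kernel with shift \<open>CARD('n)\<close> to the kernel on
  G(n,k) with shift \<open>2 * (norm P0)\<^sup>2\<close>, a constant since projections of one rank
  have the same norm.\<close>

lemma Top_Iop: fixes f :: "('n::finite) matr => real"
 assumes mk: "m + k = CARD('n)" "1 <= m" "1 <= k" and f: "cont0 (Grass k) f" and P0: "P0 : Grass m"
 shows "Top m (real CARD('n)) N (Iop m f) = Iop m (Top k (2 * (norm (P0 :: 'n matr))\<^sup>2) N f)"
proof -
 let ?c = "real CARD('n)" and ?c' = "2 * (norm P0)\<^sup>2"
 have km: "k <= CARD('n)" "m <= CARD('n)" using mk by auto
 have kp: "kern ?c N P Q = kern ?c' N (perpP P) (perpP Q)" if "P : Grass m" "Q : Grass m" for P Q :: "'n matr"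
  using inner_perp[OF that] Grass_norm[OF that(1) P0] by (simp add: kern_def algebra_simps)
 have int: "(LINT Q|(haarG m). restr (Grass m) (kern ?c N P) Q * Iop m g Q)
  = (LINT Q|(haarG k). restr (Grass k) (kern ?c' N (perpP P)) Q * g Q)"
  if P: "P : Grass m" and g: "cont0 (Grass k) g" for P :: "'n matr" and g
 proof -
  have "(%Q. restr (Grass m) (kern ?c N P) Q * Iop m g Q) = Iop m (%Q. restr (Grass k) (kern ?c' N (perpP P)) Q * g Q)"
  using kp[OF P] perp_Grass[OF mk(1)] by (auto simp: restr_def Iop_def fun_eq_iff)
  then show ?thesis
  using integral_Iop[OF mk(1), of "%Q. restr (Grass k) (kern ?c' N (perpP P)) Q * g Q"]
  by (simp add: cont0_mult cont0_restr continuous_kern g)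
 qed
 have mass: "kmass TYPE('n) m ?c N = kmass TYPE('n) k ?c' N"
 proof -
  have P0': "perpP P0 : Grass k" using P0 perp_Grass[OF mk(1)] by blast
  have 1: "(%Q. restr (Grass m) (kern ?c N P0) Q * Iop m (restr (Grass k) (%_. 1)) Q) = restr (Grass m) (kern ?c N P0)"
  using perp_Grass[OF mk(1)] by (auto simp: restr_def Iop_def fun_eq_iff)
  have 2: "(%Q. restr (Grass k) (kern ?c' N (perpP P0)) Q * restr (Grass k) (%_. 1) Q) = restr (Grass k) (kern ?c' N (perpP P0))"
  by (auto simp: restr_def)
  show ?thesis using int[OF P0 cont0_const[of "Grass k" 1]] kmass_eq[OF P0] kmass_eq[OF P0']
  by (simp only: 1 2)
 qed
 show ?thesis
 proof (rule cont0_ext[where X = "Grass m"])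
  have cI: "cont0 (Grass m) (Iop m f)" by (rule Iop_cont0[OF mk(1) f])
  show "cont0 (Grass m) (Top m ?c N (Iop m f))" by (rule Top_cont0[OF km(2) bm_Grass[OF cI]])
  show "cont0 (Grass m) (Iop m (Top k ?c' N f))" by (rule Iop_cont0[OF mk(1) Top_cont0[OF km(1) bm_Grass[OF f]]])
  fix P :: "'n matr" assume P: "P : Grass m"
  then have P': "perpP P : Grass k" using perp_Grass[OF mk(1)] by blast
  show "Top m ?c N (Iop m f) P = Iop m (Top k ?c' N f) P"
  using P by (simp add: Top_eq[OF P cI] Iop_def[of m "Top k ?c' N f"] Top_eq[OF P' f] int[OF P f] mass)
 qed
qed

text \<open>The smoothing operators on \<open>G(n,m)\<close> are intertwined with approximate identities on the sphere
  by both \<open>R\<^sub>m\<close> and \<open>I \<circ> R\<^sub>k\<close>.\<close>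

locale radon_smoothing =
 fixes m k :: nat and b b' :: "nat => nat => real" and ty :: "'n::finite itself"
 assumes mk: "m + k = CARD('n)" "1 <= m" "1 <= k"
  and b: "0 <= b N i" and b': "0 <= b' N i"
  and Top_Radon_m: "cont0 Sph (f :: 'n vect => real) ==>
  Top m (real CARD('n)) N (Radon m f) = Radon m (Zon (b N) N f)"
  and Top_Radon_k: "cont0 Sph (f :: 'n vect => real) ==>
  Top m (real CARD('n)) N (Iop m (Radon k f)) = Iop m (Radon k (Zon (b' N) N f))"
  and Zon_tendsto: "cont0 Sph (f :: 'n vect => real) ==> (!!x. f (- x) = f x) ==> 0 < e ==>
  EX N0. ALL N>=N0. ALL x:Sph. \<bar>Zon (b N) N f x - f x\<bar> < e"
  and Zon_tendsto': "cont0 Sph (f :: 'n vect => real) ==> (!!x. f (- x) = f x) ==> 0 < e ==>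
  EX N0. ALL N>=N0. ALL x:Sph. \<bar>Zon (b' N) N f x - f x\<bar> < e"

lemma smoothing_families:
 assumes mk: "m + k = CARD('n::finite)" "1 <= m" "1 <= k"
 shows "EX b b'. radon_smoothing TYPE('n) m k b b'"
proof -
 let ?c = "real CARD('n)"
 have mn: "m < CARD('n)" "k < CARD('n)" using mk by auto
 obtain P0 :: "'n matr" where P0: "P0 : Grass m" using Grass_mono_ex[of m, where 'n = 'n] mn by auto
 let ?c' = "2 * (norm P0)\<^sup>2"
 have c: "0 <= ?c" "0 <= ?c'" by auto
 have "ALL N. EX b. (ALL i. 0 <= b i) & (ALL f :: 'n vect => real. cont0 Sph f --> Top m ?c N (Radon m f) = Radon m (Zon b N f))"
  using Top_Radon[OF mk(2) mn(1) c(1)] by blast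
 then obtain b where b: "!!N i. 0 <= b N i"
  "!!N f. cont0 Sph (f :: 'n vect => real) ==> Top m ?c N (Radon m f) = Radon m (Zon (b N) N f)" by metis
 have "ALL N. EX b. (ALL i. 0 <= b i) & (ALL f :: 'n vect => real. cont0 Sph f --> Top k ?c' N (Radon k f) = Radon k (Zon b N f))"
  using Top_Radon[OF mk(3) mn(2) c(2)] by blast
 then obtain b' where b': "!!N i. 0 <= b' N i"
  "!!N f. cont0 Sph (f :: 'n vect => real) ==> Top k ?c' N (Radon k f) = Radon k (Zon (b' N) N f)" by metis
 show ?thesis
 proof (rule exI[of _ b], rule exI[of _ b'], unfold_locales)
  show "Top m ?c N (Iop m (Radon k f)) = Iop m (Radon k (Zon (b' N) N f))" if f: "cont0 Sph f" for N and f :: "'n vect => real"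
  using Top_Iop[OF mk Radon_cont0[OF mk(3) f] P0, of N] b'(2)[OF f, of N] by simp
  show "EX N0. ALL N>=N0. ALL x:Sph. \<bar>Zon (b N) N f x - f x\<bar> < e"
  if "cont0 Sph f" "!!x. f (- x) = f x" "0 < e" for e and f :: "'n vect => real"
  by (rule Zon_approximates[OF mk(2) mn(1) c(1) b(1) b(2) that])
  show "EX N0. ALL N>=N0. ALL x:Sph. \<bar>Zon (b' N) N f x - f x\<bar> < e"
  if "cont0 Sph f" "!!x. f (- x) = f x" "0 < e" for e and f :: "'n vect => real"
  by (rule Zon_approximates[OF mk(3) mn(2) c(2) b'(1) b'(2) that])
 qed (use mk b b' in auto)
qed

section \<open>Closure of the image, injectivity and range of the transforms\<close>

lemma poly_one_minus: "\<exists>\<beta>. ALL s::real. (SUM i<=N. \<alpha> i * (1 - s) ^ i) = (SUM j<=N. \<beta> j * s ^ j)"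
proof (induction N)
 case 0
 show ?case by (intro exI[of _ \<alpha>]) simp
next
 case (Suc N)
 then obtain \<beta> where \<beta>: "!!s::real. (SUM i<=N. \<alpha> i * (1 - s) ^ i) = (SUM j<=N. \<beta> j * s ^ j)" by blast
 define \<gamma> where "\<gamma> j = (if j <= N then \<beta> j else 0) + \<alpha> (Suc N) * (of_nat (Suc N choose j) * (-1) ^ j)" for j
 have "(SUM i<=Suc N. \<alpha> i * (1 - s) ^ i) = (SUM j<=Suc N. \<gamma> j * s ^ j)" for s
 proof -
  have "(1 - s) ^ Suc N = (- s + 1) ^ Suc N" by simp
  also have "... = (SUM j<=Suc N. of_nat (Suc N choose j) * (-1) ^ j * s ^ j)"
  unfolding binomial_ring by (simp add: power_minus[of s] mult.assoc del: sum.atMost_Suc)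
  finally have "\<alpha> (Suc N) * (1 - s) ^ Suc N = (SUM j<=Suc N. \<alpha> (Suc N) * (of_nat (Suc N choose j) * (-1) ^ j) * s ^ j)"
  by (simp only: sum_distrib_left mult.assoc)
  moreover have "(SUM j<=N. \<beta> j * s ^ j) = (SUM j<=Suc N. (if j <= N then \<beta> j else 0) * s ^ j)"
  by simp
  ultimately show ?thesis
  by (simp only: \<beta> sum.atMost_Suc[of "%i. \<alpha> i * (1 - s) ^ i"] \<gamma>_def distrib_right sum.distrib)
 qed
 then show ?case by blast
qed

text \<open>By Pythagoras a polynomial in the squared norm of \<open>perpP P *v y\<close> is one in
  that of \<open>P *v y\<close>, with the same bound on the degree. The coefficients \<beta> may be
  negative, so the identity serves approximation and carries no positivity.\<close>

lemma Iop_Radon_Zon: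
 assumes mk: "m + k = CARD('n::finite)" "1 <= m" "1 <= k"
 shows "\<exists>\<beta>. ALL f :: 'n vect => real. cont0 Sph f --> Iop m (Radon k (Zon b N f)) = Radon m (Zon \<beta> N f)"
proof -
 have km: "k <= CARD('n)" "m <= CARD('n)" using mk by auto
 obtain c :: "nat => real" where c: "!!i. c i > 0"
  "!!P y i. P : Grass m ==> Radon m (restr Sph (%x. (x \<bullet> y) ^ (2 * i))) P = c i * norm (P *v (y :: 'n vect)) ^ (2 * i)"
 proof (rule Radon_moments[OF mk(2) km(2)])
  fix c :: "nat => real"
  assume "!!i. c i > 0"
  "!!P y i. P : Grass m ==> Radon m (restr Sph (%x. (x \<bullet> y) ^ (2 * i))) P = c i * norm (P *v (y :: 'n vect)) ^ (2 * i)"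
  then show thesis by (rule that)
 qed
 obtain c' :: "nat => real" where c': "!!i. c' i > 0"
  "!!P y i. P : Grass k ==> Radon k (restr Sph (%x. (x \<bullet> y) ^ (2 * i))) P = c' i * norm (P *v (y :: 'n vect)) ^ (2 * i)"
 proof (rule Radon_moments[OF mk(3) km(1)])
  fix c :: "nat => real"
  assume "!!i. c i > 0"
  "!!P y i. P : Grass k ==> Radon k (restr Sph (%x. (x \<bullet> y) ^ (2 * i))) P = c i * norm (P *v (y :: 'n vect)) ^ (2 * i)"
  then show thesis by (rule that)
 qed
 obtain \<gamma> where \<gamma>: "!!s::real. (SUM i<=N. (b i * c' i) * (1 - s) ^ i) = (SUM j<=N. \<gamma> j * s ^ j)"
  using poly_one_minus[of "%i. b i * c' i" N] by blast
 define \<beta> where "\<beta> j = \<gamma> j / c j" for j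
 have "Iop m (Radon k (Zon b N f)) = Radon m (Zon \<beta> N f)" if f: "cont0 Sph f" for f :: "'n vect => real"
 proof (rule cont0_ext[where X = "Grass m"])
  have cZ: "cont0 Sph (Zon b N f)" for b by (rule Zon_cont0[OF bm_Sph[OF f]])
  show "cont0 (Grass m) (Iop m (Radon k (Zon b N f)))" by (intro Iop_cont0[OF mk(1)] Radon_cont0 mk cZ)
  show "cont0 (Grass m) (Radon m (Zon \<beta> N f))" by (intro Radon_cont0 mk cZ)
  fix P :: "'n matr" assume P: "P : Grass m"
  then have P': "perpP P : Grass k" using perp_Grass[OF mk(1)] by blast
  have "Iop m (Radon k (Zon b N f)) P = (LINT y|haarS. (SUM i<=N. b i * c' i * norm (perpP P *v y) ^ (2 * i)) * f y)"
  using P by (simp add: Iop_def Radon_Zon[OF P' mk(3) f c'(2)[OF P']])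
  also have "... = (LINT y|haarS. (SUM i<=N. \<beta> i * c i * norm (P *v y) ^ (2 * i)) * f y)"
  proof (rule integral_eqI[OF refl])
  fix y
  show "(SUM i<=N. b i * c' i * norm (perpP P *v y) ^ (2 * i)) * f y = (SUM i<=N. \<beta> i * c i * norm (P *v y) ^ (2 * i)) * f y"
  proof (cases "y : Sph")
  case True
  have "(norm (perpP P *v y))\<^sup>2 = 1 - (norm (P *v y))\<^sup>2"
  using proj_pyth[OF Grass_oproj[OF P], of y] True by (simp add: perp_vec Sph_norm)
  then have "(SUM i<=N. b i * c' i * norm (perpP P *v y) ^ (2 * i)) = (SUM j<=N. \<gamma> j * ((norm (P *v y))\<^sup>2) ^ j)"
  using \<gamma>[of "(norm (P *v y))\<^sup>2"] by (simp add: power_mult)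
  moreover have "\<beta> i * c i = \<gamma> i" for i using c(1)[of i] by (simp add: \<beta>_def)
  ultimately show ?thesis by (simp add: power_mult)
  qed (use f in "simp add: cont0_def")
  qed
  also have "... = Radon m (Zon \<beta> N f) P" by (simp add: Radon_Zon[OF P mk(2) f c(2)[OF P]])
  finally show "Iop m (Radon k (Zon b N f)) P = Radon m (Zon \<beta> N f) P" .
 qed
 then show ?thesis by blast
qed

lemma Radon_diff:
 assumes P: "P : Grass m" and m: "1 <= m" and fg: "bm f" "bm g"
 shows "Radon m (%x. f x - g x) P = Radon m f P - Radon m g P"
 using Radon_linear[OF P m fg, of 1 "-1"] by simp

text \<open>\<open>Radon k\<close> sees only the even part \<open>g\<close> of \<open>f\<close>, and
  \<open>g\<close> is uniformly close to a zonal average, which the previous lemma moves into the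
  image of \<open>Radon m\<close>.\<close>

lemma Iop_Radon_closure:
 fixes f :: "('n::finite) vect => real"
 assumes mk: "m + k = CARD('n)" "1 <= m" "1 <= k" and f: "cont0 Sph f" and e: "0 < e"
 shows "EX h. cont0 Sph h & (ALL P:Grass m. \<bar>Iop m (Radon k f) P - Radon m h P\<bar> < e)"
proof -
 obtain b b' where "radon_smoothing TYPE('n) m k b b'" using smoothing_families[OF mk] by blast
 then interpret radon_smoothing m k b b' "TYPE('n)" .
 note appr = Zon_tendsto
 define g where "g x = (1/2) * f x + (1/2) * f (- x)" for x
 have cf': "cont0 Sph (%x. f (- x))"
  using cont0_Sph_rot[of "- mat 1" f] f by (simp add: uminus_orth matrix_vector_uminus)
 have cg: "cont0 Sph g" unfolding g_def by (intro cont0_add cont0_cmult f cf')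
 have ev: "g (- x) = g x" for x by (simp add: g_def)
 have Rg: "Radon k g P = Radon k f P" if P: "P : Grass k" for P
  using Radon_linear[OF P mk(3) bm_Sph[OF f] bm_Sph[OF cf'], of "1/2" "1/2"]
  Radon_even[OF P mk(3) bm_Sph[OF f]] by (simp add: g_def[abs_def])
 obtain N where N: "!!x. x : Sph ==> \<bar>Zon (b N) N g x - g x\<bar> < e / 2"
  using appr[OF cg ev, of "e / 2"] e by auto
 obtain \<beta> where \<beta>: "!!f :: 'n vect => real. cont0 Sph f ==> Iop m (Radon k (Zon (b N) N f)) = Radon m (Zon \<beta> N f)"
  using Iop_Radon_Zon[OF mk, of "b N" N] by blast
 have bZ: "bm (Zon (b N) N g)" by (rule bm_Sph[OF Zon_cont0[OF bm_Sph[OF cg]]])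
 have "\<bar>Iop m (Radon k f) P - Radon m (Zon \<beta> N g) P\<bar> < e" if P: "P : Grass m" for P
 proof -
  have P': "perpP P : Grass k" using P perp_Grass[OF mk(1)] by blast
  have "Iop m (Radon k f) P - Radon m (Zon \<beta> N g) P = Radon k g (perpP P) - Radon k (Zon (b N) N g) (perpP P)"
  using P by (simp add: \<beta>[OF cg, symmetric] Iop_def Rg[OF P'])
  also have "... = Radon k (%x. g x - Zon (b N) N g x) (perpP P)"
  by (rule Radon_diff[OF P' mk(3) bm_Sph[OF cg] bZ, symmetric])
  also have "\<bar>\<dots>\<bar> <= e / 2"
  by (rule Radon_bound[OF P' mk(3)]) (use N in "auto intro!: bm_diff bm_Sph[OF cg] bZ simp: abs_minus_commute less_imp_le")
  finally show ?thesis using e by linarith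
 qed
 then show ?thesis using Zon_cont0[OF bm_Sph[OF cg]] by blast
qed

lemma norm_outer_vec: "x : Sph ==> norm (outer x x *v y) ^ (2 * i) = (x \<bullet> y) ^ (2 * i)"
 by (simp add: Sph_norm power_mult)

lemma outer_Grass1: "x : Sph ==> outer x x : Grass 1"
 using outer_Grass[of x] by (simp add: Sph_norm)

text \<open>The case of lines and shift zero: \<open>outer x x\<close> projects onto the line of
  \<open>x\<close>. The positive leading coefficient makes the passage between powers of
  \<open>outer x x \<bullet> Q\<close> and even moments a triangular, invertible system.\<close>

lemma Rdual_line_moments:
 assumes mk: "m + k = CARD('n::finite)" "1 <= m" "1 <= k"
 shows "EX a. 0 < a j & (ALL x:Sph. ALL y:Sph. Rdual m (restr (Grass m) (%Q. (outer x x \<bullet> Q) ^ j)) (y :: 'n vect)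
  = (SUM i<=j. a i * (x \<bullet> y) ^ (2 * i)))"
proof -
 have n: "1 < CARD('n)" "m <= CARD('n)" "m < CARD('n)" using mk by auto
 show ?thesis
 proof (rule Rdual_moments[OF _ n(1) mk(2) n(2), of 0 j])
  fix a :: "nat => real"
  assume a: "!!P th. P : Grass 1 ==> th : Sph ==> Rdual m (restr (Grass m) (%Q. (0 + P \<bullet> Q) ^ j)) th
  = (SUM i<=j. a i * norm (P *v (th :: 'n vect)) ^ (2 * i))" "m < CARD('n) ==> 0 < a j"
  have "Rdual m (restr (Grass m) (%Q. (outer x x \<bullet> Q) ^ j)) y = (SUM i<=j. a i * (x \<bullet> y) ^ (2 * i))"
  if "x : Sph" "y : Sph" for x y :: "'n vect"
  using a(1)[OF outer_Grass1[OF that(1)] that(2)] norm_outer_vec[OF that(1)] by simp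
  then show ?thesis using a(2)[OF n(3)] by blast
 qed auto
qed

text \<open>By duality with powers of \<open>outer x x \<bullet> Q\<close> and the triangular
  system, all even moments of \<open>w\<close> vanish. Then so do its zonal averages, and these
  converge to \<open>w\<close>.\<close>

lemma Radon_injective_even:
 fixes w :: "('n::finite) vect => real"
 assumes mk: "m + k = CARD('n)" "1 <= m" "1 <= k" and w: "cont0 Sph w" "!!x. w (- x) = w x"
  and z: "!!P. P : Grass m ==> Radon m w P = 0"
 shows "w = (%x. 0)"
proof -
 obtain b b' where "radon_smoothing TYPE('n) m k b b'" using smoothing_families[OF mk] by blast
 then interpret radon_smoothing m k b b' "TYPE('n)" .
 note appr = Zon_tendsto
 have m: "m <= CARD('n)" using mk by simp
 have cpw: "cont0 Sph (%y. (x \<bullet> y) ^ (2 * i) * w y)" for x i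
  by (rule cont0_mult_left[OF _ w(1)]) (intro continuous_intros)
 have M: "(LINT y|haarS. (x \<bullet> y) ^ (2 * j) * w y) = 0" if x: "x : Sph" for x j
 proof (induction j rule: less_induct)
  case (less j)
  obtain a where a: "0 < a j" "!!y. y : Sph ==> Rdual m (restr (Grass m) (%Q. (outer x x \<bullet> Q) ^ j)) (y :: 'n vect)
  = (SUM i<=j. a i * (x \<bullet> y) ^ (2 * i))"
  using Rdual_line_moments[OF mk, of j] x by blast
  define g where "g = restr (Grass m) (%Q :: 'n matr. (outer x x \<bullet> Q) ^ j)"
  have g: "cont0 (Grass m) g" unfolding g_def by (intro cont0_restr continuous_intros)
  have "0 = (LINT Q|(haarG m). Radon m w Q * g Q)"
  proof -
  have "(%Q. Radon m w Q * g Q) = (%Q. 0)" using z by (auto simp: g_def restr_def)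
  then show ?thesis by simp
  qed
  also have "... = (LINT y|haarS. w y * Rdual m g y)" by (rule Radon_duality[OF mk(2) m w(1) g])
  also have "... = (LINT y|haarS. (SUM i<=j. a i * ((x \<bullet> y) ^ (2 * i) * w y)))"
  proof (rule integral_eqI[OF refl])
  fix y
  show "w y * Rdual m g y = (SUM i<=j. a i * ((x \<bullet> y) ^ (2 * i) * w y))"
  using a(2)[of y] w(1) by (cases "y : Sph") (simp_all add: g_def sum_distrib_left mult_ac cont0_def)
  qed
  also have "... = (SUM i<=j. a i * (LINT y|haarS. (x \<bullet> y) ^ (2 * i) * w y))"
  by (subst Bochner_Integration.integral_sum) (auto intro!: integrable_haarS bm_cmult bm_Sph[OF cpw])
  also have "... = (SUM i<=j. if i = j then a j * (LINT y|haarS. (x \<bullet> y) ^ (2 * j) * w y) else 0)"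
  by (rule sum.cong) (use less in auto)
  finally show ?case using a(1) by simp
 qed
 have Z0: "Zon (b N) N w x = 0" if x: "x : Sph" for N x
 proof -
  have "Zon (b N) N w x = (LINT y|haarS. (SUM i<=N. b N i * ((x \<bullet> y) ^ (2 * i) * w y)))"
  unfolding Zon_eq[OF x w(1)] by (simp add: zker_def sum_distrib_right mult.assoc)
  also have "... = (SUM i<=N. b N i * (LINT y|haarS. (x \<bullet> y) ^ (2 * i) * w y))"
  by (subst Bochner_Integration.integral_sum) (auto intro!: integrable_haarS bm_cmult bm_Sph[OF cpw])
  finally show ?thesis by (simp add: M[OF x])
 qed
 show "w = (%x. 0)"
 proof
  fix x
  show "w x = 0"
  proof (cases "x : Sph")
  case True
  have "\<bar>w x\<bar> < e" if "0 < e" for e using appr[OF w that] Z0[OF True] True by fastforce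
  then show ?thesis by (metis less_irrefl zero_less_abs_iff)
  qed (use w in "simp add: cont0_def")
 qed
qed

text \<open>Solving the same triangular system for the moment functions \<open>p j\<close> shows
  that each is a dual transform. The densities are integrals of polynomials in \<open>Q\<close>,
  hence smooth for every continuous \<open>u\<close>.\<close>

lemma Zon_in_Rdual:
 fixes u :: "('n::finite) vect => real"
 assumes mk: "m + k = CARD('n)" "1 <= m" "1 <= k" and u: "cont0 Sph u"
 shows "EX g:CinfG m. Rdual m g = Zon b N u"
proof -
 have m: "m <= CARD('n)" using mk by simp
 define p where "p i = restr Sph (%x. \<integral>y. (x \<bullet> y) ^ (2 * i) * u y \<partial>haarS)" for i :: nat
 have cpu: "cont0 Sph (%y. (x \<bullet> y) ^ (2 * i) * u y)" for x i
  by (rule cont0_mult_left[OF _ u]) (intro continuous_intros)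
 have bC: "bm g" if "g : CinfG m" for g :: "'n matr => real" using CinfG_cont0[OF that] by (rule bm_Grass)
 have lin: "Rdual m (%P. a * f P + b * g P) = (%x. a * Rdual m f x + b * Rdual m g x)"
  if "f : CinfG m" "g : CinfG m" for a b and f g :: "'n matr => real"
 proof
  fix x
  show "Rdual m (%P. a * f P + b * g P) x = a * Rdual m f x + b * Rdual m g x"
  using Rdual_linear[OF mk(2) m _ bC[OF that(1)] bC[OF that(2)], of x a b]
  by (cases "x : Sph") (simp_all add: Rdual_def)
 qed
 have combo: "EX g:CinfG m. Rdual m g = (%x. SUM i:I. \<beta> i * q i x)"
  if "finite I" "!!i. i : I ==> EX g:CinfG m. Rdual m g = q i" for I :: "nat set" and \<beta> and q :: "nat => 'n vect => real"
  using that
 proof (induction I)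
  case empty
  have "Rdual m (restr (Grass m) (%P. 0)) = (%x :: 'n vect. 0 :: real)"
  proof
  fix x :: "'n vect" show "Rdual m (restr (Grass m) (%P. 0)) x = (0::real)"
  using Rdual_const[OF mk(2) m, of x 0] by (cases "x : Sph") (simp_all add: Rdual_def)
  qed
  then show ?case using CinfG_const[of m 0] by auto
 next
  case (insert i I)
  obtain g where g: "g : CinfG m" "Rdual m g = (%x. SUM i:I. \<beta> i * q i x)" using insert by auto
  obtain h where h: "h : CinfG m" "Rdual m h = q i" using insert.prems[of i] by auto
  show ?case
  using CinfG_linear[OF h(1) g(1), of "\<beta> i" 1] lin[OF h(1) g(1), of "\<beta> i" 1] g h insert
  by (intro bexI[of _ "%P. \<beta> i * h P + 1 * g P"]) auto
 qed
 have "EX g:CinfG m. Rdual m g = p j" for j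
 proof (induction j rule: less_induct)
  case (less j)
  obtain a where a: "0 < a j" "!!x y. x : Sph ==> y : Sph ==> Rdual m (restr (Grass m) (%Q. (outer x x \<bullet> Q) ^ j)) (y :: 'n vect)
  = (SUM i<=j. a i * (x \<bullet> y) ^ (2 * i))"
  using Rdual_line_moments[OF mk, of j] by blast
  define G where "G = kint (Grass m) Sph haarS (%Q y. (0 + outer y y \<bullet> Q) ^ j / 1) u"
  have G: "G : CinfG m" unfolding G_def
  by (intro kint_poly_CinfG compact_Sph disjI1 u) (auto intro: continuous_intros)
  have RG: "Rdual m G = (%x. SUM i<=j. a i * p i x)"
  proof
  fix x
  show "Rdual m G x = (SUM i<=j. a i * p i x)"
  proof (cases "x : Sph")
  case x: True
  have "Rdual m G x = (LINT y|haarS. Rdual m (%P. restr (Grass m \<times> Sph) (%(Q, y). (0 + outer y y \<bullet> Q) ^ j / 1) (P, y)) x * u y)"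
  unfolding G_def
  by (rule Rdual_kint[OF compact_Sph _ bm_Sph[OF u] _ _ x mk(2) m])
  (auto simp: case_prod_beta' intro!: continuous_intros)
  also have "... = (LINT y|haarS. (SUM i<=j. a i * ((x \<bullet> y) ^ (2 * i) * u y)))"
  proof (rule integral_eqI[OF refl])
  fix y
  show "Rdual m (%P. restr (Grass m \<times> Sph) (%(Q, y). (0 + outer y y \<bullet> Q) ^ j / 1) (P, y)) x * u y
  = (SUM i<=j. a i * ((x \<bullet> y) ^ (2 * i) * u y))"
  proof (cases "y : Sph")
  case y: True
  then have "(%P. restr (Grass m \<times> Sph) (%(Q, y). (0 + outer y y \<bullet> Q) ^ j / 1) (P, y))
  = restr (Grass m) (%Q. (outer y y \<bullet> Q) ^ j)" by (auto simp: restr_def)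
  then show ?thesis using a(2)[OF y x] by (simp add: sum_distrib_right inner_commute mult.assoc)
  qed (use u in "simp add: cont0_def")
  qed
  also have "... = (SUM i<=j. a i * p i x)"
  using x by (subst Bochner_Integration.integral_sum)
  (auto intro!: integrable_haarS bm_cmult bm_Sph[OF cpu] simp: p_def)
  finally show ?thesis .
  qed (simp add: Rdual_def p_def restr_def)
  qed
  obtain h where h: "h : CinfG m" "Rdual m h = (%x. SUM i:{..<j}. a i * p i x)"
  using combo[of "{..<j}" p a] less by auto
  have "Rdual m (%P. (1 / a j) * G P + (- 1 / a j) * h P) = p j"
  proof
  fix x
  have "{..j} = insert j {..<j}" by auto
  then have "Rdual m G x = a j * p j x + Rdual m h x" by (simp add: RG h(2))
  then show "Rdual m (%P. (1 / a j) * G P + (- 1 / a j) * h P) x = p j x"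
  unfolding lin[OF G h(1)] using a(1) by (simp add: field_simps)
  qed
  then show ?case using CinfG_linear[OF G h(1)] by blast
 qed
 then obtain g where g: "g : CinfG m" "Rdual m g = (%x. SUM i:{..N}. b i * p i x)"
  using combo[of "{..N}" p b] by auto
 have "Zon b N u = (%x. SUM i:{..N}. b i * p i x)"
 proof
  fix x
  show "Zon b N u x = (SUM i:{..N}. b i * p i x)"
  proof (cases "x : Sph")
  case True
  have "Zon b N u x = (LINT y|haarS. (SUM i<=N. b i * ((x \<bullet> y) ^ (2 * i) * u y)))"
  unfolding Zon_eq[OF True u] by (simp add: zker_def sum_distrib_right mult.assoc)
  also have "... = (SUM i:{..N}. b i * p i x)"
  using True by (subst Bochner_Integration.integral_sum)
  (auto intro!: integrable_haarS bm_cmult bm_Sph[OF cpu] simp: p_def)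
  finally show ?thesis .
  qed (simp add: p_def restr_def Zon_def kint_def)
 qed
 then show ?thesis using g by auto
qed

section \<open>Volumes of sections in polar coordinates\<close>

abbreviation lebn :: "nat => (nat => real) measure" where
 "lebn d \<equiv> PiM {..<d} (%_. lborel)"

interpretation lebn: product_sigma_finite "%_::nat. lborel :: real measure" ..

lemma lebn_translate: "distr (lebn d) (lebn d) (%c. \<lambda>i\<in>{..<d}. c i + a i) = lebn d"
proof (rule lebn.PiM_eqI)
 fix A :: "nat => real set" assume A: "!!i. i : {..<d} ==> A i : sets lborel"
 have m: "(%c. \<lambda>i\<in>{..<d}. c i + a i) : measurable (lebn d) (lebn d)" by measurable
 have pre: "(%c. \<lambda>i\<in>{..<d}. c i + a i) -` PiE {..<d} A \<inter> space (lebn d) = PiE {..<d} (%i. (+) (a i) -` A i)"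
  by (auto simp: space_PiM PiE_iff add.commute)
 have s: "(+) (a i) -` A i : sets lborel" if "i : {..<d}" for i
  using measurable_sets_borel[of "(+) (a i)" borel "A i"] A[OF that] by simp
 have e: "emeasure lborel ((+) (a i) -` A i) = emeasure lborel (A i)" if "i : {..<d}" for i
  using emeasure_distr[of "(+) (a i)" lborel borel "A i"] A[OF that] by (simp add: lborel_distr_plus)
 have "emeasure (distr (lebn d) (lebn d) (%c. \<lambda>i\<in>{..<d}. c i + a i)) (PiE {..<d} A) = emeasure (lebn d) (PiE {..<d} (%i. (+) (a i) -` A i))"
  using A by (subst emeasure_distr[OF m]) (auto simp: pre intro!: sets_PiM_I_finite)
 also have "... = (\<Prod>i<d. emeasure lborel (A i))"
  using s by (subst lebn.emeasure_PiM) (auto simp: e intro!: prod.cong)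
 finally show "emeasure (distr (lebn d) (lebn d) (%c. \<lambda>i\<in>{..<d}. c i + a i)) (PiE {..<d} A) = (\<Prod>i<d. emeasure lborel (A i))" .
qed auto

lemma lebn_scale: assumes t: "0 < t"
 shows "scale_measure (ennreal (t ^ d)) (distr (lebn d) (lebn d) (%c. \<lambda>i\<in>{..<d}. t * c i)) = lebn d"
proof (rule lebn.PiM_eqI)
 fix A :: "nat => real set" assume A: "!!i. i : {..<d} ==> A i : sets lborel"
 have m: "(%c. \<lambda>i\<in>{..<d}. t * c i) : measurable (lebn d) (lebn d)" by measurable
 have pre: "(%c. \<lambda>i\<in>{..<d}. t * c i) -` PiE {..<d} A \<inter> space (lebn d) = PiE {..<d} (%i. (*) t -` A i)"
  by (auto simp: space_PiM PiE_iff)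
 have s: "(*) t -` A i : sets lborel" if "i : {..<d}" for i
  using measurable_sets_borel[of "(*) t" borel "A i"] A[OF that] by simp
 have e: "emeasure lborel ((*) t -` A i) = ennreal (1 / t) * emeasure lborel (A i)" if "i : {..<d}" for i
 proof -
  have "emeasure lborel ((*) t -` A i) = emeasure (distr lborel borel ((*) t)) (A i)"
  using A[OF that] by (subst emeasure_distr) auto
  also have "... = ennreal (1 / t) * emeasure lborel (A i)"
  using t A[OF that] by (simp add: lborel_distr_mult emeasure_density_const inverse_eq_divide)
  finally show ?thesis .
 qed
 have "emeasure (distr (lebn d) (lebn d) (%c. \<lambda>i\<in>{..<d}. t * c i)) (PiE {..<d} A) = emeasure (lebn d) (PiE {..<d} (%i. (*) t -` A i))"
  using A by (subst emeasure_distr[OF m]) (auto simp: pre intro!: sets_PiM_I_finite)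
 also have "... = (\<Prod>i<d. ennreal (1 / t) * emeasure lborel (A i))"
  using s by (subst lebn.emeasure_PiM) (auto simp: e intro!: prod.cong)
 also have "... = ennreal (1 / t) ^ d * (\<Prod>i<d. emeasure lborel (A i))" by (simp add: prod.distrib)
 finally have "emeasure (scale_measure (ennreal (t ^ d)) (distr (lebn d) (lebn d) (%c. \<lambda>i\<in>{..<d}. t * c i))) (PiE {..<d} A)
  = ennreal (t ^ d) * (ennreal (1 / t) ^ d * (\<Prod>i<d. emeasure lborel (A i)))"
  by simp
 also have "... = (\<Prod>i<d. emeasure lborel (A i))"
  using t by (simp add: mult.assoc[symmetric] ennreal_power ennreal_mult'[symmetric] power_divide)
 finally show "emeasure (scale_measure (ennreal (t ^ d)) (distr (lebn d) (lebn d) (%c. \<lambda>i\<in>{..<d}. t * c i))) (PiE {..<d} A)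
  = (\<Prod>i<d. emeasure lborel (A i))" .
qed auto

text \<open>Lebesgue measure of the span when \<open>b\<close> is orthonormal, regarded as a measure
  on the ambient space.\<close>

definition Lb :: "nat => (nat => 'a::euclidean_space) => 'a measure" where
 "Lb d b = distr (lebn d) borel (%c. SUM i<d. c i *\<^sub>R b i)"

definition ons :: "nat => (nat => ('n::finite) vect) => 'n matr => bool" where
 "ons d b P \<longleftrightarrow> P : Grass d & (ALL i<d. b i : subsp P) & (ALL i<d. ALL j<d. b i \<bullet> b j = (if i = j then 1 else 0))"

lemma sets_Lb [simp, measurable_cong]: "sets (Lb d b) = sets borel"
 by (simp add: Lb_def)

lemma space_Lb [simp]: "space (Lb d b) = UNIV"
 by (simp add: Lb_def)

lemma Lb_map_measurable [measurable]: fixes b :: "nat => 'a::euclidean_space"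
 shows "(%c. SUM i<d. c i *\<^sub>R b i) : borel_measurable (lebn d)"
proof -
 have "(%c. c i) : borel_measurable (lebn d)" if "i < d" for i
  using measurable_component_singleton[of i "{..<d}" "%_. lborel :: real measure"] that by simp
 then show ?thesis using borel_measurable_sum[of "{..<d}" "%i c. c i *\<^sub>R b i" "lebn d"] by simp
qed

lemma nn_integral_Lb: "f : borel_measurable borel ==> (\<integral>\<^sup>+x. f x \<partial>Lb d b) = (\<integral>\<^sup>+c. f (SUM i<d. c i *\<^sub>R b i) \<partial>lebn d)"
 unfolding Lb_def by (rule nn_integral_distr) auto

lemma emeasure_Lb: "A : sets borel ==> emeasure (Lb d b) A = emeasure (lebn d) {c : space (lebn d). (SUM i<d. c i *\<^sub>R b i) : A}"
 unfolding Lb_def by (subst emeasure_distr) (auto intro!: arg_cong[where f = "emeasure (lebn d)"])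

lemma ons_norm: assumes "ons d b P" shows "(norm (SUM i<d. c i *\<^sub>R b i))\<^sup>2 = (SUM i<d. (c i)\<^sup>2)"
proof -
 have "(SUM i<d. c i *\<^sub>R b i) \<bullet> (SUM i<d. c i *\<^sub>R b i) = (SUM i<d. SUM j<d. if i = j then (c i)\<^sup>2 else 0)"
  unfolding inner_sum_left inner_sum_right
  by (intro sum.cong) (use assms in "auto simp: ons_def power2_eq_square")
 then show ?thesis by (simp add: power2_norm_eq_inner)
qed

lemma ons_expand: assumes b: "ons d b P" and y: "y : subsp P" shows "(SUM i<d. (b i \<bullet> y) *\<^sub>R b i) = y"
proof -
 have P: "P : Grass d" using b by (simp add: ons_def)
 have inj: "inj_on b {..<d}"
  unfolding inj_on_def using b by (metis lessThan_iff ons_def zero_neq_one)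
 have po: "pairwise orthogonal (b ` {..<d})"
  unfolding pairwise_def orthogonal_def using b by (auto simp: ons_def)
 have n1: "norm v = 1" if "v : b ` {..<d}" for v using that b by (auto simp: ons_def norm_eq_1)
 have ind: "independent (b ` {..<d})"
  by (rule pairwise_orthogonal_independent[OF po]) (use n1 in force)
 have "card (b ` {..<d}) = dim (subsp P)"
  using P by (simp add: card_image[OF inj] dim_subsp Grass_iff)
 then have "subsp P \<subseteq> span (b ` {..<d})"
  by (intro card_ge_dim_independent ind) (use b in "auto simp: ons_def")
 then have "y : span (b ` {..<d})" using y by blast
 from orthonormal_basis_expand[OF po n1 this] show ?thesis
  by (simp add: sum.reindex[OF inj] inner_commute)
qed

lemma ons_sum_in: "ons d b P ==> (SUM i<d. c i *\<^sub>R b i) : subsp P"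
 by (intro subspace_sum subspace_scale subspace_subsp) (auto simp: ons_def)

lemma Lb_translate: assumes b: "ons d b P" and y: "y : subsp P" shows "distr (Lb d b) borel (%x. x + y) = Lb d b"
proof -
 define a where "a i = b i \<bullet> y" for i
 have ya: "y = (SUM i<d. a i *\<^sub>R b i)" using ons_expand[OF b y] by (simp add: a_def)
 have m: "(%c. \<lambda>i\<in>{..<d}. c i + a i) : measurable (lebn d) (lebn d)" by measurable
 have "distr (Lb d b) borel (%x. x + y) = distr (lebn d) borel (%c. (SUM i<d. c i *\<^sub>R b i) + y)"
  unfolding Lb_def by (subst distr_distr) (auto simp: comp_def)
 also have "... = distr (lebn d) borel ((%c. SUM i<d. c i *\<^sub>R b i) \<circ> (%c. \<lambda>i\<in>{..<d}. c i + a i))"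
  by (rule distr_cong) (auto simp: ya scaleR_add_left sum.distrib)
 also have "... = distr (distr (lebn d) (lebn d) (%c. \<lambda>i\<in>{..<d}. c i + a i)) borel (%c. SUM i<d. c i *\<^sub>R b i)"
  by (rule distr_distr[symmetric]) (use m in auto)
 finally show ?thesis by (simp add: lebn_translate Lb_def)
qed

lemma Lb_scale: assumes t: "0 < t" and f: "f : borel_measurable borel"
 shows "(\<integral>\<^sup>+x. f x \<partial>Lb d b) = ennreal (t ^ d) * (\<integral>\<^sup>+x. f (t *\<^sub>R x) \<partial>Lb d b)"
proof -
 have m: "(%c. \<lambda>i\<in>{..<d}. t * c i) : measurable (lebn d) (lebn d)" by measurable
 have mf: "(%c. f (SUM i<d. c i *\<^sub>R b i)) : borel_measurable (lebn d)"
  by (rule measurable_compose[OF Lb_map_measurable f])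
 have "(\<integral>\<^sup>+x. f x \<partial>Lb d b) = (\<integral>\<^sup>+c. f (SUM i<d. c i *\<^sub>R b i) \<partial>lebn d)" by (rule nn_integral_Lb[OF f])
 also have "... = (\<integral>\<^sup>+c. f (SUM i<d. c i *\<^sub>R b i) \<partial>scale_measure (ennreal (t ^ d)) (distr (lebn d) (lebn d) (%c. \<lambda>i\<in>{..<d}. t * c i)))"
  by (simp only: lebn_scale[OF t])
 also have "... = ennreal (t ^ d) * (\<integral>\<^sup>+c. f (SUM i<d. (\<lambda>i\<in>{..<d}. t * c i) i *\<^sub>R b i) \<partial>lebn d)"
  using mf by (simp add: nn_integral_scale_measure nn_integral_distr[OF m])
 also have "(\<integral>\<^sup>+c. f (SUM i<d. (\<lambda>i\<in>{..<d}. t * c i) i *\<^sub>R b i) \<partial>lebn d) = (\<integral>\<^sup>+c. f (t *\<^sub>R (SUM i<d. c i *\<^sub>R b i)) \<partial>lebn d)"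
  by (simp add: scaleR_sum_right)
 also have "... = (\<integral>\<^sup>+x. f (t *\<^sub>R x) \<partial>Lb d b)"
  by (rule nn_integral_Lb[symmetric]) (rule measurable_compose[OF _ f], simp)
 finally show ?thesis .
qed

definition bvol :: "nat => ennreal" where
 "bvol d = emeasure (lebn d) {c : space (lebn d). (SUM i<d. (c i)\<^sup>2) <= 1}"

lemma Lb_cball: assumes "ons d b P" shows "emeasure (Lb d b) (cball 0 1) = bvol d"
proof -
 have "norm (SUM i<d. c i *\<^sub>R b i) <= 1 \<longleftrightarrow> (SUM i<d. (c i)\<^sup>2) <= 1" for c
  unfolding ons_norm[OF assms, symmetric] by (simp add: power_le_one_iff abs_square_le_1)
 then show ?thesis by (simp add: emeasure_Lb bvol_def)
qed

lemma Lb_cball_finite: assumes b: "ons d b P" shows "emeasure (Lb d b) (cball 0 r) < \<infinity>"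
proof -
 have "\<bar>c i\<bar> <= r" if "norm (SUM i<d. c i *\<^sub>R b i) <= r" "i < d" for c i
 proof -
  have "(c i)\<^sup>2 <= (SUM i<d. (c i)\<^sup>2)" using that by (intro member_le_sum) auto
  also have "... <= r\<^sup>2" using that(1) unfolding ons_norm[OF b, symmetric] by (intro power_mono) auto
  finally have "\<bar>c i\<bar> <= \<bar>r\<bar>" by (simp add: abs_le_square_iff)
  moreover have "0 <= r" using that(1) norm_ge_zero order_trans by blast
  ultimately show ?thesis by simp
 qed
 then have "emeasure (Lb d b) (cball 0 r) <= emeasure (lebn d) (PiE {..<d} (%_. {-r..r}))"
  by (simp add: emeasure_Lb) (intro emeasure_mono sets_PiM_I_finite, auto simp: space_PiM PiE_def Pi_iff extensional_def abs_le_iff minus_le_iff)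
 also have "... < \<infinity>" by (subst lebn.emeasure_PiM) (auto simp: power_less_top_ennreal emeasure_lborel_Icc_eq)
 finally show ?thesis .
qed

lemma bvol_pos: "0 < bvol d"
proof -
 \<comment> \<open>Half the side of a cube inside the ball: \<open>s \<le> 1\<close> gives
   \<open>d * s\<^sup>2 \<le> d * s \<le> 1\<close>, and the \<open>+ 1\<close> also covers
   \<open>d = 0\<close>.\<close>
 define s where "s = 1 / real (d + 1)"
 have s: "s > 0" by (simp add: s_def)
 have "(SUM i<d. (c i)\<^sup>2) <= 1" if "!!i. i < d ==> \<bar>c i\<bar> <= s" for c :: "nat => real"
 proof -
  have "(SUM i<d. (c i)\<^sup>2) <= (SUM i<d. s)"
  proof (rule sum_mono)
  fix i assume "i : {..<d}"
  then have "(c i)\<^sup>2 <= s\<^sup>2" using that[of i] s by (simp add: abs_le_square_iff[symmetric])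
  also have "s\<^sup>2 <= s"
  proof -
  have "s <= 1" by (simp add: s_def)
  then show ?thesis using s by (simp add: power2_eq_square mult_left_le)
  qed
  finally show "(c i)\<^sup>2 <= s" .
  qed
  also have "... <= 1" by (simp add: s_def field_simps)
  finally show ?thesis .
 qed
 then have sub: "PiE {..<d} (%_. {-s..s}) \<subseteq> {c : space (lebn d). (SUM i<d. (c i)\<^sup>2) <= 1}"
  by (auto simp: space_PiM PiE_iff abs_le_iff minus_le_iff)
 have m: "{c : space (lebn d). (SUM i<d. (c i)\<^sup>2) <= 1} : sets (lebn d)"
 proof -
  have "(%c. c i) : borel_measurable (lebn d)" if "i < d" for i
  using measurable_component_singleton[of i "{..<d}" "%_. lborel :: real measure"] that by simp
  then have [measurable]: "(%c. SUM i<d. (c i)\<^sup>2) : borel_measurable (lebn d)"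
  using borel_measurable_sum[of "{..<d}" "%i c. (c i)\<^sup>2" "lebn d"] by simp
  show ?thesis by measurable
 qed
 have "0 < (\<Prod>i<d. emeasure lborel {-s..s})"
  using s by (auto simp: prod_constant emeasure_lborel_Icc_eq ennreal_power)
 also have "... = emeasure (lebn d) (PiE {..<d} (%_. {-s..s}))"
  by (subst lebn.emeasure_PiM) auto
 also have "... <= bvol d" unfolding bvol_def by (rule emeasure_mono[OF sub m])
 finally show ?thesis .
qed

lemma sigma_finite_Lb: assumes b: "ons d b P" shows "sigma_finite_measure (Lb d b)"
proof
 show "EX A. countable A & A \<subseteq> sets (Lb d b) & \<Union> A = space (Lb d b) & (ALL a:A. emeasure (Lb d b) a ~= \<infinity>)"
 proof (intro exI conjI ballI)
  show "countable (range (%n::nat. cball (0::'a vect) n))" by simp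
  show "\<Union> (range (%n::nat. cball (0::'a vect) n)) = space (Lb d b)"
  by (auto simp: Lb_def real_arch_simple)
  show "emeasure (Lb d b) a ~= \<infinity>" if "a : range (%n::nat. cball (0::'a vect) n)" for a
  using that Lb_cball_finite[OF b] by (auto simp: less_top)
 qed auto
qed

lemma AE_Lb: assumes b: "ons d b P" shows "AE x in Lb d b. x : subsp P"
proof -
 have "closed (subsp P)" by (rule closed_subspace) simp
 then show ?thesis unfolding Lb_def by (subst AE_distr_iff) (auto simp: ons_sum_in[OF b])
qed

text \<open>Uniqueness of the translation invariant measure on the range of \<open>P\<close>,
  normalised by the unit ball, whose measure \<open>bvol d\<close> depends on \<open>d\<close>
  alone. It makes the basis picked by \<open>SOME\<close> in \<open>vol_in\<close>
  immaterial.\<close>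

lemma Lb_unique: fixes P :: "('n::finite) matr"
 assumes b: "ons d b P" and b': "ons d b' P" shows "Lb d b = Lb d b'"
proof (rule measure_eqI)
 fix A assume "A : sets (Lb d b)"
 then have A: "A : sets borel" by simp
 have "emeasure (Lb d b) (cball 0 1) * emeasure (Lb d b') A = emeasure (Lb d b) A * emeasure (Lb d b') (cball 0 1)"
  by (rule translation_invariant_unique[where F = "subsp P"])
  (use A sigma_finite_Lb AE_Lb Lb_translate b b' in "auto intro: subspace_neg")
 then have "bvol d * emeasure (Lb d b') A = bvol d * emeasure (Lb d b) A"
  by (simp add: Lb_cball[OF b] Lb_cball[OF b'] mult.commute)
 moreover have "bvol d ~= 0" "bvol d ~= \<infinity>"
  using bvol_pos[of d] Lb_cball_finite[OF b, of 1] Lb_cball[OF b] by auto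
 ultimately show "emeasure (Lb d b) A = emeasure (Lb d b') A" by (simp add: ennreal_mult_cancel_left)
qed simp

lemma Lb_rot: assumes b: "ons d b P" and U: "U : Stab P"
 shows "distr (Lb d b) borel (%x. U *v x) = Lb d b"
proof -
 have "distr (Lb d b) borel (%x. U *v x) = Lb d (%i. U *v b i)"
  unfolding Lb_def
  by (subst distr_distr) (auto simp: comp_def linear_sum[OF matrix_vector_mul_linear] mv_scaleR)
 moreover have "ons d (%i. U *v b i) P"
 proof -
  have P: "oproj P" using b by (auto simp: ons_def Grass_oproj)
  have "U *v x : subsp P" if "x : subsp P" for x
  using that U P by (simp add: subsp_iff Stab_def mv_assoc) (metis mv_assoc)
  then show ?thesis using b Stab_orth[OF U] by (auto simp: ons_def)
 qed
 ultimately show ?thesis using Lb_unique[OF _ b] by simp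
qed

lemma ons_exists: assumes P: "P : Grass d" shows "EX b. ons d b P"
proof -
 obtain B where B: "B \<subseteq> subsp P" "pairwise orthogonal B" "!!x. x : B ==> norm x = 1"
  "independent B" "card B = dim (subsp P)"
  using orthonormal_basis_subspace[OF subspace_subsp[of P]] by metis
 have cB: "card B = d" using P B by (simp add: dim_subsp Grass_iff)
 have fB: "finite B" using independent_imp_finite[OF B(4)] .
 obtain h where h: "bij_betw h {..<d} B"
  using ex_bij_betw_nat_finite[OF fB] cB by (auto simp: atLeast0LessThan)
 have hB: "h i : B" if "i < d" for i using h that by (auto simp: bij_betw_def)
 have inj: "h i = h j \<longleftrightarrow> i = j" if "i < d" "j < d" for i j using h that by (auto simp: bij_betw_def inj_on_def)
 have "ons d h P"
  unfolding ons_def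
 proof (intro conjI allI impI P)
  show "h i : subsp P" if "i < d" for i using hB[OF that] B by blast
  show "h i \<bullet> h j = (if i = j then 1 else 0)" if "i < d" "j < d" for i j
  using that inj B(2) B(3)[OF hB[OF that(1)]] hB by (auto simp: pairwise_def orthogonal_def norm_eq_1)
 qed
 then show ?thesis by blast
qed

lemma vol_in_Lb: assumes P: "P : Grass d" and b: "ons d b P" and K: "K : sets borel"
 shows "vol_in (subsp P) (K \<inter> subsp P) = emeasure (Lb d b) K"
proof -
 define b' where "b' = (SOME b. (ALL i<d. b i : subsp P) & (ALL i<d. ALL j<d. b i \<bullet> b j = (if i = j then 1 else 0)))"
 have "EX b. (ALL i<d. b i : subsp P) & (ALL i<d. ALL j<d. b i \<bullet> b j = (if i = j then 1 else 0))"
  using b by (auto simp: ons_def)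
 then have "(ALL i<d. b' i : subsp P) & (ALL i<d. ALL j<d. b' i \<bullet> b' j = (if i = j then 1 else 0))"
  unfolding b'_def by (rule someI_ex)
 then have b': "ons d b' P" using P by (simp add: ons_def)
 have dd: "dim (subsp P) = d" using P by (simp add: dim_subsp Grass_iff)
 have "vol_in (subsp P) (K \<inter> subsp P) = emeasure (lebn d) {c : space (lebn d). (SUM i<d. c i *\<^sub>R b' i) : K \<inter> subsp P}"
  by (simp add: vol_in_def dd Let_def b'_def)
 also have "... = emeasure (Lb d b') K"
  using ons_sum_in[OF b'] by (simp add: emeasure_Lb[OF K])
 finally show ?thesis by (simp add: Lb_unique[OF b' b])
qed

lemma radial_ray_integral:
 fixes a :: real assumes a: "0 < a" and d: "1 <= d"
 shows "(\<integral>\<^sup>+t. ennreal (real d / t ^ (d + 1)) * indicator {a..} t \<partial>lborel) = ennreal (1 / a ^ d)"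
proof -
 have "(\<integral>\<^sup>+t. ennreal (real d / t ^ (d + 1)) * indicator {a..} t \<partial>lborel) = ennreal (0 - (- (1 / a ^ d)))"
 proof (rule nn_integral_FTC_atLeast)
  fix x assume x: "a <= x"
  then have x0: "x > 0" using a by simp
  have "((%t. - (1 / t ^ d)) has_real_derivative real d * x ^ (d - 1) / (x ^ d * x ^ d)) (at x)"
  using x0 by (auto intro!: derivative_eq_intros simp: power2_eq_square)
  also have "real d * x ^ (d - 1) / (x ^ d * x ^ d) = real d / x ^ (d + 1)"
  using x0 d by (cases d) (auto simp: field_simps)
  finally show "((%t. - (1 / t ^ d)) has_real_derivative real d / x ^ (d + 1)) (at x)" .
  show "0 <= real d / x ^ (d + 1)" using x0 by simp
 next
  have "((%t::real. 1 / t ^ d) \<longlongrightarrow> 0) at_top"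
  using d by (intro tendsto_divide_0[OF tendsto_const] filterlim_at_top_imp_at_infinity filterlim_pow_at_top filterlim_ident) auto
  then show "((%t::real. - (1 / t ^ d)) \<longlongrightarrow> 0) at_top" using tendsto_minus by fastforce
 qed measurable
 then show ?thesis by simp
qed

lemma radial_ray_integral_cmult:
 assumes a: "0 < a" and d: "1 <= d"
 shows "(\<integral>\<^sup>+t. z * (ennreal (real d / t ^ (d + 1)) * indicator {a..} t) \<partial>lborel) = z * ennreal (1 / a ^ d)"
proof (subst nn_integral_cmult)
 show "(%t. ennreal (real d / t ^ (d + 1)) * indicator {a..} t) : borel_measurable lborel" by measurable
 show "z * (\<integral>\<^sup>+t. ennreal (real d / t ^ (d + 1)) * indicator {a..} t \<partial>lborel) = z * ennreal (1 / a ^ d)"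
  using radial_ray_integral[OF a d] by (rule arg_cong)
qed

lemma radial_ray_integral_scaled:
 assumes r: "0 < r" and d: "1 <= d"
 shows "(\<integral>\<^sup>+t. ennreal (real d / t ^ (d + 1) / r ^ d) * indicator {1 / r..} t \<partial>lborel) = 1"
proof -
 have "(\<integral>\<^sup>+t. ennreal (real d / t ^ (d + 1) / r ^ d) * indicator {1 / r..} t \<partial>lborel)
  = (\<integral>\<^sup>+t. ennreal (1 / r ^ d) * (ennreal (real d / t ^ (d + 1)) * indicator {1 / r..} t) \<partial>lborel)"
 proof (rule nn_integral_cong)
  fix t :: real
  show "ennreal (real d / t ^ (d + 1) / r ^ d) * indicator {1 / r..} t
  = ennreal (1 / r ^ d) * (ennreal (real d / t ^ (d + 1)) * indicator {1 / r..} t)"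
  proof (cases "1 / r <= t")
  case True
  then have "0 < t" using r by (meson divide_pos_pos less_le_trans zero_less_one)
  then show ?thesis using r True by (simp add: ennreal_mult'[symmetric])
  qed simp
 qed
 also have "... = ennreal (1 / r ^ d) * ennreal (1 / (1 / r) ^ d)"
  using r by (intro radial_ray_integral_cmult d) simp
 also have "... = 1" using r by (simp add: ennreal_mult'[symmetric] power_divide)
 finally show ?thesis .
qed

text \<open>Dilation by 2 fixes the origin, while it changes the measure by the factor
  \<open>2 ^ d\<close>; a finite mass at the origin must then be zero.\<close>

lemma Lb_zero: assumes b: "ons d b P" and d: "1 <= d" shows "AE x in Lb d b. x ~= 0"
proof -
 let ?f = "%x :: 'a vect. indicator {0} x :: ennreal"
 have e: "emeasure (Lb d b) {0} = ennreal (2 ^ d) * emeasure (Lb d b) {0}"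
 proof -
  have "(\<integral>\<^sup>+x. ?f x \<partial>Lb d b) = ennreal (2 ^ d) * (\<integral>\<^sup>+x. ?f (2 *\<^sub>R x) \<partial>Lb d b)"
  by (rule Lb_scale) auto
  moreover have "?f (2 *\<^sub>R x) = ?f x" for x by (simp add: indicator_def)
  ultimately show ?thesis by simp
 qed
 have fin: "emeasure (Lb d b) {0} < \<infinity>"
  using Lb_cball_finite[OF b, of 0] by simp
 then obtain r where r: "emeasure (Lb d b) {0} = ennreal r" "0 <= r" by (cases "emeasure (Lb d b) {0}") auto
 have "r = 2 ^ d * r" using e r by (simp add: ennreal_mult'[symmetric])
 moreover have "(2::real) ^ d > 1" using d by (simp add: one_less_power)
 ultimately have "r = 0" by (metis mult_cancel_right1 less_irrefl)
 then have "emeasure (Lb d b) {0} = 0" using r by simp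
 then have "{0} : null_sets (Lb d b)" by (intro null_setsI) auto
 then have "AE x in Lb d b. x \<notin> {0}" by (rule AE_not_in)
 then show ?thesis by simp
qed

text \<open>Inserting \<open>1 = \<integral>\<^sub>{t |x| \<ge> 1} d |x|\<^sup>-\<^sup>d t\<^sup>-\<^sup>d\<^sup>-\<^sup>1 dt\<close> and rescaling \<open>x\<close> by \<open>t\<close> turns the volume into an integral of \<open>\<rho>\<^sup>d\<close>.\<close>

lemma Lb_polar:
 assumes b: "ons d b P" and d: "1 <= d"
  and rh: "rh : borel_measurable borel" "!!x. 0 < rh (sgn x)"
 shows "emeasure (Lb d b) {x. x = 0 \<or> norm x <= rh (sgn x)}
  = (\<integral>\<^sup>+y. ennreal (indicator {y. 1 <= norm y} y / norm y ^ (2 * d) * rh (sgn y) ^ d) \<partial>Lb d b)"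
proof -
 interpret L: sigma_finite_measure "Lb d b" by (rule sigma_finite_Lb[OF b])
 interpret LL: pair_sigma_finite "Lb d b" "lborel :: real measure" ..
 define R where "R x = rh (sgn x)" for x
 have [measurable]: "R : borel_measurable borel"
 proof -
  have "(%x :: 'a vect. x /\<^sub>R norm x) : borel_measurable borel" by measurable
  from measurable_compose[OF this rh(1)] show ?thesis by (simp add: R_def[abs_def] sgn_div_norm)
 qed
 \<comment> \<open>\<open>F\<close> below is the integrand with the ray integral inserted, and
   \<open>w\<close> is the same after the substitution \<open>y = t *\<^sub>R x\<close>: for
   positive \<open>t\<close>, \<open>F x t\<close> equals
   \<open>t ^ d * w t (t *\<^sub>R x)\<close>. The lower limit for \<open>t\<close> turns into
   \<open>1 \<le> norm y\<close>, and membership in the body into the new lower limit.\<close>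
 define w where "w t y = (if 0 < t & 1 <= norm y & norm y <= t * R y
  then ennreal (real d / t ^ (d + 1)) * ennreal (1 / norm y ^ d) else 0)" for t :: real and y :: "'a vect"
 define F where "F x t = (if norm x <= R x & 1 / norm x <= t
  then ennreal (real d / t ^ (d + 1) / norm x ^ d) else 0)" for x :: "'a vect" and t :: real
 have sm: "sets (Lb d b \<Otimes>\<^sub>M (lborel :: real measure)) = sets (borel \<Otimes>\<^sub>M borel)"
  by (intro sets_pair_measure_cong) auto
 have mF: "case_prod F : borel_measurable (Lb d b \<Otimes>\<^sub>M lborel)"
 proof -
  have "case_prod F : borel_measurable (borel \<Otimes>\<^sub>M borel)" unfolding F_def by measurable
  then show ?thesis using measurable_cong_sets[OF sm refl] by blast
 qed
 have "emeasure (Lb d b) {x. x = 0 \<or> norm x <= rh (sgn x)} = (\<integral>\<^sup>+x. indicator {x. x = 0 \<or> norm x <= rh (sgn x)} x \<partial>Lb d b)"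
 proof -
  have "{x. x = 0 \<or> norm x <= rh (sgn x)} = {0} \<union> {x. norm x <= R x}" by (auto simp: R_def)
  moreover have "{x. norm x <= R x} : sets borel" by measurable
  ultimately have "{x. x = 0 \<or> norm x <= rh (sgn x)} : sets (Lb d b)" by simp
  then show ?thesis by (rule nn_integral_indicator[symmetric])
 qed
 also have "... = (\<integral>\<^sup>+x. (\<integral>\<^sup>+t. F x t \<partial>lborel) \<partial>Lb d b)"
 proof (rule nn_integral_cong_AE, use Lb_zero[OF b d] in eventually_elim)
  fix x :: "'a vect" assume x: "x ~= 0"
  have "(\<integral>\<^sup>+t. F x t \<partial>lborel) = (\<integral>\<^sup>+t. (if norm x <= R x then 1 else 0) *
  (ennreal (real d / t ^ (d + 1) / norm x ^ d) * indicator {1 / norm x..} t) \<partial>lborel)"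
  by (rule nn_integral_cong) (simp add: F_def indicator_def)
  also have "... = (if norm x <= R x then 1 else 0)
  * (\<integral>\<^sup>+t. ennreal (real d / t ^ (d + 1) / norm x ^ d) * indicator {1 / norm x..} t \<partial>lborel)"
  by (rule nn_integral_cmult) measurable
  also have "... = indicator {x. x = 0 \<or> norm x <= rh (sgn x)} x"
  using x by (subst radial_ray_integral_scaled[OF _ d]) (auto simp: indicator_def R_def)
  finally show "indicator {x. x = 0 \<or> norm x <= rh (sgn x)} x = (\<integral>\<^sup>+t. F x t \<partial>lborel)" by simp
 qed
 also have "... = (\<integral>\<^sup>+t. (\<integral>\<^sup>+x. F x t \<partial>Lb d b) \<partial>lborel)"
  by (rule LL.Fubini'[symmetric]) (rule mF)
 also have "... = (\<integral>\<^sup>+t. (\<integral>\<^sup>+y. w t y \<partial>Lb d b) \<partial>lborel)"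
 proof (rule nn_integral_cong)
  fix t :: real
  show "(\<integral>\<^sup>+x. F x t \<partial>Lb d b) = (\<integral>\<^sup>+y. w t y \<partial>Lb d b)"
  proof (cases "0 < t")
  case t: True
  have m: "w t : borel_measurable borel" unfolding w_def by measurable
  have "(\<integral>\<^sup>+y. w t y \<partial>Lb d b) = ennreal (t ^ d) * (\<integral>\<^sup>+x. w t (t *\<^sub>R x) \<partial>Lb d b)"
  by (rule Lb_scale[OF t m])
  also have "... = (\<integral>\<^sup>+x. ennreal (t ^ d) * w t (t *\<^sub>R x) \<partial>Lb d b)"
  by (rule nn_integral_cmult[symmetric]) (unfold w_def, measurable)
  also have "... = (\<integral>\<^sup>+x. F x t \<partial>Lb d b)"
  proof (rule nn_integral_cong)
  fix x :: "'a vect"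
  have sg: "sgn (t *\<^sub>R x) = sgn x" using t by (simp add: sgn_scaleR)
  show "ennreal (t ^ d) * w t (t *\<^sub>R x) = F x t"
  proof (cases "x = 0")
  case True then show ?thesis using d by (simp add: w_def F_def)
  next
  case False
  have c1: "1 <= norm (t *\<^sub>R x) \<longleftrightarrow> 1 / norm x <= t" using False t by (simp add: field_simps)
  have c2: "norm (t *\<^sub>R x) <= t * R (t *\<^sub>R x) \<longleftrightarrow> norm x <= R x" using t by (simp add: sg R_def)
  show ?thesis
  proof (cases "1 / norm x <= t & norm x <= R x")
  case True
  have "ennreal (t ^ d) * (ennreal (real d / t ^ (d + 1)) * ennreal (1 / norm (t *\<^sub>R x) ^ d))
  = ennreal (t ^ d * (real d / t ^ (d + 1) * (1 / norm (t *\<^sub>R x) ^ d)))"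
  using t by (simp add: ennreal_mult'[symmetric])
  also have "t ^ d * (real d / t ^ (d + 1) * (1 / norm (t *\<^sub>R x) ^ d)) = real d / t ^ (d + 1) / norm x ^ d"
  using t by (simp add: power_mult_distrib)
  finally show ?thesis using True False t c1 c2 by (simp add: w_def F_def)
  next
  case c: False
  have "w t (t *\<^sub>R x) = 0" using c c1 c2 unfolding w_def by (simp only: if_False simp_thms)
  moreover have "F x t = 0" using c by (auto simp: F_def)
  ultimately show ?thesis by simp
  qed
  qed
  qed
  finally show ?thesis by simp
  next
  case False
  have "F x t = 0" for x
  proof (cases "x = 0")
  case x: False
  have "1 / norm x > 0" using x by simp
  then have "\<not> 1 / norm x <= t" using False by linarith
  then show ?thesis by (simp add: F_def)
  qed (use d in "simp add: F_def")
  moreover have "w t y = 0" for y using False by (simp add: w_def)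
  ultimately show ?thesis by simp
  qed
 qed
 also have "... = (\<integral>\<^sup>+y. (\<integral>\<^sup>+t. w t y \<partial>lborel) \<partial>Lb d b)"
 proof -
  have "(%(y, t). w t y) : borel_measurable (borel \<Otimes>\<^sub>M borel)" unfolding w_def by measurable
  then have "(%(y, t). w t y) : borel_measurable (Lb d b \<Otimes>\<^sub>M lborel)"
  using measurable_cong_sets[OF sm refl] by blast
  from LL.Fubini'[OF this] show ?thesis by simp
 qed
 also have "... = (\<integral>\<^sup>+y. ennreal (indicator {y. 1 <= norm y} y / norm y ^ (2 * d) * rh (sgn y) ^ d) \<partial>Lb d b)"
 proof (rule nn_integral_cong)
  fix y :: "'a vect"
  show "(\<integral>\<^sup>+t. w t y \<partial>lborel) = ennreal (indicator {y. 1 <= norm y} y / norm y ^ (2 * d) * rh (sgn y) ^ d)"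
  proof (cases "1 <= norm y")
  case True
  define a where "a = norm y / rh (sgn y)"
  have a: "0 < a" unfolding a_def using True rh(2)[of y] by (intro divide_pos_pos) linarith+
  have le: "norm y <= t * R y \<longleftrightarrow> a <= t" for t using rh(2)[of y] by (simp add: a_def R_def pos_divide_le_eq)
  have "(\<integral>\<^sup>+t. w t y \<partial>lborel) = (\<integral>\<^sup>+t. ennreal (1 / norm y ^ d) * (ennreal (real d / t ^ (d + 1)) * indicator {a..} t) \<partial>lborel)"
  by (rule nn_integral_cong) (use a True le in "auto simp: w_def indicator_def mult.commute")
  also have "... = ennreal (1 / norm y ^ d) * ennreal (1 / a ^ d)"
  by (rule radial_ray_integral_cmult[OF a d])
  also have "... = ennreal (1 / norm y ^ d * (1 / a ^ d))" using a by (simp add: ennreal_mult'[symmetric])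
  also have "1 / norm y ^ d * (1 / a ^ d) = indicator {y. 1 <= norm y} y / norm y ^ (2 * d) * rh (sgn y) ^ d"
  using True by (simp add: a_def power_divide mult_2 power_add)
  finally show ?thesis .
  qed (simp add: w_def)
 qed
 finally show ?thesis .
qed

text \<open>The direction of a point drawn with the rotation invariant weight \<open>g\<close> has a
  law invariant under the stabiliser of \<open>P\<close>, so by uniqueness this law is
  \<open>sigmaE P\<close>. The polar formula for the unit ball shows that \<open>g\<close> has total
  mass \<open>ka\<close>.\<close>

lemma Lb_direction_measure:
 fixes P :: "('n::finite) matr"
 assumes b: "ons d b P" and d: "1 <= d"
 defines "g \<equiv> %y :: 'n vect. indicator {y. 1 <= norm y} y / norm y ^ (2 * d)"
 defines "ka \<equiv> enn2real (bvol d)"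
 shows "0 < ka" "distr (density (Lb d b) (%y. ennreal (g y / ka))) borel sgn = sigmaE P"
proof -
 have P: "P : Grass d" using b by (simp add: ons_def)
 have oP: "oproj P" using P by (rule Grass_oproj)
 have bv: "bvol d ~= 0" "bvol d ~= \<infinity>"
  using bvol_pos[of d] Lb_cball_finite[OF b, of 1] Lb_cball[OF b] by auto
 then have kab: "bvol d = ennreal ka" by (simp add: ka_def less_top)
 show ka: "0 < ka" using bv by (simp add: ka_def enn2real_positive_iff bvol_pos less_top)
 have [measurable]: "g : borel_measurable borel" unfolding g_def by measurable
 have [measurable]: "(sgn :: 'n vect => 'n vect) : borel_measurable borel"
 proof -
  have "(%x :: 'n vect. x /\<^sub>R norm x) : borel_measurable borel" by measurable
  then show ?thesis by (simp add: sgn_div_norm[abs_def])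
 qed
 have g0: "0 <= g y" for y by (simp add: g_def)
 define D where "D = density (Lb d b) (%y. ennreal (g y / ka))"
 define N where "N = distr D borel sgn"
 have mass: "(\<integral>\<^sup>+y. ennreal (g y) \<partial>Lb d b) = bvol d"
 proof -
  have "cball 0 1 = {x :: 'n vect. x = 0 \<or> norm x <= 1}" by auto
  then show ?thesis
  using Lb_polar[OF b d, of "%_. 1"] Lb_cball[OF b] by (simp add: g_def)
 qed
 have prob: "prob_space N"
  unfolding N_def
 proof (rule prob_space.prob_space_distr)
  have "emeasure D (space D) = (\<integral>\<^sup>+y. ennreal (g y / ka) \<partial>Lb d b)"
  unfolding D_def by (subst emeasure_density) auto
  also have "... = (\<integral>\<^sup>+y. ennreal (1 / ka) * ennreal (g y) \<partial>Lb d b)"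
  using ka g0 by (intro nn_integral_cong) (simp add: ennreal_mult'[symmetric])
  also have "... = ennreal (1 / ka) * ennreal ka" by (simp add: nn_integral_cmult mass kab)
  also have "... = 1" using ka by (simp add: ennreal_mult'[symmetric])
  finally show "prob_space D" by (rule prob_spaceI)
 qed (simp add: D_def)
 have AEN: "AE x in N. x : Sph \<inter> subsp P"
 proof -
  have cl: "closed (subsp P)" by (rule closed_subspace) simp
  then have Sp: "Sph \<inter> subsp P : sets borel" by simp
  have "AE y in Lb d b. sgn y : Sph \<inter> subsp P"
  using AE_Lb[OF b] Lb_zero[OF b d]
  proof eventually_elim
  fix y assume "y : subsp P" "y ~= 0"
  then show "sgn y : Sph \<inter> subsp P" by (simp add: Sph_norm norm_sgn sgn_div_norm subspace_scale)
  qed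
  then have "AE y in D. sgn y : Sph \<inter> subsp P" unfolding D_def by (subst AE_density) auto
  then show ?thesis unfolding N_def by (subst AE_distr_iff) (use Sp in "auto simp: D_def Int_def")
 qed
 have emN: "emeasure N A = (\<integral>\<^sup>+y. ennreal (g y / ka) * indicator A (sgn y) \<partial>Lb d b)" if A[measurable]: "A : sets borel" for A
 proof -
  have "emeasure N A = emeasure D (sgn -` A)"
  unfolding N_def using A by (subst emeasure_distr) (auto simp: D_def Lb_def)
  also have "... = (\<integral>\<^sup>+y. ennreal (g y / ka) * indicator (sgn -` A) y \<partial>Lb d b)"
  unfolding D_def using measurable_sets_borel[of sgn borel A] by (subst emeasure_density) auto
  finally show ?thesis by (simp add: indicator_def)
 qed
 have inv: "distr N borel (%x. U *v x) = N" if U: "U : Stab P" for U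
 proof (rule measure_eqI)
  fix A assume "A : sets (distr N borel (%x. U *v x))"
  then have A[measurable]: "A : sets borel" by simp
  have U': "(%x. U *v x) -` A : sets borel" using measurable_sets_borel[of "%x. U *v x" borel A] by simp
  have Uo: "U : orth" using U by (rule Stab_orth)
  define h where "h y = ennreal (g y / ka) * indicator A (sgn y)" for y
  have [measurable]: "h : borel_measurable borel" unfolding h_def by measurable
  have "emeasure (distr N borel (%x. U *v x)) A = emeasure N ((%x. U *v x) -` A)"
  by (subst emeasure_distr) (auto simp: N_def)
  also have "... = (\<integral>\<^sup>+y. ennreal (g y / ka) * indicator ((%x. U *v x) -` A) (sgn y) \<partial>Lb d b)"
  by (rule emN[OF U'])
  also have "... = (\<integral>\<^sup>+y. h (U *v y) \<partial>Lb d b)"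
  using Uo by (intro nn_integral_cong) (auto simp: h_def g_def indicator_def sgn_div_norm mv_scaleR)
  also have "... = (\<integral>\<^sup>+y. h y \<partial>distr (Lb d b) borel (%x. U *v x))"
  by (subst nn_integral_distr) auto
  also have "... = emeasure N A" by (simp only: Lb_rot[OF b U] emN[OF A] h_def)
  finally show "emeasure (distr N borel (%x. U *v x)) A = emeasure N A" .
 qed (simp add: N_def)
 obtain e where e: "e : Sph" "P *v e = e" using Grass_unit[OF d P] .
 have "N = distr (haar P) borel (%U. U *v e)"
 proof (rule homogeneous_measure_unique[OF oP prob _ AEN inv])
  show "case_prod (%(U::'n matr) x. U *v x) : borel_measurable borel"
  unfolding case_prod_beta' by (intro borel_contI continuous_intros)
  show "EX V:Stab P. x = V *v e" if x: "x : Sph \<inter> subsp P" for x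
  proof (rule bexI[of _ "refl (e - x)"])
  show "x = refl (e - x) *v e" using x e by (intro refl_swap(1)[symmetric]) (auto simp: Sph_norm)
  have "P *v (e - x) = e - x" using x e oP by (simp add: matrix_vector_mult_diff_distrib subsp_iff)
  then show "refl (e - x) : Stab P" using oP by (simp add: Stab_iff rot_refl_range)
  qed
 qed (auto simp: N_def mv_assoc)
 also have "... = sigmaE P" by (rule sigmaE_eq[OF oP e, symmetric])
 finally show "distr (density (Lb d b) (%y. ennreal (g y / ka))) borel sgn = sigmaE P" by (simp add: N_def D_def)
qed

section \<open>Star bodies and intersection bodies through their radial functions\<close>

definition sbody :: "(('n::finite) vect => real) => 'n vect set" where
 "sbody rh = {x. x = 0 \<or> norm x <= rh (x /\<^sub>R norm x)}"

text \<open>The polar formula writes the volume as a weighted integral of the d-th power of the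
  radial function of the direction, and the direction has law \<open>sigmaE P\<close>. The constant
  is the volume of the unit ball, common to all \<open>P\<close> and \<open>rh\<close>.\<close>

lemma vol_sbody:
 assumes d: "1 <= d"
 shows "\<exists>ka>0. ALL P:Grass d. \<forall>rh. continuous_on (Sph :: ('n::finite) vect set) rh & (\<forall>th\<in>Sph. 0 < rh th) -->
  vol_in (subsp P) (sbody rh \<inter> subsp P) = ennreal (ka * Radon d (restr Sph (%x. rh x ^ d)) P)"
proof (cases "Grass d = ({} :: 'n matr set)")
 case True
 then show ?thesis by (intro exI[of _ 1]) auto
next
 case False
 define ka where "ka = enn2real (bvol d)"
 obtain P1 :: "'n matr" where "P1 : Grass d" using False by blast
 then obtain b1 where "ons d b1 P1" using ons_exists by blast
 from Lb_direction_measure(1)[OF this d] have ka: "0 < ka" by (simp add: ka_def)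
 have "vol_in (subsp P) (sbody rh \<inter> subsp P) = ennreal (ka * Radon d (restr Sph (%x. rh x ^ d)) P)"
  if P: "P : Grass d" and rh: "continuous_on Sph rh" "!!th. th : Sph ==> 0 < rh th" for P :: "'n matr" and rh
 proof -
  obtain b where b: "ons d b P" using ons_exists[OF P] by blast
  define rh' where "rh' x = (if x : Sph then rh x else 1)" for x
  have mrh': "rh' : borel_measurable borel"
  proof -
  have "(%x. restr Sph rh x + indicator (- Sph) x) : borel_measurable borel"
  using bm_meas[OF bm_Sph[OF cont0_restr[OF rh(1)]]] borel_Sph
  by (intro borel_measurable_add borel_measurable_indicator) auto
  moreover have "(%x. restr Sph rh x + indicator (- Sph) x) = rh'" by (auto simp: rh'_def restr_def)
  ultimately show ?thesis by simp
  qed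
  have pos: "0 < rh' x" for x using rh(2) by (simp add: rh'_def)
  have sgS: "sgn x : Sph" if "x ~= 0" for x :: "'n vect" using that by (simp add: Sph_norm norm_sgn)
  have K: "sbody rh = {x. x = 0 \<or> norm x <= rh' (sgn x)}"
  using sgS by (auto simp: sbody_def rh'_def sgn_div_norm)
  define f where "f = restr Sph (%x. rh x ^ d)"
  have bf: "bm f" unfolding f_def by (intro bm_Sph cont0_restr continuous_intros rh)
  have f0: "0 <= f x" for x using rh(2) by (auto simp: f_def restr_def less_imp_le)
  have [measurable]: "f : borel_measurable borel" using bf by (rule bm_meas)
  have [measurable]: "(sgn :: 'n vect => 'n vect) : borel_measurable borel"
  proof -
  have "(%x :: 'n vect. x /\<^sub>R norm x) : borel_measurable borel" by measurable
  then show ?thesis by (simp add: sgn_div_norm[abs_def])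
  qed
  have Kb: "sbody rh : sets borel"
  proof -
  have "{x. norm x <= rh' (sgn x)} : sets borel" using mrh' by measurable
  moreover have "sbody rh = {0} \<union> {x. norm x <= rh' (sgn x)}" by (auto simp: K)
  ultimately show ?thesis by simp
  qed
  let ?g = "%y :: 'n vect. indicator {y. 1 <= norm y} y / norm y ^ (2 * d) :: real"
  have "vol_in (subsp P) (sbody rh \<inter> subsp P) = (\<integral>\<^sup>+y. ennreal (?g y * rh' (sgn y) ^ d) \<partial>Lb d b)"
  using vol_in_Lb[OF P b Kb] Lb_polar[OF b d mrh' pos] by (simp only: K)
  also have "... = (\<integral>\<^sup>+y. ennreal ka * (ennreal (?g y / ka) * ennreal (f (sgn y))) \<partial>Lb d b)"
  proof (rule nn_integral_cong_AE, use Lb_zero[OF b d] in eventually_elim)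
  fix y :: "'n vect" assume "y ~= 0"
  then have "f (sgn y) = rh' (sgn y) ^ d" using sgS by (simp add: f_def rh'_def)
  then show "ennreal (?g y * rh' (sgn y) ^ d) = ennreal ka * (ennreal (?g y / ka) * ennreal (f (sgn y)))"
  using ka f0[of "sgn y"] by (simp add: ennreal_mult'[symmetric])
  qed
  also have "... = ennreal ka * (\<integral>\<^sup>+y. ennreal (?g y / ka) * ennreal (f (sgn y)) \<partial>Lb d b)"
  by (rule nn_integral_cmult) measurable
  also have "(\<integral>\<^sup>+y. ennreal (?g y / ka) * ennreal (f (sgn y)) \<partial>Lb d b)
  = (\<integral>\<^sup>+x. ennreal (f x) \<partial>distr (density (Lb d b) (%y. ennreal (?g y / ka))) borel sgn)"
  by (subst nn_integral_distr, simp, simp, subst nn_integral_density) auto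
  also have "distr (density (Lb d b) (%y. ennreal (?g y / ka))) borel sgn = sigmaE P"
  unfolding ka_def by (rule Lb_direction_measure(2)[OF b d])
  also have "(\<integral>\<^sup>+x. ennreal (f x) \<partial>sigmaE P) = ennreal (LINT x|(sigmaE P). f x)"
  proof (rule nn_integral_eq_integral)
  obtain e where e: "e : Sph" "P *v e = e" using Grass_unit[OF d P] .
  have "sigmaE P = distr (haar P) borel (%U. U *v e)" by (rule sigmaE_eq[OF Grass_oproj[OF P] e])
  moreover have "finite_measure (distr (haar P) borel (%U. U *v e))"
  by (rule prob_space.finite_measure, rule prob_space.prob_space_distr[OF prob_space_haar]) simp
  ultimately show "integrable (sigmaE P) f" by (intro bm_integrable bf) auto
  qed (use f0 in auto)
  also have "(LINT x|(sigmaE P). f x) = Radon d f P" using P by (simp add: Radon_def)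
  finally show ?thesis
  using ka unfolding f_def by (simp add: ennreal_mult')
 qed
 then show ?thesis using ka by blast
qed

lemma star_body_sbody: "star_body K \<longleftrightarrow> (\<exists>rh. continuous_on Sph rh & (\<forall>th\<in>Sph. 0 < rh th & rh (- th) = rh th) & K = sbody rh)"
 by (simp add: star_body_def sbody_def)

lemma radial_sbody: assumes "!!th. th : Sph ==> 0 < rh th" and th: "th : Sph" shows "radial (sbody rh) th = rh th"
proof -
 have "{r. 0 < r & r *\<^sub>R th : sbody rh} = {0<..rh th}"
  using th by (auto simp: sbody_def Sph_norm)
 then show ?thesis using assms(1)[OF th] by (simp add: radial_def)
qed

lemma star_body_radial:
 assumes "star_body K"
 shows "continuous_on Sph (radial K)" "!!th. th : Sph ==> 0 < radial K th"
  "!!th. th : Sph ==> radial K (- th) = radial K th" "K = sbody (radial K)"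
proof -
 obtain rh where rh: "continuous_on Sph rh" "!!th. th : Sph ==> 0 < rh th" "!!th. th : Sph ==> rh (- th) = rh th" "K = sbody rh"
  using assms by (auto simp: star_body_sbody)
 have r: "radial K th = rh th" if "th : Sph" for th using radial_sbody[OF rh(2) that] rh(4) by simp
 have m: "- th : Sph" if "th : Sph" for th :: "'a vect" using that by (simp add: Sph_norm)
 show "continuous_on Sph (radial K)" using rh(1) r by (simp cong: continuous_on_cong)
 show "0 < radial K th" if "th : Sph" for th using rh(2) r that by simp
 show "radial K (- th) = radial K th" if "th : Sph" for th using rh(3) r that m by simp
 have "radial K (x /\<^sub>R norm x) = rh (x /\<^sub>R norm x)" if "x ~= 0" for x
  using that by (intro r) (simp add: Sph_norm)
 then have "x : sbody rh \<longleftrightarrow> x : sbody (radial K)" for x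
  by (cases "x = 0") (simp_all add: sbody_def)
 then have "sbody rh = sbody (radial K)" by blast
 then show "K = sbody (radial K)" using rh(4) by simp
qed

lemma sbody_star: "continuous_on Sph rh ==> (!!th. th : Sph ==> 0 < rh th) ==> (!!th. th : Sph ==> rh (- th) = rh th) ==> star_body (sbody rh)"
 by (auto simp: star_body_sbody)

text \<open>In terms of radial functions, \<open>K\<close> is a \<open>k\<close>-intersection body of \<open>L\<close> iff
  \<open>I \<circ> R\<^sub>k\<close> of \<open>\<rho>\<^sub>K\<^sup>k\<close> is a fixed multiple of \<open>R\<^sub>m\<close> of \<open>\<rho>\<^sub>L\<^sup>m\<close>.\<close>

lemma k_intersection_iff:
 assumes mk: "m + k = CARD('n::finite)" "1 <= m" "1 <= k"
 shows "EX c>0. ALL K L :: 'n vect set. star_body K --> star_body L -->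
  (k_intersection_body k K L \<longleftrightarrow>
  Iop m (Radon k (restr Sph (%x. radial K x ^ k))) = Radon m (restr Sph (%x. c * radial L x ^ m)))"
proof -
 obtain ka where ka: "ka > 0" "!!P rh. P : Grass k ==> continuous_on (Sph :: 'n vect set) rh ==> (!!th. th : Sph ==> 0 < rh th) ==>
  vol_in (subsp P) (sbody rh \<inter> subsp P) = ennreal (ka * Radon k (restr Sph (%x. rh x ^ k)) P)"
  using vol_sbody[OF mk(3), where 'n = 'n] by blast
 obtain l where l: "l > 0" "!!P rh. P : Grass m ==> continuous_on (Sph :: 'n vect set) rh ==> (!!th. th : Sph ==> 0 < rh th) ==>
  vol_in (subsp P) (sbody rh \<inter> subsp P) = ennreal (l * Radon m (restr Sph (%x. rh x ^ m)) P)"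
  using vol_sbody[OF mk(2), where 'n = 'n] by blast
 have mm: "CARD('n) - k = m" using mk by simp
 have "k_intersection_body k K L \<longleftrightarrow>
  Iop m (Radon k (restr Sph (%x. radial K x ^ k))) = Radon m (restr Sph (%x. l / ka * radial L x ^ m))"
  if K: "star_body K" and L: "star_body L" for K L :: "'n vect set"
 proof -
  note rK = star_body_radial[OF K] and rL = star_body_radial[OF L]
  define F G where "F = restr Sph (%x. radial K x ^ k)" and "G = restr Sph (%x. radial L x ^ m)"
  have cF: "cont0 Sph F" "cont0 Sph G" unfolding F_def G_def by (intro cont0_restr continuous_intros rK rL)+
  have bFG: "bm F" "bm G" using cF bm_Sph by auto
  have z: "bm (restr Sph (%x :: 'n vect. 0))" by (rule bm_Sph[OF cont0_const])
  have nn: "0 <= Radon k F P" if "P : Grass k" for P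
  using Radon_mono[OF that mk(3) z bFG(1)] Radon_const[OF that mk(3), of 0] rK(2) by (auto simp: F_def less_imp_le)
  have nn': "0 <= Radon m G P" if "P : Grass m" for P
  using Radon_mono[OF that mk(2) z bFG(2)] Radon_const[OF that mk(2), of 0] rL(2) by (auto simp: G_def less_imp_le)
  have eG: "restr Sph (%x. l / ka * radial L x ^ m) = (%x. l / ka * G x)" by (auto simp: G_def restr_def)
  have RG: "Radon m (%x. l / ka * G x) P = l / ka * Radon m G P" if "P : Grass m" for P
  using Radon_linear[OF that mk(2) bFG(2) bFG(2), of "l / ka" 0] by simp
  have "k_intersection_body k K L \<longleftrightarrow> (ALL H:Grass m. vol_in (subsp (perpP H)) (K \<inter> subsp (perpP H)) = vol_in (subsp H) (L \<inter> subsp H))"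
  using K L by (simp add: k_intersection_body_def mm)
  also have "... \<longleftrightarrow> (ALL H:Grass m. ka * Radon k F (perpP H) = l * Radon m G H)"
  proof (rule ball_cong[OF refl])
  fix H :: "'n matr" assume H: "H : Grass m"
  then have H': "perpP H : Grass k" using perp_Grass[OF mk(1)] by blast
  have "vol_in (subsp (perpP H)) (K \<inter> subsp (perpP H)) = ennreal (ka * Radon k F (perpP H))"
  unfolding F_def by (subst rK(4)) (rule ka(2)[OF H' rK(1,2)])
  moreover have "vol_in (subsp H) (L \<inter> subsp H) = ennreal (l * Radon m G H)"
  unfolding G_def by (subst rL(4)) (rule l(2)[OF H rL(1,2)])
  ultimately show "vol_in (subsp (perpP H)) (K \<inter> subsp (perpP H)) = vol_in (subsp H) (L \<inter> subsp H) \<longleftrightarrow>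
  ka * Radon k F (perpP H) = l * Radon m G H"
  using ka(1) l(1) nn[OF H'] nn'[OF H] by simp
  qed
  also have "... \<longleftrightarrow> (ALL H:Grass m. Iop m (Radon k F) H = Radon m (%x. l / ka * G x) H)"
  proof (rule ball_cong[OF refl])
  fix H :: "'n matr" assume H: "H : Grass m"
  then have "Iop m (Radon k F) H = Radon k F (perpP H)" by (simp add: Iop_def)
  then show "ka * Radon k F (perpP H) = l * Radon m G H \<longleftrightarrow> Iop m (Radon k F) H = Radon m (%x. l / ka * G x) H"
  unfolding RG[OF H] using ka(1) by (auto simp: field_simps)
  qed
  also have "... \<longleftrightarrow> Iop m (Radon k F) = Radon m (%x. l / ka * G x)"
  by (auto simp: fun_eq_iff Iop_def Radon_def)
  finally show ?thesis by (simp only: eG F_def)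
 qed
 then show ?thesis using ka(1) l(1) by (intro exI[of _ "l / ka"]) auto
qed

section \<open>Weak limits of empirical measures\<close>

text \<open>Schoenberg's space-filling curve: the ternary digits of the parameter carry the binary digits of
  the coordinates, so that Helly selection on the line applies to measures on any compact set.\<close>

definition tent :: "real => real" where
 "tent x = max 0 (min 1 (1 / 2 - cos (pi * x)))"

lemma tent_periodic: "tent (2 * real k + x) = tent x"
proof -
 have *: "pi * (2 * real k + x) = pi * x + 2 * real k * pi" by (simp add: algebra_simps)
 show ?thesis unfolding tent_def * cos_add using cos_2npi[of k] sin_2npi[of k] by simp
qed

text \<open>The function is 0 on [0, 1/3] and 1 on [2/3, 1], so it reads the leading ternary digit 0
  or 2 whatever tail \<open>s\<close> follows.\<close>

lemma tent_digit:
 assumes "0 <= s" "s <= 1"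
 shows "tent ((2 * of_bool c + s) / 3) = of_bool c"
proof -
 have half: "cos (pi / 3) = 1 / 2" by (rule cos_60)
 have *: "cos (pi * x) \<ge> 1 / 2" if "0 <= x" "x <= 1 / 3" for x
 proof -
  have "pi * x <= pi * (1 / 3)" using that by (intro mult_left_mono) auto
  then show ?thesis using cos_monotone_0_pi_le[of "pi * x" "pi / 3"] that half by auto
 qed
 show ?thesis
 proof (cases c)
  case True
  let ?x = "(2 + s) / 3"
  have "cos (pi * ?x) = - cos (pi * (1 - ?x))"
  using cos_pi_minus[of "pi * (1 - ?x)"] by (simp add: algebra_simps)
  moreover have "cos (pi * (1 - ?x)) \<ge> 1 / 2" using assms by (intro *) auto
  ultimately show ?thesis using True by (simp add: tent_def)
 next
  case False
  then show ?thesis using *[of "s / 3"] assms by (simp add: tent_def)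
 qed
qed

definition cantor :: "(nat => bool) => real" where
 "cantor c = (\<Sum>l. 2 * of_bool (c l) / 3 ^ Suc l)"

lemma cantor_sums: "(%l. 2 / 3 ^ Suc l :: real) sums 1"
 using sums_mult[OF geometric_sums[of "1 / 3 :: real"], of "2 / 3"] by (simp add: power_divide)

lemma cantor_summable: "summable (%l. 2 * of_bool (c l) / 3 ^ Suc l :: real)"
 by (rule summable_comparison_test'[OF sums_summable[OF cantor_sums], of 0]) auto

lemma cantor_bounds: "0 <= cantor c" "cantor c <= 1"
proof -
 show "0 <= cantor c" unfolding cantor_def by (rule suminf_nonneg[OF cantor_summable]) simp
 have "cantor c <= (\<Sum>l. 2 / 3 ^ Suc l)"
  unfolding cantor_def by (rule suminf_le[OF _ cantor_summable sums_summable[OF cantor_sums]]) auto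
 then show "cantor c <= 1" using cantor_sums by (simp add: sums_iff)
qed

lemma cantor_step: "cantor c = (2 * of_bool (c 0) + cantor (c \<circ> Suc)) / 3"
proof -
 have "cantor c = (\<Sum>l. 2 * of_bool (c (Suc l)) / 3 ^ Suc (Suc l)) + 2 * of_bool (c 0) / 3"
  using suminf_split_head[OF cantor_summable[of c]] by (simp add: cantor_def)
 also have "(\<Sum>l. 2 * of_bool (c (Suc l)) / 3 ^ Suc (Suc l)) = (\<Sum>l. (2 * of_bool ((c \<circ> Suc) l) / 3 ^ Suc l) / (3 :: real))"
  by (rule suminf_cong) simp
 also have "... = cantor (c \<circ> Suc) / 3" unfolding cantor_def by (rule suminf_divide[OF cantor_summable])
 finally show ?thesis by simp
qed

text \<open>Multiplication by 3 shifts the ternary expansion, and the digit 0 or 2 that leaves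
  contributes an even integer, which the period 2 absorbs.\<close>

lemma tent_cantor: "tent (3 ^ n * cantor c) = of_bool (c n)"
proof (induction n arbitrary: c)
 case 0
 show ?case using tent_digit[OF cantor_bounds, of "c 0" "c \<circ> Suc"] by (simp only: cantor_step[symmetric]) simp
next
 case (Suc n)
 have "3 ^ Suc n * cantor c = 2 * real (3 ^ n * of_bool (c 0)) + 3 ^ n * cantor (c \<circ> Suc)"
  by (subst cantor_step) (simp add: field_simps)
 then have "tent (3 ^ Suc n * cantor c) = tent (3 ^ n * cantor (c \<circ> Suc))" by (simp only: tent_periodic)
 also have "... = of_bool ((c \<circ> Suc) n)" by (rule Suc.IH)
 finally show ?case by simp
qed

lemma binary_expansion:
 fixes y :: real
 assumes "0 <= y" "y <= 1"
 obtains c :: "nat => bool" where "(%i. of_bool (c i) / 2 ^ Suc i) sums y"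
proof -
 define z where "z = rec_nat y (%_ w. if 1 / 2 <= w then 2 * w - 1 else 2 * w)"
 have z: "z 0 = y" "z (Suc i) = (if 1 / 2 <= z i then 2 * z i - 1 else 2 * z i)" for i by (auto simp: z_def)
 define c where "c i = (1 / 2 <= z i)" for i
 have zb: "0 <= z i & z i <= 1" for i by (induction i) (use assms in "auto simp: z")
 have s: "(SUM i<n. of_bool (c i) / 2 ^ Suc i) = y - z n / 2 ^ n" for n
  by (induction n) (auto simp: z c_def field_simps)
 have "(%n. z n / 2 ^ n) \<longlonglongrightarrow> 0"
 proof (rule tendsto_sandwich[OF _ _ tendsto_const LIMSEQ_divide_realpow_zero[of 2 1]])
  show "eventually (%n. 0 <= z n / 2 ^ n) sequentially" using zb by (intro always_eventually) auto
  show "eventually (%n. z n / 2 ^ n <= 1 / 2 ^ n) sequentially"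
  using zb by (intro always_eventually allI divide_right_mono) auto
 qed auto
 then have "(%n. y - z n / 2 ^ n) \<longlonglongrightarrow> y - 0" by (intro tendsto_intros)
 then have "(%i. of_bool (c i) / 2 ^ Suc i) sums y" unfolding sums_def s by simp
 then show thesis by (rule that)
qed

lemma space_filling:
 fixes X :: "'a::euclidean_space set"
 assumes X: "bounded X"
 obtains \<phi> :: "real => 'a" where "continuous_on UNIV \<phi>" "X \<subseteq> \<phi> ` {0..1}"
proof -
 obtain R where R: "R > 0" "!!x. x : X ==> norm x <= R" using X by (auto simp: bounded_pos)
 obtain idx :: "'a => nat" where idx: "bij_betw idx Basis {0..<DIM('a)}"
  using ex_bij_betw_finite_nat[OF finite_Basis] by blast
 define coord where "coord j t = (\<Sum>i. tent (3 ^ (DIM('a) * i + j) * t) / 2 ^ Suc i)" for j t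
 define \<phi> where "\<phi> t = (SUM b:Basis. (R * (2 * coord (idx b) t - 1)) *\<^sub>R b)" for t
 have cc: "continuous_on UNIV (coord j)" for j
 proof -
  have "uniform_limit UNIV (%n t. SUM i<n. tent (3 ^ (DIM('a) * i + j) * t) / 2 ^ Suc i) (coord j) sequentially"
  unfolding coord_def
  proof (rule Weierstrass_m_test)
  show "norm (tent (3 ^ (DIM('a) * i + j) * t) / 2 ^ Suc i) <= 1 / 2 ^ Suc i" for i t
  by (simp add: tent_def divide_right_mono)
  show "summable (%i. 1 / 2 ^ Suc i :: real)" using power_half_series by (simp add: sums_iff power_divide)
  qed
  then show ?thesis
  by (rule uniform_limit_theorem[rotated])
  (auto simp: tent_def intro!: always_eventually continuous_intros)
 qed
 have "X \<subseteq> \<phi> ` {0..1}"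
 proof
  fix x assume x: "x : X"
  define y where "y b = (x \<bullet> b / R + 1) / 2" for b
  have y: "0 <= y b" "y b <= 1" if "b : Basis" for b
  using Basis_le_norm[OF that, of x] R(1) R(2)[OF x] by (auto simp: y_def field_simps)
  have "EX c :: nat => bool. (%i. of_bool (c i) / 2 ^ Suc i) sums y b" if "b : Basis" for b
  using binary_expansion[OF y[OF that]] by blast
  then obtain c :: "'a => nat => bool"
  where c: "!!b. b : Basis ==> (%i. of_bool (c b i) / 2 ^ Suc i) sums y b" by metis
  \<comment> \<open>The binary digits of all coordinates are interleaved: position
    \<open>DIM('a) * i + idx b\<close> carries digit \<open>i\<close> of coordinate
    \<open>b\<close>.\<close>
  define d where "d n = c (inv_into Basis idx (n mod DIM('a))) (n div DIM('a))" for n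
  have d: "d (DIM('a) * i + idx b) = c b i" if "b : Basis" for b i
  proof -
  have "idx b < DIM('a)" using bij_betwE[OF idx] that by auto
  then show ?thesis using bij_betw_inv_into_left[OF idx that] by (simp add: d_def)
  qed
  have "coord (idx b) (cantor d) = y b" if "b : Basis" for b
  using c[OF that] by (simp add: coord_def tent_cantor d[OF that] sums_iff)
  then have "\<phi> (cantor d) = (SUM b:Basis. (x \<bullet> b) *\<^sub>R b)"
  unfolding \<phi>_def using R(1) by (intro sum.cong) (simp_all add: y_def field_simps)
  then have "\<phi> (cantor d) = x" by (simp add: euclidean_representation)
  then show "x : \<phi> ` {0..1}" using cantor_bounds[of d] by force
 qed
 moreover have "continuous_on UNIV \<phi>" unfolding \<phi>_def by (intro continuous_intros continuous_on_sum cc)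
 ultimately show thesis by (intro that)
qed

text \<open>The points are lifted to parameters in [0, 1] along the space-filling curve, so the
  lifted empirical measures are tight on the line. A weak limit along a subsequence lives on the
  closed set \<open>B\<close> of parameters of points of \<open>X\<close>, and its image under the
  curve is the desired measure.\<close>

lemma empirical_limit:
 fixes X :: "'a::euclidean_space set" and p :: "nat => nat => 'a" and r :: "nat => nat"
 assumes X: "compact X" and p: "!!j i. p j i : X" and r: "!!j. 0 < r j"
 obtains M s where "fin_meas_on X M" "strict_mono s"
  "!!h. cont0 X h ==> (%j. (SUM i<r (s j). h (p (s j) i)) / r (s j)) \<longlonglongrightarrow> (LINT x|M. h x)"
proof -
 obtain \<phi> :: "real => 'a" where \<phi>: "continuous_on UNIV \<phi>" "X \<subseteq> \<phi> ` {0..1}"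
  using space_filling[OF compact_imp_bounded[OF X]] by blast
 define B where "B = {0..1} \<inter> \<phi> -` X"
 have "closed (\<phi> -` X)"
  using continuous_closed_vimage[OF compact_imp_closed[OF X], of \<phi>] \<phi>(1)
  by (simp add: continuous_on_eq_continuous_at)
 then have B: "closed B" "B \<subseteq> {0..1}" unfolding B_def by auto
 have "EX t:B. \<phi> t = p j i" for j i 
 proof -
  obtain t where "t : {0..1}" "p j i = \<phi> t" using \<phi>(2) p[of j i] by blast
  then show ?thesis using p[of j i] unfolding B_def by (intro bexI[of _ t]) auto
 qed
 then obtain t where "ALL j i. t j i : B & \<phi> (t j i) = p j i" unfolding Bex_def by metis
 then have t: "t j i : B" "\<phi> (t j i) = p j i" for j i by auto
 define \<mu> where "\<mu> j = distr (uniform_count_measure {..<r j}) borel (t j)" for j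
 have meas: "t j : measurable (uniform_count_measure {..<r j}) borel" for j
  by (simp add: measurable_def sets_uniform_count_measure space_uniform_count_measure)
 have int: "integral\<^sup>L (\<mu> j) g = (SUM i<r j. g (t j i)) / r j" if "g : borel_measurable borel" for j and g :: "real => real"
  unfolding \<mu>_def using that by (simp add: integral_distr[OF meas] integral_uniform_count_measure)
 have rd: "real_distribution (\<mu> j)" for j
 proof -
  have "prob_space (uniform_count_measure {..<r j})" using r[of j] by (intro prob_space_uniform_count_measure) auto
  then have "prob_space (\<mu> j)" unfolding \<mu>_def by (rule prob_space.prob_space_distr[OF _ meas])
  then show ?thesis by (simp add: real_distribution_def real_distribution_axioms_def \<mu>_def)
 qed
 \<comment> \<open>Tightness is phrased with half-open intervals, and a parameter may be 0; hence
   the left end -1.\<close>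
 have full: "measure (\<mu> j) {-1<..1} = 1" for j
 proof -
  have "measure (\<mu> j) {-1<..1} = integral\<^sup>L (\<mu> j) (indicator {-1<..1})"
  by (simp add: \<mu>_def)
  also have "... = (SUM i<r j. 1) / r j"
  proof -
  have "indicator {-1<..1} (t j i) = (1 :: real)" for i
  using t(1)[of j i] B(2) by (auto simp: indicator_def subset_iff)
  then show ?thesis by (subst int) auto
  qed
  finally show ?thesis using r[of j] by simp
 qed
 have "tight \<mu>"
  unfolding tight_def
 proof (intro conjI allI impI rd)
  fix e :: real assume "0 < e"
  then show "EX a b. a < b & (ALL n. 1 - e < measure (\<mu> n) {a<..b})"
  by (intro exI[of _ "-1"] exI[of _ 1]) (simp add: full)
 qed
 from tight_imp_convergent_subsubsequence[OF this strict_mono_id] obtain s N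
  where s: "strict_mono s" and N: "real_distribution N" "weak_conv_m (\<mu> \<circ> id \<circ> s) N" by blast
 interpret N: real_distribution N by (rule N(1))
 have lim: "(%j. (SUM i<r (s j). g (t (s j) i)) / r (s j)) \<longlonglongrightarrow> integral\<^sup>L N g"
  if g: "continuous_on UNIV g" "!!x. \<bar>g x\<bar> <= C" for g :: "real => real" and C
 proof -
  have "(%j. integral\<^sup>L ((\<mu> \<circ> id \<circ> s) j) g) \<longlonglongrightarrow> integral\<^sup>L N g"
  by (rule weak_conv_imp_integral_bdd_continuous_conv[where B = C])
  (use g rd N in "auto simp: continuous_on_eq_continuous_at comp_def")
  then show ?thesis using borel_contI[OF g(1)] by (simp add: int)
 qed
 have ne: "B ~= {}" using t(1) by auto
 \<comment> \<open>The truncated distance to \<open>B\<close> is a bounded continuous test function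
   with integral zero against every empirical measure, hence also against the limit.\<close>
 have NB: "AE x in N. x : B"
 proof -
  let ?g = "%x. min 1 (infdist x B)"
  have c: "continuous_on UNIV ?g" by (intro continuous_intros continuous_on_infdist)
  have "(%j. 0) \<longlonglongrightarrow> integral\<^sup>L N ?g"
  using lim[OF c, of 1] t(1) by (simp add: infdist_nonneg)
  then have "integral\<^sup>L N ?g = 0" using LIMSEQ_unique[OF tendsto_const] by fastforce
  moreover have "integrable N ?g"
  by (rule N.integrable_const_bound[where B = 1])
  (use borel_contI[OF c] in "auto simp: infdist_nonneg")
  ultimately have "AE x in N. ?g x = 0"
  by (subst (asm) integral_nonneg_eq_0_iff_AE) (auto simp: infdist_nonneg)
  then show ?thesis
  proof eventually_elim
  fix x assume "min 1 (infdist x B) = 0"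
  then have "infdist x B = 0" by (auto simp: min_def split: if_splits)
  then show "x : B" using in_closed_iff_infdist_zero[OF B(1) ne] by simp
  qed
 qed
 have m\<phi>: "\<phi> : measurable N borel" using borel_contI[OF \<phi>(1)] by simp
 define M where "M = distr N borel \<phi>"
 have "AE x in N. \<phi> x : X" using NB by eventually_elim (simp add: B_def)
 then have "AE x in M. x : X"
  unfolding M_def using compact_imp_closed[OF X] by (subst AE_distr_iff[OF m\<phi>]) auto
 moreover have "prob_space M" unfolding M_def by (rule N.prob_space_distr[OF m\<phi>])
 ultimately have "fin_meas_on X M"
  using AE_iff_measurable[of "UNIV - X" M "%x. x : X"] compact_imp_closed[OF X]
  by (auto simp: fin_meas_on_def M_def prob_space.finite_measure prob_space_def space_distr)
 moreover have "(%j. (SUM i<r (s j). h (p (s j) i)) / r (s j)) \<longlonglongrightarrow> (LINT x|M. h x)" if h: "cont0 X h" for h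
 proof -
  have bh: "bm h" by (rule cont0_bm[OF _ h]) (use X in auto)
  obtain C where C: "!!x. \<bar>h x\<bar> <= C" using bmE[OF bh] by blast
  have C0: "0 <= C" using C[of undefined] by linarith
  have "continuous_on B (%x. h (\<phi> x))"
  by (rule continuous_on_compose2[OF _ continuous_on_subset[OF \<phi>(1)]])
  (use h in "auto simp: cont0_def B_def")
  \<comment> \<open>\<open>h\<close> is continuous only on \<open>X\<close>, so its pullback to
    \<open>B\<close> is extended to a bounded continuous function on the line before weak
    convergence is applied.\<close>
  then obtain g where g: "continuous_on UNIV g" "!!x. x : B ==> g x = h (\<phi> x)" "!!x. norm (g x) <= C"
  using Tietze[of B "%x. h (\<phi> x)" UNIV C] B(1) C C0 by auto
  have "integral\<^sup>L N g = (LINT x|N. h (\<phi> x))"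
  by (rule integral_cong_AE) (use NB g bm_meas[OF bh] m\<phi> borel_contI[OF g(1)] in "auto elim: eventually_mono")
  also have "... = (LINT x|M. h x)" unfolding M_def using bm_meas[OF bh] by (simp add: integral_distr[OF m\<phi>])
  finally show ?thesis using lim[OF g(1), of C] g(2,3) t by simp
 qed
 ultimately show thesis using s by (intro that)
qed

section \<open>Functionals that are positive on the image of the Radon transform\<close>

context radon_smoothing
begin

lemma dims: "m <= CARD('n)" "k <= CARD('n)" "m < CARD('n)" "k < CARD('n)" "CARD('n) - k = m" "k + m = CARD('n)"
 using mk by auto

lemma cont0_minus: "cont0 Sph f ==> cont0 Sph (%x :: 'n vect. f (- x))"
 using cont0_Sph_rot[of "- mat 1" f] by (simp add: uminus_orth matrix_vector_uminus)

lemma integral_minus: fixes f :: "'n vect => real" shows "cont0 Sph f ==> (LINT x|haarS. f (- x)) = (LINT x|haarS. f x)"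
 using haarS_invariant[of "- mat 1" f] bm_Sph[of f] by (simp add: uminus_orth matrix_vector_uminus)

lemma int_lin:
 fixes f g u :: "'n vect => real"
 assumes "cont0 Sph f" "cont0 Sph g" "cont0 Sph u"
 shows "(LINT x|haarS. (s * f x + t * g x) * u x) = s * (LINT x|haarS. f x * u x) + t * (LINT x|haarS. g x * u x)"
proof -
 have "integrable haarS (%x. f x * u x)" "integrable haarS (%x. g x * u x)"
  using assms by (auto intro!: integrable_haarS bm_Sph cont0_mult)
 then show ?thesis by (simp add: algebra_simps)
qed

lemma int_mono:
 fixes f g :: "'n vect => real"
 assumes "cont0 Sph f" "cont0 Sph g" "!!x. x : Sph ==> f x <= g x"
 shows "(LINT x|haarS. f x) <= (LINT x|haarS. g x)"
proof (rule integral_mono_AE)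
 show "AE x in haarS. f x <= g x" using AE_haarS by eventually_elim (rule assms(3))
qed (use assms in "auto intro: integrable_haarS bm_Sph")

lemma int_const: "(LINT x|(haarS :: 'n vect measure). restr Sph (%_. c) x) = c"
proof -
 have "(LINT x|(haarS :: 'n vect measure). restr Sph (%_. c) x) = (LINT x|(haarS :: 'n vect measure). c)"
  by (rule integral_cong_AE)
  (use AE_haarS borel_measurable_integrable[OF integrable_haarS[OF bm_Sph[OF cont0_const]]] in "auto elim!: eventually_mono")
 then show ?thesis using prob_space.prob_space[OF prob_space_haarS, where 'a1 = 'n] by simp
qed

lemma pairing_bound:
 fixes f u :: "'n vect => real"
 assumes f: "cont0 Sph f" and u: "cont0 Sph u" and le: "!!x. x : Sph ==> \<bar>f x\<bar> <= e"
 shows "\<bar>\<integral>x. f x * u x \<partial>haarS\<bar> <= e * (LINT x|haarS. \<bar>u x\<bar>)"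
proof -
 have au: "cont0 Sph (%x. \<bar>u x\<bar>)" using u by (auto simp: cont0_def intro!: continuous_intros)
 have fu: "cont0 Sph (%x. f x * u x)" using f u by (rule cont0_mult)
 then have afu: "cont0 Sph (%x. \<bar>f x * u x\<bar>)" by (auto simp: cont0_def intro!: continuous_intros)
 have "\<bar>\<integral>x. f x * u x \<partial>haarS\<bar> <= (LINT x|haarS. \<bar>f x * u x\<bar>)" by (rule integral_abs_bound)
 also have "... <= (LINT x|haarS. e * \<bar>u x\<bar>)"
  by (rule int_mono[OF afu cont0_cmult[OF au]]) (use le in "auto simp: abs_mult intro!: mult_right_mono")
 finally show ?thesis by simp
qed

definition ev :: "('n vect => real) => 'n vect => real" where
 "ev f x = (1/2) * f x + (1/2) * f (- x)"

lemma ev_minus [simp]: "ev f (- x) = ev f x"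
 by (simp add: ev_def)

lemma ev_cont0: "cont0 Sph f ==> cont0 Sph (ev f)"
 unfolding ev_def by (intro cont0_add cont0_cmult cont0_minus)

lemma Radon_ev: "cont0 Sph f ==> 1 <= d ==> Radon d (ev f) = Radon d f"
proof
 fix P assume f: "cont0 Sph f" "1 <= d"
 then show "Radon d (ev f) P = Radon d f P"
  using Radon_linear[of P d f "%x. f (- x)" "1/2" "1/2"] Radon_even[of P d f] cont0_minus[of f]
  by (cases "P : Grass d") (auto simp: bm_Sph ev_def[abs_def], auto simp: Radon_def)
qed

lemma integral_ev:
 assumes f: "cont0 Sph f" and u: "cont0 Sph u" "!!x. u (- x) = u x"
 shows "(LINT x|haarS. ev f x * u x) = (LINT x|haarS. f x * u x)"
 using integral_minus[OF cont0_mult[OF f u(1)]] int_lin[OF f cont0_minus[OF f] u(1), of "1/2" "1/2"]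
 by (simp add: ev_def u(2))

text \<open>Positivity is applied to \<open>f\<close> minus the least value of
  \<open>Radon m f\<close>, attained on the compact Grassmannian. Since \<open>u\<close> has
  integral one, the pairing is at least that minimum.\<close>

lemma herding_step:
 fixes u f :: "'n vect => real"
 assumes u: "cont0 Sph u" "(LINT x|haarS. u x) = 1"
  and pos: "!!f. cont0 Sph f ==> (!!P. P : Grass m ==> 0 <= Radon m f P) ==> 0 <= (LINT x|haarS. f x * u x)"
  and f: "cont0 Sph f"
 shows "EX P:Grass m. Radon m f P <= (LINT x|haarS. f x * u x)"
proof -
 define c where "c = (LINT x|haarS. f x * u x)"
 obtain P0 :: "'n matr" where "P0 : Grass m" using Grass_mono_ex[OF dims(1)] by blast
 then obtain P1 where P1: "P1 : Grass m" "!!P. P : Grass m ==> Radon m f P1 <= Radon m f P"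
  using continuous_attains_inf[OF compact_Grass, of m "Radon m f"] Radon_cont0[OF mk(2) f]
  by (auto simp: cont0_def)
 let ?z = "restr Sph (%_ :: 'n vect. Radon m f P1)"
 have z: "cont0 Sph ?z" by (rule cont0_const)
 have "0 <= (LINT x|haarS. (f x - ?z x) * u x)"
  by (rule pos[OF cont0_diff[OF f z]])
  (use P1 mk(2) bm_Sph[OF f] bm_Sph[OF z] in "simp add: Radon_diff Radon_const")
 also have "... = c - (LINT x|haarS. ?z x * u x)"
  using int_lin[OF f z u(1), of 1 "-1"] by (simp add: c_def)
 also have "(%x. ?z x * u x) = (%x. Radon m f P1 * u x)"
  using u(1) by (auto simp: restr_def cont0_def fun_eq_iff)
 finally show ?thesis using P1(1) u(2) by (auto simp: c_def intro!: bexI[of _ P1])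
qed

text \<open>Choosing the next subspace greedily keeps the squared error of the partial sums linear in the
  number of points, so the empirical averages converge.\<close>

lemma herding:
 fixes u :: "'n vect => real"
 assumes u: "cont0 Sph u" "(LINT x|haarS. u x) = 1"
  and pos: "!!f. cont0 Sph f ==> (!!P. P : Grass m ==> 0 <= Radon m f P) ==> 0 <= (LINT x|haarS. f x * u x)"
  and e: "0 < e"
 shows "EX r p. 0 < r & (ALL i. p i : (Grass m :: 'n matr set)) & (ALL f. cont0 Sph f -->
  \<bar>(SUM i<r. Radon m (Zon \<beta> N f) (p i)) / real r - (LINT x|haarS. Zon \<beta> N f x * u x)\<bar>
  <= e * ((LINT x|haarS. f x * f x) + 1))"
proof -
 obtain c :: "nat => real" where
  c: "!!P y i. P : Grass m ==> Radon m (restr Sph (%x. (x \<bullet> y) ^ (2 * i))) P = c i * norm (P *v (y :: 'n vect)) ^ (2 * i)"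
 proof (rule Radon_moments[OF mk(2) dims(1)])
  fix c :: "nat => real"
  assume "!!P y i. P : Grass m ==> Radon m (restr Sph (%x. (x \<bullet> y) ^ (2 * i))) P = c i * norm (P *v (y :: 'n vect)) ^ (2 * i)"
  then show thesis by (rule that)
 qed
 \<comment> \<open>Represents evaluation of \<open>Radon m (Zon \<beta> N f)\<close> at
   \<open>P\<close> as an L2 pairing with \<open>f\<close>, as \<open>U\<close> does for the target
   functional. The zonal smoothing is what makes these representers functions bounded uniformly in
   \<open>P\<close>.\<close>
 define q where "q P = restr Sph (%y :: 'n vect. SUM i<=N. \<beta> i * c i * norm (P *v y) ^ (2 * i))" for P :: "'n matr"
 have cq: "cont0 Sph (q P)" for P unfolding q_def by (intro cont0_restr continuous_intros)
 have Rq: "Radon m (Zon \<beta> N f) P = (LINT y|haarS. f y * q P y)" if "P : Grass m" "cont0 Sph f" for P f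
 proof -
  have "(%y. (SUM i<=N. \<beta> i * c i * norm (P *v y) ^ (2 * i)) * f y) = (%y. f y * q P y)"
  using that(2) by (auto simp: q_def restr_def cont0_def fun_eq_iff)
  then show ?thesis using Radon_Zon[OF that(1) mk(2) that(2) c[OF that(1)]] by simp
 qed
 define U where "U = Zon \<beta> N u"
 have cU: "cont0 Sph U" unfolding U_def by (rule Zon_cont0[OF bm_Sph[OF u(1)]])
 have ZU: "(LINT x|haarS. Zon \<beta> N f x * u x) = (LINT x|haarS. f x * U x)" if "cont0 Sph f" for f
  using Zon_selfadjoint[OF bm_Sph[OF that] bm_Sph[OF u(1)], of \<beta> N] by (simp add: U_def mult.commute)
 obtain BU where BU: "!!x. \<bar>U x\<bar> <= BU" using bmE[OF bm_Sph[OF cU]] by blast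
 define C where "C = ((SUM i<=N. \<bar>\<beta> i * c i\<bar>) + BU)\<^sup>2"
 have qC: "(q P y - U y)\<^sup>2 <= C" if P: "P : Grass m" for P y
 proof -
  have "\<bar>q P y\<bar> <= (SUM i<=N. \<bar>\<beta> i * c i\<bar>)"
  proof (cases "y : Sph")
  case True
  have "norm (P *v y) <= 1"
  using proj_norm_le[OF Grass_oproj[OF P], of y] True by (simp add: Sph_norm)
  then have "\<bar>\<beta> i * c i * norm (P *v y) ^ (2 * i)\<bar> <= \<bar>\<beta> i * c i\<bar> * 1" for i
  unfolding abs_mult[of "\<beta> i * c i"] by (intro mult_left_mono) (auto intro!: power_le_one)
  then have "(SUM i<=N. \<bar>\<beta> i * c i * norm (P *v y) ^ (2 * i)\<bar>) <= (SUM i<=N. \<bar>\<beta> i * c i\<bar>)"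
  by (intro sum_mono) simp
  moreover have "\<bar>q P y\<bar> <= (SUM i<=N. \<bar>\<beta> i * c i * norm (P *v y) ^ (2 * i)\<bar>)"
  using True by (simp add: q_def sum_abs)
  ultimately show ?thesis by linarith
  qed (auto simp: q_def restr_def intro: sum_nonneg)
  then have "\<bar>q P y - U y\<bar> <= (SUM i<=N. \<bar>\<beta> i * c i\<bar>) + BU" using BU[of y] by linarith
  then show ?thesis unfolding C_def by (subst abs_le_square_iff[symmetric]) linarith
 qed
 define S where "S p r x = (SUM i<r. q (p i) x - U x)" for p and r :: nat and x
 have cS: "cont0 Sph (S p r)" for p r unfolding S_def by (intro cont0_sum cont0_diff cq cU)
 have "EX p. (ALL i. p i : Grass m) & (LINT x|haarS. S p r x * S p r x) <= r * C" for r
 proof (induction r)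
  case 0
  obtain P0 :: "'n matr" where "P0 : Grass m" using Grass_mono_ex[OF dims(1)] by blast
  then show ?case by (intro exI[of _ "%_. P0"]) (simp add: S_def)
 next
  case (Suc r)
  then obtain p where p: "!!i. p i : Grass m" "(LINT x|haarS. S p r x * S p r x) <= r * C" by blast
  define F where "F = S p r"
  have cF: "cont0 Sph F" unfolding F_def by (rule cS)
  \<comment> \<open>Applied to the current error \<open>F\<close> itself: the cross term with the
    increment \<open>D\<close> is then non-positive, and the squared error grows by at most
    \<open>C\<close>.\<close>
  obtain P where P: "P : Grass m" "Radon m (Zon \<beta> N F) P <= (LINT x|haarS. Zon \<beta> N F x * u x)"
  using herding_step[OF u pos Zon_cont0[OF bm_Sph[OF cF]]] by blast
  define D where "D x = q P x - U x" for x
  have cD: "cont0 Sph D" unfolding D_def by (intro cont0_diff cq cU)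
  have FD: "(LINT x|haarS. F x * D x) <= 0"
  using P(2) int_lin[OF cq cU cF, of 1 P "-1"] unfolding ZU[OF cF] Rq[OF P(1) cF]
  by (simp add: D_def mult.commute)
  have D2: "(LINT x|haarS. D x * D x) <= C"
  proof -
  have "(LINT x|haarS. D x * D x) <= (LINT x|haarS. restr Sph (%_ :: 'n vect. C) x)"
  by (rule int_mono[OF cont0_mult[OF cD cD] cont0_const]) (use qC[OF P(1)] in "simp add: D_def power2_eq_square")
  then show ?thesis by (simp add: int_const)
  qed
  have S': "S (p(r := P)) (Suc r) = (%x. 1 * F x + 1 * D x)"
  by (simp add: S_def F_def D_def fun_eq_iff)
  have cFD: "cont0 Sph (%x. 1 * F x + 1 * D x)" by (intro cont0_add cont0_cmult cF cD)
  have "(LINT x|haarS. (1 * F x + 1 * D x) * (1 * F x + 1 * D x))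
  = (LINT x|haarS. F x * F x) + 2 * (LINT x|haarS. F x * D x) + (LINT x|haarS. D x * D x)"
  using int_lin[OF cF cD cFD, of 1 1] int_lin[OF cF cD cF, of 1 1] int_lin[OF cF cD cD, of 1 1]
  by (simp add: mult.commute)
  then have "(LINT x|haarS. S (p(r := P)) (Suc r) x * S (p(r := P)) (Suc r) x) <= Suc r * C"
  unfolding S' using p(2) FD D2 by (simp add: F_def algebra_simps)
  moreover have "ALL i. (p(r := P)) i : Grass m" using p(1) P(1) by simp
  ultimately show ?case by blast
 qed
 then have ex: "EX p. (ALL i. p i : Grass m) & (LINT x|haarS. S p r x * S p r x) <= r * C" for r by blast
 \<comment> \<open>A squared error of at most \<open>r * C\<close> becomes at most
   \<open>C / r\<close> after division by the number of points, to be below the square of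
   \<open>e\<close>.\<close>
 obtain r :: nat where r: "real r > C / e\<^sup>2" "0 < r"
  using reals_Archimedean2[of "max 0 (C / e\<^sup>2)"] by (auto simp: max_def split: if_splits)
 obtain p where p: "!!i. p i : Grass m" "(LINT x|haarS. S p r x * S p r x) <= r * C" using ex[of r] by blast
 have "\<bar>(SUM i<r. Radon m (Zon \<beta> N f) (p i)) / real r - (LINT x|haarS. Zon \<beta> N f x * u x)\<bar>
  <= e * ((LINT x|haarS. f x * f x) + 1)" if f: "cont0 Sph f" for f
 proof -
  define s where "s x = S p r x / r" for x
  have cs: "cont0 Sph s" using cont0_cmult[OF cS, of "1 / r" p r] by (simp add: s_def[abs_def])
  have ss: "(LINT x|haarS. s x * s x) <= e\<^sup>2"
  proof -
  have "(LINT x|haarS. s x * s x) = (LINT x|haarS. S p r x * S p r x) / (r * r)" by (simp add: s_def)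
  also have "... <= (r * C) / (r * r)" by (rule divide_right_mono[OF p(2)]) simp
  also have "... = C / r" using r(2) by simp
  also have "... <= e\<^sup>2" using r e by (simp add: field_simps)
  finally show ?thesis .
  qed
  \<comment> \<open>Cauchy-Schwarz in additive form: the square of \<open>e * f - t * s\<close> is
    integrated, with \<open>t\<close> equal to 1 and to -1 for the two signs.\<close>
  have fs: "2 * (t * (LINT x|haarS. f x * s x)) <= e * (LINT x|haarS. f x * f x) + e" if t: "t * t = 1" for t
  proof -
  define w where "w x = e * f x + (- t) * s x" for x
  have cw: "cont0 Sph w" unfolding w_def by (intro cont0_add cont0_cmult f cs)
  have "0 <= (LINT x|haarS. w x * w x)" by (rule integral_nonneg_AE) simp
  also have "... = e * (LINT x|haarS. f x * w x) + (- t) * (LINT x|haarS. s x * w x)"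
  unfolding w_def by (rule int_lin[OF f cs cw[unfolded w_def]])
  also have "(LINT x|haarS. f x * w x) = e * (LINT x|haarS. f x * f x) - t * (LINT x|haarS. f x * s x)"
  using int_lin[OF f cs f, of e "- t"] by (simp add: w_def mult.commute)
  also have "(LINT x|haarS. s x * w x) = e * (LINT x|haarS. f x * s x) - t * (LINT x|haarS. s x * s x)"
  using int_lin[OF f cs cs, of e "- t"] by (simp add: w_def mult.commute)
  also have "e * (e * (LINT x|haarS. f x * f x) - t * (LINT x|haarS. f x * s x))
  + (- t) * (e * (LINT x|haarS. f x * s x) - t * (LINT x|haarS. s x * s x))
  = e * e * (LINT x|haarS. f x * f x) - 2 * e * t * (LINT x|haarS. f x * s x) + t * t * (LINT x|haarS. s x * s x)"
  by (simp add: algebra_simps)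
  finally have "0 <= e * (e * (LINT x|haarS. f x * f x) - 2 * (t * (LINT x|haarS. f x * s x)) + e)"
  using ss t by (simp add: algebra_simps power2_eq_square)
  then have "0 <= e * (LINT x|haarS. f x * f x) - 2 * (t * (LINT x|haarS. f x * s x)) + e"
  using e by (simp add: zero_le_mult_iff)
  then show ?thesis by linarith
  qed
  have "(SUM i<r. Radon m (Zon \<beta> N f) (p i)) / real r - (LINT x|haarS. Zon \<beta> N f x * u x)
  = (SUM i<r. (LINT x|haarS. f x * q (p i) x) - (LINT x|haarS. f x * U x)) / r"
  unfolding ZU[OF f] Rq[OF p(1) f] using r(2) by (simp add: sum_subtractf diff_divide_distrib)
  also have "(%i. (LINT x|haarS. f x * q (p i) x) - (LINT x|haarS. f x * U x)) = (%i. \<integral>x. f x * (q (p i) x - U x) \<partial>haarS)"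
  using int_lin[OF cq cU f, of 1 _ "-1"] by (simp add: mult.commute fun_eq_iff)
  also have "(SUM i<r. \<integral>x. f x * (q (p i) x - U x) \<partial>haarS) = (LINT x|haarS. f x * S p r x)"
  unfolding S_def sum_distrib_left
  by (rule Bochner_Integration.integral_sum[symmetric]) (intro integrable_haarS bm_Sph cont0_mult f cont0_diff cq cU)
  finally have eq: "(SUM i<r. Radon m (Zon \<beta> N f) (p i)) / real r - (LINT x|haarS. Zon \<beta> N f x * u x) = (LINT x|haarS. f x * s x)"
  by (simp add: s_def)
  have "0 <= e * (LINT x|haarS. f x * f x)" using e by (intro mult_nonneg_nonneg integral_nonneg_AE) auto
  then show ?thesis unfolding eq using fs[of 1] fs[of "-1"] e by (simp add: algebra_simps)
 qed
 then show ?thesis using p(1) r(2) by blast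
qed

text \<open>For each \<open>N\<close>, herding supplies finitely many planes whose averages
  reproduce the pairing with zonal averages of order \<open>N\<close> up to a multiple of
  \<open>1 / Suc N\<close>. A weak limit of these empirical measures works for even
  \<open>f\<close>, since zonal averages of even functions converge uniformly; both sides see only
  the even part of \<open>f\<close>.\<close>

lemma representing_prob:
 fixes u :: "'n vect => real"
 assumes u: "cont0 Sph u" "!!x. u (- x) = u x" "(LINT x|haarS. u x) = 1"
  and pos: "!!f. cont0 Sph f ==> (!!P. P : Grass m ==> 0 <= Radon m f P) ==> 0 <= (LINT x|haarS. f x * u x)"
 shows "EX M. fin_meas_on (Grass m) M & (ALL f. cont0 Sph f --> (LINT x|haarS. f x * u x) = (LINT P|M. Radon m f P))"
proof -
 define good where "good N r p \<longleftrightarrow> 0 < r & (ALL i. p i : (Grass m :: 'n matr set)) & (ALL f. cont0 Sph f -->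
  \<bar>(SUM i<r. Radon m (Zon (b N) N f) (p i)) / real r - (LINT x|haarS. Zon (b N) N f x * u x)\<bar>
  <= 1 / real (Suc N) * ((LINT x|haarS. f x * f x) + 1))" for N r p
 have "EX r p. good N r p" for N unfolding good_def by (rule herding[OF u(1,3) pos]) auto
 then obtain r p where good: "!!N. good N (r N) (p N)" by metis
 have r: "!!N. 0 < r N" and p: "!!N i. p N i : (Grass m :: 'n matr set)"
  and rp: "!!N f. cont0 Sph f ==>
  \<bar>(SUM i<r N. Radon m (Zon (b N) N f) (p N i)) / real (r N) - (LINT x|haarS. Zon (b N) N f x * u x)\<bar>
  <= 1 / real (Suc N) * ((LINT x|haarS. f x * f x) + 1)"
  using good unfolding good_def by blast+
 obtain M s where M: "fin_meas_on (Grass m) M" and s: "strict_mono (s :: nat => nat)"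
  and lim: "!!h. cont0 (Grass m) h ==> (%j. (SUM i<r (s j). h (p (s j) i)) / r (s j)) \<longlonglongrightarrow> (LINT x|M. h x)"
 proof (rule empirical_limit[of "Grass m :: 'n matr set" p r])
  show "compact (Grass m :: 'n matr set)" by (rule compact_Grass)
  show "p j i : Grass m" for j i by (rule p)
  show "0 < r j" for j by (rule r)
  fix M and s :: "nat => nat"
  assume "fin_meas_on (Grass m :: 'n matr set) M" "strict_mono s"
  "!!h. cont0 (Grass m) h ==> (%j. (SUM i<r (s j). h (p (s j) i)) / r (s j)) \<longlonglongrightarrow> (LINT x|M. h x)"
  then show thesis by (rule that)
 qed
 have even: "(LINT x|haarS. f x * u x) = (LINT P|M. Radon m f P)" if f: "cont0 Sph f" "!!x. f (- x) = f x" for f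
 proof -
  let ?Z = "%N. Zon (b N) N f"
  define J where "J = (LINT x|haarS. \<bar>u x\<bar>)"
  define A where "A = (LINT x|haarS. f x * f x)"
  have J: "0 <= J" unfolding J_def by (rule integral_nonneg_AE) simp
  have cZ: "cont0 Sph (?Z N)" for N by (rule Zon_cont0[OF bm_Sph[OF f(1)]])
  have "(%j. (SUM i<r (s j). Radon m f (p (s j) i)) / r (s j)) \<longlonglongrightarrow> (LINT x|haarS. f x * u x)"
  proof (rule LIMSEQ_I)
  fix e :: real assume e: "0 < e"
  define d where "d = e / 3 / (J + 1)"
  have d: "0 < d" using e J by (simp add: d_def)
  have "d + d * J = d * (J + 1)" by (simp add: algebra_simps)
  also have "... = e / 3" using J unfolding d_def by (intro nonzero_eq_divide_eq[THEN iffD1, OF _ refl]) auto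
  finally have dJ: "d + d * J = e / 3" .
  obtain N0 where N0: "!!N x. N \<ge> N0 ==> x : Sph ==> \<bar>?Z N x - f x\<bar> < d"
  using Zon_tendsto[OF f d] by blast
  obtain N1 :: nat where N1: "3 * (A + 1) / e < real N1" using reals_Archimedean2 by blast
  have "norm ((SUM i<r (s j). Radon m f (p (s j) i)) / r (s j) - (LINT x|haarS. f x * u x)) < e"
  if "j \<ge> max N0 N1" for j
  proof -
  define N where "N = s j"
  have N: "N \<ge> N0" "N \<ge> N1" using that seq_suble[OF s, of j] by (auto simp: N_def)
  have le: "\<bar>?Z N x - f x\<bar> <= d" if "x : Sph" for x using N0[OF N(1) that] by simp
  have c: "cont0 Sph (%x. ?Z N x - f x)" by (rule cont0_diff[OF cZ f(1)])
  have 1: "\<bar>(LINT x|haarS. ?Z N x * u x) - (LINT x|haarS. f x * u x)\<bar> <= d * J"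
  using pairing_bound[OF c u(1) le] int_lin[OF cZ f(1) u(1), of 1 N "-1"] by (simp add: J_def)
  have "\<bar>Radon m (?Z N) (p N i) - Radon m f (p N i)\<bar> <= d" for i
  using Radon_bound[OF p mk(2) bm_Sph[OF c] le]
  Radon_diff[OF p mk(2) bm_Sph[OF cZ] bm_Sph[OF f(1)]] by simp
  then have "(SUM i<r N. \<bar>Radon m (?Z N) (p N i) - Radon m f (p N i)\<bar>) <= r N * d"
  using sum_bounded_above[of "{..<r N}" _ d] by simp
  then have "\<bar>(SUM i<r N. Radon m (?Z N) (p N i)) - (SUM i<r N. Radon m f (p N i))\<bar> <= r N * d"
  unfolding sum_subtractf[symmetric] by (rule order_trans[OF sum_abs])
  then have 2: "\<bar>(SUM i<r N. Radon m (?Z N) (p N i)) / r N - (SUM i<r N. Radon m f (p N i)) / r N\<bar> <= d"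
  unfolding diff_divide_distrib[symmetric] using r[of N] by (simp add: divide_le_eq mult.commute)
  have A: "0 <= A" unfolding A_def by (rule integral_nonneg_AE) simp
  have "1 / real (Suc N) * (A + 1) <= e / 3"
  proof -
  have "3 * (A + 1) < e * real N1" using N1 e by (simp add: field_simps)
  also have "... <= e * Suc N" using N(2) e by (intro mult_left_mono) auto
  finally show ?thesis by (simp add: field_simps)
  qed
  then have 3: "\<bar>(SUM i<r N. Radon m (?Z N) (p N i)) / r N - (LINT x|haarS. ?Z N x * u x)\<bar> <= e / 3"
  using rp[OF f(1), of N] unfolding A_def[symmetric] by linarith
  show ?thesis using 1 2 3 dJ e unfolding N_def[symmetric] real_norm_def by linarith
  qed
  then show "EX no. ALL j>=no. norm ((SUM i<r (s j). Radon m f (p (s j) i)) / r (s j) - (LINT x|haarS. f x * u x)) < e"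
  by blast
  qed
  then show ?thesis using lim[OF Radon_cont0[OF mk(2) f(1)]] LIMSEQ_unique by blast
 qed
 have "(LINT x|haarS. f x * u x) = (LINT P|M. Radon m f P)" if f: "cont0 Sph f" for f
  using even[OF ev_cont0[OF f] ev_minus] Radon_ev[OF f mk(2)] integral_ev[OF f u(1,2)] by simp
 then show ?thesis using M by blast
qed

lemma representing_measure:
 fixes u :: "'n vect => real"
 assumes u: "cont0 Sph u" "!!x. u (- x) = u x" "0 < (LINT x|haarS. u x)"
  and pos: "!!f. cont0 Sph f ==> (!!P. P : Grass m ==> 0 <= Radon m f P) ==> 0 <= (LINT x|haarS. f x * u x)"
 shows "EX M. fin_meas_on (Grass m) M & (ALL f. cont0 Sph f --> (LINT x|haarS. f x * u x) = (LINT P|M. Radon m f P))"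
proof -
 define a where "a = (LINT x|haarS. u x)"
 have a: "0 < a" using u(3) by (simp add: a_def)
 let ?u = "%x. (1 / a) * u x"
 have "EX M. fin_meas_on (Grass m) M & (ALL f. cont0 Sph f --> (LINT x|haarS. f x * ?u x) = (LINT P|M. Radon m f P))"
 proof (rule representing_prob)
  show "(LINT x|haarS. ?u x) = 1" using a by (simp add: a_def)
  show "0 <= (LINT x|haarS. f x * ?u x)" if "cont0 Sph f" "!!P. P : Grass m ==> 0 <= Radon m f P" for f
  using pos[OF that] a by simp
 qed (use u in \<open>auto intro: cont0_cmult[of _ _ "1 / a", simplified]\<close>)
 then obtain M where M: "fin_meas_on (Grass m) M"
  "!!f. cont0 Sph f ==> (LINT x|haarS. f x * ?u x) = (LINT P|M. Radon m f P)" by blast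
 let ?M = "density M (%_. ennreal a)"
 have M': "sets M = sets borel" "finite_measure M" "emeasure M (UNIV - Grass m) = 0"
  using M(1) by (auto simp: fin_meas_on_def)
 have sp: "space M = UNIV" using sets_eq_imp_space_eq[OF M'(1)] by simp
 have "fin_meas_on (Grass m) ?M"
  using M' sp finite_measure.emeasure_finite[OF M'(2), of UNIV]
  by (auto simp: fin_meas_on_def emeasure_density_const ennreal_mult_eq_top_iff intro!: finite_measureI)
 moreover have "(LINT x|haarS. f x * u x) = (LINT P|?M. Radon m f P)" if f: "cont0 Sph f" for f
 proof -
  have "Radon m f : borel_measurable M"
  using bm_meas[OF bm_Grass[OF Radon_cont0[OF mk(2) f]]] measurable_cong_sets[OF M'(1) refl] by blast
  then have "(LINT P|?M. Radon m f P) = a * (LINT P|M. Radon m f P)"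
  using a by (subst integral_density) auto
  also have "... = (LINT x|haarS. f x * u x)" unfolding M(2)[OF f, symmetric] using a by simp
  finally show ?thesis by simp
 qed
 ultimately show ?thesis by blast
qed

end

section \<open>Cosets of measures\<close>

text \<open>Members of \<open>CS\<close> need not be measurable off the sphere; all integrals of a non-measurable one
  are \<open>0\<close>, so it behaves like the zero function.\<close>

lemma CS_reduce:
 fixes f :: "('n::finite) vect => real"
 assumes f: "f : CS"
 defines "f' \<equiv> if f : borel_measurable borel then restr Sph f else (%x. 0)"
 shows "cont0 Sph f'" "1 <= d ==> Radon d f = Radon d f'"
proof -
 have cr: "cont0 Sph (restr Sph f)" using f by (intro cont0_restr) (simp add: CS_def)
 then show "cont0 Sph f'" by (auto simp: f'_def cont0_def)
 show "Radon d f = Radon d f'" if d: "1 <= d"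
 proof
  fix P
  show "Radon d f P = Radon d f' P"
  proof (cases "P : Grass d")
  case P: True
  obtain e where e: "e : Sph" "P *v e = e" using Grass_unit[OF d P] .
  note s = sigmaE_eq[OF Grass_oproj[OF P] e]
  show ?thesis
  proof (cases "f : borel_measurable borel")
  case True
  have mU: "(%U. U *v e) : borel_measurable (haar P)" by measurable
  have r: "restr Sph f : borel_measurable borel" by (rule bm_meas, rule bm_Sph, rule cr)
  have "integral\<^sup>L (sigmaE P) f = (LINT U|(haar P). f (U *v e))"
  unfolding s by (rule integral_distr[OF mU True])
  also have "... = (LINT U|(haar P). restr Sph f (U *v e))"
  proof (rule integral_cong_AE)
  show "AE U in haar P. f (U *v e) = restr Sph f (U *v e)"
  using AE_haar[OF Grass_oproj[OF P]] by eventually_elim (use e in simp)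
  qed (use measurable_compose[OF mU] True r in auto)
  also have "... = integral\<^sup>L (sigmaE P) (restr Sph f)"
  unfolding s by (rule integral_distr[OF mU r, symmetric])
  finally show ?thesis using P True by (simp add: Radon_def f'_def)
  next
  case False
  then have "\<not> integrable (sigmaE P) f" using borel_measurable_integrable[of "sigmaE P" f] by (auto simp: s)
  then show ?thesis using False by (simp add: Radon_def f'_def not_integrable_integral_eq)
  qed
  qed (simp add: Radon_def)
 qed
qed

context radon_smoothing
begin

abbreviation cG :: "('n matr => real) => bool" where "cG \<equiv> cont0 (Grass m)"

text \<open>Linear and bounded in the maximum norm on continuous functions, with an explicit
  constant. Measures in \<open>MG\<close> and densities are treated alike through this
  notion.\<close>

definition functional :: "(('n matr => real) => real) => bool" where
 "functional A \<longleftrightarrow> (ALL f g s t. cG f --> cG g --> A (%P. s * f P + t * g P) = s * A f + t * A g) \<and>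
  (EX C>=0. ALL f e. cG f --> (ALL P:Grass m. \<bar>f P\<bar> <= e) --> \<bar>A f\<bar> <= C * e)"

text \<open>The relation whose classes correspond to the cosets, by \<open>coset_cong\<close> and
  \<open>coset_eqD\<close>.\<close>

definition eqv :: "(('n matr => real) => real) => (('n matr => real) => real) => bool" where
 "eqv A B \<longleftrightarrow> (ALL f. cont0 Sph f --> A (Radon m f) = B (Radon m f))"

text \<open>Membership in \<open>M_BP\<close> at the level of representatives, tested on the image
  itself rather than on its closure; \<open>coset_M_BP\<close> justifies this.\<close>

definition posR :: "(('n matr => real) => real) => bool" where
 "posR A \<longleftrightarrow> (ALL f. cont0 Sph f --> (ALL P:Grass m. 0 <= Radon m f P) --> 0 <= A (Radon m f))"

definition posI :: "(('n matr => real) => real) => bool" where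
 "posI A \<longleftrightarrow> (ALL f. cont0 Sph f --> (ALL x:Sph. 0 <= f x) --> 0 <= A (Radon m f) & 0 <= A (Iop m (Radon k f)))"

lemma Grass_nonempty: obtains P :: "'n matr" where "P : Grass m"
 using Grass_mono_ex[OF dims(1)] by blast

lemma cG_bm: "cG f ==> bm f"
 by (rule bm_Grass)

lemma cG_Radon: "cont0 Sph f ==> cG (Radon m f)"
 by (rule Radon_cont0[OF mk(2)])

lemma cG_IRadon: "cont0 Sph f ==> cG (Iop m (Radon k f))"
 by (rule Iop_cont0[OF mk(1) Radon_cont0[OF mk(3)]])

lemma functional_cong: "functional A ==> (!!f. cG f ==> B f = A f) ==> functional B"
 unfolding functional_def by (auto simp: cont0_add cont0_cmult)

lemma functional_linear: "functional A ==> cG f ==> cG g ==> A (%P. s * f P + t * g P) = s * A f + t * A g"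
 unfolding functional_def by blast

lemma functional_diff: "functional A ==> cG f ==> cG g ==> A (%P. f P - g P) = A f - A g"
 using functional_linear[of A f g 1 "-1"] by simp

lemma functional_integral:
 assumes "fin_meas_on (Grass m) M" shows "functional (%f. integral\<^sup>L M f)"
proof -
 have M: "sets M = sets borel" "finite_measure M" "emeasure M (UNIV - Grass m) = 0"
  using assms by (auto simp: fin_meas_on_def)
 interpret finite_measure M by (rule M(2))
 have sp: "space M = UNIV" using sets_eq_imp_space_eq[OF M(1)] by simp
 have i: "integrable M f" if "cG f" for f using bm_integrable[OF M(2,1) cG_bm[OF that]] .
 have AE: "AE P in M. P : Grass m"
  by (rule AE_I'[of "UNIV - Grass m"]) (use M sp in "auto simp: null_sets_def")
 have "\<bar>integral\<^sup>L M f\<bar> <= measure M UNIV * e" if f: "cG f" "ALL P:Grass m. \<bar>f P\<bar> <= e" for f e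
 proof -
  have "\<bar>integral\<^sup>L M f\<bar> <= (LINT P|M. \<bar>f P\<bar>)" by (rule integral_abs_bound)
  also have "... <= (LINT P|M. e)"
  by (rule integral_mono_AE) (use AE f(2) i[OF f(1)] in "auto elim!: eventually_mono")
  finally show ?thesis using sp by simp
 qed
 then show ?thesis
  unfolding functional_def using i by (auto intro!: exI[of _ "measure M UNIV"])
qed

lemma functional_minus:
 assumes A: "functional A" and B: "functional B" shows "functional (%f. A f - B f)"
proof -
 obtain C where C: "C \<ge> 0" "!!f e. cG f ==> ALL P:Grass m. \<bar>f P\<bar> <= e ==> \<bar>A f\<bar> <= C * e"
  using A unfolding functional_def by blast
 obtain D where D: "D \<ge> 0" "!!f e. cG f ==> ALL P:Grass m. \<bar>f P\<bar> <= e ==> \<bar>B f\<bar> <= D * e"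
  using B unfolding functional_def by blast
 have "\<bar>A f - B f\<bar> <= (C + D) * e" if "cG f" "ALL P:Grass m. \<bar>f P\<bar> <= e" for f e
  using C(2)[OF that] D(2)[OF that] by (simp add: algebra_simps)
 then have "EX E>=0. ALL f e. cG f --> (ALL P:Grass m. \<bar>f P\<bar> <= e) --> \<bar>A f - B f\<bar> <= E * e"
  using C(1) D(1) by (intro exI[of _ "C + D"]) auto
 moreover have "A (%P. s * f P + t * g P) - B (%P. s * f P + t * g P) = s * (A f - B f) + t * (A g - B g)"
  if "cG f" "cG g" for f g s t
  using functional_linear[OF A that] functional_linear[OF B that] by (simp add: algebra_simps)
 ultimately show ?thesis unfolding functional_def by blast
qed

lemma functional_MG: "A : MG m ==> functional A"
 unfolding MG_def using functional_minus[OF functional_integral functional_integral] by fastforce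

text \<open>The positive and negative parts of \<open>g\<close> serve as densities of the two
  measures. Agreement is stated on continuous functions, which is all that a coset depends
  on.\<close>

lemma densG_MG:
 assumes g: "cG g"
 shows "EX A:MG m. ALL f. cG f --> A f = densG m g f"
proof -
 have H: "finite_measure (haarG m :: 'n matr measure)" "sets (haarG m :: 'n matr measure) = sets borel"
  using finite_haarG[OF dims(1)] by auto
 have ex: "fin_meas_on (Grass m) (density (haarG m) (%P. ennreal (p P))) \<and>
  (ALL f. cG f --> (LINT P|(density (haarG m) (%P. ennreal (p P))). f P) = (LINT P|(haarG m). p P * f P))"
  if p: "bm p" "!!P. 0 <= p P" "!!P. P \<notin> Grass m ==> p P = 0" for p :: "'n matr => real"
 proof -
  let ?D = "density (haarG m) (%P. ennreal (p P))"
  have mp: "p : borel_measurable (haarG m)" "(%P. ennreal (p P)) : borel_measurable (haarG m)"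
  using bm_meas[OF p(1)] by (auto simp: measurable_cong_sets[OF H(2) refl])
  have sG: "Grass m : sets (borel :: 'n matr measure)" by (simp add: borel_Grass)
  have "emeasure ?D UNIV = (\<integral>\<^sup>+P. ennreal (p P) \<partial>haarG m)"
  using mp H(2) sets_eq_imp_space_eq[OF H(2)] by (subst emeasure_density) auto
  also have "... < \<infinity>"
  using bm_integrable[OF H p(1)] p(2) by (subst nn_integral_eq_integral) auto
  finally have fin: "finite_measure ?D"
  using sets_eq_imp_space_eq[OF H(2)] by (intro finite_measureI) auto
  have "emeasure ?D (UNIV - Grass m) = (\<integral>\<^sup>+P. 0 \<partial>(haarG m :: 'n matr measure))"
  proof -
  have "ennreal (p P) * indicator (UNIV - Grass m) P = 0" for P using p(3) by (cases "P : Grass m") auto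
  then show ?thesis using mp H(2) sG by (subst emeasure_density) (auto simp del: indicator_diff mult_eq_0_iff)
  qed
  then have 1: "fin_meas_on (Grass m) ?D" using fin H(2) by (simp add: fin_meas_on_def)
  have "(LINT P|?D. f P) = (LINT P|(haarG m). p P * f P)" if "cG f" for f
  using bm_meas[OF cG_bm[OF that]] mp(1) p(2)
  by (subst integral_density) (auto simp: measurable_cong_sets[OF H(2) refl])
  then show ?thesis using 1 by blast
 qed
 have cp: "cG (%P. max 0 (g P))" "cG (%P. max 0 (- g P))"
  using g by (auto simp: cont0_def intro!: continuous_intros)
 define M1 where "M1 = density (haarG m) (%P. ennreal (max 0 (g P)))"
 define M2 where "M2 = density (haarG m) (%P. ennreal (max 0 (- g P)))"
 have M1: "fin_meas_on (Grass m) M1" "!!f. cG f ==> integral\<^sup>L M1 f = (LINT P|(haarG m). max 0 (g P) * f P)"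
  using ex[OF cG_bm[OF cp(1)]] cp(1) unfolding M1_def by (auto simp: cont0_def)
 have M2: "fin_meas_on (Grass m) M2" "!!f. cG f ==> integral\<^sup>L M2 f = (LINT P|(haarG m). max 0 (- g P) * f P)"
  using ex[OF cG_bm[OF cp(2)]] cp(2) unfolding M2_def by (auto simp: cont0_def)
 have "integral\<^sup>L M1 f - integral\<^sup>L M2 f = densG m g f" if f: "cG f" for f
 proof -
  have "integrable (haarG m) (%P. max 0 (g P) * f P)" "integrable (haarG m) (%P. max 0 (- g P) * f P)"
  by (intro bm_integrable[OF H] cG_bm cont0_mult cp f)+
  then have "integral\<^sup>L M1 f - integral\<^sup>L M2 f = (LINT P|(haarG m). max 0 (g P) * f P - max 0 (- g P) * f P)"
  by (simp add: M1(2)[OF f] M2(2)[OF f])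
  also have "... = densG m g f"
  unfolding densG_def by (rule integral_eqI) (auto simp: max_def)
  finally show ?thesis .
 qed
 moreover have "(%f. integral\<^sup>L M1 f - integral\<^sup>L M2 f) : MG m" using M1(1) M2(1) unfolding MG_def by blast
 ultimately show ?thesis by (intro bexI[of _ "%f. integral\<^sup>L M1 f - integral\<^sup>L M2 f"]) auto
qed

lemma functional_densG: "cG g ==> functional (densG m g)"
proof -
 assume "cG g"
 then obtain A where "A : MG m" "ALL f. cG f --> A f = densG m g f" using densG_MG by blast
 then show ?thesis using functional_cong[OF functional_MG, of A "densG m g"] by simp
qed

definition in_clos :: "('n matr => real) => bool" where
 "in_clos F \<longleftrightarrow> cG F & (ALL e>0. EX h. cont0 Sph h & (ALL P:Grass m. \<bar>F P - Radon m h P\<bar> < e))"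

lemma in_clos_IRadon: "cont0 Sph f ==> in_clos (Iop m (Radon k f))"
 unfolding in_clos_def using cG_IRadon Iop_Radon_closure[OF mk] by blast

lemma functional_approx:
 assumes A: "functional A" and F: "cG F"
  and ex: "!!e. 0 < e ==> EX G. cG G & 0 <= A G & (ALL P:Grass m. \<bar>F P - G P\<bar> <= e)"
 shows "0 <= A F"
proof (rule ccontr)
 obtain C where C: "C \<ge> 0" "!!f e. cG f ==> ALL P:Grass m. \<bar>f P\<bar> <= e ==> \<bar>A f\<bar> <= C * e"
  using A unfolding functional_def by blast
 assume "\<not> 0 <= A F"
 then have neg: "A F < 0" by simp
 define e where "e = - A F / (2 * (C + 1))"
 have e: "0 < e" unfolding e_def using neg C(1) by (intro divide_pos_pos) auto
 obtain G where G: "cG G" "0 <= A G" "ALL P:Grass m. \<bar>F P - G P\<bar> <= e" using ex[OF e] by blast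
 have "\<bar>A F - A G\<bar> <= C * e" using C(2)[OF cont0_diff[OF F G(1)] G(3)] functional_diff[OF A F G(1)] by simp
 also have "... <= (C + 1) * e" using e by (intro mult_right_mono) auto
 also have "... = - A F / 2" using C unfolding e_def by (simp add: field_simps)
 finally show False using G(2) neg by linarith
qed

text \<open>An approximant of a non-negative \<open>F\<close> is non-negative only up to
  \<open>e / 2\<close>; adding that constant, which lies in the image of \<open>Radon m\<close>,
  repairs this at the price of doubling the error.\<close>

lemma posR_clos:
 assumes A: "functional A" "posR A" and F: "in_clos F" "!!P. P : Grass m ==> 0 <= F P"
 shows "0 <= A F"
proof (rule functional_approx[OF A(1)])
 show "cG F" using F(1) by (simp add: in_clos_def)
 fix e :: real assume "0 < e"
 then have e: "0 < e / 2" by simp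
 then obtain h where h: "cont0 Sph h" "!!P. P : Grass m ==> \<bar>F P - Radon m h P\<bar> < e / 2"
  using F(1) unfolding in_clos_def by blast
 let ?h = "%x. 1 * h x + 1 * restr Sph (%_. e / 2) x"
 have c: "cont0 Sph ?h" by (intro cont0_add cont0_cmult h cont0_const)
 have R: "Radon m ?h P = Radon m h P + e / 2" if "P : Grass m" for P
  using Radon_linear[OF that mk(2) bm_Sph[OF h(1)] bm_Sph[OF cont0_const], of 1 1] Radon_const[OF that mk(2)]
  by simp
 have "0 <= A (Radon m ?h)"
  using A(2) c unfolding posR_def
 proof (elim allE impE)
  show "ALL P:Grass m. 0 <= Radon m ?h P"
  proof
  fix P :: "'n matr" assume P: "P : Grass m"
  show "0 <= Radon m ?h P" unfolding R[OF P] using F(2)[OF P] h(2)[OF P] by linarith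
  qed
 qed
 moreover have "\<bar>F P - Radon m ?h P\<bar> <= e" if P: "P : Grass m" for P
  unfolding R[OF P] using h(2)[OF P] e by linarith
 ultimately show "EX G. cG G & 0 <= A G & (ALL P:Grass m. \<bar>F P - G P\<bar> <= e)"
  using cG_Radon[OF c] by blast
qed

text \<open>For non-negative \<open>f\<close>, \<open>Iop m (Radon k f)\<close> is non-negative and
  lies in the closure of the image of \<open>Radon m\<close>, so positivity on the image controls
  both conditions.\<close>

lemma posR_imp_posI:
 assumes A: "functional A" "posR A" shows "posI A"
 unfolding posI_def
proof (intro allI impI conjI)
 fix f :: "'n vect => real" assume f: "cont0 Sph f" "ALL x:Sph. 0 <= f x"
 have R0: "0 <= Radon d f P" if "1 <= d" "P : Grass d" for d and P
  using Radon_mono[OF that(2,1) bm_const[of 0] bm_Sph[OF f(1)]] f(2) that by (simp add: Radon_def)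
 then show "0 <= A (Radon m f)" using A(2) f(1) mk(2) unfolding posR_def by blast
 show "0 <= A (Iop m (Radon k f))"
  by (rule posR_clos[OF A in_clos_IRadon[OF f(1)]])
  (use R0[OF mk(3)] perp_Grass[OF mk(1)] in "auto simp: Iop_def")
qed

text \<open>Applied to \<open>Iop m (Radon k f)\<close>, this makes the second condition in
  \<open>posI\<close> independent of the representative. The approximation is run for the difference
  of the functionals in both orders.\<close>

lemma eqv_clos:
 assumes A: "functional A" and B: "functional B" and AB: "eqv A B" and F: "in_clos F"
 shows "A F = B F"
proof -
 have F': "cG F" using F by (simp add: in_clos_def)
 have "0 <= A F - B F" if A: "functional A" and B: "functional B" and AB: "eqv A B" for A B
 proof (rule functional_approx[OF functional_minus[OF A B] F'])
  fix e :: real assume "0 < e"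
  then obtain h where "cont0 Sph h" "ALL P:Grass m. \<bar>F P - Radon m h P\<bar> < e" using F unfolding in_clos_def by blast
  then show "EX G. cG G & 0 <= A G - B G & (ALL P:Grass m. \<bar>F P - G P\<bar> <= e)"
  using AB cG_Radon[of h] unfolding eqv_def by (intro exI[of _ "Radon m h"]) force
 qed
 from this[OF A B AB] this[OF B A] AB show ?thesis by (simp add: eqv_def)
qed

lemma posR_cong: "eqv A B ==> posR A \<longleftrightarrow> posR B"
 unfolding posR_def eqv_def by auto

lemma posI_cong: "functional A ==> functional B ==> eqv A B ==> posI A \<longleftrightarrow> posI B"
 unfolding posI_def using eqv_clos[of A B] in_clos_IRadon by (auto simp: eqv_def)

lemma CS_Radon: "f : CS ==> EX f'. cont0 Sph f' & (ALL d>=1. Radon d f = Radon d f') & ((ALL x:Sph. 0 <= f x) --> (ALL x:Sph. 0 <= f' x))"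
 for f :: "'n vect => real"
 using CS_reduce[of f]
 by (intro exI[of _ "if f : borel_measurable borel then restr Sph f else (%x. 0)"]) auto

lemma cont0_CS: "cont0 Sph f ==> f : CS"
 by (simp add: cont0_def CS_def)

lemma eqv_CS: "eqv A B \<longleftrightarrow> (ALL f:CS. A (Radon m f) = B (Radon m f))"
 unfolding eqv_def using CS_Radon mk(2) cont0_CS by metis

lemma coset_cong: "eqv A B ==> coset k A = coset k B"
 by (simp add: coset_def dims eqv_CS)

lemma coset_eqD: "A : MG m ==> coset k A = coset k B ==> eqv A B"
 unfolding coset_def dims eqv_CS by auto

lemma coset_M_BP: assumes A: "A : MG m" shows "coset k A : M_BP k \<longleftrightarrow> posR A"
proof
 assume "coset k A : M_BP k"
 then obtain B where B: "coset k A = coset k B"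
  "!!f. f : closG m (ImR m) ==> (ALL P:Grass m. 0 <= f P) ==> 0 <= B f"
  by (auto simp: M_BP_def dims)
 have "posR B"
  unfolding posR_def
 proof (intro allI impI)
  fix f :: "'n vect => real" assume f: "cont0 Sph f" "ALL P:Grass m. 0 <= Radon m f P"
  have "Radon m f : closG m (ImR m)"
  using cG_Radon[OF f(1)] cont0_CS[OF f(1)] unfolding closG_def CG_def cont0_def ImR_def by force
  then show "0 <= B (Radon m f)" using B(2) f(2) by blast
 qed
 then show "posR A" using posR_cong[OF coset_eqD[OF A B(1)]] by blast
next
 assume p: "posR A"
 have "0 <= A f" if f: "f : closG m (ImR m)" "ALL P:Grass m. 0 <= f P" for f
 proof (rule posR_clos[OF functional_MG[OF A] p])
  have "EX h. cont0 Sph h & (ALL P:Grass m. \<bar>f P - Radon m h P\<bar> < e)" if "0 < e" for e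
  proof -
  obtain h1 where h1: "h1 : ImR m" "ALL P:Grass m. \<bar>f P - h1 P\<bar> < e"
  using f(1) \<open>0 < e\<close> unfolding closG_def by blast
  then obtain h0 where h0: "h0 : CS" "ALL P:Grass m. \<bar>f P - Radon m h0 P\<bar> < e"
  unfolding ImR_def by blast
  obtain h where "cont0 Sph h" "ALL d>=1. Radon d h0 = Radon d h" using CS_Radon[OF h0(1)] by blast
  then show ?thesis using h0(2) mk(2) by (intro exI[of _ h]) auto
  qed
  then show "in_clos f" using f(1) unfolding in_clos_def by (auto simp: closG_def CG_def cont0_def)
 qed (use f(2) in auto)
 then show "coset k A : M_BP k" using A unfolding M_BP_def dims by blast
qed

lemma posI_CS: "posI A \<longleftrightarrow> nonnegS (Rstar m A) & nonnegS (Rstar k (perpM m A))"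
proof -
 have "(ALL f. cont0 Sph f --> (ALL x:Sph. 0 <= f x) --> 0 <= A (Radon m f) & 0 <= A (Iop m (Radon k f)))
  \<longleftrightarrow> (ALL f:CSplus. 0 <= A (Radon m f) & 0 <= A (Iop m (Radon k f)))" (is "?L \<longleftrightarrow> ?R")
 proof
  assume L: ?L
  show ?R
  proof
  fix f :: "'n vect => real" assume "f : CSplus"
  then obtain f' where "cont0 Sph f'" "ALL d>=1. Radon d f = Radon d f'" "ALL x:Sph. 0 <= f' x"
  using CS_Radon[of f] unfolding CSplus_def by blast
  then show "0 <= A (Radon m f) & 0 <= A (Iop m (Radon k f))" using L mk by simp
  qed
 qed (auto simp: CSplus_def cont0_CS)
 then show ?thesis unfolding posI_def nonnegS_def Rstar_def perpM_def by auto
qed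

lemma coset_M_I: assumes A: "A : MG m" shows "coset k A : M_I k \<longleftrightarrow> posI A"
proof
 assume "coset k A : M_I k"
 then obtain B where B: "coset k A = coset k B" "B : MG m" "posI B"
  by (auto simp: M_I_def dims posI_CS)
 then show "posI A" using posI_cong[OF functional_MG[OF A] functional_MG[OF B(2)] coset_eqD[OF A B(1)]] by blast
next
 assume "posI A"
 then show "coset k A : M_I k" using A unfolding M_I_def dims posI_CS by blast
qed

lemma coset_densG:
 assumes g: "cG g"
 shows "coset k (densG m g) : M_BP k \<longleftrightarrow> posR (densG m g)" "coset k (densG m g) : M_I k \<longleftrightarrow> posI (densG m g)"
  "coset k (densG m g) = coset k A ==> eqv (densG m g) A"
proof -
 obtain B where B: "B : MG m" "ALL f. cG f --> B f = densG m g f" using densG_MG[OF g] by blast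
 have e: "eqv B (densG m g)" using B(2) cG_Radon by (simp add: eqv_def)
 note c = coset_cong[OF e]
 show "coset k (densG m g) : M_BP k \<longleftrightarrow> posR (densG m g)"
  using coset_M_BP[OF B(1)] c posR_cong[OF e] by simp
 show "coset k (densG m g) : M_I k \<longleftrightarrow> posI (densG m g)"
  using coset_M_I[OF B(1)] c posI_cong[OF functional_MG[OF B(1)] functional_densG[OF g] e] by simp
 show "eqv (densG m g) A" if "coset k (densG m g) = coset k A"
  using coset_eqD[OF B(1), of A] c that e by (simp add: eqv_def)
qed

lemma M_BP_subset_M_I: "M_BP k \<subseteq> (M_I k :: (('n matr => real) => real) set set)"
proof
 fix c :: "(('n matr => real) => real) set" assume c: "c : M_BP k"
 then obtain A where "c = coset k A" "A : MG m" by (auto simp: M_BP_def dims)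
 then show "c : M_I k" using c coset_M_BP coset_M_I posR_imp_posI functional_MG by blast
qed

lemma M_equal_iff: "M_BP k = (M_I k :: (('n matr => real) => real) set set) \<longleftrightarrow> (ALL A:MG m. posI A --> posR A)"
proof -
 have "M_I k \<subseteq> (M_BP k :: (('n matr => real) => real) set set)" if "ALL A:MG m. posI A --> posR A"
 proof
  fix c :: "(('n matr => real) => real) set" assume c: "c : M_I k"
  then obtain A where "c = coset k A" "A : MG m" by (auto simp: M_I_def dims)
  then show "c : M_BP k" using c coset_M_BP coset_M_I that by blast
 qed
 then show ?thesis using M_BP_subset_M_I coset_M_BP coset_M_I by blast
qed

lemma Minf_equal_iff: "Minf_BP k = (Minf_I k :: (('n matr => real) => real) set set) \<longleftrightarrow>
  (ALL g:CinfG m. posI (densG m g) --> posR (densG m g))"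
proof -
 have "Minf_I k \<subseteq> (Minf_BP k :: (('n matr => real) => real) set set)" if "ALL g:CinfG m. posI (densG m g) --> posR (densG m g)"
  using that coset_densG(1,2)[OF CinfG_cont0] by (auto simp: Minf_I_def Minf_BP_def Minf_def dims)
 moreover have "posR (densG m g)" if "Minf_BP k = (Minf_I k :: (('n matr => real) => real) set set)"
  "g : CinfG m" "posI (densG m g)" for g
 proof -
  have "coset k (densG m g) : Minf_I k"
  using that coset_densG(2)[OF CinfG_cont0[OF that(2)]] by (auto simp: Minf_I_def Minf_def dims)
  then show ?thesis using that(1) coset_densG(1)[OF CinfG_cont0[OF that(2)]] unfolding Minf_BP_def by blast
 qed
 ultimately show ?thesis using M_BP_subset_M_I unfolding Minf_I_def Minf_BP_def by blast
qed

end

section \<open>L2 estimates for the smoothing operators and the cone\<close>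

context radon_smoothing
begin

abbreviation T :: "nat => ('n matr => real) => 'n matr => real" where "T \<equiv> Top m (real CARD('n))"

definition ip :: "('n matr => real) => ('n matr => real) => real" where
 "ip f g = (LINT P|(haarG m). f P * g P)"

lemma integrable_haarG: "cG f ==> integrable (haarG m) f"
 by (rule bm_integrable[OF finite_haarG(1,2)[OF dims(1)] cG_bm])

lemma ip_commute: "ip f g = ip g f"
 by (simp add: ip_def mult.commute)

lemma ip_add: "cG f ==> cG g ==> cG h ==> ip (%P. s * f P + t * g P) h = s * ip f h + t * ip g h"
 using integrable_haarG[OF cont0_mult, of f h] integrable_haarG[OF cont0_mult, of g h]
 by (simp add: ip_def algebra_simps)

lemma AE_Gr: "AE P in (haarG m :: 'n matr measure). P : Grass m"
proof -
 obtain P :: "'n matr" where "P : Grass m" by (rule Grass_nonempty)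
 then show ?thesis by (rule AE_haarG)
qed

lemma integral_mono_G:
 "cG f ==> cG g ==> (!!P. P : Grass m ==> f P <= g P) ==> (LINT P|(haarG m). f P) <= (LINT P|(haarG m). g P)"
 by (rule integral_mono_AE) (use AE_Gr integrable_haarG in "auto elim!: eventually_mono")

lemma cG_one: "cG (restr (Grass m) (%_. c))"
 by (rule cont0_const)

lemma ip_one: "cG f ==> ip f (restr (Grass m) (%_. 1)) = oneG m f"
 unfolding ip_def oneG_def
 by (rule integral_eqI) (auto simp: restr_def cont0_def)

lemma oneG_one: "oneG m (restr (Grass m) (%_. c) :: 'n matr => real) = c"
proof -
 have "oneG m (restr (Grass m) (%_. c) :: 'n matr => real) = (LINT P|(haarG m :: 'n matr measure). c)"
  unfolding oneG_def
  by (rule integral_cong_AE)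
  (use AE_Gr borel_measurable_integrable[OF integrable_haarG[OF cG_one]] in "auto elim!: eventually_mono")
 then show ?thesis using prob_space.prob_space[OF finite_haarG(3)[OF dims(1)]] by simp
qed

lemma T_cG: "cG f ==> cG (T N f)"
 by (rule Top_cont0[OF dims(1) cG_bm])

lemma T_eq: "cG f ==> P : Grass m ==> T N f P = ip (restr (Grass m) (kern (real CARD('n)) N P)) f / kmass TYPE('n) m (real CARD('n)) N"
 unfolding ip_def by (rule Top_eq)

lemma cG_kern: "cG (restr (Grass m) (kern c N P))"
 by (intro cont0_restr continuous_intros)

lemma T_add: assumes f: "cG f" "cG g" shows "T N (%P. f P + g P) = (%P. T N f P + T N g P)"
proof (rule cont0_ext[of "Grass m"])
 fix P :: "'n matr" assume P: "P : Grass m"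
 show "T N (%P. f P + g P) P = T N f P + T N g P"
  using ip_add[OF f cG_kern, of 1 1] unfolding T_eq[OF f(1) P] T_eq[OF f(2) P] T_eq[OF cont0_add[OF f] P]
  by (simp add: ip_commute add_divide_distrib)
qed (intro T_cG cont0_add f)+

lemma T_selfadjoint: assumes f: "cG f" "cG g" shows "ip (T N f) g = ip f (T N g)"
proof -
 let ?K = "%P Q :: 'n matr. kern (real CARD('n)) N P Q / kmass TYPE('n) m (real CARD('n)) N"
 have "(%y x. ?K x y) = ?K" by (simp add: kern_commute fun_eq_iff)
 then have "kint (Grass m) (Grass m) (haarG m) (%y x. ?K x y) g = kint (Grass m) (Grass m) (haarG m) ?K g"
  by (rule arg_cong[where f = "%k. kint (Grass m) (Grass m) (haarG m) k g"])
 then show ?thesis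
  using kint_fubini[OF compact_Grass compact_Grass compact_kernel_cont cG_bm[OF f(1)] cG_bm[OF f(2)]
  finite_haarG(1,2)[OF dims(1)] finite_haarG(1,2)[OF dims(1)]]
  by (simp add: ip_def Top_def mult.commute[of "g _"])
qed

text \<open>The kernel is bounded on the compact product, so smoothing maps L1 into bounded
  functions; this is what upgrades L2 approximation to uniform approximation.\<close>

lemma T_bound: "EX B>=0. ALL f P. cG f --> \<bar>T N f P\<bar> <= B * (LINT Q|(haarG m). \<bar>f Q\<bar>)"
proof -
 let ?c = "real CARD('n)" and ?z = "kmass TYPE('n) m (real CARD('n)) N"
 obtain P0 :: "'n matr" where P0: "P0 : Grass m" by (rule Grass_nonempty)
 have z: "0 < ?z" using kmass_pos[OF P0 mk(2)] by simp
 have "continuous_on (Grass m \<times> Grass m) (case_prod (kern ?c N) :: 'n matr \<times> 'n matr => real)"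
  unfolding case_prod_beta' by (intro continuous_intros)
 then have "bounded (case_prod (kern ?c N) ` (Grass m \<times> Grass m :: ('n matr \<times> 'n matr) set))"
  by (intro compact_imp_bounded compact_continuous_image compact_Times compact_Grass)
 then obtain K where "0 < K" "ALL x:case_prod (kern ?c N) ` (Grass m \<times> Grass m :: ('n matr \<times> 'n matr) set). norm x <= K"
  unfolding bounded_pos by blast
 then have K: "0 < K" "\<bar>kern ?c N P Q\<bar> <= K" if "P : Grass m" "Q : Grass m" for P Q :: "'n matr"
  using that by (auto simp: ball_simps)
 then have K: "0 < K" "!!P Q. P : (Grass m :: 'n matr set) ==> Q : Grass m ==> \<bar>kern ?c N P Q\<bar> <= K"
  using P0 by blast+
 have "\<bar>T N f P\<bar> <= (K / ?z) * (LINT Q|(haarG m). \<bar>f Q\<bar>)" if f: "cG f" for f P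
 proof (cases "P : Grass m")
  case P: True
  have af: "cG (%Q. \<bar>f Q\<bar>)" using f by (auto simp: cont0_def intro!: continuous_intros)
  have kf: "cG (%Q. restr (Grass m) (kern ?c N P) Q * f Q)" by (rule cont0_mult[OF cG_kern f])
  then have akf: "cG (%Q. \<bar>restr (Grass m) (kern ?c N P) Q * f Q\<bar>)"
  by (auto simp: cont0_def intro!: continuous_intros)
  have "\<bar>ip (restr (Grass m) (kern ?c N P)) f\<bar> <= (LINT Q|(haarG m). \<bar>restr (Grass m) (kern ?c N P) Q * f Q\<bar>)"
  unfolding ip_def by (rule integral_abs_bound)
  also have "... <= (LINT Q|(haarG m). K * \<bar>f Q\<bar>)"
  by (rule integral_mono_G[OF akf cont0_cmult[OF af]]) (use K(2)[OF P] in "auto simp: abs_mult intro!: mult_right_mono")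
  finally have "\<bar>ip (restr (Grass m) (kern ?c N P)) f\<bar> <= K * (LINT Q|(haarG m). \<bar>f Q\<bar>)" by simp
  then show ?thesis unfolding T_eq[OF f P] using z by (simp add: divide_right_mono)
 next
  case False
  then have "T N f P = 0" using T_cG[OF f] by (simp add: cont0_def)
  then show ?thesis using K z by (auto intro!: mult_nonneg_nonneg divide_nonneg_pos integral_nonneg_AE)
 qed
 then show ?thesis using K z by (intro exI[of _ "K / ?z"]) auto
qed

lemma T_tendsto: "cG f ==> 0 < e ==> EX N. ALL P:Grass m. \<bar>T N f P - f P\<bar> < e"
 using Top_approximates[OF mk(2) dims(1), of "real CARD('n)" f e] by auto

definition cone :: "('n matr => real) => bool" where
 "cone h \<longleftrightarrow> (EX g1 g2. cont0 Sph g1 & cont0 Sph g2 & (ALL x:Sph. 0 <= g1 x) & (ALL x:Sph. 0 <= g2 x) \<and>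
  h = (%P. Radon m g1 P + Iop m (Radon k g2) P))"

lemma cone_cG: "cone h ==> cG h"
 unfolding cone_def using cG_Radon cG_IRadon cont0_add by blast

lemma Radon_zero: "Radon d (%x. 0) P = 0"
 by (simp add: Radon_def)

lemma Radon_lin: "cont0 Sph f ==> cont0 Sph g ==> 1 <= d ==> Radon d (%x. s * f x + t * g x) P = s * Radon d f P + t * Radon d g P"
 for f :: "'n vect => real"
 by (cases "P : Grass d") (auto simp: Radon_linear bm_Sph, auto simp: Radon_def)

lemma Radon_nonneg: "cont0 Sph f ==> (ALL x:Sph. 0 <= f x) ==> 1 <= d ==> 0 <= Radon d f P"
 for f :: "'n vect => real"
 using Radon_mono[of P d "%_. 0" f] by (cases "P : Grass d") (auto simp: bm_Sph Radon_zero, auto simp: Radon_def)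

lemma cone_nonneg: "cone h ==> 0 <= h P"
 unfolding cone_def Iop_def using Radon_nonneg mk by fastforce

lemma cont0_zero: "cont0 X (%x. 0)"
 by (simp add: cont0_def)

lemma cone_Radon: "cont0 Sph g ==> ALL x:Sph. 0 <= g x ==> cone (Radon m g)"
 unfolding cone_def by (intro exI[of _ g] exI[of _ "%x. 0"]) (auto simp: Iop_def Radon_zero cont0_zero)

lemma cone_IRadon: "cont0 Sph g ==> ALL x:Sph. 0 <= g x ==> cone (Iop m (Radon k g))"
 unfolding cone_def by (intro exI[of _ g] exI[of _ "%x. 0"]) (auto simp: Radon_zero cont0_zero)

lemma cone_comb:
 assumes h: "cone h" "cone h'" and st: "0 <= s" "0 <= t"
 shows "cone (%P. s * h P + t * h' P)"
proof -
 obtain g1 g2 g1' g2' where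
  g: "cont0 Sph g1" "cont0 Sph g2" "ALL x:Sph. 0 <= g1 x" "ALL x:Sph. 0 <= g2 x" "h = (%P. Radon m g1 P + Iop m (Radon k g2) P)"
  and g': "cont0 Sph g1'" "cont0 Sph g2'" "ALL x:Sph. 0 <= g1' x" "ALL x:Sph. 0 <= g2' x" "h' = (%P. Radon m g1' P + Iop m (Radon k g2') P)"
  using h unfolding cone_def by blast
 show ?thesis
  unfolding cone_def
 proof (intro exI conjI)
  show "cont0 Sph (%x. s * g1 x + t * g1' x)" "cont0 Sph (%x. s * g2 x + t * g2' x)"
  by (intro cont0_add cont0_cmult g g')+
  show "(%P. s * h P + t * h' P) = (%P. Radon m (%x. s * g1 x + t * g1' x) P + Iop m (Radon k (%x. s * g2 x + t * g2' x)) P)"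
  unfolding g(5) g'(5) using Radon_lin[OF g(1) g'(1) mk(2)] Radon_lin[OF g(2) g'(2) mk(3)]
  by (simp add: fun_eq_iff Iop_def algebra_simps)
 qed (use g g' st in auto)
qed

lemma cone_T: assumes "cone h" shows "cone (T N h)"
proof -
 obtain g1 g2 where
  g: "cont0 Sph g1" "cont0 Sph g2" "ALL x:Sph. 0 <= g1 x" "ALL x:Sph. 0 <= g2 x" "h = (%P. Radon m g1 P + Iop m (Radon k g2) P)"
  using assms unfolding cone_def by blast
 have "T N h = (%P. Radon m (Zon (b N) N g1) P + Iop m (Radon k (Zon (b' N) N g2)) P)"
  unfolding g(5) using T_add[OF cG_Radon[OF g(1)] cG_IRadon[OF g(2)]] Top_Radon_m[OF g(1)] Top_Radon_k[OF g(2)] by simp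
 moreover have "ALL x:Sph. 0 <= Zon (b N) N g1 x" "ALL x:Sph. 0 <= Zon (b' N) N g2 x"
  using Zon_nonneg[OF b, of g1] Zon_nonneg[OF b', of g2] g by auto
 ultimately show ?thesis
  unfolding cone_def using Zon_cont0[OF bm_Sph[OF g(1)]] Zon_cont0[OF bm_Sph[OF g(2)]] by blast
qed

text \<open>The non-negative function \<open>(\<bar>w P\<bar> - e)\<^sup>2 / e\<close> is integrated
  over a probability measure; this takes the place of Cauchy-Schwarz.\<close>

lemma L1_L2: assumes w: "cG w" and "0 < e" shows "2 * (LINT P|(haarG m). \<bar>w P\<bar>) <= ip w w / e + e"
proof -
 have aw: "cG (%P. \<bar>w P\<bar>)" using w by (auto simp: cont0_def intro!: continuous_intros)
 let ?r = "%P. (1 / e) * (w P * w P) + restr (Grass m) (%_. e) P"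
 have i: "integrable (haarG m) (%P. w P * w P)" "integrable (haarG m) (restr (Grass m) (%_. e) :: 'n matr => real)"
  by (intro integrable_haarG cont0_mult w cG_one)+
 have "(LINT P|(haarG m). 2 * \<bar>w P\<bar>) <= (LINT P|(haarG m). ?r P)"
 proof (rule integral_mono_G)
  fix P :: "'n matr" assume P: "P : Grass m"
  have "0 <= (\<bar>w P\<bar> - e)\<^sup>2 / e" using assms(2) by simp
  also have "... = (1 / e) * (w P * w P) + e - 2 * \<bar>w P\<bar>"
  using assms(2) by (simp add: field_simps power2_eq_square)
  finally show "2 * \<bar>w P\<bar> <= ?r P" using P by simp
 qed (intro cont0_add cont0_cmult cont0_mult w aw cG_one)+
 also have "(LINT P|(haarG m). ?r P) = (1 / e) * ip w w + oneG m (restr (Grass m) (%_. e) :: 'n matr => real)"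
  using i unfolding ip_def oneG_def by (subst Bochner_Integration.integral_add) auto
 finally show ?thesis using oneG_one[of e] by simp
qed

lemma ip_square: "cG f ==> cG g ==> ip (%P. f P + t * g P) (%P. f P + t * g P) = ip f f + 2 * t * ip f g + t * t * ip g g"
proof -
 assume f: "cG f" and g: "cG g"
 let ?w = "%P. f P + t * g P"
 have w: "cG ?w" by (intro cont0_add cont0_cmult f g)
 have "ip ?w ?w = ip f ?w + t * ip g ?w" using ip_add[OF f g w, of 1 t] by simp
 also have "ip f ?w = ip f f + t * ip f g"
  using ip_add[OF f g f, of 1 t] ip_commute[of f ?w] ip_commute[of g f] by simp
 also have "ip g ?w = ip f g + t * ip g g"
  using ip_add[OF f g g, of 1 t] ip_commute[of g ?w] by simp
 finally show ?thesis by (simp add: algebra_simps)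
qed

lemma ip_self_nonneg: "0 <= ip f f"
 unfolding ip_def by (rule integral_nonneg_AE) simp

end

lemma CS_integral:
 fixes f :: "('n::finite) vect => real"
 shows "f : CS ==> integral\<^sup>L haarS f = integral\<^sup>L haarS (if f : borel_measurable borel then restr Sph f else (%x. 0))"
proof (cases "f : borel_measurable borel")
 case True
 assume "f : CS"
 then have "restr Sph f : borel_measurable borel"
  using CS_reduce(1)[of f] True by (auto intro: bm_meas bm_Sph)
 then have "integral\<^sup>L haarS f = integral\<^sup>L haarS (restr Sph f)"
  using True AE_haarS by (intro integral_cong_AE) (auto simp: measurable_cong_sets[OF sets_haarS refl] elim!: eventually_mono)
 then show ?thesis using True by simp
next
 case False
 then have "\<not> integrable haarS f"
  using borel_measurable_integrable[of haarS f] by (auto simp: measurable_cong_sets[OF sets_haarS refl])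
 then show ?thesis using False by (simp add: not_integrable_integral_eq)
qed

section \<open>Density of the cone and the closure equality\<close>

context radon_smoothing
begin

definition smooth_property :: bool where
 "smooth_property \<longleftrightarrow> (ALL g:CinfG m. posI (densG m g) --> posR (densG m g))"

lemma densG_ip: "densG m g f = ip f g"
 by (simp add: densG_def ip_def)

text \<open>If the \<open>L\<^sup>2\<close> distance of \<open>F\<close> from the cone were positive, the smoothed difference \<open>h - F\<close> for a near
  minimiser \<open>h\<close>, plus a small constant, would be a smooth density non-negative on the cone but negative on \<open>F\<close>.\<close>

lemma cone_L2_dense:
 assumes T2: smooth_property and f: "cont0 Sph f" "ALL P:Grass m. 0 <= Radon m f P" and \<delta>: "0 < \<delta>"
 defines "F \<equiv> Radon m f"
 shows "EX h. cone h & ip (%P. h P + (-1) * F P) (%P. h P + (-1) * F P) < \<delta>"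
proof (rule ccontr)
 assume contra: "\<not> ?thesis"
 define n2 where "n2 h = ip (%P. h P + (-1) * F P) (%P. h P + (-1) * F P)" for h
 have lower: "\<delta> <= n2 h" if "cone h" for h using contra that by (force simp: n2_def not_less)
 have cF: "cG F" unfolding F_def by (rule cG_Radon[OF f(1)])
 have ne: "n2 ` Collect cone ~= {}" using cone_Radon[OF cont0_zero] by blast
 define d2 where "d2 = Inf (n2 ` Collect cone)"
 have bb: "bdd_below (n2 ` Collect cone)" by (rule bdd_belowI[of _ \<delta>]) (use lower in auto)
 have d2: "d2 <= n2 h" if "cone h" for h unfolding d2_def by (rule cInf_lower[OF _ bb]) (use that in auto)
 have d2_pos: "0 < d2" using cInf_greatest[OF ne, of \<delta>] lower \<delta> unfolding d2_def by force
 have near: "EX h. cone h & n2 h < d2 + e" if "0 < e" for e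
  using cInf_lessD[OF ne, of "d2 + e"] that unfolding d2_def by auto
 \<comment> \<open>The L1 norm of \<open>g0\<close> will be at most \<open>(d2 + 2) / 2\<close>, so
   this choice makes the error from replacing \<open>T N F\<close> by \<open>F\<close> at most
   \<open>d2 / 4\<close>.\<close>
 define \<eta> where "\<eta> = d2 / (2 * (d2 + 2))"
 have \<eta>: "0 < \<eta>" using d2_pos by (simp add: \<eta>_def)
 obtain N where N: "!!P. P : Grass m ==> \<bar>T N F P - F P\<bar> < \<eta>" using T_tendsto[OF cF \<eta>] by blast
 obtain B where B: "B \<ge> 0" "!!f P. cG f ==> \<bar>T N f P\<bar> <= B * (LINT Q|(haarG m). \<bar>f Q\<bar>)"
  using T_bound[of N] by blast
 have F0: "0 <= oneG m F" unfolding oneG_def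
  by (rule integral_nonneg_AE) (use AE_Gr f(2) in "auto simp: F_def elim!: eventually_mono")
 \<comment> \<open>Bounds the squared norm of the near minimiser, by the parallelogram law for
   \<open>h = g0 + F\<close>.\<close>
 define H where "H = 2 * (d2 + 1) + 2 * ip F F"
 have H: "0 <= H" using ip_self_nonneg[of F] d2_pos by (simp add: H_def)
 \<comment> \<open>Collects the factors of \<open>ep\<close> in the final estimate; the extra 1
   makes it positive.\<close>
 define S where "S = (1 + H) / 2 + B * oneG m F + 1"
 have S: "0 < S" using H B(1) F0 by (simp add: S_def add_nonneg_pos)
 define ep where "ep = min 1 (d2 / 4 / S)"
 have ep: "0 < ep" "ep <= 1" "ep * S <= d2 / 4"
  using d2_pos S by (auto simp: ep_def min_def field_simps split: if_splits)
 obtain h where h: "cone h" "n2 h < d2 + ep * ep" using near[of "ep * ep"] ep by auto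
 have ch: "cG h" using h(1) by (rule cone_cG)
 define g0 where "g0 P = h P + (-1) * F P" for P
 have c0: "cG g0" unfolding g0_def by (intro cont0_add cont0_cmult ch cF)
 have n2h: "n2 h = ip g0 g0" by (simp add: n2_def g0_def[abs_def])
 \<comment> \<open>First-order condition at an almost minimal \<open>h\<close>: moving by
   \<open>t * h'\<close> stays in the cone, and \<open>t = ep / \<beta>\<close> balances the defect
   \<open>ep * ep\<close> against the quadratic term.\<close>
 have var: "ip g0 h' \<ge> - (ep * \<beta>)" if h': "cone h'" and \<beta>: "0 < \<beta>" "!!P. P : Grass m ==> \<bar>h' P\<bar> <= \<beta>" for h' \<beta>
 proof -
  define t where "t = ep / \<beta>"
  have t: "0 < t" using ep \<beta> by (simp add: t_def)
  have ch': "cG h'" using h' by (rule cone_cG)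
  have hh: "ip h' h' <= \<beta> * \<beta>"
  proof -
  have "ip h' h' <= (LINT P|(haarG m :: 'n matr measure). restr (Grass m) (%_. \<beta> * \<beta>) P)"
  unfolding ip_def
  proof (rule integral_mono_G[OF cont0_mult[OF ch' ch'] cG_one])
  fix P :: "'n matr" assume P: "P : Grass m"
  have "\<bar>h' P\<bar> * \<bar>h' P\<bar> <= \<beta> * \<beta>" using \<beta>(2)[OF P] by (intro mult_mono) auto
  then show "h' P * h' P <= restr (Grass m) (%_. \<beta> * \<beta>) P" using P by simp
  qed
  then show ?thesis using oneG_one by (simp add: oneG_def)
  qed
  have "d2 <= n2 (%P. 1 * h P + t * h' P)" by (rule d2, rule cone_comb[OF h(1) h']) (use t in auto)
  also have "n2 (%P. 1 * h P + t * h' P) = ip (%P. g0 P + t * h' P) (%P. g0 P + t * h' P)"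
  by (simp add: n2_def g0_def algebra_simps)
  also have "... = ip g0 g0 + 2 * t * ip g0 h' + t * t * ip h' h'" by (rule ip_square[OF c0 ch'])
  also have "t * t * ip h' h' <= t * t * (\<beta> * \<beta>)" by (rule mult_left_mono[OF hh]) (use t in auto)
  also have "t * t * (\<beta> * \<beta>) = ep * ep" using \<beta> by (simp add: t_def)
  finally have "0 <= 2 * (t * ip g0 h' + ep * ep)" using h(2) n2h by simp
  also have "t * ip g0 h' + ep * ep = t * (ip g0 h' + ep * \<beta>)" using \<beta> by (simp add: t_def field_simps)
  finally have "0 <= t * (ip g0 h' + ep * \<beta>)" by simp
  then show ?thesis using t by (simp add: zero_le_mult_iff)
 qed
 \<comment> \<open>The opposite direction along \<open>h\<close> itself: \<open>(1 - ep) * h\<close>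
   is still in the cone because \<open>ep \<le> 1\<close>.\<close>
 have g0h: "ip g0 h <= ep * (1 + H) / 2"
 proof -
  have "h = (%P. g0 P + 1 * F P)" by (simp add: g0_def)
  then have "ip h h = ip g0 g0 + 2 * ip g0 F + ip F F" using ip_square[OF c0 cF, of 1] by simp
  moreover have "0 <= ip g0 g0 - 2 * ip g0 F + ip F F"
  using ip_square[OF c0 cF, of "-1"] ip_self_nonneg[of "%P. g0 P + (-1) * F P"] by simp
  moreover have "ep * ep <= 1" using ep by (simp add: mult_le_one)
  ultimately have hh: "ip h h <= H" using h(2) n2h by (simp add: H_def)
  have "d2 <= n2 (%P. (1 - ep) * h P + 0 * h P)" by (rule d2, rule cone_comb[OF h(1) h(1)]) (use ep in auto)
  also have "n2 (%P. (1 - ep) * h P + 0 * h P) = ip (%P. g0 P + (-ep) * h P) (%P. g0 P + (-ep) * h P)"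
  by (simp add: n2_def g0_def algebra_simps)
  also have "... = ip g0 g0 - 2 * ep * ip g0 h + ep * ep * ip h h" using ip_square[OF c0 ch, of "-ep"] by simp
  also have "ep * ep * ip h h <= ep * ep * H" by (rule mult_left_mono[OF hh]) simp
  finally have "0 <= ep * (ep * (1 + H) - 2 * ip g0 h)" using h(2) n2h by (simp add: algebra_simps)
  then show ?thesis using ep by (simp add: zero_le_mult_iff)
 qed
 \<comment> \<open>Smoothing \<open>g0\<close> gives a smooth density; the constant
   \<open>ep * B\<close> compensates the loss allowed by \<open>var\<close>, as \<open>T N w\<close>
   is at most \<open>B\<close> times the mean of \<open>w\<close> for \<open>w\<close> in the
   cone.\<close>
 define g where "g P = 1 * T N g0 P + (ep * B) * restr (Grass m) (%_. 1) P" for P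
 have gC: "g : CinfG m" unfolding g_def by (intro CinfG_linear Top_CinfG dims c0 CinfG_const)
 have ipg: "ip w g = ip g0 (T N w) + ep * B * oneG m w" if w: "cG w" for w
  using ip_add[OF T_cG[OF c0] cG_one w, of 1 N "ep * B" 1] T_selfadjoint[OF c0 w] ip_one[OF w]
  by (simp add: g_def[abs_def] ip_commute)
 have pos: "0 <= ip w g" if w: "cone w" for w
 proof -
  have cw: "cG w" using w by (rule cone_cG)
  have aw: "(LINT Q|(haarG m). \<bar>w Q\<bar>) = oneG m w" unfolding oneG_def using cone_nonneg[OF w] by simp
  have w1: "0 <= oneG m w" unfolding oneG_def using cone_nonneg[OF w] by simp
  have "- (ep * B * oneG m w) <= ip g0 (T N w) + e" if e: "0 < e" for e
  proof -
  \<comment> \<open>The summand \<open>e / ep\<close> keeps \<beta> positive when the first term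
    vanishes; it contributes exactly \<open>e\<close>, which is arbitrary.\<close>
  define \<beta> where "\<beta> = B * oneG m w + e / ep"
  have "0 < \<beta>" using e ep B(1) w1 by (simp add: \<beta>_def add_nonneg_pos)
  moreover have "\<bar>T N w P\<bar> <= \<beta>" for P
  using B(2)[OF cw, of P] aw e ep by (simp add: \<beta>_def add_increasing2)
  ultimately have "- (ep * \<beta>) <= ip g0 (T N w)" by (intro var cone_T w)
  moreover have "ep * \<beta> = ep * B * oneG m w + e" using ep by (simp add: \<beta>_def algebra_simps)
  ultimately show ?thesis by simp
  qed
  then have "- (ep * B * oneG m w) <= ip g0 (T N w)" by (rule field_le_epsilon)
  then show ?thesis unfolding ipg[OF cw] by simp
 qed
 have "posI (densG m g)"
  unfolding posI_def densG_ip using pos cone_Radon cone_IRadon by blast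
 then have "posR (densG m g)" using T2 gC unfolding smooth_property_def by blast
 then have "0 <= ip F g" using f unfolding posR_def densG_ip F_def by blast
 also have "ip F g = ip g0 (T N F) + ep * B * oneG m F" by (rule ipg[OF cF])
 also have "ip g0 (T N F) = ip g0 F + ip g0 (%P. T N F P + (-1) * F P)"
  using ip_add[OF T_cG[OF cF] cF c0, of 1 N "-1"] by (simp add: ip_commute)
 also have "ip g0 (%P. T N F P + (-1) * F P) <= d2 / 4"
 proof -
  let ?w = "%P. T N F P + (-1) * F P"
  have cw: "cG ?w" by (intro cont0_add cont0_cmult T_cG cF)
  have a: "cG (%P. \<bar>g0 P\<bar>)" using c0 by (auto simp: cont0_def intro!: continuous_intros)
  have "ip g0 ?w <= (LINT P|(haarG m). \<eta> * \<bar>g0 P\<bar>)"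
  unfolding ip_def
  proof (rule integral_mono_G[OF cont0_mult[OF c0 cw] cont0_cmult[OF a]])
  fix P :: "'n matr" assume P: "P : Grass m"
  have "g0 P * ?w P <= \<bar>g0 P\<bar> * \<bar>?w P\<bar>" by (simp add: abs_mult[symmetric])
  also have "... <= \<bar>g0 P\<bar> * \<eta>" using N[OF P] by (intro mult_left_mono) auto
  finally show "g0 P * ?w P <= \<eta> * \<bar>g0 P\<bar>" by (simp add: mult.commute)
  qed
  also have "... = \<eta> * (LINT P|(haarG m). \<bar>g0 P\<bar>)" by simp
  also have "... <= \<eta> * ((d2 + 2) / 2)"
  proof (rule mult_left_mono)
  have "ep * ep <= 1" using ep by (simp add: mult_le_one)
  then show "(LINT P|(haarG m). \<bar>g0 P\<bar>) <= (d2 + 2) / 2" using L1_L2[OF c0, of 1] h(2) n2h by simp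
  qed (use \<eta> in simp)
  also have "... = d2 / 4" using d2_pos unfolding \<eta>_def by (simp add: field_simps)
  finally show ?thesis .
 qed
 also have "ip g0 F = ip g0 h - ip g0 g0"
 proof -
  have "F = (%P. 1 * h P + (-1) * g0 P)" by (simp add: g0_def)
  have "ip g0 F = ip (%P. 1 * h P + (-1) * g0 P) g0" unfolding \<open>F = _\<close>[symmetric] by (rule ip_commute)
  also have "... = ip h g0 - ip g0 g0" using ip_add[OF ch c0 c0, of 1 "-1"] by simp
  finally show ?thesis by (simp add: ip_commute[of h])
 qed
 finally have "0 <= ip g0 h - ip g0 g0 + d2 / 4 + ep * B * oneG m F" by simp
 moreover have "d2 <= ip g0 g0" using d2[OF h(1)] n2h by simp
 moreover have "ep * S = ep * (1 + H) / 2 + ep * B * oneG m F + ep" by (simp add: S_def algebra_simps)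
 ultimately show False using g0h ep d2_pos by linarith
qed

text \<open>Smoothing preserves the cone, and \<open>T N h\<close> differs from \<open>T N F\<close>
  by \<open>T N w\<close>, which is uniformly small once \<open>w\<close> is small in L2.
  \<open>N\<close> is fixed beforehand so that \<open>T N F\<close> is close to
  \<open>F\<close>.\<close>

lemma cone_dense:
 assumes T2: smooth_property and f: "cont0 Sph f" "ALL P:Grass m. 0 <= Radon m f P" and e: "0 < e"
 shows "EX h. cone h & (ALL P:Grass m. \<bar>Radon m f P - h P\<bar> < e)"
proof -
 define F where "F = Radon m f"
 have cF: "cG F" unfolding F_def by (rule cG_Radon[OF f(1)])
 obtain N where N: "!!P. P : Grass m ==> \<bar>T N F P - F P\<bar> < e / 2" using T_tendsto[OF cF, of "e / 2"] e by auto
 obtain B where B: "B \<ge> 0" "!!f P. cG f ==> \<bar>T N f P\<bar> <= B * (LINT Q|(haarG m). \<bar>f Q\<bar>)"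
  using T_bound[of N] by blast
 define s where "s = e / 2 / (B + 1)"
 have s: "0 < s" using e B by (simp add: s_def)
 have "0 < s * s" using s by simp
 from cone_L2_dense[OF T2 f this] obtain h where
  h: "cone h" "ip (%P. h P + (-1) * F P) (%P. h P + (-1) * F P) < s * s" unfolding F_def by blast
 define w where "w P = h P + (-1) * F P" for P
 have cw: "cG w" unfolding w_def by (intro cont0_add cont0_cmult cone_cG h cF)
 have "ip w w / s <= s" using h(2) s by (simp add: w_def[abs_def] divide_le_eq)
 then have "(LINT P|(haarG m). \<bar>w P\<bar>) <= s" using L1_L2[OF cw s] by linarith
 then have "B * (LINT P|(haarG m). \<bar>w P\<bar>) <= B * s" using B(1) by (rule mult_left_mono)
 also have "... <= (B + 1) * s" using s by (simp add: algebra_simps)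
 also have "... = e / 2" using B(1) unfolding s_def by (intro nonzero_eq_divide_eq[THEN iffD1, OF _ refl, THEN trans[OF mult.commute]]) auto
 finally have Tw: "\<bar>T N w P\<bar> <= e / 2" for P using B(2)[OF cw, of P] by linarith
 have "h = (%P. w P + F P)" by (simp add: w_def)
 then have "T N h = (%P. T N w P + T N F P)" using T_add[OF cw cF] by simp
 then have "\<bar>F P - T N h P\<bar> < e" if "P : Grass m" for P 
  unfolding \<open>T N h = _\<close> using Tw[of P] N[OF that] by linarith
 then show ?thesis using cone_T[OF h(1)] unfolding F_def by blast
qed

lemma oneG_Radon: "cont0 Sph f ==> 1 <= d ==> d <= CARD('n) ==> oneG d (Radon d f) = (LINT x|haarS. f x)" for f :: "'n vect => real"
proof -
 assume f: "cont0 Sph f" and d: "1 <= d" "d <= CARD('n)"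
 have "(LINT P|(haarG d). Radon d f P * restr (Grass d) (%_. 1) P) = (LINT x|haarS. f x * Rdual d (restr (Grass d) (%_. 1)) x)"
  by (rule Radon_duality[OF d f cont0_const])
 moreover have "(%P. Radon d f P * restr (Grass d) (%_. 1) P) = Radon d f" by (auto simp: restr_def Radon_def)
 moreover have "f x * Rdual d (restr (Grass d) (%_. 1)) x = f x" for x
  using f Rdual_const[OF d, of x 1] by (cases "x : Sph") (auto simp: cont0_def)
 ultimately show ?thesis by (simp add: oneG_def)
qed

lemma oneG_m: "cont0 Sph f ==> oneG m (Radon m f) = (LINT x|haarS. f x)" for f :: "'n vect => real"
 by (rule oneG_Radon[OF _ mk(2) dims(1)])

lemma oneG_k: "cont0 Sph f ==> oneG m (Iop m (Radon k f)) = (LINT x|haarS. f x)" for f :: "'n vect => real"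
 using integral_Iop[OF mk(1) Radon_cont0[OF mk(3)]] oneG_Radon[OF _ mk(3) dims(2)] by (simp add: oneG_def)

lemma cone_CSplus: "{(%P. Radon m g1 P + Iop m (Radon k g2) P) | g1 g2.
  g1 : (CSplus :: ('n vect => real) set) & g2 : CSplus} = Collect cone" (is "?L = _")
proof (intro set_eqI iffI)
 fix h assume "h : ?L"
 then obtain g1 g2 :: "'n vect => real" where h: "h = (%P. Radon m g1 P + Iop m (Radon k g2) P)"
  and g: "g1 : CS" "g2 : CS" "ALL x:Sph. 0 <= g1 x" "ALL x:Sph. 0 <= g2 x" unfolding CSplus_def by blast
 obtain g1' where g1': "cont0 Sph g1'" "ALL d>=1. Radon d g1 = Radon d g1'" "ALL x:Sph. 0 <= g1' x"
  using CS_Radon[OF g(1)] g(3) by blast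
 obtain g2' where g2': "cont0 Sph g2'" "ALL d>=1. Radon d g2 = Radon d g2'" "ALL x:Sph. 0 <= g2' x"
  using CS_Radon[OF g(2)] g(4) by blast
 have "h = (%P. Radon m g1' P + Iop m (Radon k g2') P)" using h g1'(2) g2'(2) mk by simp
 then show "h : Collect cone" unfolding cone_def using g1' g2' by blast
next
 fix h assume "h : Collect cone"
 then obtain g1 g2 where "cont0 Sph g1" "cont0 Sph g2" "ALL x:Sph. 0 <= g1 x" "ALL x:Sph. 0 <= g2 x"
  "h = (%P. Radon m g1 P + Iop m (Radon k g2) P)" unfolding cone_def by blast
 then show "h : ?L" using cont0_CS unfolding CSplus_def by blast
qed

lemma ImR_eq: "ImR m = Radon m ` Collect (cont0 (Sph :: 'n vect set))"
 unfolding ImR_def using CS_Radon mk(2) cont0_CS by (fastforce simp: image_iff)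

definition closure_equality :: bool where
 "closure_equality \<longleftrightarrow> closG m {f : ImR m. ALL P:Grass m. 0 <= f P} = closG m {(%P. Radon m g1 P + Iop m (Radon k g2) P) | g1 g2.
  g1 : (CSplus :: ('n vect => real) set) & g2 : CSplus}"

lemma smooth_imp_closure_equality: assumes T2: smooth_property shows closure_equality
proof -
 let ?A = "{f : ImR m. ALL P:Grass m. 0 <= f P} :: ('n matr => real) set"
 have sub: "closG m X \<subseteq> closG m Y" if step: "!!G e. G : X ==> 0 < e ==> EX G':Y. ALL P:Grass m. \<bar>G P - G' P\<bar> < e"
  for X Y :: "('n matr => real) set"
 proof
  fix F assume F: "F : closG m X"
  have "EX g:Y. ALL P:Grass m. \<bar>F P - g P\<bar> < e" if e: "0 < e" for e
  proof -
  obtain G where G: "G : X" "!!P. P : Grass m ==> \<bar>F P - G P\<bar> < e / 2"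
  using F half_gt_zero[OF e] unfolding closG_def by blast
  obtain G' where G': "G' : Y" "!!P. P : Grass m ==> \<bar>G P - G' P\<bar> < e / 2" 
  using step[OF G(1) half_gt_zero[OF e]] by blast
  have "\<bar>F P - G' P\<bar> < e" if "P : Grass m" for P using G(2)[OF that] G'(2)[OF that] by linarith
  then show ?thesis using G'(1) by blast
  qed
  then show "F : closG m Y" using F unfolding closG_def by blast
 qed
 show ?thesis
  unfolding closure_equality_def cone_CSplus
 proof (intro equalityI sub)
  fix G and e :: real assume "G : ?A" "0 < e"
  then show "EX G':Collect cone. ALL P:Grass m. \<bar>G P - G' P\<bar> < e"
  using cone_dense[OF T2] unfolding ImR_eq by blast
 next
  fix G and e :: real assume "G : Collect cone" and e: "0 < e"
  then obtain g1 g2 where g: "cont0 Sph g1" "cont0 Sph g2" "ALL x:Sph. 0 <= g1 x" "ALL x:Sph. 0 <= g2 x"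
  "G = (%P. Radon m g1 P + Iop m (Radon k g2) P)" unfolding cone_def by blast
  obtain h where h: "cont0 Sph h" "!!P. P : Grass m ==> \<bar>Iop m (Radon k g2) P - Radon m h P\<bar> < e / 2"
  using Iop_Radon_closure[OF mk g(2) half_gt_zero[OF e]] by blast
  \<comment> \<open>Adding \<open>e / 2\<close> to the approximant of
    \<open>Iop m (Radon k g2)\<close> restores non-negativity of the image while the total error
    stays below \<open>e\<close>.\<close>
  define h2 where "h2 x = 1 * h x + (e / 2) * restr Sph (%_. 1) x" for x
  have ch2: "cont0 Sph h2" unfolding h2_def by (intro cont0_add cont0_cmult h cont0_const)
  define h' where "h' x = 1 * g1 x + 1 * h2 x" for x
  have ch': "cont0 Sph h'" unfolding h'_def by (intro cont0_add cont0_cmult g ch2)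
  have R: "Radon m h' P = Radon m g1 P + Radon m h P + e / 2" if "P : Grass m" for P
  using Radon_lin[OF g(1) ch2 mk(2), of 1 1 P] Radon_lin[OF h(1) cont0_const mk(2), of 1 "e / 2" 1 P] Radon_const[OF that mk(2), of 1]
  by (simp add: h'_def[abs_def] h2_def[abs_def])
  have "0 <= Radon m h' P & \<bar>G P - Radon m h' P\<bar> < e" if P: "P : Grass m" for P
  proof -
  have "0 <= Iop m (Radon k g2) P" using Radon_nonneg[OF g(2,4) mk(3)] by (simp add: Iop_def)
  moreover have "0 <= Radon m g1 P" by (rule Radon_nonneg[OF g(1,3) mk(2)])
  ultimately show ?thesis using h(2)[OF P] unfolding R[OF P] g(5) by linarith
  qed
  then show "EX G':?A. ALL P:Grass m. \<bar>G P - G' P\<bar> < e"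
  using ch' unfolding ImR_eq by (intro bexI[of _ "Radon m h'"]) auto
 qed
qed

lemma closure_equality_imp_all: assumes closure_equality shows "ALL A:MG m. posI A --> posR A"
proof (intro ballI impI)
 fix A :: "('n matr => real) => real" assume A: "A : MG m" "posI A"
 show "posR A"
  unfolding posR_def
 proof (intro allI impI)
  fix f :: "'n vect => real" assume f: "cont0 Sph f" "ALL P:Grass m. 0 <= Radon m f P"
  have "Radon m f : closG m {f : ImR m. ALL P:Grass m. 0 <= f P}"
  unfolding closG_def
  proof (intro CollectI conjI allI impI)
  show "Radon m f : CG m" using cG_Radon[OF f(1)] by (simp add: CG_def cont0_def)
  fix e :: real assume "0 < e"
  then show "EX g:{f : ImR m. ALL P:Grass m. 0 <= f P}. ALL P:Grass m. \<bar>Radon m f P - g P\<bar> < e"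
  using f unfolding ImR_eq by (intro bexI[of _ "Radon m f"]) auto
  qed
  then have cl: "Radon m f : closG m (Collect cone)" using assms unfolding closure_equality_def cone_CSplus by blast
  show "0 <= A (Radon m f)"
  proof (rule functional_approx[OF functional_MG[OF A(1)] cG_Radon[OF f(1)]])
  fix e :: real assume "0 < e"
  then obtain G where G: "cone G" "ALL P:Grass m. \<bar>Radon m f P - G P\<bar> < e" using cl unfolding closG_def by blast
  obtain g1 g2 where g: "cont0 Sph g1" "cont0 Sph g2" "ALL x:Sph. 0 <= g1 x" "ALL x:Sph. 0 <= g2 x"
  "G = (%P. Radon m g1 P + Iop m (Radon k g2) P)" using G(1) unfolding cone_def by blast
  have "A G = A (Radon m g1) + A (Iop m (Radon k g2))"
  using functional_linear[OF functional_MG[OF A(1)] cG_Radon[OF g(1)] cG_IRadon[OF g(2)], of 1 1] g(5) by simp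
  then have "0 <= A G" using A(2) g unfolding posI_def by (metis add_nonneg_nonneg)
  then show "EX G. cG G & 0 <= A G & (ALL P:Grass m. \<bar>Radon m f P - G P\<bar> <= e)"
  using cone_cG[OF G(1)] G(2) by (intro exI[of _ G]) (auto simp: less_imp_le)
  qed
 qed
qed

lemma all_imp_smooth: "ALL A:MG m. posI A --> posR A ==> smooth_property"
 unfolding smooth_property_def
proof (intro ballI impI)
 fix g :: "'n matr => real" assume all: "ALL A:MG m. posI A --> posR A" and g: "g : CinfG m" "posI (densG m g)"
 obtain B where B: "B : MG m" "ALL f. cG f --> B f = densG m g f" using densG_MG[OF CinfG_cont0[OF g(1)]] by blast
 have e: "eqv B (densG m g)" using B(2) cG_Radon by (simp add: eqv_def)
 show "posR (densG m g)"
  using all B(1) posR_cong[OF e] posI_cong[OF functional_MG[OF B(1)] functional_densG[OF CinfG_cont0[OF g(1)]] e] g(2) by blast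
qed

end

section \<open>The equivalences\<close>

context radon_smoothing
begin

lemma cG_1: "cG (restr (Grass m) (%_. 1))"
 by (rule cG_one)

lemma densG_comb:
 assumes "cG g" "cG f"
 shows "densG m (%P. s * g P + t * restr (Grass m) (%_. 1) P) f = s * densG m g f + t * oneG m f"
 using ip_add[OF assms(1) cG_1 assms(2), of s t] ip_one[OF assms(2)] by (simp add: densG_ip ip_commute[of f])

lemma geoneS_iff:
 fixes A :: "('n matr => real) => real"
 shows "geoneS (Rstar m A) & geoneS (Rstar k (perpM m A)) \<longleftrightarrow>
  (ALL f. cont0 Sph f --> (ALL x:Sph. 0 <= f x) -->
  (LINT x|haarS. f x) <= A (Radon m f) & (LINT x|haarS. f x) <= A (Iop m (Radon k f)))"
 (is "?L \<longleftrightarrow> ?R")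
proof
 assume ?L
 then show ?R by (auto simp: geoneS_def nonnegS_def Rstar_def perpM_def CSplus_def cont0_CS)
next
 assume R: ?R
 have "integral\<^sup>L haarS f <= A (Radon m f) & integral\<^sup>L haarS f <= A (Iop m (Radon k f))"
  if f: "f : CSplus" for f :: "'n vect => real"
 proof -
  define f' where "f' = (if f : borel_measurable borel then restr Sph f else (%x. 0))"
  have fC: "f : CS" "ALL x:Sph. 0 <= f' x" using f by (auto simp: CSplus_def f'_def)
  note r = CS_reduce[OF fC(1)] CS_integral[OF fC(1)]
  show ?thesis using R r(1) r(2)[OF mk(2)] r(2)[OF mk(3)] r(3) fC(2) unfolding f'_def[symmetric] by simp
 qed
 then show ?L by (auto simp: geoneS_def nonnegS_def Rstar_def perpM_def)
qed

definition one_shift_property :: bool where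
 "one_shift_property \<longleftrightarrow> (ALL mu : MG m :: (('n matr => real) => real) set.
  coset k (%f. mu f + oneG m f) : M_BP k & coset k mu : M_I k --> coset k mu : M_BP k)"

definition no_extremal_measure :: bool where
 "no_extremal_measure \<longleftrightarrow> \<not> (EX mu : MG m :: (('n matr => real) => real) set.
  coset k mu : Minf_BP k & geoneS (Rstar m mu) & geoneS (Rstar k (perpM m mu)) \<and>
  Inf {mu f | f. f : ImR m & (ALL P:Grass m. 0 <= f P) & oneG m f = 1} = 0)"

lemma all_imp_one_shift_property: "ALL A:MG m. posI A --> posR A ==> one_shift_property"
 unfolding one_shift_property_def using coset_M_BP coset_M_I by blast

definition test :: "('n vect => real) => bool" where
 "test f \<longleftrightarrow> cont0 Sph f & (ALL P:Grass m. 0 <= Radon m f P) & (LINT x|haarS. f x) = 1"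

lemma test_set:
 "{A f | f. f : ImR m & (ALL P:Grass m. 0 <= f P) & oneG m f = 1} = (%f. A (Radon m f)) ` Collect test"
 unfolding ImR_eq test_def using oneG_m by force

lemma test_one: "test (restr Sph (%_. 1))"
 unfolding test_def using int_const[of 1] mk(2) by (simp add: cont0_const Radon_const)

text \<open>Subtracting Haar measure from an extremal \<open>mu\<close> gives a functional
  satisfying both hypotheses of the shift property. The conclusion then says that \<open>mu\<close>
  is at least one on normalised non-negative functions in the image, against the infimum
  zero.\<close>

lemma one_shift_property_imp_no_extremal_measure: assumes one_shift_property shows no_extremal_measure
 unfolding no_extremal_measure_def test_set
proof (rule notI, elim bexE conjE)
 fix mu :: "('n matr => real) => real"
 assume mu: "mu : MG m" "coset k mu : Minf_BP k" and ge: "geoneS (Rstar m mu)" "geoneS (Rstar k (perpM m mu))"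
  and inf: "Inf ((%f. mu (Radon m f)) ` Collect test) = 0"
 obtain g where g: "g : CinfG m" "coset k mu = coset k (densG m g)"
  using mu(2) by (auto simp: Minf_BP_def Minf_def dims)
 have cg: "cG g" using g(1) by (rule CinfG_cont0)
 have e: "eqv mu (densG m g)" by (rule coset_eqD[OF mu(1) g(2)])
 note clos = eqv_clos[OF functional_MG[OF mu(1)] functional_densG[OF cg] e]
 define g' where "g' P = 1 * g P + (-1) * restr (Grass m) (%_. 1) P" for P
 have cg': "cG g'" unfolding g'_def by (intro cont0_add cont0_cmult cg cG_1)
 obtain A where A: "A : MG m" "ALL f. cG f --> A f = densG m g' f" using densG_MG[OF cg'] by blast
 have AG: "A f = densG m g f - oneG m f" if "cG f" for f
  using A(2) that densG_comb[OF cg that, of 1 "-1"] by (simp add: g'_def[abs_def])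
 have Am: "A (Radon m f) = mu (Radon m f) - (LINT x|haarS. f x)" if "cont0 Sph f" for f
  using AG[OF cG_Radon[OF that]] e that oneG_m[OF that] by (simp add: eqv_def)
 have Ak: "A (Iop m (Radon k f)) = mu (Iop m (Radon k f)) - (LINT x|haarS. f x)" if "cont0 Sph f" for f
  using AG[OF cG_IRadon[OF that]] clos[OF in_clos_IRadon[OF that]] oneG_k[OF that] by simp
 have "posI A" using geoneS_iff[of mu] ge Am Ak unfolding posI_def by auto
 moreover have "eqv (%f. A f + oneG m f) mu" using Am oneG_m by (simp add: eqv_def)
 then have "coset k (%f. A f + oneG m f) : M_BP k" using coset_cong[of "%f. A f + oneG m f" mu] mu(2) by (simp add: Minf_BP_def)
 ultimately have "posR A" using assms A(1) coset_M_BP[OF A(1)] coset_M_I[OF A(1)] unfolding one_shift_property_def by blast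
 then have "1 <= mu (Radon m f)" if "test f" for f
  using that Am[of f] unfolding posR_def test_def by fastforce
 then have "1 <= Inf ((%f. mu (Radon m f)) ` Collect test)"
  using test_one by (intro cInf_greatest) auto
 then show False using inf by simp
qed

text \<open>For a counterexample \<open>g\<close> let \<open>I0 < 0\<close> be the infimum over
  normalised test functions. Then \<open>t * g + 1\<close> with \<open>t * I0 = -1\<close> has
  infimum exactly zero, and \<open>posI\<close> for \<open>g\<close> provides both lower bounds by
  Haar measure.\<close>

lemma no_extremal_measure_imp_smooth: assumes no_extremal_measure shows smooth_property
 unfolding smooth_property_def
proof (intro ballI impI, rule ccontr)
 fix g :: "'n matr => real"
 assume g: "g : CinfG m" "posI (densG m g)" and "\<not> posR (densG m g)"
 then obtain f0 where f0: "cont0 Sph f0" "ALL P:Grass m. 0 <= Radon m f0 P" "densG m g (Radon m f0) < 0"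
  unfolding posR_def by force
 have cg: "cG g" using g(1) by (rule CinfG_cont0)
 define V where "V f = densG m g (Radon m f)" for f
 \<comment> \<open>Functions of mean zero cannot be normalised, but a non-negative transform of mean
   zero vanishes identically.\<close>
 have zero: "V f = 0" if f: "cont0 Sph f" "ALL P:Grass m. 0 <= Radon m f P" "(LINT x|haarS. f x) <= 0" for f
 proof -
  have "Radon m f P = 0" for P
  by (rule haarG_nonneg_zero[OF cG_Radon[OF f(1)]]) (use f oneG_m[OF f(1)] in "auto simp: oneG_def")
  then show ?thesis by (simp add: V_def densG_def)
 qed
 have scale: "test (%x. (1 / (LINT x|haarS. f x)) * f x) & V (%x. (1 / (LINT x|haarS. f x)) * f x) = V f / (LINT x|haarS. f x)"
  if f: "cont0 Sph f" "ALL P:Grass m. 0 <= Radon m f P" "0 < (LINT x|haarS. f x)" for f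
 proof -
  let ?c = "1 / (LINT x|haarS. f x)"
  have R: "Radon m (%x. ?c * f x) P = ?c * Radon m f P" for P using Radon_lin[OF f(1) f(1) mk(2), of ?c 0] by simp
  show ?thesis
  using f cont0_cmult[OF f(1), of ?c] unfolding test_def V_def R densG_def by simp
 qed
 obtain G where G: "G > 0" "!!P. \<bar>g P\<bar> <= G" using bmE[OF cG_bm[OF cg]] by blast
 have bound: "- G <= V f" if "test f" for f
 proof -
  have f: "cont0 Sph f" "ALL P:Grass m. 0 <= Radon m f P" "(LINT x|haarS. f x) = 1" using that by (auto simp: test_def)
  have "(LINT P|(haarG m). (- G) * Radon m f P) <= (LINT P|(haarG m). Radon m f P * g P)"
  proof (rule integral_mono_G[OF cont0_cmult[OF cG_Radon[OF f(1)]] cont0_mult[OF cG_Radon[OF f(1)] cg]])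
  fix P :: "'n matr" assume P: "P : Grass m"
  have "Radon m f P * (- G) <= Radon m f P * g P" using f(2) P G(2)[of P] by (intro mult_left_mono) auto
  then show "(- G) * Radon m f P <= Radon m f P * g P" by (simp add: mult.commute)
  qed
  then show ?thesis using oneG_m[OF f(1)] f(3) by (simp add: V_def densG_def oneG_def)
 qed
 define I0 where "I0 = Inf (V ` Collect test)"
 have ne: "V ` Collect test ~= {}" using test_one by blast
 have bb: "bdd_below (V ` Collect test)" by (rule bdd_belowI[of _ "- G"]) (use bound in auto)
 have I0: "I0 <= V f" if "test f" for f unfolding I0_def by (rule cInf_lower[OF _ bb]) (use that in auto)
 have f0p: "0 < (LINT x|haarS. f0 x)" using zero[OF f0(1,2)] f0(3) by (force simp: V_def)
 have neg: "I0 < 0"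
  using scale[OF f0(1,2) f0p] I0[of "%x. (1 / (LINT x|haarS. f0 x)) * f0 x"] f0(3) f0p
  divide_neg_pos[of "V f0" "\<integral>x. f0 x \<partial>haarS"] unfolding V_def[of f0, symmetric] by linarith
 define t where "t = - 1 / I0"
 have t: "0 < t" "t * I0 = - 1" using neg by (auto simp: t_def divide_neg_neg)
 have lower: "0 <= t * V f + (LINT x|haarS. f x)" if f: "cont0 Sph f" "ALL P:Grass m. 0 <= Radon m f P" for f
 proof -
  have "0 <= (LINT P|(haarG m). Radon m f P)"
  by (rule integral_nonneg_AE) (use AE_Gr f(2) in "auto elim!: eventually_mono")
  then have F: "0 <= (LINT x|haarS. f x)" using oneG_m[OF f(1)] by (simp add: oneG_def)
  show ?thesis
  proof (cases "(LINT x|haarS. f x) = 0")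
  case True
  then show ?thesis using zero[OF f] by simp
  next
  case False
  then have F: "0 < (LINT x|haarS. f x)" using F by simp
  have "I0 <= V f / (LINT x|haarS. f x)" using scale[OF f F] I0 by metis
  then have "t * (I0 * (LINT x|haarS. f x)) <= t * V f" using F t(1) by (intro mult_left_mono) (auto simp: le_divide_eq)
  then show ?thesis using t(2) by (simp add: mult.assoc[symmetric])
  qed
 qed
 define g' where "g' P = t * g P + 1 * restr (Grass m) (%_. 1) P" for P
 have g': "g' : CinfG m" unfolding g'_def by (intro CinfG_linear g CinfG_const)
 have cg': "cG g'" using g' by (rule CinfG_cont0)
 obtain A where A: "A : MG m" "ALL f. cG f --> A f = densG m g' f" using densG_MG[OF cg'] by blast
 have AG: "A f = t * densG m g f + oneG m f" if "cG f" for f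
  using A(2) that densG_comb[OF cg that, of t 1] by (simp add: g'_def[abs_def])
 have Am: "A (Radon m f) = t * V f + (LINT x|haarS. f x)" if "cont0 Sph f" for f
  using AG[OF cG_Radon[OF that]] oneG_m[OF that] by (simp add: V_def)
 have "eqv A (densG m g')" using A(2) cG_Radon by (simp add: eqv_def)
 then have "coset k A : Minf k" using coset_cong g' by (auto simp: Minf_def dims)
 moreover have "posR A" unfolding posR_def using Am lower by simp
 then have "coset k A : M_BP k" using coset_M_BP[OF A(1)] by blast
 ultimately have 1: "coset k A : Minf_BP k" by (simp add: Minf_BP_def)
 have 2: "geoneS (Rstar m A) & geoneS (Rstar k (perpM m A))"
  unfolding geoneS_iff
  using g(2) t(1) Am AG[OF cG_IRadon] oneG_k unfolding posI_def V_def by (simp add: mult_nonneg_nonneg)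
 have "Inf ((%f. A (Radon m f)) ` Collect test) = 0"
 proof (rule cInf_eq_non_empty)
  show "(%f. A (Radon m f)) ` Collect test ~= {}" using test_one by blast
  show "0 <= x" if x: "x : (%f. A (Radon m f)) ` Collect test" for x
  proof -
  obtain f where f: "test f" "x = A (Radon m f)" using x by blast
  show ?thesis using lower[of f] Am[of f] f unfolding test_def by simp
  qed
  fix y assume y: "!!x. x : (%f. A (Radon m f)) ` Collect test ==> y <= x"
  have "(y - 1) / t <= V f" if f: "test f" for f
  proof -
  have "y <= A (Radon m f)" using y f by blast
  then show ?thesis using Am[of f] f t(1) by (simp add: test_def divide_le_eq mult.commute)
  qed
  then have "(y - 1) / t <= I0" unfolding I0_def by (intro cInf_greatest[OF ne]) auto
  then have "y - 1 <= t * I0" using t(1) by (simp add: divide_le_eq mult.commute)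
  then show "y <= 0" using t(2) by simp
 qed
 then show False using assms A(1) 1 2 unfolding no_extremal_measure_def test_set by blast
qed

end

text \<open>Off the sphere the radial function is homogeneous of degree -1, hence continuous away
  from the origin. \<open>BP\<close> multiplies it with arbitrary members of \<open>CS\<close>,
  which may be non-measurable off the sphere; positivity lets such a factor be recovered from the
  product by division.\<close>

lemma star_body_radial_measurable:
 fixes K :: "('n::finite) vect set"
 assumes K: "star_body K" shows "radial K : borel_measurable borel" "th ~= 0 ==> 0 < radial K th"
proof -
 note r = star_body_radial[OF K]
 have S: "x /\<^sub>R norm x : Sph" if "x ~= 0" for x :: "'n vect" using that by (simp add: Sph_norm)
 have eq: "radial K x = radial K (x /\<^sub>R norm x) / norm x" if x: "x ~= 0" for x
 proof -
  let ?rh = "radial K (x /\<^sub>R norm x)"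
  have "r *\<^sub>R x : K \<longleftrightarrow> r <= ?rh / norm x" if "0 < r" for r
  proof -
  have v: "(r *\<^sub>R x) /\<^sub>R norm (r *\<^sub>R x) = x /\<^sub>R norm x" using that x by simp
  have "y : K \<longleftrightarrow> y = 0 \<or> norm y <= radial K (y /\<^sub>R norm y)" for y
  using r(4) unfolding sbody_def by blast
  from this[of "r *\<^sub>R x"] show ?thesis unfolding v using that x by (simp add: le_divide_eq)
  qed
  then have "{r. 0 < r & r *\<^sub>R x : K} = {0<..?rh / norm x}" by auto
  then show ?thesis using r(2)[OF S[OF x]] x by (simp add: radial_def[of K x])
 qed
 show "0 < radial K th" if "th ~= 0" using eq[OF that] r(2)[OF S[OF that]] that by simp
 have "continuous_on (- {0}) (%x. radial K (x /\<^sub>R norm x) / norm x)"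
 proof (rule continuous_on_divide)
  show "continuous_on (- {0}) (%x. radial K (x /\<^sub>R norm x))"
  proof (rule continuous_on_compose2[OF r(1)])
  show "continuous_on (- {0}) (%x :: 'n vect. x /\<^sub>R norm x)" by (intro continuous_intros) simp
  show "(%x. x /\<^sub>R norm x) ` (- {0}) \<subseteq> (Sph :: 'n vect set)" using S by blast
  qed
 qed (auto intro: continuous_intros)
 then have "continuous_on (- {0}) (radial K)"
 proof (rule continuous_on_eq)
  fix x :: "'n vect" assume "x : - {0}"
  then show "radial K (x /\<^sub>R norm x) / norm x = radial K x" by (intro eq[symmetric]) simp
 qed
 then show "radial K : borel_measurable borel"
  by (intro borel_measurable_continuous_countable_exceptions[of "{0}"]) auto
qed

text \<open>The cofactor of \<open>x - y\<close> in \<open>x ^ k - y ^ k\<close> contains the term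
  \<open>y ^ (k - 1)\<close> and otherwise non-negative ones. It converts uniform closeness of k-th
  powers into closeness in the radial metric.\<close>

lemma root_diff_le:
 fixes x y :: real
 assumes "0 <= x" "0 < c" "c <= y" "1 <= k"
 shows "\<bar>x - y\<bar> * c ^ (k - 1) <= \<bar>x ^ k - y ^ k\<bar>"
proof -
 obtain j where k: "k = Suc j" using assms(4) by (cases k) auto
 have "c ^ j <= y ^ j" using assms by (intro power_mono) auto
 also have "... <= (SUM p<Suc j. x ^ p * y ^ (j - p))"
  using assms by (subst sum.lessThan_Suc_shift) (auto intro!: sum_nonneg mult_nonneg_nonneg)
 finally have "\<bar>x - y\<bar> * c ^ j <= \<bar>x - y\<bar> * (SUM p<Suc j. x ^ p * y ^ (j - p))" by (intro mult_left_mono) auto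
 also have "... = \<bar>x - y\<bar> * \<bar>SUM p<Suc j. x ^ p * y ^ (j - p)\<bar>"
 proof -
  have "0 <= (SUM p<Suc j. x ^ p * y ^ (j - p))"
  using assms by (intro sum_nonneg mult_nonneg_nonneg zero_le_power) auto
  then show ?thesis by (simp only: abs_of_nonneg)
 qed
 also have "... = \<bar>x ^ k - y ^ k\<bar>" by (simp only: k power_diff_sumr2 abs_mult diff_Suc_Suc mult.commute[of "x ^ _"])
 finally show ?thesis by (simp add: k)
qed

section \<open>The classes of bodies and the smooth property\<close>

context radon_smoothing
begin

definition rk :: "'n vect set => 'n vect => real" where
 "rk K = restr Sph (%x. radial K x ^ k)"

lemma rk: assumes "star_body K"
 shows "cont0 Sph (rk K)" "rk K (- x) = rk K x" "x : Sph ==> 0 < rk K x" "x : Sph ==> 0 <= rk K x"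
proof -
 note r = star_body_radial[OF assms]
 show "cont0 Sph (rk K)" unfolding rk_def by (intro cont0_restr continuous_intros r)
 show "rk K (- x) = rk K x"
 proof (cases "x : Sph")
  case True
  then have "- x : Sph" by (simp add: Sph_norm)
  then show ?thesis using True r(3) by (simp add: rk_def)
 next
  case False
  then have "- x \<notin> Sph" by (simp add: Sph_norm)
  then show ?thesis using False by (simp add: rk_def restr_def)
 qed
 show "0 < rk K x" if "x : Sph" using r(2)[OF that] that by (simp add: rk_def)
 then show "0 <= rk K x" if "x : Sph" using that by force
qed

lemma pair_rk: "cont0 Sph f ==> (%x. f x * radial K x ^ k) = (%x. f x * rk K x)"
 by (auto simp: rk_def restr_def cont0_def fun_eq_iff)

text \<open>Tested against the negative part of \<open>u\<close>, the pairing is minus the integral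
  of a square.\<close>

lemma positive_pairing:
 fixes u :: "'n vect => real"
 assumes u: "cont0 Sph u" and pos: "!!f. cont0 Sph f ==> ALL x:Sph. 0 <= f x ==> 0 <= (LINT x|haarS. f x * u x)"
 shows "0 <= u x"
proof -
 let ?f = "%x. max 0 (- u x)"
 have cf: "cont0 Sph ?f" using u by (auto simp: cont0_def intro!: continuous_intros)
 have "?f x * u x = - (?f x * ?f x)" for x by (auto simp: max_def)
 then have "(LINT x|haarS. ?f x * ?f x) <= 0" using pos[OF cf] by simp
 then have "?f x * ?f x = 0" by (intro haarS_nonneg_zero[OF cont0_mult[OF cf cf]]) auto
 then show ?thesis by (auto simp: max_def split: if_splits)
qed

text \<open>Removes the measure from the definition; the converse direction is the representation
  theorem for functionals positive on the image. In this form the condition passes to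
  limits.\<close>

lemma BP_iff:
 assumes K: "star_body K"
 shows "K : BP k \<longleftrightarrow> (ALL f. cont0 Sph f --> (ALL P:Grass m. 0 <= Radon m f P) --> 0 <= (LINT x|haarS. f x * rk K x))"
  (is "_ \<longleftrightarrow> ?R")
proof
 assume "K : BP k"
 then obtain mu where mu: "mu : MGplus m" "!!g. g : CS ==> integral\<^sup>L haarS (%th. g th * radial K th ^ k) = mu (Radon m g)"
  by (auto simp: BP_def dims)
 obtain M where M: "fin_meas_on (Grass m) M" "mu = (%f. integral\<^sup>L M f)" using mu(1) unfolding MGplus_def by blast
 show ?R
 proof (intro allI impI)
  fix f :: "'n vect => real" assume f: "cont0 Sph f" "ALL P:Grass m. 0 <= Radon m f P"
  have "0 <= Radon m f P" for P using f(2) by (cases "P : Grass m") (auto simp: Radon_def)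
  then have "0 <= mu (Radon m f)" unfolding M(2) by simp
  then show "0 <= (LINT x|haarS. f x * rk K x)" using mu(2)[OF cont0_CS[OF f(1)]] pair_rk[OF f(1), of K] by simp
 qed
next
 assume R: ?R
 note r = rk[OF K]
 have "(LINT x|haarS. rk K x) > 0"
 proof (rule ccontr)
  assume "\<not> (LINT x|haarS. rk K x) > 0"
  then have "rk K (axis undefined 1) = 0" by (intro haarS_nonneg_zero[OF r(1,4)]) auto
  then show False using r(3)[OF Sph_axis] by simp
 qed
 then obtain M where M: "fin_meas_on (Grass m) M"
  "!!f. cont0 Sph f ==> (LINT x|haarS. f x * rk K x) = (LINT P|M. Radon m f P)"
  using representing_measure[OF r(1,2)] R by blast
 have "(LINT x|haarS. g x * radial K x ^ k) = (LINT P|M. Radon m g P)" if g: "g : CS" for g :: "'n vect => real"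
 proof -
  note red = CS_reduce[OF g]
  note mr = star_body_radial_measurable[OF K]
  have mS: "!!f :: 'n vect => real. f : borel_measurable haarS \<longleftrightarrow> f : borel_measurable borel"
  by (simp add: measurable_cong_sets[OF sets_haarS refl])
  show ?thesis
  proof (cases "g : borel_measurable borel")
  case True
  have c: "cont0 Sph (restr Sph g)" using red(1) True by simp
  have "(LINT x|haarS. g x * radial K x ^ k) = (LINT x|haarS. restr Sph g x * rk K x)"
  proof (rule integral_cong_AE)
  show "(%x. g x * radial K x ^ k) : borel_measurable haarS" unfolding mS using True mr(1) by measurable
  show "(%x. restr Sph g x * rk K x) : borel_measurable haarS"
  unfolding mS by (rule bm_meas, rule bm_Sph, rule cont0_mult[OF c r(1)])
  show "AE x in haarS. g x * radial K x ^ k = restr Sph g x * rk K x"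
  using AE_haarS by eventually_elim (simp add: rk_def)
  qed
  then show ?thesis using M(2)[OF c] red(2)[OF mk(2)] True by simp
  next
  case False
  \<comment> \<open>A non-measurable \<open>g\<close> makes the product non-measurable, as the
    radial function is measurable and positive off the origin; both sides are then 0 by the
    convention for non-integrable functions.\<close>
  have "\<not> integrable haarS (%x. g x * radial K x ^ k)"
  proof
  assume "integrable haarS (%x. g x * radial K x ^ k)"
  then have h: "(%x. g x * radial K x ^ k) : borel_measurable borel"
  using borel_measurable_integrable mS by blast
  have "(%x. if x = 0 then g 0 else g x * radial K x ^ k / radial K x ^ k) : borel_measurable borel"
  using h mr(1) by measurable
  also have "(%x. if x = 0 then g 0 else g x * radial K x ^ k / radial K x ^ k) = g"
  using mr(2) by (auto simp: fun_eq_iff) (metis less_irrefl)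
  finally show False using False by simp
  qed
  then have "(LINT x|haarS. g x * radial K x ^ k) = 0" by (rule not_integrable_integral_eq)
  then show ?thesis using red(2)[OF mk(2)] False by (simp add: Radon_zero)
  qed
 qed
 then show "K : BP k" using K M(1) unfolding BP_def MGplus_def dims by blast
qed

lemma densG_Radon: "cG g ==> cont0 Sph f ==> densG m g (Radon m f) = (LINT x|haarS. f x * Rdual m g x)"
 unfolding densG_def by (rule Radon_duality[OF mk(2) dims(1)])

lemma densG_IRadon:
 assumes g: "cG g" and f: "cont0 Sph f"
 shows "densG m g (Iop m (Radon k f)) = (LINT x|haarS. f x * Rdual k (Iop k g) x)"
proof -
 have cI: "cont0 (Grass k) (Iop k g)" by (rule Iop_cont0[OF dims(6) g])
 have cR: "cont0 (Grass k) (Radon k f)" by (rule Radon_cont0[OF mk(3) f])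
 have "(%P. Iop m (Radon k f) P * g P) = Iop m (%P. Radon k f P * Iop k g P)"
  using Iop_Iop[OF mk(1) g] by (simp add: Iop_mult)
 then have "densG m g (Iop m (Radon k f)) = (LINT P|(haarG k). Radon k f P * Iop k g P)"
  using integral_Iop[OF mk(1) cont0_mult[OF cR cI]] by (simp add: densG_def)
 then show ?thesis using Radon_duality[OF mk(3) dims(2) f cI] by simp
qed

lemma Rdual_facts:
 assumes g: "cG g"
 shows "cont0 Sph (Rdual m g)" "cont0 Sph (Rdual k (Iop k g))"
  "Rdual m g (- x) = Rdual m g x" "Rdual k (Iop k g) (- x) = Rdual k (Iop k g) x"
proof -
 have cI: "cont0 (Grass k) (Iop k g)" by (rule Iop_cont0[OF dims(6) g])
 show c: "cont0 Sph (Rdual m g)" "cont0 Sph (Rdual k (Iop k g))"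
  by (intro Rdual_cont0 mk dims g cI)+
 have S: "- x : Sph \<longleftrightarrow> x : Sph" by (simp add: Sph_norm)
 show "Rdual m g (- x) = Rdual m g x"
  using Rdual_even[OF mk(2) dims(1), of x g] c(1) S cG_bm[OF g] by (cases "x : Sph") (auto simp: cont0_def)
 show "Rdual k (Iop k g) (- x) = Rdual k (Iop k g) x"
  using Rdual_even[OF mk(3) dims(2), of x "Iop k g"] c(2) S bm_Grass[OF cI] by (cases "x : Sph") (auto simp: cont0_def)
qed

text \<open>The k-th root of \<open>Rdual m g + e\<close> and the m-th root of
  \<open>(Rdual k (Iop k g) + e) / c\<close> serve as radial functions;
  \<open>Radon_Rdual_intertwine\<close> gives the required equality of transforms, and
  \<open>e\<close> keeps both functions strictly positive.\<close>

lemma k_intersection_body_exists: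
 assumes g: "cG g" and pos: "!!x. x : Sph ==> 0 <= Rdual m g x" "!!x. x : Sph ==> 0 <= Rdual k (Iop k g) x"
  and e: "0 < e"
 shows "EX K L. k_intersection_body k K L & star_body K & (ALL x:Sph. radial K x ^ k = Rdual m g x + e)"
proof -
 obtain c where c: "0 < c" "!!K L :: 'n vect set. star_body K ==> star_body L ==> (k_intersection_body k K L \<longleftrightarrow>
  Iop m (Radon k (restr Sph (%x. radial K x ^ k))) = Radon m (restr Sph (%x. c * radial L x ^ m)))"
  using k_intersection_iff[OF mk] by blast
 note R = Rdual_facts[OF g]
 define u where "u x = 1 * Rdual m g x + 1 * restr Sph (%_. e) x" for x
 define v where "v x = 1 * Rdual k (Iop k g) x + 1 * restr Sph (%_. e) x" for x
 have cu: "cont0 Sph u" "cont0 Sph v" unfolding u_def v_def by (intro cont0_add cont0_cmult cont0_const R)+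
 have up: "0 < u x" "0 < v x" if "x : Sph" for x using pos[OF that] that e by (auto simp: u_def v_def)
 have ue: "u (- x) = u x" "v (- x) = v x" if "x : Sph" for x
  using that R(3,4)[of x] by (auto simp: u_def v_def restr_def Sph_norm)
 define K where "K = sbody (%x. root k (u x))"
 define L where "L = sbody (%x. root m (v x / c))"
 have K: "star_body K" unfolding K_def
  by (rule sbody_star) (use cu up ue mk in "auto simp: cont0_def intro!: continuous_intros")
 have L: "star_body L" unfolding L_def
  by (rule sbody_star) (use cu up ue mk c in "auto simp: cont0_def intro!: continuous_intros")
 have rK: "radial K x ^ k = u x" if "x : Sph" for x
  unfolding K_def using radial_sbody[of "%x. root k (u x)" x] up[of _] that mk(3)
  by (simp add: real_root_pow_pos2 less_imp_le)
 have rL: "c * radial L x ^ m = v x" if "x : Sph" for x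
  unfolding L_def using radial_sbody[of "%x. root m (v x / c)" x] up that mk(2) c(1)
  by (simp add: real_root_pow_pos2 less_imp_le)
 have 1: "restr Sph (%x. radial K x ^ k) = u" "restr Sph (%x. c * radial L x ^ m) = v"
  using cu rK rL by (auto simp: restr_def cont0_def fun_eq_iff)
 have "Iop m (Radon k u) = Radon m v"
 proof (rule cont0_ext[OF cG_IRadon[OF cu(1)] cG_Radon[OF cu(2)]])
  fix P :: "'n matr" assume P: "P : Grass m"
  then have P': "perpP P : Grass k" using perp_Grass[OF mk(1)] by blast
  have "Radon k u (perpP P) = Radon k (Rdual m g) (perpP P) + e"
  using Radon_lin[OF R(1) cont0_const mk(3), of 1 1 e "perpP P"] Radon_const[OF P' mk(3), of e] by (simp add: u_def[abs_def])
  moreover have "Radon m v P = Radon m (Rdual k (Iop k g)) P + e"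
  using Radon_lin[OF R(2) cont0_const mk(2), of 1 1 e P] Radon_const[OF P mk(2), of e] by (simp add: v_def[abs_def])
  moreover have "Radon m (Rdual k (Iop k g)) P = Radon k (Rdual m g) (perpP P)"
  using Radon_Rdual_intertwine[OF mk g] P by (simp add: Iop_def)
  ultimately show "Iop m (Radon k u) P = Radon m v P" using P by (simp add: Iop_def)
 qed
 then have "k_intersection_body k K L" using c(2)[OF K L] 1 by simp
 then show ?thesis using K rK by (intro exI[of _ K] exI[of _ L]) (auto simp: u_def)
qed

lemma Icls_const: "k_intersection_body k K L ==> K : Icls k"
 for K :: "'n vect set"
proof -
 assume K: "k_intersection_body k K L"
 have "(Sph :: 'n vect set) ~= {}" using Sph_axis by blast
 from cSUP_const[OF this, of "0 :: real"] have "(%j :: nat. SUP th\<in>Sph. \<bar>radial K th - radial K th\<bar>) \<longlonglongrightarrow> 0" by simp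
 moreover have "star_body K" using K by (simp add: k_intersection_body_def)
 ultimately show ?thesis using K unfolding Icls_def by (intro CollectI conjI exI[of _ "%_. K"]) auto
qed

text \<open>\<open>posI\<close> makes both dual transforms of \<open>g\<close> non-negative, so for
  each \<open>e > 0\<close> there is an intersection body with k-th radial power
  \<open>Rdual m g + e\<close>. It lies in \<open>BP k\<close> by assumption, and \<open>e\<close>
  tends to zero in the resulting inequality.\<close>

lemma BP_eq_imp_smooth:
 assumes S1: "BP k = (Icls k :: 'n vect set set)" shows smooth_property
 unfolding smooth_property_def
proof (intro ballI impI)
 fix g :: "'n matr => real" assume g: "g : CinfG m" "posI (densG m g)"
 have cg: "cG g" using g(1) by (rule CinfG_cont0)
 note R = Rdual_facts[OF cg]
 have u: "0 <= Rdual m g x" for x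
  by (rule positive_pairing[OF R(1)]) (use g(2) densG_Radon[OF cg] in "auto simp: posI_def")
 have v: "0 <= Rdual k (Iop k g) x" for x
  by (rule positive_pairing[OF R(2)]) (use g(2) densG_IRadon[OF cg] in "auto simp: posI_def")
 show "posR (densG m g)"
  unfolding posR_def
 proof (intro allI impI)
  fix f :: "'n vect => real" assume f: "cont0 Sph f" "ALL P:Grass m. 0 <= Radon m f P"
  have ge: "0 <= (LINT x|haarS. f x * Rdual m g x) + e * (LINT x|haarS. f x)" if e: "0 < e" for e
  proof -
  obtain K L where K: "k_intersection_body k K L" "star_body K" "ALL x:Sph. radial K x ^ k = Rdual m g x + e"
  using k_intersection_body_exists[OF cg u v e] by blast
  have "K : BP k" using Icls_const[OF K(1)] S1 by simp
  then have "0 <= (LINT x|haarS. f x * rk K x)" using BP_iff[OF K(2)] f by blast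
  also have "(%x. f x * rk K x) = (%x. f x * Rdual m g x + e * f x)"
  using K(3) f(1) by (auto simp: rk_def restr_def cont0_def fun_eq_iff algebra_simps)
  also have "(LINT x|haarS. f x * Rdual m g x + e * f x) = (LINT x|haarS. f x * Rdual m g x) + e * (LINT x|haarS. f x)"
  using integrable_haarS[OF bm_Sph[OF cont0_mult[OF f(1) R(1)]]] integrable_haarS[OF bm_Sph[OF f(1)]] by simp
  finally show ?thesis .
  qed
  have F: "0 <= (LINT x|haarS. f x)"
  unfolding oneG_m[OF f(1), symmetric] oneG_def
  by (rule integral_nonneg_AE) (use AE_Gr f(2) in "auto elim!: eventually_mono")
  have "0 <= (LINT x|haarS. f x * Rdual m g x)"
  proof (rule field_le_epsilon)
  fix e :: real assume e: "0 < e"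
  let ?F = "\<integral>x. f x \<partial>haarS"
  have "e / (?F + 1) * ?F <= e" using e F by (simp add: field_simps)
  moreover have "0 < e / (?F + 1)" using e F by simp
  ultimately show "0 <= (LINT x|haarS. f x * Rdual m g x) + e" using ge[of "e / (?F + 1)"] by linarith
  qed
  then show "0 <= densG m g (Radon m f)" using densG_Radon[OF cg f(1)] by simp
 qed
qed

text \<open>A smooth \<open>g\<close> is chosen whose dual transform is a zonal average of
  \<open>u = rk K\<close>. Its second dual transform follows from
  \<open>R_m R_k^* I g = I R_k Zon u = T R_m v = R_m Zon v\<close> and injectivity on even
  functions, so it is a zonal average of \<open>v\<close> and also non-negative. The smooth property
  then applies to \<open>g\<close>.\<close>

lemma k_intersection_body_positive:
 assumes T2: smooth_property and KL: "k_intersection_body k K L"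
  and f: "cont0 Sph f" "ALL P:Grass m. 0 <= Radon m f P"
 shows "0 <= (LINT x|haarS. f x * rk K x)"
proof -
 have st: "star_body K" "star_body L" using KL by (auto simp: k_intersection_body_def)
 obtain c where c: "0 < c" "Iop m (Radon k (rk K)) = Radon m (restr Sph (%x. c * radial L x ^ m))"
  using k_intersection_iff[OF mk] st KL unfolding rk_def by blast
 define v where "v = restr Sph (%x. c * radial L x ^ m)"
 note rL = star_body_radial[OF st(2)]
 have cv: "cont0 Sph v" unfolding v_def by (intro cont0_restr continuous_intros rL)
 have v0: "0 <= v x" for x
  using rL(2)[of x] c(1) by (cases "x : Sph") (auto simp: v_def restr_def intro!: mult_nonneg_nonneg less_imp_le)
 note u = rk[OF st(1)]
 have pos: "0 <= (LINT x|haarS. f x * Zon (b' N) N (rk K) x)" for N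
 proof -
  obtain g where g: "g : CinfG m" "Rdual m g = Zon (b' N) N (rk K)" using Zon_in_Rdual[OF mk u(1)] by blast
  have cg: "cG g" using g(1) by (rule CinfG_cont0)
  note R = Rdual_facts[OF cg]
  let ?v = "Zon (b N) N v"
  have cZ: "cont0 Sph ?v" by (rule Zon_cont0[OF bm_Sph[OF cv]])
  have "Radon m (Rdual k (Iop k g)) = Iop m (Radon k (Zon (b' N) N (rk K)))"
  using Radon_Rdual_intertwine[OF mk cg] g(2) by simp
  also have "... = T N (Radon m v)" using Top_Radon_k[OF u(1)] c(2) by (simp add: v_def)
  also have "... = Radon m ?v" by (rule Top_Radon_m[OF cv])
  finally have eq: "Radon m (Rdual k (Iop k g)) = Radon m ?v" .
  have "(%x. Rdual k (Iop k g) x - ?v x) = (%x. 0)"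
  by (rule Radon_injective_even[OF mk cont0_diff[OF R(2) cZ]])
  (use R(4) Zon_even[of "b N" N v] Radon_diff[OF _ mk(2) bm_Sph[OF R(2)] bm_Sph[OF cZ]] eq in auto)
  then have Rv: "Rdual k (Iop k g) = ?v" by (simp add: fun_eq_iff)
  have "posI (densG m g)"
  unfolding posI_def
  proof (intro allI impI)
  fix f :: "'n vect => real" assume f: "cont0 Sph f" "ALL x:Sph. 0 <= f x"
  have f0: "0 <= f x" for x using f by (cases "x : Sph") (auto simp: cont0_def)
  have "0 <= Zon (b' N) N (rk K) x" "0 <= ?v x" for x
  using Zon_nonneg[OF b', of "rk K"] u(4) Zon_nonneg[OF b, of v] v0 by auto
  then show "0 <= densG m g (Radon m f) & 0 <= densG m g (Iop m (Radon k f))"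
  unfolding densG_Radon[OF cg f(1)] densG_IRadon[OF cg f(1)] Rv g(2) using f0 by (simp add: integral_nonneg_AE)
  qed
  then have "posR (densG m g)" using T2 g(1) unfolding smooth_property_def by blast
  then have "0 <= densG m g (Radon m f)" using f unfolding posR_def by blast
  then show ?thesis using densG_Radon[OF cg f(1)] g(2) by simp
 qed
 show ?thesis
 proof (rule field_le_epsilon)
  fix e :: real assume e: "0 < e"
  define J where "J = (LINT x|haarS. \<bar>f x\<bar>)"
  have J: "0 <= J" unfolding J_def by (rule integral_nonneg_AE) simp
  define d where "d = e / (J + 1)"
  have d: "0 < d" "d * J <= e" using e J by (auto simp: d_def field_simps)
  obtain N where N: "!!x. x : Sph ==> \<bar>Zon (b' N) N (rk K) x - rk K x\<bar> < d" using Zon_tendsto'[OF u(1,2) d(1)] by blast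
  let ?Z = "Zon (b' N) N (rk K)"
  have cZ: "cont0 Sph ?Z" by (rule Zon_cont0[OF bm_Sph[OF u(1)]])
  have "\<bar>\<integral>x. (?Z x - rk K x) * f x \<partial>haarS\<bar> <= d * J"
  unfolding J_def by (rule pairing_bound[OF cont0_diff[OF cZ u(1)] f(1)]) (use N in "auto simp: less_imp_le")
  moreover have "(LINT x|haarS. (?Z x - rk K x) * f x) = (LINT x|haarS. f x * ?Z x) - (LINT x|haarS. f x * rk K x)"
  using int_lin[OF cZ u(1) f(1), of 1 "-1"] by (simp add: mult.commute)
  ultimately show "0 <= (LINT x|haarS. f x * rk K x) + e" using pos[of N] d(2) by linarith
 qed
qed

lemma radial_bdd:
 fixes K L :: "'n vect set"
 assumes "star_body K" "star_body L"
 shows "bdd_above ((%th. \<bar>radial K th - radial L th\<bar>) ` Sph)"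
proof -
 have "continuous_on Sph (%th. \<bar>radial K th - radial L th\<bar>)"
  by (intro continuous_intros star_body_radial assms)
 then show ?thesis by (intro bounded_imp_bdd_above compact_imp_bounded compact_continuous_image compact_Sph)
qed

text \<open>The positivity criterion of \<open>BP_iff\<close> passes to radial limits by dominated
  convergence; convergence in the radial metric bounds all the radial functions uniformly.\<close>

lemma smooth_imp_Icls_BP:
 assumes T2: smooth_property and K: "K : Icls k" shows "(K :: 'n vect set) : BP k"
proof -
 obtain Ks where st: "star_body K" and Ks: "!!j. EX L. k_intersection_body k (Ks j) L"
  and lim: "(%j. SUP th\<in>Sph. \<bar>radial (Ks j) th - radial K th\<bar>) \<longlonglongrightarrow> 0"
  using K unfolding Icls_def by blast
 have sj: "star_body (Ks j)" for j using Ks[of j] by (auto simp: k_intersection_body_def)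
 define s where "s j = (SUP th\<in>Sph. \<bar>radial (Ks j) th - radial K th\<bar>)" for j
 have le: "\<bar>radial (Ks j) x - radial K x\<bar> <= s j" if "x : Sph" for j x
  unfolding s_def by (rule cSUP_upper[OF that radial_bdd[OF sj st]])
 obtain B where B: "0 < B" "!!j. s j <= B"
  using lim convergent_imp_Bseq[of s] unfolding Bseq_def s_def[symmetric] convergent_def by (auto simp: s_def[symmetric]) (metis abs_le_D1)
 obtain C where C: "C > 0" "!!x. x : Sph ==> \<bar>radial K x\<bar> <= C"
  using compact_imp_bounded[OF compact_continuous_image[OF star_body_radial(1)[OF st] compact_Sph]]
  unfolding bounded_pos by auto
 have ptw: "(%j. rk (Ks j) x) \<longlonglongrightarrow> rk K x" for x
 proof (cases "x : Sph")
  case True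
  have "(%j. radial (Ks j) x) \<longlonglongrightarrow> radial K x"
  by (rule Lim_transform_bound[of "%j. radial (Ks j) x - radial K x" s, THEN LIM_zero_cancel])
  (use le[OF True] lim in "auto simp: s_def[symmetric] intro!: always_eventually order_trans[OF le[OF True]]")
  then show ?thesis using True by (auto simp: rk_def intro!: tendsto_intros)
 qed (simp add: rk_def restr_def)
 show ?thesis
  unfolding BP_iff[OF st]
 proof (intro allI impI)
  fix f :: "'n vect => real" assume f: "cont0 Sph f" "ALL P:Grass m. 0 <= Radon m f P"
  have "(%j. \<integral>x. f x * rk (Ks j) x \<partial>haarS) \<longlonglongrightarrow> (LINT x|haarS. f x * rk K x)"
  proof (rule integral_dominated_convergence[where w = "%x. \<bar>f x\<bar> * (C + B) ^ k"])
  show "(%x. f x * rk K x) : borel_measurable haarS" "!!j. (%x. f x * rk (Ks j) x) : borel_measurable haarS"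
  by (intro borel_measurable_integrable integrable_haarS bm_Sph cont0_mult f rk st sj)+
  have "integrable haarS (%x. \<bar>f x\<bar>)" by (intro integrable_abs integrable_haarS bm_Sph f)
  then show "integrable haarS (%x. \<bar>f x\<bar> * (C + B) ^ k)" by simp
  show "AE x in haarS. (%j. f x * rk (Ks j) x) \<longlonglongrightarrow> f x * rk K x" by (intro AE_I2 tendsto_intros ptw)
  show "AE x in haarS. norm (f x * rk (Ks j) x) <= \<bar>f x\<bar> * (C + B) ^ k" for j
  using AE_haarS
  proof eventually_elim
  fix x :: "'n vect" assume x: "x : Sph"
  have "0 <= radial (Ks j) x" "radial (Ks j) x <= C + B"
  using le[OF x, of j] B(2)[of j] C(2)[OF x] star_body_radial(2)[OF sj x, of j] by linarith+
  then have "\<bar>rk (Ks j) x\<bar> <= (C + B) ^ k" using x by (simp add: rk_def power_mono)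
  then show "norm (f x * rk (Ks j) x) <= \<bar>f x\<bar> * (C + B) ^ k" by (simp add: abs_mult mult_left_mono)
  qed
  qed
  moreover have "0 <= (LINT x|haarS. f x * rk (Ks j) x)" for j
  using Ks[of j] k_intersection_body_positive[OF T2 _ f] by blast
  ultimately show "0 <= (LINT x|haarS. f x * rk K x)" by (intro LIMSEQ_le_const) auto
 qed
qed

end

context radon_smoothing
begin

text \<open>The smoothing operator applied to the measure \<open>M\<close> has a continuous
  non-negative density. The transpose of the relation \<open>Top_Radon_m\<close> identifies its dual
  transform.\<close>

lemma smoothed_density:
 assumes M: "fin_meas_on (Grass m) M"
  and rep: "!!f. cont0 Sph f ==> (LINT x|haarS. f x * u x) = (LINT P|M. Radon m f P)"
  and u: "cont0 Sph u"
 shows "EX g. cG g & (ALL P. 0 <= g P) & Rdual m g = Zon (b N) N u"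
proof -
 let ?c = "real CARD('n)" and ?z = "kmass TYPE('n) m (real CARD('n)) N"
 let ?K = "%P Q :: 'n matr. kern ?c N P Q / ?z"
 obtain P0 :: "'n matr" where P0: "P0 : Grass m" by (rule Grass_nonempty)
 have z: "0 < ?z" using kmass_pos[OF P0 mk(2)] by simp
 have fM: "finite_measure M" "sets M = sets borel" using M by (auto simp: fin_meas_on_def)
 note kc = compact_Grass[of m] compact_Grass[of m] compact_kernel_cont
 define g where "g = kint (Grass m) (Grass m) M ?K (%_. 1)"
 have cg: "cG g" unfolding g_def by (rule kint_cont0[OF kc bm_const fM])
 have g0: "0 <= g P" for P
  unfolding g_def kint_def
  by (rule integral_nonneg_AE, rule AE_I2)
  (use kern_nonneg[of ?c P m _ m N] z in "auto simp: restr_def intro!: divide_nonneg_pos")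
 have "Rdual m g = Zon (b N) N u"
 proof (rule cont0_eq_if_pairings)
  show "cont0 Sph (Rdual m g)" by (rule Rdual_facts(1)[OF cg])
  show "cont0 Sph (Zon (b N) N u)" by (rule Zon_cont0[OF bm_Sph[OF u]])
  fix h :: "'n vect => real" assume h: "cont0 Sph h"
  have "(LINT x|haarS. h x * Rdual m g x) = (LINT P|(haarG m). Radon m h P * g P)"
  by (rule Radon_duality[OF mk(2) dims(1) h cg, symmetric])
  also have "... = (LINT Q|M. 1 * kint (Grass m) (Grass m) (haarG m) (%Q P. ?K P Q) (Radon m h) Q)"
  unfolding g_def by (rule kint_fubini[OF kc bm_const cG_bm[OF cG_Radon[OF h]] fM finite_haarG(1,2)[OF dims(1)]])
  also have "(%Q P. ?K P Q) = ?K" by (simp add: kern_commute fun_eq_iff)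
  also have "(LINT Q|M. 1 * kint (Grass m) (Grass m) (haarG m) ?K (Radon m h) Q) = (LINT Q|M. Radon m (Zon (b N) N h) Q)"
  using Top_Radon_m[OF h, of N] by (simp add: Top_def)
  also have "... = (LINT x|haarS. Zon (b N) N h x * u x)" by (rule rep[OF Zon_cont0[OF bm_Sph[OF h]], symmetric])
  also have "... = (LINT x|haarS. h x * Zon (b N) N u x)"
  using Zon_selfadjoint[OF bm_Sph[OF h] bm_Sph[OF u], of "b N" N] by (simp add: mult.commute)
  finally show "(LINT x|haarS. h x * Rdual m g x) = (LINT x|haarS. h x * Zon (b N) N u x)" .
 qed
 then show ?thesis using cg g0 by blast
qed

text \<open>A non-negative smoothed density has both dual transforms non-negative, so
  \<open>k_intersection_body_exists\<close> applies to it directly. The inclusion thus holds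
  unconditionally; the approximating bodies converge because their k-th radial powers do.\<close>

lemma BP_subset_Icls: assumes K: "K : BP k" shows "(K :: 'n vect set) : Icls k"
proof -
 have st: "star_body K" using K by (simp add: BP_def)
 note r = star_body_radial[OF st] and u = rk[OF st]
 obtain mu where mu: "mu : MGplus m" "!!g. g : CS ==> integral\<^sup>L haarS (%th. g th * radial K th ^ k) = mu (Radon m g)"
  using K by (auto simp: BP_def dims)
 obtain M where M: "fin_meas_on (Grass m) M" "mu = (%f. integral\<^sup>L M f)" using mu(1) unfolding MGplus_def by blast
 have rep: "(LINT x|haarS. f x * rk K x) = (LINT P|M. Radon m f P)" if "cont0 Sph f" for f
  using mu(2)[OF cont0_CS[OF that]] pair_rk[OF that, of K] M(2) by simp
 have ne: "(Sph :: 'n vect set) ~= {}" using Sph_axis by blast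
 obtain x0 where x0: "x0 : Sph" "!!x. x : Sph ==> radial K x0 <= radial K x"
  using continuous_attains_inf[OF compact_Sph ne r(1)] by blast
 define c where "c = radial K x0"
 have c: "0 < c" "!!x. x : Sph ==> c <= radial K x" using r(2)[OF x0(1)] x0(2) by (auto simp: c_def)
 have ex: "EX K' L. k_intersection_body k K' L & (ALL x:Sph. \<bar>radial K' x - radial K x\<bar> <= 1 / real (Suc j))" for j
 proof -
  \<comment> \<open>The k-th powers differ by at most \<open>2 * e\<close>, one \<open>e\<close>
    from the zonal average and one from the added constant; \<open>root_diff_le\<close> with lower
    bound \<open>c\<close> turns this into \<open>1 / real (Suc j)\<close>.\<close>
  define e where "e = c ^ (k - 1) / real (Suc j) / 2"
  have e: "0 < e" using c(1) by (simp add: e_def)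
  obtain N where N: "!!x. x : Sph ==> \<bar>Zon (b N) N (rk K) x - rk K x\<bar> < e" using Zon_tendsto[OF u(1,2) e] by blast
  obtain g where g: "cG g" "!!P. 0 <= g P" "Rdual m g = Zon (b N) N (rk K)"
  using smoothed_density[OF M(1) rep u(1)] by blast
  have "0 <= Rdual k (Iop k g) x" if "x : Sph" for x
  using Rdual_mono[OF mk(3) dims(2) that bm_Grass[OF cont0_const] bm_Grass[OF Iop_cont0[OF dims(6) g(1)]], of k 0]
  Rdual_const[OF mk(3) dims(2) that, of 0] g(2) by (simp add: restr_def Iop_def)
  moreover have "0 <= Rdual m g x" for x unfolding g(3) by (rule Zon_nonneg[OF b u(4)])
  ultimately obtain K' L where K': "k_intersection_body k K' L" "star_body K'" "ALL x:Sph. radial K' x ^ k = Rdual m g x + e"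
  using k_intersection_body_exists[OF g(1) _ _ e] by blast
  have "\<bar>radial K' x - radial K x\<bar> <= 1 / real (Suc j)" if x: "x : Sph" for x
  proof -
  have "\<bar>radial K' x - radial K x\<bar> * c ^ (k - 1) <= \<bar>radial K' x ^ k - radial K x ^ k\<bar>"
  by (rule root_diff_le) (use star_body_radial(2)[OF K'(2) x] c x mk(3) in auto)
  also have "... <= 2 * e" using K'(3) N[OF x] x g(3) by (simp add: rk_def)
  also have "... = 1 / real (Suc j) * c ^ (k - 1)"
  proof -
  have "2 * (y / z / 2) = 1 / z * y" for y z :: real by simp
  then show ?thesis unfolding e_def .
  qed
  finally show ?thesis using c(1) by (simp only: mult_le_cancel_right_pos zero_less_power)
  qed
  then show ?thesis using K'(1) by blast
 qed
 then obtain Ks where Ks: "!!j. EX L. k_intersection_body k (Ks j) L"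
  "!!j x. x : Sph ==> \<bar>radial (Ks j) x - radial K x\<bar> <= 1 / real (Suc j)" by metis
 have "(%j. SUP th\<in>Sph. \<bar>radial (Ks j) th - radial K th\<bar>) \<longlonglongrightarrow> 0"
 proof (rule tendsto_sandwich[OF _ _ tendsto_const LIMSEQ_inverse_real_of_nat])
  have "star_body (Ks j)" for j using Ks(1)[of j] by (auto simp: k_intersection_body_def)
  then have "0 <= (SUP th\<in>Sph. \<bar>radial (Ks j) th - radial K th\<bar>)" for j
  by (intro cSUP_upper2[OF radial_bdd[OF _ st] Sph_axis]) auto
  then show "\<forall>\<^sub>F j in sequentially. 0 <= (SUP th\<in>Sph. \<bar>radial (Ks j) th - radial K th\<bar>)" by simp
  have "(SUP th\<in>Sph. \<bar>radial (Ks j) th - radial K th\<bar>) <= inverse (real (Suc j))" for j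
  by (rule cSUP_least[OF ne]) (use Ks(2)[of _ j] in "simp add: inverse_eq_divide")
  then show "\<forall>\<^sub>F j in sequentially. (SUP th\<in>Sph. \<bar>radial (Ks j) th - radial K th\<bar>) <= inverse (real (Suc j))" by simp
 qed
 then show ?thesis using st Ks(1) unfolding Icls_def by blast
qed

text \<open>One cycle runs from the smooth property through the closure equality to positivity for
  all measures and back. A second one runs from positivity for all measures through the shift
  property and the absence of extremal measures to the smooth property.\<close>

lemma equivalences:
 "(BP k = (Icls k :: 'n vect set set) \<longleftrightarrow> smooth_property) \<and>
 (Minf_BP k = (Minf_I k :: (('n matr => real) => real) set set) \<longleftrightarrow> smooth_property) \<and>
 (M_BP k = (M_I k :: (('n matr => real) => real) set set) \<longleftrightarrow> smooth_property) \<and>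
 (closure_equality \<longleftrightarrow> smooth_property) & (one_shift_property \<longleftrightarrow> smooth_property) & (no_extremal_measure \<longleftrightarrow> smooth_property)"
proof -
 have "BP k = (Icls k :: 'n vect set set)" if smooth_property
  using BP_subset_Icls smooth_imp_Icls_BP[OF that] by blast
 then show ?thesis
  using BP_eq_imp_smooth Minf_equal_iff M_equal_iff smooth_imp_closure_equality closure_equality_imp_all all_imp_smooth
  all_imp_one_shift_property one_shift_property_imp_no_extremal_measure no_extremal_measure_imp_smooth unfolding smooth_property_def[symmetric] by blast
qed

end

theorem mainTheorem6:
  fixes k :: nat
  assumes "1 \<le> k" and "k \<le> CARD('n::finite) - 1"
  defines "m \<equiv> CARD('n) - k"
  defines "S1 \<equiv> (BP k = (Icls k :: 'n vect set set))"
      and "S2 \<equiv> (Minf_BP k = (Minf_I k :: (('n matr \<Rightarrow> real) \<Rightarrow> real) set set))"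
      and "S3 \<equiv> (M_BP k = (M_I k :: (('n matr \<Rightarrow> real) \<Rightarrow> real) set set))"
      and "S4 \<equiv> (closG m {f \<in> ImR m. \<forall>P\<in>Grass m. 0 \<le> f P} =
                closG m {(\<lambda>P. Radon m g1 P + Iop m (Radon k g2) P) | g1 g2.
                          g1 \<in> (CSplus :: ('n vect \<Rightarrow> real) set) \<and> g2 \<in> CSplus})"
      and "S5 \<equiv> (\<forall>mu \<in> MG m :: (('n matr \<Rightarrow> real) \<Rightarrow> real) set.
                 coset k (\<lambda>f. mu f + oneG m f) \<in> M_BP k \<and> coset k mu \<in> M_I k
                 \<longrightarrow> coset k mu \<in> M_BP k)"
      and "S6 \<equiv> (\<not> (\<exists>mu \<in> MG m :: (('n matr \<Rightarrow> real) \<Rightarrow> real) set.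
                 coset k mu \<in> Minf_BP k \<and> geoneS (Rstar m mu) \<and> geoneS (Rstar k (perpM m mu)) \<and>
                 Inf {mu f | f. f \<in> ImR m \<and> (\<forall>P\<in>Grass m. 0 \<le> f P) \<and> oneG m f = 1} = 0))"
  shows "(S1 \<longleftrightarrow> S2) \<and> (S2 \<longleftrightarrow> S3) \<and> (S3 \<longleftrightarrow> S4) \<and> (S4 \<longleftrightarrow> S5) \<and> (S5 \<longleftrightarrow> S6)"
proof -
 have mk: "m + k = CARD('n)" "1 <= m" "1 <= k" using assms(1,2) by (auto simp: m_def)
 obtain b b' where "radon_smoothing TYPE('n) m k b b'" using smoothing_families[OF mk] by blast
 then interpret radon_smoothing m k b b' "TYPE('n)" .
 show ?thesis
  using equivalences unfolding S1_def S2_def S3_def S4_def S5_def S6_def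
  closure_equality_def one_shift_property_def no_extremal_measure_def by blast
qed

end
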